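(* Under the standing assumptions on the data listed in the context, assume in addition that the optimal control problems $$\text{minimize } J_k(u_k,u_{-k})\quad\text{subject to } u_k\in\mathcal U^k_{ad}\qquad(k=1,\ldots,m)$$ are all convex optimization problems. Then there exists a classical Nash equilibrium, i.e. there exists $\bar{\mathbf u}=(\bar u_1,\ldots,\bar u_m)\in\mathcal U^1_{ad}\times\cdots\times\mathcal U^m_{ad}$ such that $$\bar u_k\in\operatorname{argmin}_{u_k\in\mathcal U^k_{ad}}J_k(u_k,\bar u_{-k})\qquad\text{for all }k=1,\ldots,m.$$
   Context: Data. Let $m\ge 1$ be an integer and $N\in\{1,2,3\}$. Let $\Omega\subset\mathbb R^N$ be an open bounded domain with Lipschitz boundary $\Gamma$, and let $\mathcal A y=-\sum_{i,j=1}^N\partial_{x_j}(a_{ij}(x)\partial_{x_i}y)$ with $a_{ij}\in L^\infty(\Omega)$ and, for some $\lambda_{\mathcal A}>0$, $\lambda_{\mathcal A}\|\xi\|^2\le\sum_{i,j}a_{ij}(x)\xi_i\xi_j$ for all $\xi\in\mathbb R^N$ and a.a. $x\in\Omega$. Let $\zeta_k,B_k\in L^\infty(\Omega)$ for $k=1,\ldots,m$, with $\zeta_k(x)\ge\zeta_{0k}>0$ for a.a. $x\in\Omega$ ($\zeta_{0k}$ a constant). Let $f,L_1,\ldots,L_m:\Omega\times\mathbb R\to\mathbb R$ be Carathéodory functions of class $C^2$ with respect to the second variable $y$. Assumptions on $f$: $f(\cdot,0)\in L^2(\Omega)$, $\frac{\partial f}{\partial y}(x,y)\ge0$ for a.a.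 $x\in\Omega$ (and all $y$), and for every $M>0$ there is $C_{f,M}>0$ with $|\frac{\partial f}{\partial y}(x,y)|+|\frac{\partial^2f}{\partial y^2}(x,y)|\le C_{f,M}$ and $|\frac{\partial^2f}{\partial y^2}(x,y_2)-\frac{\partial^2f}{\partial y^2}(x,y_1)|\le C_{f,M}|y_2-y_1|$ for a.a. $x\in\Omega$ and all $|y|,|y_1|,|y_2|\le M$. Assumptions on $L_k$ (each $k$): $L_k(\cdot,0)\in L^1(\Omega)$, and for every $M>0$ there are $C_{L_k,M}>0$ and $\psi_{k,M}\in L^2(\Omega)$ with $|\frac{\partial L_k}{\partial y}(x,y)|\le\psi_{k,M}(x)$, $|\frac{\partial^2L_k}{\partial y^2}(x,y)|\le C_{L_k,M}$ and $|\frac{\partial^2L_k}{\partial y^2}(x,y_2)-\frac{\partial^2L_k}{\partial y^2}(x,y_1)|\le C_{L_k,M}|y_2-y_1|$ for a.a. $x\in\Omega$ and all $|y|,|y_1|,|y_2|\le M$. State and costs. For $w\in L^2(\Omega)$, $y_w\in H^1_0(\Omega)\cap C(\bar\Omega)$ denotes the unique weak solution of $\mathcal A y+f(x,y)=w$ in $\Omega$, $y=0$ on $\Gamma$. For $(u_1,\ldots,u_m)\in L^2(\Omega)^m$ put $u=\sum_{i=1}^mB_iu_i$ and $$J_k(u_1,\ldots,u_m)=\int_\Omega L_k(x,y_u(x))\,dx+\frac12\int_\Omega\zeta_k(x)u_k(x)^2\,dx .$$ One writes $(u_k,u_{-k})$ for $(u_1,\ldots,u_m)$, where $u_{-k}$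 collects the components other than $u_k$. Admissible sets. For each $k$, $\mathcal U^k_{ad}\subset L^2(\Omega)$ is nonempty, convex, closed and bounded. The $k$-th problem is convex if $u_k\mapsto J_k(u_k,u_{-k})$ is convex on $\mathcal U^k_{ad}$ for every choice of the other players' admissible decisions $u_{-k}$. *)

theory Defs
  imports "HOL-Analysis.Analysis"
begin

text \<open>Functions on a domain \<open>\<Omega>\<close> are total functions on \<^typ>\<open>real ^ 'n\<close>; their values
  outside \<open>\<Omega>\<close> (for a state: outside the closure of \<open>\<Omega>\<close>) carry no meaning.  Elements of
  Lebesgue and Sobolev spaces are represented by functions rather than by classes modulo equality
  almost everywhere.\<close>

section \<open>Domains\<close>

text \<open>Locally \<open>\<Omega>\<close> lies on one side of the graph of a Lipschitz function over the
  hyperplane orthogonal to a unit vector \<open>e\<close>; \<open>x - (x \<bullet> e) e\<close> is the projection of \<open>x\<close>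
  onto that hyperplane.\<close>

definition lipschitz_boundary :: "(real ^ 'n) set \<Rightarrow> bool" where
  "lipschitz_boundary \<Omega> \<longleftrightarrow>
    (\<forall>p \<in> frontier \<Omega>. \<exists>Z e \<gamma> C.
       open Z \<and> p \<in> Z \<and> norm e = 1 \<and> C-lipschitz_on {z. z \<bullet> e = 0} \<gamma> \<and>
       \<Omega> \<inter> Z = {x \<in> Z. x \<bullet> e < \<gamma> (x - (x \<bullet> e) *\<^sub>R e)})"

definition bounded_lipschitz_domain :: "(real ^ 'n) set \<Rightarrow> bool" where
  "bounded_lipschitz_domain \<Omega> \<longleftrightarrow>
    open \<Omega> \<and> connected \<Omega> \<and> \<Omega> \<noteq> {} \<and> bounded \<Omega> \<and> lipschitz_boundary \<Omega>"


section \<open>Lebesgue spaces\<close>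

definition L1_space :: "(real ^ 'n) set \<Rightarrow> (real ^ 'n \<Rightarrow> real) set" where
  "L1_space \<Omega> = {g. integrable (lebesgue_on \<Omega>) g}"

definition L2_space :: "(real ^ 'n) set \<Rightarrow> (real ^ 'n \<Rightarrow> real) set" where
  "L2_space \<Omega> = {g \<in> borel_measurable (lebesgue_on \<Omega>). integrable (lebesgue_on \<Omega>) (\<lambda>x. (g x)\<^sup>2)}"

definition Linf_space :: "(real ^ 'n) set \<Rightarrow> (real ^ 'n \<Rightarrow> real) set" where
  "Linf_space \<Omega> = {g \<in> borel_measurable (lebesgue_on \<Omega>). \<exists>C. AE x in lebesgue_on \<Omega>. \<bar>g x\<bar> \<le> C}"

definition L2_norm :: "(real ^ 'n) set \<Rightarrow> (real ^ 'n \<Rightarrow> real) \<Rightarrow> real" where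
  "L2_norm \<Omega> g = sqrt (\<integral>x. (g x)\<^sup>2 \<partial>lebesgue_on \<Omega>)"

text \<open>Closedness in the seminorm \<^const>\<open>L2_norm\<close>.  A set that is closed in this sense
  contains with a function all functions of \<^const>\<open>L2_space\<close> equal to it almost everywhere,
  so these sets are exactly the closed subsets of the quotient space.\<close>

definition L2_closed :: "(real ^ 'n) set \<Rightarrow> (real ^ 'n \<Rightarrow> real) set \<Rightarrow> bool" where
  "L2_closed \<Omega> U \<longleftrightarrow>
    (\<forall>v \<in> L2_space \<Omega>. (\<forall>\<epsilon>>0. \<exists>w \<in> U. L2_norm \<Omega> (\<lambda>x. w x - v x) < \<epsilon>) \<longrightarrow> v \<in> U)"

definition L2_bounded :: "(real ^ 'n) set \<Rightarrow> (real ^ 'n \<Rightarrow> real) set \<Rightarrow> bool" where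
  "L2_bounded \<Omega> U \<longleftrightarrow> (\<exists>R. \<forall>v \<in> U. L2_norm \<Omega> v \<le> R)"

text \<open>The library constants \<^const>\<open>convex\<close> and \<^const>\<open>convex_on\<close> require a real vector space
  type, which the function type is not.\<close>

definition convex_function_set :: "('a \<Rightarrow> real) set \<Rightarrow> bool" where
  "convex_function_set U \<longleftrightarrow>
    (\<forall>v \<in> U. \<forall>w \<in> U. \<forall>t \<in> {0..1}. (\<lambda>x. (1 - t) * v x + t * w x) \<in> U)"

definition convex_functional_on ::
    "('a \<Rightarrow> real) set \<Rightarrow> (('a \<Rightarrow> real) \<Rightarrow> real) \<Rightarrow> bool" where
  "convex_functional_on U F \<longleftrightarrow>
    (\<forall>v \<in> U. \<forall>w \<in> U. \<forall>t \<in> {0..1}.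
       F (\<lambda>x. (1 - t) * v x + t * w x) \<le> (1 - t) * F v + t * F w)"


section \<open>Sobolev spaces\<close>

definition partial_deriv :: "'n \<Rightarrow> (real ^ 'n \<Rightarrow> real) \<Rightarrow> real ^ 'n \<Rightarrow> real" where
  "partial_deriv i \<phi> x = frechet_derivative \<phi> (at x) (axis i 1)"

primrec Ck :: "nat \<Rightarrow> (real ^ 'n \<Rightarrow> real) \<Rightarrow> bool" where
  "Ck 0 \<phi> \<longleftrightarrow> continuous_on UNIV \<phi>"
| "Ck (Suc k) \<phi> \<longleftrightarrow> (\<forall>x. \<phi> differentiable at x) \<and> (\<forall>i. Ck k (partial_deriv i \<phi>))"

definition test_functions :: "(real ^ 'n) set \<Rightarrow> (real ^ 'n \<Rightarrow> real) set" where
  "test_functions \<Omega> =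
    {\<phi>. (\<forall>k. Ck k \<phi>) \<and> compact (closure {x. \<phi> x \<noteq> 0}) \<and> closure {x. \<phi> x \<noteq> 0} \<subseteq> \<Omega>}"

definition has_weak_deriv ::
    "(real ^ 'n) set \<Rightarrow> 'n \<Rightarrow> (real ^ 'n \<Rightarrow> real) \<Rightarrow> (real ^ 'n \<Rightarrow> real) \<Rightarrow> bool" where
  "has_weak_deriv \<Omega> i y g \<longleftrightarrow>
    (\<forall>\<phi> \<in> test_functions \<Omega>.
       (\<integral>x. y x * partial_deriv i \<phi> x \<partial>lebesgue_on \<Omega>) = - (\<integral>x. g x * \<phi> x \<partial>lebesgue_on \<Omega>))"

text \<open>The choice is irrelevant: square integrable weak derivatives are unique up to
  equality almost everywhere in \<open>\<Omega>\<close>.\<close>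

definition weak_deriv ::
    "(real ^ 'n) set \<Rightarrow> 'n \<Rightarrow> (real ^ 'n \<Rightarrow> real) \<Rightarrow> (real ^ 'n \<Rightarrow> real)" where
  "weak_deriv \<Omega> i y = (SOME g. g \<in> L2_space \<Omega> \<and> has_weak_deriv \<Omega> i y g)"

definition H1_space :: "(real ^ 'n) set \<Rightarrow> (real ^ 'n \<Rightarrow> real) set" where
  "H1_space \<Omega> = {y \<in> L2_space \<Omega>. \<forall>i. \<exists>g \<in> L2_space \<Omega>. has_weak_deriv \<Omega> i y g}"

definition H1_norm :: "(real ^ 'n) set \<Rightarrow> (real ^ 'n \<Rightarrow> real) \<Rightarrow> real" where
  "H1_norm \<Omega> y = sqrt ((L2_norm \<Omega> y)\<^sup>2 + (\<Sum>i\<in>UNIV. (L2_norm \<Omega> (weak_deriv \<Omega> i y))\<^sup>2))"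

definition H10_space :: "(real ^ 'n) set \<Rightarrow> (real ^ 'n \<Rightarrow> real) set" where
  "H10_space \<Omega> =
    {y \<in> H1_space \<Omega>. \<forall>\<epsilon>>0. \<exists>\<phi> \<in> test_functions \<Omega>. H1_norm \<Omega> (\<lambda>x. \<phi> x - y x) < \<epsilon>}"


section \<open>Nonlinearities\<close>

definition C2_real :: "(real \<Rightarrow> real) \<Rightarrow> bool" where
  "C2_real g \<longleftrightarrow>
    (\<forall>y. g differentiable at y) \<and> (\<forall>y. deriv g differentiable at y) \<and>
    continuous_on UNIV (deriv (deriv g))"

text \<open>Caratheodory functions of class \<open>C\<^sup>2\<close> in the second variable; continuity in the
  second variable is part of \<^const>\<open>C2_real\<close>.\<close>

definition caratheodory_C2 :: "(real ^ 'n) set \<Rightarrow> (real ^ 'n \<Rightarrow> real \<Rightarrow> real) \<Rightarrow> bool" where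
  "caratheodory_C2 \<Omega> h \<longleftrightarrow>
    (\<forall>y. (\<lambda>x. h x y) \<in> borel_measurable (lebesgue_on \<Omega>)) \<and>
    (AE x in lebesgue_on \<Omega>. C2_real (h x))"

definition state_nonlinearity :: "(real ^ 'n) set \<Rightarrow> (real ^ 'n \<Rightarrow> real \<Rightarrow> real) \<Rightarrow> bool" where
  "state_nonlinearity \<Omega> f \<longleftrightarrow>
    caratheodory_C2 \<Omega> f \<and>
    (\<lambda>x. f x 0) \<in> L2_space \<Omega> \<and>
    (AE x in lebesgue_on \<Omega>. \<forall>y. deriv (f x) y \<ge> 0) \<and>
    (\<forall>M>0. \<exists>C>0. AE x in lebesgue_on \<Omega>.
       (\<forall>y. \<bar>y\<bar> \<le> M \<longrightarrow> \<bar>deriv (f x) y\<bar> + \<bar>deriv (deriv (f x)) y\<bar> \<le> C) \<and>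
       (\<forall>y1 y2. \<bar>y1\<bar> \<le> M \<and> \<bar>y2\<bar> \<le> M \<longrightarrow>
          \<bar>deriv (deriv (f x)) y2 - deriv (deriv (f x)) y1\<bar> \<le> C * \<bar>y2 - y1\<bar>))"

definition cost_integrand :: "(real ^ 'n) set \<Rightarrow> (real ^ 'n \<Rightarrow> real \<Rightarrow> real) \<Rightarrow> bool" where
  "cost_integrand \<Omega> l \<longleftrightarrow>
    caratheodory_C2 \<Omega> l \<and>
    (\<lambda>x. l x 0) \<in> L1_space \<Omega> \<and>
    (\<forall>M>0. \<exists>C>0. \<exists>\<psi> \<in> L2_space \<Omega>. AE x in lebesgue_on \<Omega>.
       (\<forall>y. \<bar>y\<bar> \<le> M \<longrightarrow> \<bar>deriv (l x) y\<bar> \<le> \<psi> x \<and> \<bar>deriv (deriv (l x)) y\<bar> \<le> C) \<and>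
       (\<forall>y1 y2. \<bar>y1\<bar> \<le> M \<and> \<bar>y2\<bar> \<le> M \<longrightarrow>
          \<bar>deriv (deriv (l x)) y2 - deriv (deriv (l x)) y1\<bar> \<le> C * \<bar>y2 - y1\<bar>))"


section \<open>State equation and costs\<close>

definition elliptic_coefficients ::
    "(real ^ 'n) set \<Rightarrow> ('n \<Rightarrow> 'n \<Rightarrow> real ^ 'n \<Rightarrow> real) \<Rightarrow> bool" where
  "elliptic_coefficients \<Omega> a \<longleftrightarrow>
    (\<forall>i j. a i j \<in> Linf_space \<Omega>) \<and>
    (\<exists>\<Lambda>>0. AE x in lebesgue_on \<Omega>. \<forall>\<xi> :: real ^ 'n.
       \<Lambda> * (norm \<xi>)\<^sup>2 \<le> (\<Sum>i\<in>UNIV. \<Sum>j\<in>UNIV. a i j x * \<xi> $ i * \<xi> $ j))"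

text \<open>Weak solutions in \<open>H\<^sup>1\<^sub>0(\<Omega>) \<inter> C(closure \<Omega>)\<close> of the equation
  \<open>- (\<Sum>i j. \<partial>\<^sub>j (a\<^sub>i\<^sub>j \<partial>\<^sub>i y)) + f(x, y) = w\<close> in \<open>\<Omega>\<close>, \<open>y = 0\<close> on the boundary.\<close>

definition weak_solution ::
    "(real ^ 'n) set \<Rightarrow> ('n \<Rightarrow> 'n \<Rightarrow> real ^ 'n \<Rightarrow> real) \<Rightarrow> (real ^ 'n \<Rightarrow> real \<Rightarrow> real) \<Rightarrow>
     (real ^ 'n \<Rightarrow> real) \<Rightarrow> (real ^ 'n \<Rightarrow> real) \<Rightarrow> bool" where
  "weak_solution \<Omega> a f w y \<longleftrightarrow>
    y \<in> H10_space \<Omega> \<and> continuous_on (closure \<Omega>) y \<and>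
    (\<forall>\<phi> \<in> H10_space \<Omega>.
       (\<integral>x. (\<Sum>i\<in>UNIV. \<Sum>j\<in>UNIV. a i j x * weak_deriv \<Omega> i y x * weak_deriv \<Omega> j \<phi> x) \<partial>lebesgue_on \<Omega>)
       + (\<integral>x. f x (y x) * \<phi> x \<partial>lebesgue_on \<Omega>)
       = (\<integral>x. w x * \<phi> x \<partial>lebesgue_on \<Omega>))"

text \<open>A state is determined on the closure of \<open>\<Omega>\<close> only; it is set to \<open>0\<close> elsewhere to
  make the description definite.\<close>

definition state ::
    "(real ^ 'n) set \<Rightarrow> ('n \<Rightarrow> 'n \<Rightarrow> real ^ 'n \<Rightarrow> real) \<Rightarrow> (real ^ 'n \<Rightarrow> real \<Rightarrow> real) \<Rightarrow>
     (real ^ 'n \<Rightarrow> real) \<Rightarrow> (real ^ 'n \<Rightarrow> real)" where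
  "state \<Omega> a f w = (THE y. weak_solution \<Omega> a f w y \<and> (\<forall>x. x \<notin> closure \<Omega> \<longrightarrow> y x = 0))"

text \<open>A decision profile \<open>u\<close> of the players \<open>1, \<dots>, m\<close> is a function on \<^typ>\<open>nat\<close> of which
  only the values at \<open>1, \<dots>, m\<close> matter.  The profile \<open>(v, u\<^sub>-\<^sub>k)\<close> is \<open>u(k := v)\<close>.\<close>

definition cost ::
    "(real ^ 'n) set \<Rightarrow> ('n \<Rightarrow> 'n \<Rightarrow> real ^ 'n \<Rightarrow> real) \<Rightarrow> (real ^ 'n \<Rightarrow> real \<Rightarrow> real) \<Rightarrow> nat \<Rightarrow>
     (nat \<Rightarrow> real ^ 'n \<Rightarrow> real) \<Rightarrow> (nat \<Rightarrow> real ^ 'n \<Rightarrow> real \<Rightarrow> real) \<Rightarrow> (nat \<Rightarrow> real ^ 'n \<Rightarrow> real) \<Rightarrow>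
     nat \<Rightarrow> (nat \<Rightarrow> real ^ 'n \<Rightarrow> real) \<Rightarrow> real" where
  "cost \<Omega> a f m B L \<zeta> k u =
    (\<integral>x. L k x (state \<Omega> a f (\<lambda>z. \<Sum>i=1..m. B i z * u i z) x) \<partial>lebesgue_on \<Omega>)
    + 1 / 2 * (\<integral>x. \<zeta> k x * (u k x)\<^sup>2 \<partial>lebesgue_on \<Omega>)"

definition convex_problem ::
    "nat \<Rightarrow> (nat \<Rightarrow> ('a \<Rightarrow> real) set) \<Rightarrow> (nat \<Rightarrow> (nat \<Rightarrow> 'a \<Rightarrow> real) \<Rightarrow> real) \<Rightarrow> nat \<Rightarrow> bool" where
  "convex_problem m Uad J k \<longleftrightarrow>
    (\<forall>u. (\<forall>i \<in> {1..m} - {k}. u i \<in> Uad i) \<longrightarrow>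
       convex_functional_on (Uad k) (\<lambda>v. J k (u(k := v))))"

definition nash_equilibrium ::
    "nat \<Rightarrow> (nat \<Rightarrow> ('a \<Rightarrow> real) set) \<Rightarrow> (nat \<Rightarrow> (nat \<Rightarrow> 'a \<Rightarrow> real) \<Rightarrow> real) \<Rightarrow>
     (nat \<Rightarrow> 'a \<Rightarrow> real) \<Rightarrow> bool" where
  "nash_equilibrium m Uad J u \<longleftrightarrow>
    (\<forall>k \<in> {1..m}. u k \<in> Uad k) \<and>
    (\<forall>k \<in> {1..m}. is_arg_min (\<lambda>v. J k (u(k := v))) (\<lambda>v. v \<in> Uad k) (u k))"

end

theory Submission
  imports Defs "HOL-Library.Diagonal_Subsequence" "HOL-Computational_Algebra.Polynomial"
begin

text \<open>Weakly convergent controls have uniformly convergent states: the difference of two states is a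
  subsolution of a linear equation, its energy tends to zero by Rellich's theorem, and Stampacchia's
  iteration turns a small \<open>L\<^sup>2\<close> norm into a small supremum.  The costs are therefore the sum of a weakly
  continuous term and a convex term in the player's own control.  For finitely many deviations per
  player, Brouwer's theorem gives a fixed point of Nash's map; by weak compactness, a limit of such
  fixed points along a dense sequence of deviations is an equilibrium.

  That a weak solution is continuous up to the boundary is De Giorgi's theorem, proved with the
  oscillation estimate in the interior and with the density of the complement at the Lipschitz
  boundary.\<close>

text \<open>No Sobolev embedding is used. Averaging the translation bound for
  \<open>ph (x + h) - ph x\<close> over a ball gives one inequality,
  \<open>test_nash_inequality\<close>, whose last term contains only ball integrals. Bounding these
  by the L1 norm gives a Faber-Krahn inequality for functions of small support; their weak
  continuity gives Rellich's theorem. Faber-Krahn drives both level iterations, in which superlevel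
  sets are compared with balls whose radii shrink by the factor 4. With a right-hand side in L2 one
  step gains \<open>4 ^ 3\<close>, which keeps up with the volumes of the balls as long as the
  dimension is at most 3. The oscillation estimates need a bounded right-hand side, so the data are
  truncated and continuity is recovered as a uniform limit. In the game, only the whole cost is
  convex in the player's own control, while the state part is weakly continuous but of unknown
  convexity. Hence Nash's map, which needs cost comparisons only, replaces best responses, and the
  limit is taken in the comparisons: on the deviating side the player's own control is fixed, so the
  merely semicontinuous term does no harm.\<close>

abbreviation (input) leb_ae (binder "ae " 10) where "leb_ae P \<equiv> AE x in lebesgue. P x"
abbreviation (input) leb_int (binder "lint " 10) where "leb_int f \<equiv> integral\<^sup>L lebesgue f"
abbreviation (input) BM :: "('a::euclidean_space => 'b::topological_space) set" where "BM \<equiv> borel_measurable lebesgue"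
abbreviation (input) "vol \<equiv> measure lebesgue"
abbreviation (input) "ind \<equiv> indicator"
abbreviation (input) "pd \<equiv> partial_deriv"
abbreviation (input) seq_tendsto (infixr "~~>" 60) where "f ~~> l \<equiv> (f \<longlongrightarrow> l) sequentially"
abbreviation (input) square ("_^2" [1000] 999) where "x^2 \<equiv> power2 x"
notation (input) scaleR (infixr "*R" 75)

section \<open>Hilbert spaces\<close>

text \<open>Midpoints stay in the convex set, so the parallelogram law makes a minimizing sequence
  Cauchy; \<open>any_closest_point_dot\<close> then turns the nearest point into the obtuse-angle
  inequality.\<close>

lemma hilbert_projection:
 fixes S :: "'a::{real_inner, complete_space} set"
 assumes "closed S" "convex S" "S \<noteq> {}"
 obtains p where "p \<in> S" "\<And>y. y \<in> S ==> inner (x - p) (y - p) <= 0"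
proof -
 define d where "d = infdist x S"
 have "\<exists>y\<in>S. dist x y < d + 1 / Suc n" for n
  using assms(3) cInf_lessD[of "dist x ` S" "d + 1 / Suc n"]
  by (auto simp: d_def infdist_def)
 then obtain f where f: "\<And>n. f n \<in> S" "\<And>n. dist x (f n) < d + 1 / Suc n" by metis
 have d0: "d >= 0" by (simp add: d_def infdist_nonneg)
 have dle: "d <= norm (x - y)" if "y \<in> S" for y
  using infdist_le[OF that, of x] by (simp add: d_def dist_norm)
 have fn: "(norm (x - f n))^2 <= d^2 + (2*d+1) / Suc n" for n
 proof -
  have "(norm (x - f n))^2 <= (d + 1 / Suc n)^2"
   using f(2)[of n] by (intro power_mono) (auto simp: dist_norm)
  also have "\<dots> = d^2 + 2*d*(1 / Suc n) + (1 / Suc n)*(1 / Suc n)"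
   by (simp add: power2_eq_square algebra_simps)
  also have "(1 / Suc n)*(1 / Suc n) <= 1 * (1 / Suc n)"
   by (intro mult_right_mono) auto
  finally show ?thesis by (simp add: algebra_simps add_divide_distrib)
 qed
 have par: "(norm (f m - f n))^2 <= 2*(2*d+1) / Suc n + 2*(2*d+1) / Suc m" for m n
 proof -
  have mid: "(1/2) *R f m + (1/2) *R f n \<in> S"
   using convexD[OF assms(2) f(1) f(1), of "1/2" "1/2"] by simp
  have "(norm (f m - f n))^2 = 2 * (norm (x - f m))^2 + 2 * (norm (x - f n))^2
    - 4 * (norm (x - ((1/2) *R f m + (1/2) *R f n)))^2"
   unfolding power2_norm_eq_inner by (simp add: inner_diff inner_add algebra_simps inner_commute)
  moreover have "d^2 <= (norm (x - ((1/2) *R f m + (1/2) *R f n)))^2"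
   using dle[OF mid] d0 by (intro power_mono) auto
  ultimately have "(norm (f m - f n))^2 <= 2 * ((2*d+1) / Suc m) + 2 * ((2*d+1) / Suc n)"
   using fn[of m] fn[of n] by linarith
  thus ?thesis by simp
 qed
 have "Cauchy f"
 proof (rule metric_CauchyI)
  fix e :: real assume e: "e > 0"
  define C where "C = 4*(2*d+1)"
  obtain M :: nat where M: "C / e^2 < M" using reals_Archimedean2 by blast
  have C0: "C > 0" using d0 by (simp add: C_def)
  have "dist (f m) (f n) < e" if "m >= M" "n >= M" for m n
  proof -
   have Mp: "real M > 0" using M C0 e by (smt (verit) divide_pos_pos zero_less_power)
   have "C / 2 / Suc k <= C / 2 / M" if "k >= M" for k
    using that C0 Mp by (intro divide_left_mono) auto
   from this[OF that(1)] this[OF that(2)]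
   moreover have "(norm (f m - f n))^2 <= C / 2 / Suc n + C / 2 / Suc m"
   proof -
    have "C / 2 = 2*(2*d+1)" by (simp add: C_def)
    thus ?thesis using par[of m n] by metis
   qed
   ultimately have "(norm (f m - f n))^2 <= C / M" by linarith
   also have "\<dots> < e^2" using M Mp e by (simp add: field_simps)
   finally show ?thesis using e by (simp add: dist_norm power2_less_imp_less)
  qed
  thus "\<exists>M. \<forall>m\<ge>M. \<forall>n\<ge>M. dist (f m) (f n) < e" by blast
 qed
 then obtain p where p: "f ~~> p" using Cauchy_convergent convergent_def by blast
 have pS: "p \<in> S" using assms(1) f(1) p closed_sequentially by blast
 have "norm (x - p) <= d"
 proof (rule LIMSEQ_le[of "%n. norm (x - f n)" _ "%n. d + 1 / Suc n"])
  show "(%n. norm (x - f n)) ~~> norm (x - p)" by (intro tendsto_intros p)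
  have "(%n. d + 1 / real (Suc n)) ~~> d + 0"
   by (intro tendsto_intros) (use LIMSEQ_inverse_real_of_nat in \<open>simp add: inverse_eq_divide\<close>)
  thus "(%n. d + 1 / real (Suc n)) ~~> d" by simp
  show "\<exists>N. \<forall>n\<ge>N. norm (x - f n) <= d + 1 / Suc n" using f(2) by (auto simp: dist_norm intro: less_imp_le)
 qed
 hence "\<forall>z\<in>S. dist x p <= dist x z" using dle by (fastforce simp: dist_norm)
 thus thesis using that[OF pS] any_closest_point_dot[OF assms(2,1) pS] by blast
qed

text \<open>Both \<open>p + y\<close> and \<open>p - y\<close> lie in the subspace, so the
  obtuse-angle inequality holds with both signs.\<close>

lemma hilbert_projection_subspace:
 fixes V :: "'a::{real_inner, complete_space} set"
 assumes "closed V" "subspace V"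
 obtains p where "p \<in> V" "\<And>y. y \<in> V ==> inner (x - p) y = 0"
proof -
 obtain p where p: "p \<in> V" "\<And>y. y \<in> V ==> inner (x - p) (y - p) <= 0"
  using hilbert_projection[OF assms(1) subspace_imp_convex[OF assms(2)]] subspace_0[OF assms(2)] by blast
 have "inner (x - p) y = 0" if "y \<in> V" for y
  using p(2)[of "p + y"] p(2)[of "p - y"] p(1) that assms(2)
  by (simp add: subspace_add subspace_diff)
 thus thesis using that p(1) by blast
qed

text \<open>The kernel is a closed subspace, and the component \<open>e\<close> orthogonal to it of
  a vector \<open>x0\<close> with \<open>l x0 \<noteq> 0\<close> spans its complement in
  \<open>V\<close>. Assuming everything only on a closed subspace \<open>V\<close> of a complete
  type lets the result apply to \<open>W Om\<close> without a new type.\<close>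

lemma riesz_representation:
 fixes V :: "'a::{real_inner, complete_space} set"
 assumes V: "closed V" "subspace V"
  and add: "\<And>x y. x \<in> V ==> y \<in> V ==> l (x + y) = l x + l y"
  and scale: "\<And>c x. x \<in> V ==> l (c *R x) = c * l x"
  and bnd: "\<And>x. x \<in> V ==> \<bar>l x\<bar> <= C * norm x"
 obtains r where "r \<in> V" "\<And>x. x \<in> V ==> l x = inner r x"
proof (cases "\<forall>x\<in>V. l x = 0")
 case True
 thus thesis using that[of 0] subspace_0[OF V(2)] by simp
next
 case False
 then obtain x0 where x0: "x0 \<in> V" "l x0 \<noteq> 0" by blast
 have diff: "l (x - y) = l x - l y" if "x \<in> V" "y \<in> V" for x y
  using add[of "x - y" y] that subspace_diff[OF V(2)] by simp
 define K where "K = {x \<in> V. l x = 0}"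
 have "subspace K" unfolding K_def subspace_def
  using add scale subspace_0[OF V(2)] subspace_add[OF V(2)] subspace_scale[OF V(2)] scale[of 0 0]
  by auto
 moreover have "closed K"
 proof (unfold closed_sequential_limits, intro allI impI, elim conjE)
  fix f x assume f: "\<forall>n. f n \<in> K" "f ~~> x"
  have xV: "x \<in> V" using V(1) f closed_sequentially[of V f x] by (auto simp: K_def)
  have "\<bar>l x\<bar> <= C * norm (x - f n)" for n
   using bnd[of "x - f n"] diff[of x "f n"] f(1) xV subspace_diff[OF V(2)] by (auto simp: K_def)
  moreover have "(%n. C * norm (x - f n)) ~~> C * norm (x - x)" by (intro tendsto_intros f)
  ultimately have "\<bar>l x\<bar> <= 0" using LIMSEQ_le_const[of _ "C * norm (x-x)" "\<bar>l x\<bar>"] by simp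
  thus "x \<in> K" using xV by (simp add: K_def)
 qed
 ultimately obtain p where p: "p \<in> K" "\<And>y. y \<in> K ==> inner (x0 - p) y = 0"
  using hilbert_projection_subspace by blast
 define e where "e = x0 - p"
 have eV: "e \<in> V" and le: "l e = l x0"
  using p(1) x0 diff subspace_diff[OF V(2)] by (auto simp: e_def K_def)
 have e0: "inner e e \<noteq> 0" using le x0 scale[OF eV, of 0] by auto
 define r where "r = (l e / inner e e) *R e"
 have "l x = inner r x" if x: "x \<in> V" for x
 proof -
  \<comment> \<open>Subtracting this multiple of \<open>e\<close> makes \<open>l\<close> vanish, so
    the remainder lies in the kernel and is orthogonal to \<open>e\<close>.\<close>
  have "x - (l x / l e) *R e \<in> K"
   using x eV diff scale le x0 subspace_diff[OF V(2)] subspace_scale[OF V(2)] by (simp add: K_def)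
  hence "inner e (x - (l x / l e) *R e) = 0" using p(2) by (simp add: e_def)
  hence "inner e x = l x / l e * inner e e" by (simp add: inner_diff)
  thus ?thesis using e0 le x0 by (simp add: r_def)
 qed
 moreover have "r \<in> V" using eV subspace_scale[OF V(2)] by (simp add: r_def)
 ultimately show thesis using that by blast
qed

section \<open>Weak convergence and weak compactness\<close>

definition weakly_to :: "(nat => 'a::real_inner) => 'a => bool" where
 "weakly_to x l \<longleftrightarrow> (\<forall>y. (%n. inner (x n) y) ~~> inner l y)"

lemma weakly_to_subseq: "weakly_to x l ==> strict_mono r ==> weakly_to (x \<circ> r) l"
 using LIMSEQ_subseq_LIMSEQ by (fastforce simp: weakly_to_def o_def)

lemma strongly_to_weakly_to: "x ~~> l ==> weakly_to x l"
 unfolding weakly_to_def by (intro allI tendsto_inner tendsto_const)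

text \<open>The vector \<open>l - p\<close>, with \<open>p\<close> the projection of
  \<open>l\<close> onto \<open>S\<close>, separates \<open>l\<close> from \<open>S\<close>; in the
  limit the separating inequality says that \<open>l - p\<close> has norm zero.\<close>

lemma weakly_closed_convex:
 fixes S :: "'a::{real_inner, complete_space} set"
 assumes "closed S" "convex S" "weakly_to x l" "\<And>n. x n \<in> S"
 shows "l \<in> S"
proof -
 obtain p where p: "p \<in> S" "\<And>y. y \<in> S ==> inner (l - p) (y - p) <= 0"
  using hilbert_projection[OF assms(1,2)] assms(4) by blast
 have "(%n. inner (x n) (l - p) - inner p (l - p)) ~~> inner l (l - p) - inner p (l - p)"
  using assms(3) by (intro tendsto_diff tendsto_const) (auto simp: weakly_to_def)
 moreover have "inner (x n) (l - p) - inner p (l - p) <= 0" for n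
  using p(2)[OF assms(4)[of n]] by (simp add: inner_diff inner_commute)
 ultimately have "inner l (l - p) - inner p (l - p) <= 0"
  using LIMSEQ_le_const2 by blast
 hence "inner (l - p) (l - p) <= 0" by (simp add: inner_diff)
 thus ?thesis using p(1) by (metis antisym inner_eq_zero_iff inner_ge_zero right_minus_eq)
qed

text \<open>A diagonal subsequence pairs convergently with every member \<open>x m\<close> of the
  sequence itself. The set \<open>V\<close> of all vectors with this property is a closed subspace
  containing the sequence, and a vector orthogonal to \<open>V\<close> pairs to zero with the
  sequence, so \<open>V\<close> is everything. Riesz represents the limit functional.\<close>

theorem weak_compactness:
 fixes x :: "nat => 'a::{real_inner, complete_space}"
 assumes bnd: "\<And>n. norm (x n) <= R"
 obtains r l where "strict_mono (r :: nat => nat)" "weakly_to (x \<circ> r) l"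
proof -
 have R0: "R >= 0" using bnd[of 0] norm_ge_zero order_trans by blast
 interpret subseqs "%m s. convergent (%n. inner (x (s n)) (x m))"
 proof
  fix m and s :: "nat => nat" assume "strict_mono s"
  have "bounded (range (%n. inner (x (s n)) (x m)))"
   unfolding bounded_iff using bnd R0
   by (intro exI[of _ "R * R"])
    (auto intro!: order_trans[OF Cauchy_Schwarz_ineq2] mult_mono)
  then obtain l r where "strict_mono r" "((%n. inner (x (s n)) (x m)) \<circ> r) ~~> l"
   using bounded_imp_convergent_subsequence by blast
  thus "\<exists>r'. strict_mono r' \<and> convergent (%n. inner (x ((s \<circ> r') n)) (x m))"
   by (auto simp: convergent_def o_def)
 qed
 define y where "y = x \<circ> diagseq"
 have ym: "convergent (%n. inner (y n) (x m))" for m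
 proof -
  \<comment> \<open>From index \<open>Suc m\<close> on, the diagonal sequence is a subsequence of
    the one selected for \<open>x m\<close>; the shift is removed by
    \<open>LIMSEQ_offset\<close>.\<close>
  have "convergent (%n. inner (x ((diagseq \<circ> ((+) (Suc m))) n)) (x m))"
  proof (rule diagseq_holds)
   fix r s n assume "strict_mono (r::nat=>nat)" "convergent (%k. inner (x (s k)) (x n))"
   thus "convergent (%k. inner (x ((s \<circ> r) k)) (x n))"
    unfolding convergent_def using LIMSEQ_subseq_LIMSEQ by (fastforce simp: o_def)
  qed
  then obtain L where "(%n. inner (y (n + Suc m)) (x m)) ~~> L"
   by (auto simp: o_def add.commute y_def convergent_def)
  hence "(%n. inner (y n) (x m)) ~~> L" by (rule LIMSEQ_offset)
  thus ?thesis by (auto simp: convergent_def)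
 qed
 have ybnd: "norm (y n) <= R" for n by (simp add: y_def bnd)
 define V where "V = {z. convergent (%n. inner (y n) z)}"
 have sV: "subspace V"
  unfolding subspace_def V_def
  by (auto simp: inner_add_right intro: convergent_add convergent_mult convergent_const)
 have cV: "closed V"
 proof (unfold closed_sequential_limits, intro allI impI, elim conjE)
  fix f l assume f: "\<forall>n. f n \<in> V" "f ~~> l"
  have "Cauchy (%n. inner (y n) l)"
  proof (rule metric_CauchyI)
   fix e :: real assume e: "e > 0"
   \<comment> \<open>Using \<open>R + 1\<close> instead of \<open>R\<close> keeps the denominator
     positive when \<open>R = 0\<close>.\<close>
   define e' where "e' = e / (3 * (R + 1))"
   have e': "e' > 0" using e R0 by (simp add: e'_def)
   obtain k where k: "norm (f k - l) < e'"
    using metric_LIMSEQ_D[OF f(2) e'] by (auto simp: dist_norm)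
   have "Cauchy (%n. inner (y n) (f k))" using f(1) by (simp add: V_def Cauchy_convergent_iff)
   then obtain M where M: "\<And>m n. m >= M ==> n >= M ==> \<bar>inner (y m) (f k) - inner (y n) (f k)\<bar> < e/3"
    using metric_CauchyD[of _ "e/3"] e by (force simp: dist_real_def)
   have small: "\<bar>inner (y m) (f k - l)\<bar> <= e/3" for m
   proof -
    have "\<bar>inner (y m) (f k - l)\<bar> <= norm (y m) * norm (f k - l)" by (rule Cauchy_Schwarz_ineq2)
    also have "\<dots> <= R * e'" using ybnd[of m] k R0 by (intro mult_mono) auto
    also have "\<dots> <= e / 3" using e R0 by (simp add: e'_def field_simps)
    finally show ?thesis .
   qed
   have "dist (inner (y m) l) (inner (y n) l) < e" if "m >= M" "n >= M" for m n
    using M[OF that] small[of m] small[of n] unfolding dist_real_def inner_diff_right by linarith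
   thus "\<exists>M. \<forall>m\<ge>M. \<forall>n\<ge>M. dist (inner (y m) l) (inner (y n) l) < e" by blast
  qed
  thus "l \<in> V" by (simp add: V_def Cauchy_convergent_iff)
 qed
 have VU: "z \<in> V" for z
 proof -
  obtain p where p: "p \<in> V" "\<And>v. v \<in> V ==> inner (z - p) v = 0"
   using hilbert_projection_subspace[OF cV sV] by blast
  have "y n \<in> V" for n using ym by (simp add: V_def y_def)
  hence "inner (y n) (z - p) = 0" for n using p(2) by (simp add: inner_commute)
  hence "z - p \<in> V" by (simp add: V_def convergent_const)
  thus ?thesis using subspace_add[OF sV p(1), of "z - p"] by simp
 qed
 define L where "L z = lim (%n. inner (y n) z)" for z
 have L: "(%n. inner (y n) z) ~~> L z" for z
  using VU[of z] by (simp add: V_def L_def convergent_LIMSEQ_iff)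
 obtain r where r: "\<And>z. L z = inner r z"
 proof (rule riesz_representation[of "UNIV :: 'a set" L R])
  show "L (a + b) = L a + L b" for a b
   by (rule LIMSEQ_unique[OF L]) (simp add: inner_add_right, intro tendsto_intros L)
  show "L (c *R a) = c * L a" for c a
   by (rule LIMSEQ_unique[OF L]) (simp, intro tendsto_intros L)
  show "\<bar>L z\<bar> <= R * norm z" for z
  proof (rule LIMSEQ_le_const2[OF tendsto_rabs[OF L]], intro exI allI impI)
   show "\<bar>inner (y n) z\<bar> <= R * norm z" for n
    using Cauchy_Schwarz_ineq2[of "y n" z] mult_right_mono[OF ybnd[of n] norm_ge_zero[of z]] by linarith
  qed
 qed (auto intro: that)
 have "weakly_to (x \<circ> diagseq) r"
  using L by (simp add: weakly_to_def r y_def)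
 thus thesis using that subseq_diagseq by blast
qed

text \<open>Riesz represents \<open>F p\<close> by a vector \<open>T p\<close>, and the map taking
  \<open>p\<close> to \<open>p - \<tau> T p\<close> is a contraction: expanding the square gives the
  factor \<open>1 - 2 \<tau> c + \<tau>^2 C'^2\<close>, which is minimal for \<tau> =
  \<open>c / C'^2\<close>. Its fixed point is the zero of \<open>T\<close>.\<close>

theorem strongly_monotone_solvable:
 fixes V :: "'a::{real_inner, complete_space} set" and F :: "'a => 'a => real"
 assumes V: "closed V" "subspace V"
  and add: "\<And>p x y. p \<in> V ==> x \<in> V ==> y \<in> V ==> F p (x + y) = F p x + F p y"
  and scale: "\<And>p c x. p \<in> V ==> x \<in> V ==> F p (c *R x) = c * F p x"
  and bnd0: "\<And>x. x \<in> V ==> \<bar>F 0 x\<bar> <= K * norm x"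
  and lip: "\<And>p q x. p \<in> V ==> q \<in> V ==> x \<in> V ==> \<bar>F p x - F q x\<bar> <= C * norm (p - q) * norm x"
  and mono: "\<And>p q. p \<in> V ==> q \<in> V ==> F p (p - q) - F q (p - q) >= c * (norm (p - q))^2"
  and c: "c > 0"
 obtains p where "p \<in> V" "\<And>x. x \<in> V ==> F p x = 0"
proof -
 have V0: "0 \<in> V" using V(2) by (rule subspace_0)
 have "\<exists>r\<in>V. \<forall>x\<in>V. F p x = inner r x" if p: "p \<in> V" for p
 proof -
  have "\<bar>F p x\<bar> <= (K + C * norm p) * norm x" if "x \<in> V" for x
   using bnd0[OF that] lip[OF p V0 that] by (simp add: algebra_simps)
  then obtain r where "r \<in> V" "\<And>x. x \<in> V ==> F p x = inner r x"
   using riesz_representation[OF V, of "F p"] add scale p by metis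
  thus ?thesis by blast
 qed
 then obtain T where T: "\<And>p. p \<in> V ==> T p \<in> V" "\<And>p x. p \<in> V ==> x \<in> V ==> F p x = inner (T p) x"
  by metis
 \<comment> \<open>Enlarging the Lipschitz constant to at least \<open>c\<close> makes it positive
   and keeps the squared contraction factor \<open>1 - c^2 / C'^2\<close> nonnegative.\<close>
 define C' where "C' = max C c"
 have C': "C' > 0" "C' >= c" using c by (auto simp: C'_def)
 have Tlip: "norm (T p - T q) <= C' * norm (p - q)" if "p \<in> V" "q \<in> V" for p q
 proof -
  define x where "x = T p - T q"
  have x: "x \<in> V" using T(1) that subspace_diff[OF V(2)] by (simp add: x_def)
  have "norm x * norm x = inner (T p) x - inner (T q) x"
   by (simp add: x_def inner_diff_left[symmetric] power2_norm_eq_inner[symmetric] power2_eq_square)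
  also have "\<dots> = F p x - F q x" using T(2) that x by simp
  also have "\<dots> <= C * norm (p - q) * norm x" using lip[OF that x] by linarith
  also have "\<dots> <= C' * norm (p - q) * norm x" by (intro mult_right_mono) (auto simp: C'_def)
  finally show ?thesis unfolding x_def[symmetric]
   by (cases "norm x = 0") (use C' in auto)
 qed
 have Tmono: "inner (T p - T q) (p - q) >= c * (norm (p - q))^2" if "p \<in> V" "q \<in> V" for p q
  using mono[OF that] T(2) that subspace_diff[OF V(2)] by (simp add: inner_diff_left)
 define \<tau> where "\<tau> = c / C'^2"
 define S where "S p = p - \<tau> *R T p" for p
 have tau: "\<tau> > 0" using c C' by (simp add: \<tau>_def)
 define k where "k = sqrt (1 - c^2 / C'^2)"
 have k: "0 <= k" "k < 1" "k^2 = 1 - c^2 / C'^2"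
  using c C' power_mono[of c C' 2] by (auto simp: k_def divide_le_eq)
 have contr: "dist (S p) (S q) <= k * dist p q" if "p \<in> V" "q \<in> V" for p q
 proof -
  have "(norm (S p - S q))^2 = (norm (p - q))^2 - 2 * \<tau> * inner (T p - T q) (p - q) + \<tau>^2 * (norm (T p - T q))^2"
   unfolding S_def power2_norm_eq_inner
   by (simp add: inner_diff inner_commute algebra_simps power2_eq_square)
  also have "\<dots> <= (norm (p - q))^2 - 2 * \<tau> * (c * (norm (p - q))^2) + \<tau>^2 * (C' * norm (p - q))^2"
   using Tmono[OF that] Tlip[OF that] tau
   by (intro add_mono diff_mono mult_left_mono power_mono) auto
  also have "\<dots> = (1 - 2 * \<tau> * c + \<tau>^2 * C'^2) * (norm (p - q))^2" by (simp add: algebra_simps power_mult_distrib)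
  also have "1 - 2 * \<tau> * c + \<tau>^2 * C'^2 = k^2"
  proof -
   have "\<tau> * c = c^2 / C'^2" by (simp add: \<tau>_def power2_eq_square)
   moreover have "\<tau>^2 * C'^2 = c^2 / C'^2" using C' by (simp add: \<tau>_def power2_eq_square)
   ultimately show ?thesis unfolding k by simp
  qed
  finally have "(norm (S p - S q))^2 <= (k * norm (p - q))^2" by (simp add: power_mult_distrib)
  moreover have "0 <= k * norm (p - q)" using k(1) by simp
  ultimately show ?thesis unfolding dist_norm by (rule power2_le_imp_le)
 qed
 have "\<exists>!p. p \<in> V \<and> S p = p"
 proof (rule Banach_fix[OF _ _ k(1,2)])
  show "complete V" using V(1) by (simp add: complete_eq_closed)
  show "S ` V \<subseteq> V" using T(1) V(2) by (auto simp: S_def subspace_diff subspace_scale)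
 qed (use V0 contr in auto)
 then obtain p where "p \<in> V" "S p = p" by blast
 thus thesis using that[of p] T(2) tau by (simp add: S_def)
qed

section \<open>The Hilbert space of square integrable functions\<close>

definition sqi :: "('a::euclidean_space => real) => bool" where
 "sqi f \<longleftrightarrow> f \<in> BM \<and> integrable lebesgue (%x. (f x)^2)"

lemma sqi_measurable[measurable_dest]: "sqi f ==> f \<in> BM"
 by (simp add: sqi_def)

lemma sqi_square_integrable: "sqi f ==> integrable lebesgue (%x. (f x)^2)"
 by (simp add: sqi_def)

lemma sqi_bound:
 assumes "sqi g" "f \<in> BM" "ae x. \<bar>f x\<bar> <= C * \<bar>g x\<bar>"
 shows "sqi f"
proof -
 have [measurable]: "f \<in> BM" by fact
 have "integrable lebesgue (%x. (f x)^2)"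
 proof (rule Bochner_Integration.integrable_bound)
  show "integrable lebesgue (%x. C^2 * (g x)^2)" using assms(1) by (simp add: sqi_def)
  show "ae x. norm ((f x)^2) <= norm (C^2 * (g x)^2)"
   using assms(3)
  proof eventually_elim
   case (elim x)
   hence "\<bar>f x\<bar>^2 <= (C * \<bar>g x\<bar>)^2" by (intro power_mono) auto
   thus ?case by (simp add: power_mult_distrib)
  qed
 qed simp
 thus ?thesis using assms(2) by (simp add: sqi_def)
qed

lemma sqi_mult_integrable:
 assumes "sqi f" "sqi g" shows "integrable lebesgue (%x. f x * g x)"
proof (rule Bochner_Integration.integrable_bound)
 show "integrable lebesgue (%x. (f x)^2 + (g x)^2)" using assms by (simp add: sqi_def)
 show "(%x. f x * g x) \<in> BM"
  using assms by (auto simp: sqi_def intro: borel_measurable_times)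
 show "ae x. norm (f x * g x) <= norm ((f x)^2 + (g x)^2)"
 proof (intro AE_I2)
  fix x
  have "0 <= (\<bar>f x\<bar> - \<bar>g x\<bar>)^2" by simp
  hence "2 * (\<bar>f x\<bar> * \<bar>g x\<bar>) <= (f x)^2 + (g x)^2" by (simp add: power2_diff)
  moreover have "0 <= \<bar>f x\<bar> * \<bar>g x\<bar>" by simp
  ultimately have "\<bar>f x\<bar> * \<bar>g x\<bar> <= (f x)^2 + (g x)^2" by linarith
  thus "norm (f x * g x) <= norm ((f x)^2 + (g x)^2)" by (simp add: abs_mult)
 qed
qed

lemma sqi_zero[simp]: "sqi (%x. 0)" by (simp add: sqi_def)

lemma sqi_cmult: "sqi f ==> sqi (%x. c * f x)"
 by (rule sqi_bound[of f _ "\<bar>c\<bar>"]) (auto simp: sqi_def abs_mult)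

lemma sqi_add: assumes "sqi f" "sqi g" shows "sqi (%x. f x + g x)"
proof -
 have "integrable lebesgue (%x. (f x)^2 + (g x)^2 + 2 * (f x * g x))"
  using assms sqi_mult_integrable[OF assms] by (auto simp: sqi_def)
 moreover have "(%x. f x + g x) \<in> BM"
  using assms by (auto simp: sqi_def intro: borel_measurable_add)
 ultimately show ?thesis by (simp add: sqi_def power2_sum algebra_simps)
qed

lemma sqi_uminus: "sqi f ==> sqi (%x. - f x)"
 using sqi_cmult[of f "-1"] by simp

lemma sqi_diff: "sqi f ==> sqi g ==> sqi (%x. f x - g x)"
 using sqi_add[OF _ sqi_uminus] by simp

lemma sqi_abs: "sqi f ==> sqi (%x. \<bar>f x\<bar>)"
 by (rule sqi_bound[of f _ 1]) (auto simp: sqi_def)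

lemma sqi_sum: "(\<And>i. i \<in> I ==> sqi (f i)) ==> sqi (%x. \<Sum>i\<in>I. f i x)"
 by (induction I rule: infinite_finite_induct) (auto intro: sqi_add)

lemma sqi_mult_bounded:
 assumes "sqi f" "b \<in> BM" "ae x. \<bar>b x\<bar> <= C"
 shows "sqi (%x. b x * f x)"
proof (rule sqi_bound[OF assms(1)])
 show "ae x. \<bar>b x * f x\<bar> <= C * \<bar>f x\<bar>"
  using assms(3) by eventually_elim (auto simp: abs_mult intro: mult_right_mono)
qed (use assms in \<open>auto simp: sqi_def\<close>)

lemma sqi_indicator:
 assumes "S \<in> lmeasurable" shows "sqi (ind S)"
proof -
 have "(ind S x :: real)^2 = ind S x" for x by (simp add: indicator_def)
 thus ?thesis using assms borel_measurable_indicator[of S lebesgue]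
  by (auto simp: sqi_def fmeasurable_def)
qed

section \<open>The quotient space L2 and its completeness\<close>

definition l2_rel :: "('a::euclidean_space => real) => ('a => real) => bool" where
 "l2_rel f g \<longleftrightarrow> sqi f \<and> sqi g \<and> (ae x. f x = g x)"

lemma part_equivp_l2_rel: "part_equivp (l2_rel :: ('a::euclidean_space => real) => _)"
proof (rule part_equivpI)
 show "\<exists>x. l2_rel x x" by (rule exI[of _ "%x. 0"]) (simp add: l2_rel_def)
 show "symp l2_rel" unfolding symp_def l2_rel_def by (auto elim: AE_mp)
 have trans: "ae x. f x = h x"
  if "ae x. f x = g x" "ae x. g x = h x" for f g h :: "'a => real"
  using that by eventually_elim simp
 have "l2_rel f h" if "l2_rel f g" "l2_rel g h" for f g h :: "'a => real"
  using trans[of f g h] that by (simp add: l2_rel_def)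
 thus "transp (l2_rel :: ('a => real) => _)" by (rule transpI)
qed

\<comment> \<open>The relation holds only between square integrable functions, so the quotient is
  partial: its elements are exactly the L2 classes, and \<open>cls f\<close> is meaningful only
  under \<open>sqi f\<close>. A type is wanted because the Hilbert space theorems are stated for the
  type classes of inner product and complete spaces.\<close>
quotient_type (overloaded) 'a l2 = "'a::euclidean_space => real" / partial: l2_rel
 morphisms rep_l2 cls
 by (rule part_equivp_l2_rel)

lemma cls_eq_iff: "sqi f ==> sqi g ==> cls f = cls g \<longleftrightarrow> (ae x. f x = g x)"
 using Quotient3_rel[OF Quotient3_l2, of f g] by (auto simp: l2_rel_def)

lemma cls_eqI: "sqi f ==> sqi g ==> (ae x. f x = g x) ==> cls f = cls g"
 by (simp add: cls_eq_iff)

lemma l2_cases[cases type: l2]: obtains f where "x = cls f" "sqi f"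
proof -
 have "l2_rel (rep_l2 x) (rep_l2 x)" "cls (rep_l2 x) = x"
  by (simp_all add: Quotient3_rep_reflp[OF Quotient3_l2] Quotient3_abs_rep[OF Quotient3_l2])
 thus thesis using that[of "rep_l2 x"] by (simp add: l2_rel_def)
qed

lemma AE_eq_combine:
 assumes "AE x in M. f x = f' x" "AE x in M. g x = g' x"
 shows "AE x in M. h (f x) (g x) = h (f' x) (g' x)"
 using assms by eventually_elim simp

lemma l2_rel_combine:
 fixes f f' g g' :: "'a::euclidean_space => real"
 assumes "l2_rel f f'" "l2_rel g g'"
  "\<And>f g :: 'a => real. sqi f ==> sqi g ==> sqi (%x. h (f x) (g x))"
 shows "l2_rel (%x. h (f x) (g x)) (%x. h (f' x) (g' x))"
 using assms AE_eq_combine[of f f' lebesgue g g' h] assms(3)[of f g] assms(3)[of f' g']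
 by (simp add: l2_rel_def)

instantiation l2 :: (euclidean_space) real_inner
begin

lift_definition zero_l2 :: "'a l2" is "%x. 0" by (simp add: l2_rel_def)

lift_definition plus_l2 :: "'a l2 => 'a l2 => 'a l2" is "%f g x. f x + g x"
 by (rule l2_rel_combine[where h="(+)"]) (simp_all add: sqi_add)

lift_definition uminus_l2 :: "'a l2 => 'a l2" is "%f x. - f x"
 by (rule l2_rel_combine[where h="%a b. - a"]) (simp_all add: sqi_uminus)

lift_definition minus_l2 :: "'a l2 => 'a l2 => 'a l2" is "%f g x. f x - g x"
 by (rule l2_rel_combine[where h="(-)"]) (simp_all add: sqi_diff)

lift_definition scaleR_l2 :: "real => 'a l2 => 'a l2" is "%c f x. c * f x"
 by (rule l2_rel_combine[where h="%a b. _ * a"]) (simp_all add: sqi_cmult)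

lift_definition inner_l2 :: "'a l2 => 'a l2 => real" is "%f g. (lint x. f x * g x)"
proof -
 fix f f' g g' :: "'a => real" assume *: "l2_rel f f'" "l2_rel g g'"
 show "(lint x. f x * g x) = (lint x. f' x * g' x)"
 proof (rule integral_cong_AE)
  show "ae x. f x * g x = f' x * g' x"
   using * unfolding l2_rel_def by (intro AE_eq_combine[where h="(*)"]) auto
 qed (use * in \<open>auto simp: l2_rel_def sqi_def\<close>)
qed

definition norm_l2 :: "'a l2 => real" where "norm_l2 x = sqrt (inner x x)"
definition dist_l2 :: "'a l2 => 'a l2 => real" where "dist_l2 x y = norm (x - y)"
definition sgn_l2 :: "'a l2 => 'a l2" where "sgn_l2 x = scaleR (inverse (norm x)) x"
definition uniformity_l2 :: "('a l2 \<times> 'a l2) filter" where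
 "uniformity_l2 = (INF e\<in>{0<..}. principal {(x, y). dist x y < e})"
definition open_l2 :: "'a l2 set => bool" where
 "open_l2 U \<longleftrightarrow> (\<forall>x\<in>U. eventually (%(x', y). x' = x --> y \<in> U) uniformity)"

lemma cls_simps:
 fixes f g :: "'a => real"
 shows "sqi f ==> sqi g ==> cls f + cls g = cls (%x. f x + g x)"
  and "sqi f ==> sqi g ==> cls f - cls g = cls (%x. f x - g x)"
  and "sqi f ==> - cls f = cls (%x. - f x)"
  and "sqi f ==> c *R cls f = cls (%x. c * f x)"
  and "sqi f ==> sqi g ==> inner (cls f) (cls g) = (lint x. f x * g x)"
  and "(0::'a l2) = cls (%x. 0)"
 by (auto simp: plus_l2.abs_eq minus_l2.abs_eq uminus_l2.abs_eq scaleR_l2.abs_eq inner_l2.abs_eq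
   zero_l2_def l2_rel_def)

instance
proof
 fix x y z :: "'a l2" and r s :: real
 obtain f where f: "x = cls f" "sqi f" by (cases x)
 obtain g where g: "y = cls g" "sqi g" by (cases y)
 obtain h where h: "z = cls h" "sqi h" by (cases z)
 note I = sqi_add sqi_diff sqi_uminus sqi_cmult f g h
 show "x + y + z = x + (y + z)" "x + y = y + x" "0 + x = x" "- x + x = 0" "x - y = x + - y"
  "r *R (x + y) = r *R x + r *R y" "(r + s) *R x = r *R x + s *R x"
  "r *R s *R x = (r * s) *R x" "1 *R x = x"
  by (simp_all add: I cls_simps algebra_simps)
 show "dist x y = norm (x - y)" "sgn x = inverse (norm x) *R x" "norm x = sqrt (inner x x)"
  by (simp_all add: dist_l2_def sgn_l2_def norm_l2_def)
 show "uniformity = (INF e\<in>{0<..}. principal {(x, y :: 'a l2). dist x y < e})"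
  by (simp add: uniformity_l2_def)
 show "open U \<longleftrightarrow> (\<forall>x\<in>U. eventually (%(x', y). x' = x --> y \<in> U) uniformity)" for U :: "'a l2 set"
  by (simp add: open_l2_def)
 show "inner x y = inner y x" by (simp add: I cls_simps mult.commute)
 show "inner (x + y) z = inner x z + inner y z"
  using sqi_mult_integrable[OF f(2) h(2)] sqi_mult_integrable[OF g(2) h(2)]
  by (simp add: I cls_simps distrib_right)
 show "inner (r *R x) y = r * inner x y" by (simp add: I cls_simps mult.assoc)
 show "0 <= inner x x" by (simp add: I cls_simps)
 show "inner x x = 0 \<longleftrightarrow> x = 0"
  using f(2) by (simp add: f cls_simps cls_eq_iff integral_nonneg_eq_0_iff_AE sqi_mult_integrable)
qed

end

lemma norm_cls: "sqi f ==> (norm (cls f))^2 = (lint x. (f x)^2)"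
 by (simp only: power2_norm_eq_inner cls_simps(5)) (simp add: power2_eq_square)

lemma cls_sum: "(\<And>i. i \<in> I ==> sqi (f i)) ==> (\<Sum>i\<in>I. cls (f i)) = cls (%x. \<Sum>i\<in>I. f i x)"
 by (induction I rule: infinite_finite_induct) (auto simp: cls_simps sqi_sum)

lemma norm_cls_mono:
 assumes "sqi f" "sqi g" "ae x. \<bar>f x\<bar> <= C * \<bar>g x\<bar>" "C >= 0"
 shows "norm (cls f) <= C * norm (cls g)"
proof (rule power2_le_imp_le)
 have "(lint x. (f x)^2) <= (lint x. C^2 * (g x)^2)"
 proof (rule integral_mono_AE)
  show "ae x. (f x)^2 <= C^2 * (g x)^2" using assms(3)
  proof eventually_elim
   case (elim x)
   hence "\<bar>f x\<bar>^2 <= (C * \<bar>g x\<bar>)^2" by (intro power_mono) auto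
   thus ?case by (simp add: power_mult_distrib)
  qed
 qed (use assms in \<open>auto simp: sqi_def\<close>)
 thus "(norm (cls f))^2 <= (C * norm (cls g))^2"
  by (simp add: norm_cls assms power_mult_distrib)
 show "0 <= C * norm (cls g)" using assms by simp
qed

lemma cls_tendsto_iff:
 assumes "\<And>n. sqi (f n)" "sqi g"
 shows "(%n. cls (f n)) ~~> cls g \<longleftrightarrow> (%n. (lint x. (f n x - g x)^2)) ~~> 0"
proof -
 have eq: "(lint x. (f n x - g x)^2) = (norm (cls (f n) - cls g))^2" for n
  using assms by (simp add: cls_simps norm_cls sqi_diff)
 show ?thesis
 proof
  assume "(%n. cls (f n)) ~~> cls g"
  hence "(%n. norm (cls (f n) - cls g)) ~~> 0" by (simp add: LIM_zero tendsto_norm_zero)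
  from tendsto_power[OF this, of 2] show "(%n. (lint x. (f n x - g x)^2)) ~~> 0" by (simp add: eq)
 next
  assume "(%n. (lint x. (f n x - g x)^2)) ~~> 0"
  from tendsto_real_sqrt[OF this] have "(%n. norm (cls (f n) - cls g)) ~~> 0" by (simp add: eq)
  thus "(%n. cls (f n)) ~~> cls g" by (simp add: LIM_zero_iff tendsto_norm_zero_iff)
 qed
qed

text \<open>Carries L2 convergence through pointwise Lipschitz maps such as absolute values,
  truncations and multiplication by a bounded function, without passing to subsequences.\<close>

lemma cls_tendsto_lipschitz:
 assumes "(%n. cls (f n)) ~~> cls f'" "\<And>n. sqi (f n)" "sqi f'" "\<And>n. sqi (g n)" "sqi g'"
  "\<And>n. ae x. \<bar>g n x - g' x\<bar> <= C * \<bar>f n x - f' x\<bar>" "C >= 0"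
 shows "(%n. cls (g n)) ~~> cls g'"
proof -
 have le: "norm (cls (g n) - cls g') <= C * norm (cls (f n) - cls f')" for n
  using norm_cls_mono[of "%x. g n x - g' x" "%x. f n x - f' x" C] assms by (simp add: cls_simps sqi_diff)
 have "(%n. C * norm (cls (f n) - cls f')) ~~> C * norm (cls f' - cls f')"
  by (intro tendsto_intros assms(1))
 hence "(%n. C * norm (cls (f n) - cls f')) ~~> 0" by simp
 hence "(%n. cls (g n) - cls g') ~~> 0"
  by (rule Lim_null_comparison[rotated]) (use le in simp)
 thus ?thesis by (rule LIM_zero_cancel)
qed

text \<open>The limit inherits the bound by \<open>C * \<bar>h x\<bar>\<close>, so the squared error
  is at most \<open>(2 * C)^2 * (h x)^2\<close> and the ordinary theorem applies to it.\<close>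

lemma cls_dominated_convergence:
 assumes "\<And>n. f n \<in> BM" "g \<in> BM" "sqi h"
  "ae x. (%n. f n x) ~~> g x" "\<And>n. ae x. \<bar>f n x\<bar> <= C * \<bar>h x\<bar>"
 shows "sqi g" "\<And>n. sqi (f n)" "(%n. cls (f n)) ~~> cls g"
proof -
 have [measurable]: "\<And>n. f n \<in> BM" "g \<in> BM" by fact+
 have all: "ae x. \<forall>n. \<bar>f n x\<bar> <= C * \<bar>h x\<bar>" using assms(5) by (simp add: AE_all_countable)
 have gle: "ae x. \<bar>g x\<bar> <= C * \<bar>h x\<bar>" using assms(4) all
 proof eventually_elim
  case (elim x)
  thus ?case using LIMSEQ_le_const2[OF tendsto_rabs[of "%n. f n x"]] by blast
 qed
 show g: "sqi g" by (rule sqi_bound[OF assms(3,2) gle])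
 show f: "sqi (f n)" for n by (rule sqi_bound[OF assms(3) assms(1) assms(5)])
 have "(%n. (lint x. (f n x - g x)^2)) ~~> (\<integral>x. 0 \<partial>(lebesgue :: 'a measure))"
 proof (rule integral_dominated_convergence[where w="%x. (2*C)^2 * (h x)^2"])
  show "integrable lebesgue (%x. (2*C)^2 * (h x)^2)" using assms(3) by (simp add: sqi_def)
  show "ae x. (%n. (f n x - g x)^2) ~~> 0" using assms(4)
  proof eventually_elim
   case (elim x)
   from tendsto_power[OF LIM_zero[OF this], of 2] show ?case by simp
  qed
  show "ae x. norm ((f n x - g x)^2) <= (2*C)^2 * (h x)^2" for n using gle assms(5)[of n]
  proof eventually_elim
   case (elim x)
   hence "\<bar>f n x - g x\<bar>^2 <= (2 * C * \<bar>h x\<bar>)^2" by (intro power_mono) auto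
   thus ?case by (simp add: power_mult_distrib)
  qed
 qed simp_all
 thus "(%n. cls (f n)) ~~> cls g" by (simp add: cls_tendsto_iff f g)
qed

text \<open>L2 convergence is L1 convergence of the squared differences.\<close>

lemma cls_AE_subseq:
 assumes "(%n. cls (f n)) ~~> cls g" "\<And>n. sqi (f n)" "sqi g"
 obtains r where "strict_mono (r :: nat => nat)" "ae x. (%n. f (r n) x) ~~> g x"
proof -
 have "\<exists>r::nat=>nat. strict_mono r \<and> (ae x. (%n. (f (r n) x - g x)^2) ~~> 0)"
 proof (rule tendsto_L1_AE_subseq)
  show "integrable lebesgue (%x. (f n x - g x)^2)" for n using sqi_diff[of "f n" g] assms by (simp add: sqi_def)
  show "(%n. (lint x. norm ((f n x - g x)^2))) ~~> 0" using assms cls_tendsto_iff[of f g] by simp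
 qed
 then obtain r :: "nat => nat" where r: "strict_mono r" "ae x. (%n. (f (r n) x - g x)^2) ~~> 0" by blast
 from r(2) have "ae x. (%n. f (r n) x) ~~> g x"
 proof eventually_elim
  case (elim x)
  from tendsto_real_sqrt[OF this] have "(%n. f (r n) x - g x) ~~> 0" by (simp add: tendsto_rabs_zero_iff)
  thus ?case by (simp add: LIM_zero_iff)
 qed
 with r(1) show thesis by (rule that)
qed

text \<open>Riesz-Fischer. Along a subsequence with consecutive distances below
  \<open>(1/2)^n\<close>, the sums of absolute increments are bounded in L2 and hence, by monotone
  convergence, bounded almost everywhere. The telescoping series yields a pointwise limit, and
  Fatou's lemma upgrades it to an L2 limit.\<close>

instance l2 :: (euclidean_space) complete_space
proof
 fix X :: "nat => 'a l2" assume C: "Cauchy X"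
 have "\<forall>n. \<exists>N. \<forall>i\<ge>N. \<forall>j\<ge>N. norm (X i - X j) < (1/2)^n"
  using C unfolding Cauchy_def dist_norm by (metis half_gt_zero_iff zero_less_power zero_less_one)
 then obtain N where N: "\<And>n i j. i >= N n ==> j >= N n ==> norm (X i - X j) < (1/2)^n" by metis
 \<comment> \<open>The maximum with \<open>Suc m\<close> makes \<open>r\<close> strictly increasing
   while it still passes the Cauchy threshold \<open>N n\<close>.\<close>
 define r where "r = rec_nat (N 0) (%n m. max (Suc m) (N (Suc n)))"
 have rS: "r (Suc n) = max (Suc (r n)) (N (Suc n))" for n by (simp add: r_def)
 have r: "r n < r (Suc n)" "N n <= r n" for n
  using rS[of n] by simp (cases n; simp add: r_def)
 hence sm: "strict_mono r" by (simp add: strict_mono_Suc_iff)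
 have Ystep: "norm (X (r (Suc n)) - X (r n)) < (1/2)^n" for n
  using N[of n "r (Suc n)" "r n"] r(2)[of n] r(1)[of n] by simp
 define f where "f n = (SOME f. X (r n) = cls f \<and> sqi f)" for n
 have f: "X (r n) = cls (f n)" "sqi (f n)" for n
 proof -
  have "\<exists>f. X (r n) = cls f \<and> sqi f" by (cases "X (r n)") auto
  from someI_ex[OF this] show "X (r n) = cls (f n)" "sqi (f n)" unfolding f_def[symmetric] by blast+
 qed
 have [measurable]: "f n \<in> BM" for n using f(2) by (rule sqi_measurable)
 define S where "S k x = (\<Sum>i<k. \<bar>f (Suc i) x - f i x\<bar>)" for k x
 have sS: "sqi (S k)" for k unfolding S_def by (intro sqi_sum sqi_abs sqi_diff f)
 have [measurable]: "S n \<in> BM" for n using sS by (rule sqi_measurable)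
 have S2: "(lint x. (S k x)^2) <= 4" for k
 proof -
  have "norm (cls (S k)) <= (\<Sum>i<k. norm (cls (%x. \<bar>f (Suc i) x - f i x\<bar>)))"
   unfolding S_def by (subst cls_sum[symmetric]) (intro sqi_abs sqi_diff f norm_sum)+
  also have "\<dots> <= (\<Sum>i<k. (1/2)^i)"
  proof (rule sum_mono)
   fix i
   have "norm (cls (%x. \<bar>f (Suc i) x - f i x\<bar>)) <= 1 * norm (cls (%x. f (Suc i) x - f i x))"
    by (intro norm_cls_mono sqi_abs sqi_diff f) auto
   also have "\<dots> = norm (X (r (Suc i)) - X (r i))" by (simp add: f cls_simps)
   finally show "norm (cls (%x. \<bar>f (Suc i) x - f i x\<bar>)) <= (1/2)^i" using Ystep[of i] by simp
  qed
  also have "\<dots> <= 2" by (simp add: geometric_sum) 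
  finally have "(norm (cls (S k)))^2 <= 2^2" by (intro power_mono) auto
  thus ?thesis by (simp add: norm_cls sS)
 qed
 have "(\<integral>\<^sup>+x. (SUP k. ennreal ((S k x)^2)) \<partial>lebesgue) = (SUP k. \<integral>\<^sup>+x. ennreal ((S k x)^2) \<partial>lebesgue)"
 proof (rule nn_integral_monotone_convergence_SUP)
  show "incseq (%k x. ennreal ((S k x)^2))"
   unfolding incseq_def le_fun_def S_def
   by (intro allI impI ennreal_leI power_mono sum_mono2 sum_nonneg) auto
 qed simp
 also have "\<dots> <= 4"
 proof (rule SUP_least)
  fix k
  have "(\<integral>\<^sup>+x. ennreal ((S k x)^2) \<partial>lebesgue) = ennreal (lint x. (S k x)^2)"
   using sS[of k] by (intro nn_integral_eq_integral) (auto simp: sqi_def)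
  thus "(\<integral>\<^sup>+x. ennreal ((S k x)^2) \<partial>lebesgue) <= 4" using S2[of k] ennreal_leI by fastforce
 qed
 finally have "(\<integral>\<^sup>+x. (SUP k. ennreal ((S k x)^2)) \<partial>lebesgue) \<noteq> \<infinity>" by (auto simp: top_unique)
 hence "ae x. (SUP k. ennreal ((S k x)^2)) \<noteq> \<infinity>"
  by (intro nn_integral_noteq_infinite) auto
 hence conv: "ae x. convergent (%n. f n x)"
 proof eventually_elim
  case (elim x)
  then obtain c where c: "c >= 0" "(SUP k. ennreal ((S k x)^2)) = ennreal c"
   by (cases "SUP k. ennreal ((S k x)^2)") auto
  have "S k x <= sqrt c" for k
  proof -
   have "ennreal ((S k x)^2) <= ennreal c" unfolding c(2)[symmetric] by (rule SUP_upper) simp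
   hence "(S k x)^2 <= c" using c(1) by (simp add: ennreal_le_iff)
   thus ?thesis by (rule real_le_rsqrt)
  qed
  hence "summable (%i. \<bar>f (Suc i) x - f i x\<bar>)"
   by (intro summableI_nonneg_bounded[where x="sqrt c"]) (auto simp: S_def)
  hence "summable (%i. f (Suc i) x - f i x)" by (rule summable_rabs_cancel)
  hence "convergent (%n. f n x - f 0 x)"
   by (simp add: summable_iff_convergent sum_lessThan_telescope[of "%n. f n x"])
  hence "convergent (%n. f n x - f 0 x + f 0 x)" by (intro convergent_add convergent_const)
  thus ?case by simp
 qed
 define g where "g x = lim (%n. f n x)" for x
 have [measurable]: "g \<in> BM" unfolding g_def by measurable
 have lim: "ae x. (%n. f n x) ~~> g x"
  using conv by eventually_elim (simp add: g_def convergent_LIMSEQ_iff)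
 have key: "(\<integral>\<^sup>+x. ennreal ((g x - f n x)^2) \<partial>lebesgue) <= ennreal (((1/2)^n)^2)" for n
 proof -
  have "(\<integral>\<^sup>+x. ennreal ((g x - f n x)^2) \<partial>lebesgue)
    = (\<integral>\<^sup>+x. liminf (%m. ennreal ((f m x - f n x)^2)) \<partial>lebesgue)"
  proof (rule nn_integral_cong_AE)
   show "ae x. ennreal ((g x - f n x)^2) = liminf (%m. ennreal ((f m x - f n x)^2))"
    using lim
   proof eventually_elim
    case (elim x)
    hence "(%m. ennreal ((f m x - f n x)^2)) ~~> ennreal ((g x - f n x)^2)"
     by (intro tendsto_intros) auto
    thus ?case by (intro lim_imp_Liminf[symmetric] sequentially_bot)
   qed
  qed
  also have "\<dots> <= liminf (%m. \<integral>\<^sup>+x. ennreal ((f m x - f n x)^2) \<partial>lebesgue)"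
   by (rule nn_integral_liminf) simp
  also have "\<dots> <= liminf (%m. ennreal (((1/2)^n)^2))"
  proof (rule Liminf_mono, rule eventually_sequentiallyI[of n])
   fix m assume m: "n <= m"
   have "(\<integral>\<^sup>+x. ennreal ((f m x - f n x)^2) \<partial>lebesgue) = ennreal (lint x. (f m x - f n x)^2)"
    using sqi_diff[OF f(2) f(2)] by (intro nn_integral_eq_integral) (auto simp: sqi_def)
   also have "(lint x. (f m x - f n x)^2) = (norm (X (r m) - X (r n)))^2"
    by (simp add: f cls_simps norm_cls sqi_diff)
   also have "\<dots> <= ((1/2)^n)^2"
    using N[of n "r m" "r n"] r(2)[of n] strict_mono_less_eq[OF sm, of n m] m
    by (intro power_mono) auto
   finally show "(\<integral>\<^sup>+x. ennreal ((f m x - f n x)^2) \<partial>lebesgue) <= ennreal (((1/2)^n)^2)"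
    by (simp add: ennreal_leI)
  qed
  finally show ?thesis by (simp add: Liminf_const)
 qed
 have gd: "sqi (%x. g x - f n x)" for n
  unfolding sqi_def using key[of n]
  by (auto intro!: integrableI_nonneg simp: top_unique less_top intro: le_less_trans)
 hence sg: "sqi g" using sqi_add[OF gd[of 0] f(2)[of 0]] by simp
 have nb: "norm (X (r n) - cls g) <= (1/2)^n" for n
 proof -
  have "(norm (cls g - cls (f n)))^2 = (lint x. (g x - f n x)^2)"
   using f sg gd by (simp add: cls_simps norm_cls)
  moreover have "ennreal (lint x. (g x - f n x)^2) <= ennreal (((1/2)^n)^2)"
   using key[of n] gd[of n] by (subst nn_integral_eq_integral[symmetric]) (auto simp: sqi_def)
  ultimately have "(norm (cls g - cls (f n)))^2 <= ((1/2)^n)^2" by (simp add: ennreal_le_iff)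
  hence "norm (cls g - cls (f n)) <= (1/2)^n" by (rule power2_le_imp_le) simp
  thus ?thesis by (simp add: f norm_minus_commute)
 qed
 have "(%n. X (r n) - cls g) ~~> 0"
  by (rule Lim_null_comparison[where g="%n. (1/2)^n"]) (use nb LIMSEQ_power_zero[of "1/2::real"] in auto)
 hence "(X \<circ> r) ~~> cls g" by (simp add: LIM_zero_iff o_def)
 thus "convergent X"
  using Cauchy_converges_subseq[OF C sm] by (auto simp: convergent_def)
qed

section \<open>Dense sets of indicator functions and separability\<close>

lemma closure_seqI: "(\<And>n. f n \<in> S) ==> f ~~> x ==> x \<in> closure S"
 for x :: "'a::first_countable_topology"
 unfolding closure_sequential by blast

lemma closure_seqE:
 fixes x :: "'a::first_countable_topology"
 assumes "x \<in> closure S" obtains f where "\<And>n. f n \<in> S" "f ~~> x"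
 using assms unfolding closure_sequential by blast

text \<open>The residual of the projection onto \<open>V\<close> is orthogonal to the given
  indicators. The sets over which its integral vanishes, after intersection with a fixed box, form a
  Dynkin system; since \<open>G\<close> is Int-stable they include all Borel sets, and the residual
  is zero. The boxes provide finite measure, on which square integrable functions are integrable,
  and \<open>UNIV\<close> is added to handle complements.\<close>

lemma l2_dense:
 fixes V :: "'a::euclidean_space l2 set"
 assumes V: "closed V" "subspace V" and G: "Int_stable G" "sets borel = sigma_sets UNIV G"
  and ind: "\<And>A n. A \<in> insert UNIV G ==> cls (ind (A \<inter> box (- (real n *R One)) (real n *R One))) \<in> V"
 shows "V = UNIV"
proof -
 define B :: "nat => 'a set" where "B n = box (- (real n *R One)) (real n *R One)" for n
 have Bb: "A \<inter> B n \<in> sets borel" if "A \<in> sets borel" for A n using that by (simp add: B_def sets.Int)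
 have "x \<in> V" for x
 proof -
  obtain p where p: "p \<in> V" "\<And>y. y \<in> V ==> inner (x - p) y = 0"
   using hilbert_projection_subspace[OF V] by blast
  obtain f where f: "x - p = cls f" "sqi f" by (cases "x - p") auto
  \<comment> \<open>The Dynkin argument runs over Borel sets, so the Lebesgue measurable residual is
    replaced by a Borel function equal to it almost everywhere.\<close>
  obtain g where g[measurable]: "g \<in> borel_measurable lborel" and fg': "AE x in lborel. f x = g x"
   using completion_ex_borel_measurable_real[OF sqi_measurable[OF f(2)]] by blast
  have bm: "(%x. ind A x * f x) \<in> BM" "(%x. ind A x * g x) \<in> BM" if "A \<in> sets borel" for A
   using that sqi_measurable[OF f(2)] measurable_completion[OF g] by (auto intro!: borel_measurable_times borel_measurable_indicator)
  have fg: "ae x. ind A x * f x = ind A x * g x" for A using AE_completion[OF fg'] by (rule eventually_mono) simp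
  have eq: "(lint x. ind A x * f x) = (\<integral>x. ind A x * g x \<partial>lborel)" if A: "A \<in> sets borel" for A
   using integral_cong_AE[OF bm[OF A] fg] A g by (simp add: integral_completion)
  have lm: "A \<inter> B n \<in> lmeasurable" if "A \<in> sets borel" for A n
   using fmeasurable_Int_fmeasurable[OF lmeasurable_box, of A] that by (simp add: B_def Int_commute)
  have int: "set_integrable lborel (A \<inter> B n) g" if A: "A \<in> sets borel" for A n
  proof -
   have "integrable lebesgue (%x. ind (A \<inter> B n) x * g x)"
    by (rule integrable_cong_AE_imp[OF sqi_mult_integrable[OF sqi_indicator[OF lm[OF A]] f(2)] bm(2)[OF Bb[OF A]] fg])
   moreover have "(%x. ind (A \<inter> B n) x * g x) \<in> borel_measurable lborel"
    using g Bb[OF A] by (intro borel_measurable_times borel_measurable_indicator) simp_all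
   ultimately show ?thesis unfolding set_integrable_def by (simp only: integrable_completion real_scaleR_def)
  qed
  have G0: "(LINT x:A \<inter> B n|lborel. g x) = 0" if A: "A \<in> insert UNIV G" for A n
  proof -
   have "G \<subseteq> sets borel" unfolding G(2) by (rule sigma_sets_superset_generator)
   hence Ab: "A \<in> sets borel" using A sets.top[of borel] by (metis insertE space_borel subsetD)
   have "inner (cls f) (cls (ind (A \<inter> B n))) = (lint x. f x * ind (A \<inter> B n) x)"
    using f(2) by (intro cls_simps(5) sqi_indicator lm Ab)
   thus ?thesis using p(2)[OF ind[OF A]] eq[OF Bb[OF Ab]]
    by (simp add: f(1) set_lebesgue_integral_def B_def[symmetric] mult.commute)
  qed
  have zero: "(LINT x:A \<inter> B n|lborel. g x) = 0" if "A \<in> sets borel" for A n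
  proof -
   have sub: "G \<subseteq> Pow UNIV" by simp
   show ?thesis using G(1) sub that[unfolded G(2)]
   proof (induction rule: sigma_sets_induct_disjoint)
    case (basic A)
    thus ?case by (simp add: G0)
   next
    case empty show ?case by (simp add: set_lebesgue_integral_def)
   next
    case (compl A)
    hence A: "A \<in> sets borel" "UNIV - A \<in> sets borel" unfolding G(2) by (blast intro: sigma_sets.Compl)+
    have "(LINT x:(A \<inter> B n) \<union> ((UNIV - A) \<inter> B n)|lborel. g x)
      = (LINT x:A \<inter> B n|lborel. g x) + (LINT x:(UNIV - A) \<inter> B n|lborel. g x)"
     using A by (intro set_integral_Un int) auto
    moreover have "(A \<inter> B n) \<union> ((UNIV - A) \<inter> B n) = UNIV \<inter> B n" by blast
    ultimately show ?case using compl G0[of UNIV n] by simp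
   next
    case (union A)
    hence A: "A i \<in> sets borel" for i unfolding G(2) by blast
    have "(LINT x:(\<Union>i. A i \<inter> B n)|lborel. g x) = (\<Sum>i. LINT x:A i \<inter> B n|lborel. g x)"
    proof (rule lebesgue_integral_countable_add)
     show "(A i \<inter> B n) \<inter> (A j \<inter> B n) = {}" if "i \<noteq> j" for i j
      using union(1) that by (auto simp: disjoint_family_on_def)
     show "set_integrable lborel (\<Union>i. A i \<inter> B n) g"
      using int[of "\<Union>i. A i" n] A by (simp add: sets.countable_UN)
    qed (use Bb[OF A] in simp)
    thus ?case using union by simp
   qed
  qed
  have "AE x in lborel. \<forall>n. ind (B n) x * g x = 0"
  proof (subst AE_all_countable, rule allI, rule sigma_finite_measure.density_zero[OF sigma_finite_lborel])
   fix n
   show "integrable lborel (%x. ind (B n) x * g x)" using int[of UNIV n] by (simp add: set_integrable_def)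
   show "(LINT x:A|lborel. ind (B n) x * g x) = 0" if "A \<in> sets lborel" for A
    using zero[of A n] that by (simp add: set_lebesgue_integral_def indicator_inter_arith mult.assoc)
  qed
  hence "ae x. \<forall>n. ind (B n) x * g x = 0" by (rule AE_completion)
  with AE_completion[OF fg'] have "ae x. f x = 0"
  proof eventually_elim
   case (elim x)
   have "x \<in> (\<Union>n::nat. B n)" unfolding B_def UN_box_eq_UNIV by simp
   then obtain n where "x \<in> B n" by blast
   with elim(1) spec[OF elim(2), of n] show ?case by simp
  qed
  hence "x - p = 0" using f by (simp add: f cls_simps cls_eq_iff)
  thus ?thesis using p(1) by simp
 qed
 thus ?thesis by blast
qed

lemma l2_dense_boxes:
 fixes V :: "'a::euclidean_space l2 set"
 assumes V: "closed V" "subspace V" and box: "\<And>a b. cls (ind (box a b)) \<in> V"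
 shows "V = UNIV"
proof (rule l2_dense[OF V])
 show "Int_stable (range (%(a, b). box a b :: 'a set))"
  unfolding Int_stable_def by (auto simp: box_Int_box image_iff)
 show "sets borel = sigma_sets UNIV (range (%(a, b). box a b :: 'a set))"
  by (subst borel_eq_box) (simp add: sets_measure_of)
qed (auto simp: box_Int_box box)

text \<open>Finite intersections from a countable basis form a countable Int-stable generator;
  finite sums of rational multiples of their indicators, cut off by boxes, are dense. Writing the
  sums as \<open>sum_list\<close> over \<open>lists Y\<close> makes countability and closure under
  addition immediate.\<close>

lemma l2_separable: "\<exists>C :: 'a::euclidean_space l2 set. countable C \<and> closure C = UNIV"
proof -
 obtain \<B> :: "'a set set" where \<B>: "countable \<B>" "topological_basis \<B>" using ex_countable_basis by blast
 define G where "G = Inter ` {F. finite F \<and> F \<subseteq> \<B>}"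
 have cG: "countable G" unfolding G_def by (intro countable_image countable_Collect_finite_subset \<B>)
 have "A \<inter> A' \<in> G" if "A \<in> G" "A' \<in> G" for A A'
 proof -
  obtain F where F: "A = \<Inter>F" "finite F" "F \<subseteq> \<B>" using \<open>A \<in> G\<close> unfolding G_def by blast
  obtain F' where "A' = \<Inter>F'" "finite F'" "F' \<subseteq> \<B>" using \<open>A' \<in> G\<close> unfolding G_def by blast
  with F show ?thesis unfolding G_def by (intro image_eqI[of _ _ "F \<union> F'"]) auto
 qed
 hence iG: "Int_stable G" by (simp add: Int_stable_def)
 have sG: "sets borel = sigma_sets UNIV G"
 proof (rule antisym)
  have "\<B> \<subseteq> G"
  proof
   fix b assume "b \<in> \<B>" thus "b \<in> G" unfolding G_def by (intro image_eqI[of _ _ "{b}"]) auto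
  qed
  thus "sets borel \<subseteq> sigma_sets UNIV G"
   unfolding borel_eq_countable_basis[OF \<B>] by (simp add: sets_measure_of sigma_sets_mono')
  have "G \<subseteq> sets borel" using topological_basis_open[OF \<B>(2)]
   by (auto simp: G_def intro!: borel_open open_Inter)
  thus "sigma_sets UNIV G \<subseteq> sets borel" using sets.sigma_sets_subset[of G borel] by simp
 qed
 define Y where "Y = (%(q, A, n). of_rat q *R cls (ind (A \<inter> box (- (real n *R One)) (real n *R One)))) ` (UNIV \<times> insert UNIV G \<times> UNIV)"
 define C where "C = sum_list ` lists Y"
 have cC: "countable C" unfolding C_def Y_def using cG
  by (intro countable_image countable_lists countable_SIGMA) auto
 have add0: "x + y \<in> C" if "x \<in> C" "y \<in> C" for x y
 proof -
  obtain k where k: "x = sum_list k" "k \<in> lists Y" using \<open>x \<in> C\<close> unfolding C_def by blast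
  obtain l where "y = sum_list l" "l \<in> lists Y" using \<open>y \<in> C\<close> unfolding C_def by blast
  with k show ?thesis unfolding C_def by (intro image_eqI[of _ _ "k @ l"]) auto
 qed
 have sc0: "of_rat r *R x \<in> C" if "x \<in> C" for r x
 proof -
  obtain l where l: "x = sum_list l" "l \<in> lists Y" using \<open>x \<in> C\<close> unfolding C_def by blast
  have "of_rat r *R y \<in> Y" if "y \<in> Y" for y
  proof -
   obtain q A n where "y = of_rat q *R cls (ind (A \<inter> box (- (real n *R One)) (real n *R One)))" "A \<in> insert UNIV G"
    using \<open>y \<in> Y\<close> unfolding Y_def by auto
   thus ?thesis unfolding Y_def by (intro image_eqI[of _ _ "(r * q, A, n)"]) (auto simp: of_rat_mult)
  qed
  hence "map ((*R) (of_rat r)) l \<in> lists Y" using l(2) by auto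
  moreover have "of_rat r *R sum_list l = sum_list (map ((*R) (of_rat r)) l)" by (induction l) (auto simp: scaleR_add_right)
  ultimately show ?thesis unfolding C_def l(1) by blast
 qed
 have "closure C = UNIV"
 proof (rule l2_dense[OF _ _ iG sG])
  show "subspace (closure C)" unfolding subspace_def
  proof (intro conjI ballI allI)
   have "sum_list [] \<in> C" unfolding C_def by (rule imageI) simp
   thus "0 \<in> closure C" using closure_subset[of C] by (simp add: subsetD)
   fix x assume x: "x \<in> closure C"
   obtain f where f: "\<And>n. f n \<in> C" "f ~~> x" using closure_seqE[OF x] by blast
   show "x + y \<in> closure C" if y: "y \<in> closure C" for y
   proof -
    obtain g where g: "\<And>n. g n \<in> C" "g ~~> y" using closure_seqE[OF y] by blast
    show ?thesis by (rule closure_seqI[OF add0[OF f(1) g(1)] tendsto_add[OF f(2) g(2)]])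
   qed
   fix c :: real
   have "c \<in> closure \<rat>" by (simp add: Rats_closure_real)
   then obtain s where s: "\<And>n. s n \<in> \<rat>" "s ~~> c" using closure_seqE by blast
   have "s n *R f n \<in> C" for n using s(1)[of n] by (rule Rats_cases) (simp add: sc0 f(1))
   thus "c *R x \<in> closure C" by (rule closure_seqI[OF _ tendsto_scaleR[OF s(2) f(2)]])
  qed
  fix A n assume "A \<in> insert UNIV G"
  hence "cls (ind (A \<inter> box (- (real n *R One)) (real n *R One))) \<in> Y" unfolding Y_def
   by (intro image_eqI[of _ _ "(1, A, n)"]) auto
  hence "sum_list [cls (ind (A \<inter> box (- (real n *R One)) (real n *R One)))] \<in> C" unfolding C_def by (intro imageI) simp
  thus "cls (ind (A \<inter> box (- (real n *R One)) (real n *R One))) \<in> closure C" using closure_subset[of C] by (simp add: subsetD)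
 qed simp
 with cC show ?thesis by blast
qed

text \<open>This class is demanded by \<open>nash_existence\<close>, where a dense sequence of
  deviations is taken from every admissible set.\<close>

instance l2 :: (euclidean_space) second_countable_topology
proof
 obtain C :: "'a l2 set" where C: "countable C" "closure C = UNIV" using l2_separable by blast
 define B where "B = (%(c, n). ball c (1 / real (Suc n))) ` (C \<times> (UNIV :: nat set))"
 have "topological_basis B"
 proof (rule topological_basisI)
  fix U :: "'a l2 set" and x assume U: "open U" "x \<in> U"
  obtain e where e: "e > 0" "ball x e \<subseteq> U" using U open_contains_ball by blast
  obtain n where n: "1 / real (Suc n) < e / 2" using nat_approx_posE[of "e/2"] e(1) by auto
  obtain c where c: "c \<in> C" "dist c x < 1 / real (Suc n)"
   using closure_approachable[of x C] C(2) by (metis UNIV_I of_nat_0_less_iff zero_less_Suc zero_less_divide_1_iff)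
  have "ball c (1 / real (Suc n)) \<subseteq> ball x e"
  proof
   fix y assume "y \<in> ball c (1 / real (Suc n))"
   thus "y \<in> ball x e" using dist_triangle[of x y c] c(2) n by (simp add: dist_commute)
  qed
  thus "\<exists>B'\<in>B. x \<in> B' \<and> B' \<subseteq> U" using c e(2) unfolding B_def by fastforce
 qed (auto simp: B_def)
 moreover have "countable B" using C(1) by (auto simp: B_def)
 ultimately show "\<exists>B :: 'a l2 set set. countable B \<and> open = generate_topology B"
  using topological_basis_imp_subbasis by blast
qed

section \<open>Smooth functions\<close>

lemma partial_deriv_eq:
 "(ph has_derivative ph') (at x) ==> pd i ph x = ph' (axis i 1)"
 unfolding partial_deriv_def by (metis frechet_derivative_at)

lemma Ck_Suc_imp: "Ck (Suc k) ph ==> Ck k ph"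
proof (induction k arbitrary: ph)
 case 0
 thus ?case
  by (auto intro!: continuous_at_imp_continuous_on differentiable_imp_continuous_within)
next
 case (Suc k)
 thus ?case by (metis Ck.simps(2))
qed

lemma partial_deriv_const: "pd i (%x. c) = (%x. 0)"
 by (rule ext) (simp add: partial_deriv_eq[OF has_derivative_const])

lemma Ck_const: "Ck k (%x. c)"
 by (induction k arbitrary: c) (auto simp: partial_deriv_const)

lemma partial_deriv_coord: "pd i (%x. x $ j) = (%x. axis i 1 $ j)"
 by (rule ext) (intro partial_deriv_eq, auto intro!: derivative_eq_intros bounded_linear_imp_has_derivative bounded_linear_vec_nth)

lemma Ck_coord: "Ck k (%x :: real ^ 'n. x $ j)"
proof (cases k)
 case 0 thus ?thesis by (simp add: continuous_on_component)
next
 case (Suc n)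
 have "(%x. x $ j) differentiable at x" for x :: "real ^ 'n"
  by (intro bounded_linear_imp_differentiable bounded_linear_vec_nth)
 thus ?thesis using Suc by (simp add: partial_deriv_coord Ck_const)
qed

lemma differentiable_partial_deriv_add:
 assumes "f differentiable at x" "g differentiable at x"
 shows "pd i (%x. f x + g x) x = pd i f x + pd i g x"
proof -
 obtain f' g' where d: "(f has_derivative f') (at x)" "(g has_derivative g') (at x)"
  using assms by (auto simp: differentiable_def)
 show ?thesis
  using partial_deriv_eq[OF has_derivative_add[OF d]] partial_deriv_eq[OF d(1)] partial_deriv_eq[OF d(2)] by simp
qed

lemma differentiable_partial_deriv_mult:
 assumes "f differentiable at x" "g differentiable at x"
 shows "pd i (%x. f x * g x) x = f x * pd i g x + pd i f x * g x"
proof -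
 obtain f' g' where d: "(f has_derivative f') (at x)" "(g has_derivative g') (at x)"
  using assms by (auto simp: differentiable_def)
 show ?thesis
  using partial_deriv_eq[OF has_derivative_mult[OF d]] partial_deriv_eq[OF d(1)] partial_deriv_eq[OF d(2)] by simp
qed

lemma Ck_add: "Ck k f ==> Ck k g ==> Ck k (%x. f x + g x)"
proof (induction k arbitrary: f g)
 case 0 thus ?case by (simp add: continuous_on_add)
next
 case (Suc k)
 hence "pd i (%x. f x + g x) = (%x. pd i f x + pd i g x)" for i
  by (intro ext differentiable_partial_deriv_add) auto
 thus ?case using Suc by (auto intro: differentiable_add)
qed

lemma Ck_mult: "Ck k f ==> Ck k g ==> Ck k (%x. f x * g x)"
proof (induction k arbitrary: f g)
 case 0 thus ?case by (simp add: continuous_on_mult)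
next
 case (Suc k)
 hence "pd i (%x. f x * g x) = (%x. f x * pd i g x + pd i f x * g x)" for i
  by (intro ext differentiable_partial_deriv_mult) auto
 moreover have "Ck k f" "Ck k g" using Suc.prems Ck_Suc_imp by blast+
 ultimately show ?case using Suc by (auto intro: differentiable_mult Ck_add)
qed

text \<open>Stated for a family \<open>S\<close> closed under differentiation, because one step of
  the induction on \<open>k\<close> replaces \<open>h\<close> by its derivative.\<close>

lemma Ck_compose:
 assumes S: "\<And>h. h \<in> S ==> \<exists>h'\<in>S. \<forall>t. (h has_real_derivative h' t) (at t)"
 shows "h \<in> S ==> Ck k ph ==> Ck k (%x. h (ph x))"
proof (induction k arbitrary: h)
 case 0
 then obtain h' where "\<And>t. (h has_real_derivative h' t) (at t)" using S by blast
 hence "continuous_on UNIV h" by (meson DERIV_isCont continuous_at_imp_continuous_on)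
 thus ?case using 0 continuous_on_compose2[of UNIV h UNIV ph] by simp
next
 case (Suc k)
 obtain h' where h': "h' \<in> S" "\<And>t. (h has_real_derivative h' t) (at t)" using S Suc.prems(1) by blast
 have d: "((%x. h (ph x)) has_derivative (%v. frechet_derivative ph (at x) v * h' (ph x))) (at x)" for x
  using Suc.prems(2) by (intro DERIV_compose_FDERIV[OF h'(2)]) (simp add: frechet_derivative_works)
 have "pd i (%x. h (ph x)) = (%x. pd i ph x * h' (ph x))" for i
  using partial_deriv_eq[OF d] by (auto simp: partial_deriv_def)
 moreover have "Ck k (%x. h' (ph x))" using Suc.IH[OF h'(1)] Ck_Suc_imp[OF Suc.prems(2)] by blast
 ultimately show ?case using Suc.prems d by (auto simp: differentiable_def intro: Ck_mult)
qed

definition smooth :: "(real ^ 'n => real) => bool" where "smooth ph \<longleftrightarrow> (\<forall>k. Ck k ph)"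

lemma smooth_const: "smooth (%x. c)" by (simp add: smooth_def Ck_const)
lemma smooth_coord: "smooth (%x. x $ j)" by (simp add: smooth_def Ck_coord)
lemma smooth_add: "smooth f ==> smooth g ==> smooth (%x. f x + g x)" by (simp add: smooth_def Ck_add)
lemma smooth_mult: "smooth f ==> smooth g ==> smooth (%x. f x * g x)" by (simp add: smooth_def Ck_mult)
lemma smooth_diff: "smooth f ==> smooth g ==> smooth (%x. f x - g x)"
 using smooth_add[of f "%x. (-1) * g x"] smooth_mult[OF smooth_const, of g "-1"] by simp
lemma smooth_sum: "(\<And>i. i \<in> I ==> smooth (f i)) ==> smooth (%x. \<Sum>i\<in>I. f i x)"
 by (induction I rule: infinite_finite_induct) (auto intro: smooth_add smooth_const)
lemma smooth_prod: "(\<And>i. i \<in> I ==> smooth (f i)) ==> smooth (%x. \<Prod>i\<in>I. f i x)"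
 by (induction I rule: infinite_finite_induct) (auto intro: smooth_mult smooth_const)
lemma smooth_partial_deriv: "smooth ph ==> smooth (pd i ph)"
 unfolding smooth_def by (metis Ck.simps(2))
lemma smooth_differentiable: "smooth ph ==> ph differentiable at x"
 unfolding smooth_def by (metis Ck.simps(2))
lemma smooth_continuous: "smooth ph ==> continuous_on UNIV ph"
 unfolding smooth_def by (metis Ck.simps(1))
lemma smooth_has_derivative:
 "smooth ph ==> (ph has_derivative frechet_derivative ph (at x)) (at x)"
 using frechet_derivative_works smooth_differentiable by blast

section \<open>Smooth approximations of the positive part\<close>

definition flat :: "real => real poly => real => real" where
 "flat d p t = (if t > 0 then poly p (1 / t) * exp (- d / t) else 0)"

lemma poly_mult_exp_tendsto_0:
 fixes d :: real
 assumes "d > 0" shows "((%s. poly p s * exp (- d * s)) \<longlongrightarrow> 0) at_top"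
proof -
 have "((%s. s ^ k * exp (- d * s)) \<longlongrightarrow> 0) at_top" for k :: nat
 proof -
  have "filterlim (%s. d * s) at_top at_top"
   using assms by (intro filterlim_tendsto_pos_mult_at_top[OF tendsto_const] filterlim_ident)
  from filterlim_compose[OF tendsto_power_div_exp_0[of k] this]
  have "((%s. (1 / d ^ k) * ((d * s) ^ k / exp (d * s))) \<longlongrightarrow> (1 / d ^ k) * 0) at_top"
   by (intro tendsto_mult tendsto_const)
  moreover have "(1 / d ^ k) * ((d * s) ^ k / exp (d * s)) = s ^ k * exp (- d * s)" for s
   using assms by (simp add: power_mult_distrib exp_minus field_simps)
  ultimately show ?thesis by simp
 qed
 hence "((%s. \<Sum>i\<le>degree p. coeff p i * (s ^ i * exp (- d * s))) \<longlongrightarrow> (\<Sum>i\<le>degree p. coeff p i * 0)) at_top"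
  by (intro tendsto_sum tendsto_mult tendsto_const)
 thus ?thesis by (simp add: poly_altdef sum_distrib_right mult.assoc)
qed

text \<open>With \<open>s = 1/t\<close>, differentiating \<open>p(s) exp(-d s)\<close> gives the
  polynomial \<open>s^2 (d p - p')\<close> in place of \<open>p\<close>; this closed family is what
  \<open>Ck_compose\<close> needs. At 0 the derivative exists and vanishes because the exponential
  beats every polynomial in \<open>s\<close>.\<close>

lemma flat_deriv:
 assumes d: "d > 0"
 shows "(flat d p has_real_derivative flat d (monom 1 2 * (smult d p - pderiv p)) t) (at t)"
proof -
 consider "t > 0" | "t < 0" | "t = 0" by linarith
 thus ?thesis
 proof cases
  case 1
  have "((%t. poly p (1 / t) * exp (- d / t)) has_real_derivative
    flat d (monom 1 2 * (smult d p - pderiv p)) t) (at t)"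
   using 1 by (auto intro!: derivative_eq_intros simp: flat_def poly_monom)
    (simp add: field_simps power2_eq_square)
  thus ?thesis
   by (rule DERIV_cong_ev[THEN iffD1, OF refl _ refl, rotated])
    (use 1 in \<open>auto simp: flat_def intro: eventually_mono[OF order_tendstoD(1)[OF tendsto_ident_at 1]]
      eventually_nhds_x_imp_x[of "%x. _"] eventually_mono[OF eventually_nhds_in_open[of "{0<..}" t]]\<close>)
 next
  case 2
  have "((%t. 0) has_real_derivative flat d (monom 1 2 * (smult d p - pderiv p)) t) (at t)"
   using 2 by (simp add: flat_def)
  thus ?thesis
   by (rule DERIV_cong_ev[THEN iffD1, OF refl _ refl, rotated])
    (use 2 in \<open>auto simp: flat_def intro: eventually_mono[OF eventually_nhds_in_open[of "{..<0}" t]]\<close>)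
 next
  case 3
  have "((%h. flat d p h / h) \<longlongrightarrow> 0) (at_right 0)"
  proof -
   have "((%s. poly (pCons 0 p) s * exp (- d * s)) \<longlongrightarrow> 0) at_top" by (rule poly_mult_exp_tendsto_0[OF d])
   from filterlim_compose[OF this filterlim_inverse_at_top_right]
   have "((%h. poly (pCons 0 p) (inverse h) * exp (- d * inverse h)) \<longlongrightarrow> 0) (at_right 0)" .
   moreover have "\<forall>\<^sub>F h in at_right 0. poly (pCons 0 p) (inverse h) * exp (- d * inverse h) = flat d p h / h"
    by (auto simp: eventually_at_right_field flat_def field_simps intro!: exI[of _ 1])
   ultimately show ?thesis by (rule Lim_transform_eventually)
  qed
  moreover have "((%h. flat d p h / h) \<longlongrightarrow> 0) (at_left 0)"
   by (rule tendsto_eventually) (auto simp: eventually_at_left_field flat_def intro!: exI[of _ "-1"])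
  ultimately have "((%h. flat d p h / h) \<longlongrightarrow> 0) (at 0)" by (simp add: filterlim_split_at)
  thus ?thesis using 3 by (simp add: DERIV_def flat_def)
 qed
qed

lemma smooth_flat: "d > 0 ==> smooth ph ==> smooth (%x. flat d p (ph x))"
 unfolding smooth_def using Ck_compose[of "range (flat d)" "flat d p"] flat_deriv[of d] by blast

text \<open>A smooth substitute for the positive part: 1-Lipschitz uniformly in \<open>d\<close>,
  and tending to \<open>max 0 t\<close> as \<open>d\<close> tends to 0.\<close>

definition psi :: "real => real => real" where
 "psi d t = (if t > 0 then t * exp (- d / t) else 0)"

definition psi' :: "real => real => real" where
 "psi' d t = (if t > 0 then (1 + d / t) * exp (- d / t) else 0)"

lemma psi_flat: "psi d = (%t. t * flat d 1 t)"
 by (auto simp: psi_def flat_def fun_eq_iff)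

lemma psi_deriv: assumes "d > 0" shows "(psi d has_real_derivative psi' d t) (at t)"
proof -
 have "((%t. t * flat d 1 t) has_real_derivative
   1 * flat d 1 t + flat d (monom 1 2 * (smult d 1 - pderiv 1)) t * t) (at t)"
  by (intro DERIV_mult DERIV_ident flat_deriv assms)
 moreover have "1 * flat d 1 t + flat d (monom 1 2 * (smult d 1 - pderiv 1)) t * t = psi' d t"
  by (auto simp: flat_def psi'_def poly_monom field_simps power2_eq_square)
 ultimately show ?thesis by (simp add: psi_flat)
qed

lemma smooth_psi: "d > 0 ==> smooth ph ==> smooth (%x. psi d (ph x))"
 unfolding psi_flat by (intro smooth_mult smooth_flat)

text \<open>The upper bound is \<open>1 + s <= exp s\<close> at \<open>s = d / t\<close>.\<close>

lemma psi'_bounds: "d > 0 ==> 0 <= psi' d t" "d > 0 ==> psi' d t <= 1"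
proof -
 assume d: "d > 0"
 show "0 <= psi' d t" using d by (auto simp: psi'_def intro!: mult_nonneg_nonneg add_nonneg_nonneg)
 have "(1 + d / t) * exp (- d / t) <= exp (d / t) * exp (- d / t)"
  by (intro mult_right_mono exp_ge_add_one_self) auto
 also have "\<dots> = 1" by (simp add: exp_minus)
 finally show "psi' d t <= 1" by (simp add: psi'_def)
qed

lemma psi_lipschitz: assumes "d > 0" shows "\<bar>psi d a - psi d b\<bar> <= \<bar>a - b\<bar>"
proof -
 have "norm (psi d a - psi d b) <= 1 * norm (a - b)"
  by (rule field_differentiable_bound[of UNIV _ "psi' d"])
   (use psi_deriv[OF assms] psi'_bounds[OF assms] in \<open>auto intro: has_field_derivative_at_within\<close>)
 thus ?thesis by simp
qed

lemma psi_nonpos[simp]: "t <= 0 ==> psi d t = 0" by (simp add: psi_def)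

lemma isCont_psi': assumes "d > 0" shows "isCont (psi' d) t"
proof -
 have "psi' d = (%t. flat d 1 t + t * flat d (monom d 2) t)"
  by (auto simp: flat_def psi'_def poly_monom fun_eq_iff field_simps power2_eq_square)
 moreover have "isCont (flat d p) t" for p by (rule DERIV_isCont[OF flat_deriv[OF assms]])
 ultimately show ?thesis by (simp add: isCont_def tendsto_intros)
qed

lemma psi_tendsto: "(%n. psi (1 / real (Suc n)) t) ~~> max 0 t"
proof (cases "t > 0")
 case True
 have "(%n. t * exp (- (inverse (real (Suc n))) / t)) ~~> t * exp (- 0 / t)"
  using True by (intro tendsto_intros LIMSEQ_inverse_real_of_nat) auto
 thus ?thesis using True by (simp add: psi_def inverse_eq_divide)
qed simp

text \<open>The limit at \<open>t = 0\<close> is 0; for this reason the gradient in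
  \<open>h10_trunc\<close> is set to zero on the level set \<open>u = k\<close>.\<close>

lemma psi'_tendsto: "(%n. psi' (1 / real (Suc n)) t) ~~> (if t > 0 then 1 else 0)"
proof (cases "t > 0")
 case True
 have "(%n. (1 + inverse (real (Suc n)) / t) * exp (- (inverse (real (Suc n))) / t)) ~~> (1 + 0 / t) * exp (- 0 / t)"
  using True by (intro tendsto_intros LIMSEQ_inverse_real_of_nat) auto
 thus ?thesis using True by (simp add: psi'_def inverse_eq_divide)
qed (simp add: psi'_def)

section \<open>Test functions\<close>

definition grad :: "(real ^ 'n => real) => real ^ 'n => real ^ 'n" where
 "grad ph x = (\<chi> i. pd i ph x)"

lemma grad_nth[simp]: "grad ph x $ i = pd i ph x" by (simp add: grad_def)

lemma frechet_derivative_grad: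
 assumes "ph differentiable at x"
 shows "frechet_derivative ph (at x) h = grad ph x \<bullet> h"
proof -
 have lin: "linear (frechet_derivative ph (at x))"
  using assms by (simp add: linear_frechet_derivative)
 have "h = (\<Sum>i\<in>UNIV. (h $ i) *R axis i 1)"
  by (simp add: vec_eq_iff axis_def if_distrib cong: if_cong)
 hence "frechet_derivative ph (at x) h = frechet_derivative ph (at x) (\<Sum>i\<in>UNIV. (h $ i) *R axis i 1)"
  by (rule arg_cong)
 also have "\<dots> = (\<Sum>i\<in>UNIV. h $ i * pd i ph x)"
  by (simp add: linear_sum[OF lin] linear_cmul[OF lin] partial_deriv_def)
 finally have "frechet_derivative ph (at x) h = (\<Sum>i\<in>UNIV. h $ i * pd i ph x)" .
 thus ?thesis by (simp add: inner_vec_def mult.commute)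
qed

lemma smooth_has_derivative_grad: "smooth ph ==> (ph has_derivative (%h. grad ph x \<bullet> h)) (at x)"
 using smooth_has_derivative[of ph x] frechet_derivative_grad[OF smooth_differentiable, of ph x]
 by (metis (no_types, lifting) ext)

lemma continuous_grad: "smooth ph ==> continuous_on S (grad ph)"
 unfolding grad_def
 by (intro continuous_on_vec_lambda continuous_on_subset[OF smooth_continuous[OF smooth_partial_deriv]]) auto

lemma grad_add: "smooth f ==> smooth g ==> grad (%x. f x + g x) x = grad f x + grad g x"
 by (simp add: vec_eq_iff differentiable_partial_deriv_add smooth_differentiable)

lemma grad_mult: "smooth f ==> smooth g ==> grad (%x. f x * g x) x = f x *R grad g x + g x *R grad f x"
 by (simp add: vec_eq_iff differentiable_partial_deriv_mult smooth_differentiable mult.commute)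

lemma grad_const: "grad (%x. c) x = 0" by (simp add: vec_eq_iff partial_deriv_const)

lemma grad_compose:
 assumes "smooth ph" "(h has_real_derivative h') (at (ph x))"
 shows "grad (%x. h (ph x)) x = h' *R grad ph x"
proof -
 have "((%x. h (ph x)) has_derivative (%v. grad ph x \<bullet> v * h')) (at x)"
  using DERIV_compose_FDERIV[OF assms(2) smooth_has_derivative_grad[OF assms(1)]] .
 thus ?thesis by (simp add: vec_eq_iff partial_deriv_eq inner_axis mult.commute)
qed

lemma test_functionI:
 assumes "smooth ph" "compact K" "K \<subseteq> Om" "\<And>x. x \<notin> K ==> ph x = 0"
 shows "ph \<in> test_functions Om"
proof -
 have "closure {x. ph x \<noteq> 0} \<subseteq> K" using assms(2,4) by (intro closure_minimal) (auto intro: compact_imp_closed)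
 moreover have "compact (closure {x. ph x \<noteq> 0})"
  using closed_Int_compact[OF closed_closure assms(2)] calculation by (metis Int_absorb2)
 ultimately show ?thesis using assms
  by (auto simp: test_functions_def smooth_def)
qed

lemma test_smooth: "ph \<in> test_functions Om ==> smooth ph"
 by (simp add: test_functions_def smooth_def)

lemma test_support:
 assumes "ph \<in> test_functions Om"
 shows "\<exists>K. compact K \<and> K \<subseteq> Om \<and> (\<forall>x. x \<notin> K --> ph x = 0 \<and> grad ph x = 0)"
proof -
 define K where "K = closure {x. ph x \<noteq> 0}"
 have K: "smooth ph" "compact K" "K \<subseteq> Om" using assms by (auto simp: test_functions_def smooth_def K_def)
 have z: "ph x = 0" if "x \<notin> K" for x using that closure_subset by (force simp: K_def)
 have "grad ph x = 0" if x: "x \<notin> K" for x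
 proof -
  have "open (- K)" using K(2) compact_imp_closed by blast
  hence "(ph has_derivative (%h. 0)) (at x)"
   using has_derivative_transform_within_open[of "%x. 0" "%h. 0" x UNIV "- K" ph] z x by auto
  thus ?thesis by (simp add: vec_eq_iff partial_deriv_eq)
 qed
 hence "\<forall>x. x \<notin> K --> ph x = 0 \<and> grad ph x = 0" using z by blast
 thus ?thesis using K(2,3) by blast
qed

lemma test_zero_outside:
 assumes "ph \<in> test_functions Om" "x \<notin> Om" shows "ph x = 0 \<and> grad ph x = 0"
 using test_support[OF assms(1)] assms(2) by blast

lemma test_zero: "(%x. 0) \<in> test_functions Om"
 by (rule test_functionI[OF smooth_const compact_empty]) simp_all

lemma test_add:
 assumes "f \<in> test_functions Om" "g \<in> test_functions Om" shows "(%x. f x + g x) \<in> test_functions Om"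
proof -
 obtain K where K: "compact K" "K \<subseteq> Om" "\<forall>x. x \<notin> K --> f x = 0" using test_support[OF assms(1)] by blast
 have smf: "smooth f" using assms(1) by (rule test_smooth)
 obtain L where L: "compact L" "L \<subseteq> Om" "\<forall>x. x \<notin> L --> g x = 0" using test_support[OF assms(2)] by blast
 have smg: "smooth g" using assms(2) by (rule test_smooth)
 show ?thesis by (rule test_functionI[of _ "K \<union> L"]) (use K L smf smg in \<open>auto intro: smooth_add\<close>)
qed

lemma test_mult:
 assumes "f \<in> test_functions Om" "smooth g" shows "(%x. g x * f x) \<in> test_functions Om"
proof -
 obtain K where K: "compact K" "K \<subseteq> Om" "\<forall>x. x \<notin> K --> f x = 0" using test_support[OF assms(1)] by blast
 have smf: "smooth f" using assms(1) by (rule test_smooth)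
 show ?thesis by (rule test_functionI[of _ K]) (use K assms smf in \<open>auto intro: smooth_mult\<close>)
qed

text \<open>Subtracting \<open>psi d (- k)\<close> makes the composition vanish wherever
  \<open>f\<close> does; for \<open>k < 0\<close> compact support would be lost otherwise.\<close>

lemma test_psi:
 assumes "f \<in> test_functions Om" "d > 0" shows "(%x. psi d (f x - k) - psi d (- k)) \<in> test_functions Om"
proof -
 obtain K where K: "compact K" "K \<subseteq> Om" "\<forall>x. x \<notin> K --> f x = 0" using test_support[OF assms(1)] by blast
 have smf: "smooth f" using assms(1) by (rule test_smooth)
 show ?thesis by (rule test_functionI[of _ K]) (use K assms smf in \<open>auto intro!: smooth_diff smooth_psi smooth_const\<close>)
qed

lemma test_bounded:
 assumes "ph \<in> test_functions Om" obtains C where "\<And>x. \<bar>ph x\<bar> <= C" "\<And>x. norm (grad ph x) <= C" "C >= 0"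
proof -
 obtain K where "compact K" "\<forall>x. x \<notin> K --> ph x = 0 \<and> grad ph x = 0" using test_support[OF assms] by blast
 hence K: "smooth ph" "compact K" "\<And>x. x \<notin> K ==> ph x = 0" "\<And>x. x \<notin> K ==> grad ph x = 0"
  using test_smooth[OF assms] by auto
 have "continuous_on K ph" "continuous_on K (grad ph)"
  using K(1) by (auto intro: continuous_on_subset[OF smooth_continuous] continuous_grad)
 hence "bounded (ph ` K)" "bounded (grad ph ` K)"
  using K(2) by (auto intro: compact_imp_bounded compact_continuous_image)
 then obtain A B where AB: "\<And>x. x \<in> K ==> \<bar>ph x\<bar> <= A" "\<And>x. x \<in> K ==> norm (grad ph x) <= B"
  unfolding bounded_iff by auto
 show thesis
 proof (rule that[of "max 0 (max A B)"])
  show "\<bar>ph x\<bar> <= max 0 (max A B)" for x by (cases "x \<in> K") (use AB[of x] K(3)[of x] in auto)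
  show "norm (grad ph x) <= max 0 (max A B)" for x by (cases "x \<in> K") (use AB[of x] K(4)[of x] in auto)
 qed simp
qed

section \<open>Integral inequalities for smooth functions\<close>

lemma nn_integral_lborel_affine:
 fixes t :: "'a::euclidean_space" and f :: "'a => ennreal"
 assumes [measurable]: "f \<in> borel_measurable borel" and "c \<noteq> 0"
 shows "(\<integral>\<^sup>+x. f x \<partial>lborel) = ennreal (\<bar>c\<bar> ^ DIM('a)) * (\<integral>\<^sup>+x. f (t + c *R x) \<partial>lborel)"
 by (subst lborel_affine[OF assms(2), of t])
  (simp add: nn_integral_density nn_integral_distr nn_integral_cmult)

lemma nn_integral_lborel_shift:
 fixes t :: "'a::euclidean_space" and f :: "'a => ennreal"
 assumes "f \<in> borel_measurable borel"
 shows "(\<integral>\<^sup>+x. f (x + t) \<partial>lborel) = (\<integral>\<^sup>+x. f x \<partial>lborel)"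
 using nn_integral_lborel_affine[OF assms, of 1 t] by (simp add: add.commute)

lemma integral_lborel_shift:
 fixes t :: "'a::euclidean_space" and f :: "'a => real"
 assumes [measurable]: "f \<in> borel_measurable borel"
 shows "(\<integral>x. f (x + t) \<partial>lborel) = (\<integral>x. f x \<partial>lborel)"
proof -
 have "(\<integral>x. f x \<partial>lborel) = (\<integral>x. f x \<partial>distr lborel borel ((+) t))" by (simp add: lborel_distr_plus)
 also have "\<dots> = (\<integral>x. f (t + x) \<partial>lborel)" by (rule integral_distr) auto
 finally show ?thesis by (simp add: add.commute)
qed

lemma smooth_borel[measurable_dest]: "smooth ph ==> ph \<in> borel_measurable borel"
 by (intro borel_measurable_continuous_onI smooth_continuous)

lemma grad_borel: "smooth ph ==> grad ph \<in> borel_measurable borel"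
 by (intro borel_measurable_continuous_onI continuous_grad)

lemma borel_lebesgue: "f \<in> borel_measurable borel ==> f \<in> BM"
 by (rule measurable_completion) simp

lemma test_integrable:
 assumes "f \<in> test_functions Om" "g \<in> borel_measurable borel" "\<And>x. f x = 0 \<and> grad f x = 0 ==> g x = 0"
  "\<And>x. \<bar>g x :: real\<bar> <= C"
 shows "integrable lborel g"
proof -
 obtain K where K: "compact K" "\<forall>x. x \<notin> K --> f x = 0 \<and> grad f x = 0"
  using test_support[OF assms(1)] by blast
 show ?thesis
 proof (rule Bochner_Integration.integrable_bound)
  show "integrable lborel (%x. \<bar>C\<bar> * ind K x)"
   using K(1) emeasure_compact_finite[of K] by (auto intro!: integrable_mult_right simp: borel_compact)
  show "AE x in lborel. norm (g x) <= norm (\<bar>C\<bar> * ind K x)"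
  proof (intro AE_I2)
   fix x
   show "norm (g x) <= norm (\<bar>C\<bar> * ind K x)"
    using assms(3)[of x] assms(4)[of x] K(2) by (cases "x \<in> K") auto
  qed
 qed (use assms(2) in simp)
qed

lemma segment_FTC:
 assumes "smooth ph" "a <= b"
 shows "has_bochner_integral lborel (%s. (grad ph (x + s *R h) \<bullet> h) * ind {a..b} s)
      (ph (x + b *R h) - ph (x + a *R h))"
proof (rule has_bochner_integral_FTC_Icc_real[OF assms(2), of "%s. ph (x + s *R h)"])
 fix s :: real
 have "((%s. x + s *R h) has_derivative (%v. v *R h)) (at s)"
  by (auto intro!: derivative_eq_intros)
 from has_derivative_compose[OF this smooth_has_derivative_grad[OF assms(1)]]
 have "((%s. ph (x + s *R h)) has_derivative (%v. (grad ph (x + s *R h) \<bullet> h) * v)) (at s)"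
  by (simp add: mult.commute)
 thus "((%s. ph (x + s *R h)) has_real_derivative grad ph (x + s *R h) \<bullet> h) (at s)"
  by (simp add: has_field_derivative_def)
 have "continuous_on UNIV (%s. grad ph (x + s *R h) \<bullet> h)"
  by (intro continuous_intros continuous_on_compose2[OF continuous_grad[OF assms(1), of UNIV]]) auto
 thus "isCont (%s. grad ph (x + s *R h) \<bullet> h) s" by (simp add: continuous_on_eq_continuous_at)
qed

lemma segment_bound:
 assumes "smooth ph" "a <= b"
 shows "ennreal \<bar>ph (x + b *R h) - ph (x + a *R h)\<bar>
  <= (\<integral>\<^sup>+s. ennreal (norm (grad ph (x + s *R h)) * norm h) * ind {a..b} s \<partial>lborel)"
proof -
 note I = segment_FTC[OF assms, of x h]
 have m[measurable]: "grad ph \<in> borel_measurable borel" by (rule grad_borel[OF assms(1)])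
 have "ennreal \<bar>ph (x + b *R h) - ph (x + a *R h)\<bar>
   = ennreal (norm (\<integral>s. (grad ph (x + s *R h) \<bullet> h) * ind {a..b} s \<partial>lborel))"
  using has_bochner_integral_integral_eq[OF I] by simp
 also have "\<dots> <= (\<integral>\<^sup>+s. norm ((grad ph (x + s *R h) \<bullet> h) * ind {a..b} s) \<partial>lborel)"
  by (rule integral_norm_bound_ennreal[OF integrable.intros[OF I]] )
 also have "\<dots> <= (\<integral>\<^sup>+s. ennreal (norm (grad ph (x + s *R h)) * norm h) * ind {a..b} s \<partial>lborel)"
  by (intro nn_integral_mono) (auto simp: indicator_def Cauchy_Schwarz_ineq2 intro!: ennreal_leI)
 finally show ?thesis .
qed

text \<open>Jensen's inequality on the unit interval, obtained from the nonnegative variance of the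
  directional derivative \<open>F\<close> about its mean \<open>D\<close>.\<close>

lemma segment_square_bound:
 assumes "smooth ph"
 shows "ennreal ((ph (x + h) - ph x)^2)
  <= (\<integral>\<^sup>+s. ennreal ((norm (grad ph (x + s *R h)))^2 * (norm h)^2) * ind {0..1} s \<partial>lborel)"
proof -
 define F where "F s = grad ph (x + s *R h) \<bullet> h" for s
 define D where "D = ph (x + h) - ph x"
 have I: "has_bochner_integral lborel (%s. F s * ind {0..1} s) D"
  using segment_FTC[OF assms, of 0 1 x h] by (simp add: F_def D_def)
 have contF: "continuous_on UNIV F" unfolding F_def
  by (intro continuous_intros continuous_on_compose2[OF continuous_grad[OF assms, of UNIV]]) auto
 have I2: "integrable lborel (%s. (F s)^2 * ind {0..1} s)"
  using borel_integrable_compact[of "{0..1::real}" "%s. (F s)^2"] contF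
  by (auto simp: mult.commute intro!: continuous_intros continuous_on_subset[OF contF])
 have "0 <= (\<integral>s. (F s - D)^2 * ind {0..1} s \<partial>lborel)" by (intro integral_nonneg_AE) auto
 also have "(\<integral>s. (F s - D)^2 * ind {0..1} s \<partial>lborel)
   = (\<integral>s. (F s)^2 * ind {0..1} s - 2 * D * (F s * ind {0..1} s) + D^2 * ind {0..1} s \<partial>lborel)"
  by (intro Bochner_Integration.integral_cong) (auto simp: power2_eq_square algebra_simps indicator_def)
 also have "\<dots> = (\<integral>s. (F s)^2 * ind {0..1} s \<partial>lborel) - 2 * D * D + D^2"
  using I I2 has_bochner_integral_integral_eq[OF I] integrable.intros[OF I] by simp
 finally have "D^2 <= (\<integral>s. (F s)^2 * ind {0..1} s \<partial>lborel)" by (simp add: power2_eq_square)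
 hence "ennreal (D^2) <= ennreal (\<integral>s. (F s)^2 * ind {0..1} s \<partial>lborel)" by (rule ennreal_leI)
 also have "\<dots> = (\<integral>\<^sup>+s. ennreal ((F s)^2 * ind {0..1} s) \<partial>lborel)"
  using I2 by (intro nn_integral_eq_integral[symmetric]) auto
 also have "\<dots> <= (\<integral>\<^sup>+s. ennreal ((norm (grad ph (x + s *R h)))^2 * (norm h)^2) * ind {0..1} s \<partial>lborel)"
 proof (intro nn_integral_mono)
  fix s :: real
  have "(F s)^2 <= (norm (grad ph (x + s *R h)) * norm h)^2"
   unfolding F_def using Cauchy_Schwarz_ineq2 by (metis abs_ge_zero power2_abs power_mono)
  thus "ennreal ((F s)^2 * ind {0..1} s)
    <= ennreal ((norm (grad ph (x + s *R h)))^2 * (norm h)^2) * ind {0..1} s"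
   by (auto simp: indicator_def power_mult_distrib intro: ennreal_leI)
 qed
 finally show ?thesis by (simp add: D_def)
qed

text \<open>Integrate the segment bound over \<open>x\<close>, exchange the integrals, and use
  translation invariance for each fixed \<open>s\<close>.\<close>

lemma translation_bound:
 assumes "smooth ph"
 shows "(\<integral>\<^sup>+x. ennreal ((ph (x + h) - ph x)^2) \<partial>lborel)
  <= ennreal ((norm h)^2) * (\<integral>\<^sup>+x. ennreal ((norm (grad ph x))^2) \<partial>lborel)"
proof -
 have m[measurable]: "grad ph \<in> borel_measurable borel" by (rule grad_borel[OF assms])
 define G where "G = (\<integral>\<^sup>+x. ennreal ((norm (grad ph x))^2) \<partial>lborel)"
 have "(\<integral>\<^sup>+x. ennreal ((ph (x + h) - ph x)^2) \<partial>lborel)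
  <= (\<integral>\<^sup>+x. (\<integral>\<^sup>+s. ennreal ((norm (grad ph (x + s *R h)))^2 * (norm h)^2) * ind {0..1} s \<partial>lborel) \<partial>lborel)"
  by (intro nn_integral_mono segment_square_bound[OF assms])
 also have "\<dots> = (\<integral>\<^sup>+s. (\<integral>\<^sup>+x. ennreal ((norm (grad ph (x + s *R h)))^2 * (norm h)^2) * ind {0..1} s \<partial>lborel) \<partial>lborel)"
  by (rule lborel_pair.Fubini') measurable
 also have "\<dots> = (\<integral>\<^sup>+s. ennreal ((norm h)^2) * G * ind {0..1::real} s \<partial>lborel)"
 proof (rule nn_integral_cong)
  fix s :: real
  have "(\<integral>\<^sup>+x. ennreal ((norm (grad ph (x + s *R h)))^2 * (norm h)^2) * ind {0..1} s \<partial>lborel)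
    = (\<integral>\<^sup>+x. ennreal ((norm h)^2) * ind {0..1} s * ennreal ((norm (grad ph (x + s *R h)))^2) \<partial>lborel)"
   by (intro nn_integral_cong) (simp add: ennreal_mult mult_ac)
  also have "\<dots> = ennreal ((norm h)^2) * ind {0..1} s * (\<integral>\<^sup>+x. ennreal ((norm (grad ph (x + s *R h)))^2) \<partial>lborel)"
   by (rule nn_integral_cmult) measurable
  also have "(\<integral>\<^sup>+x. ennreal ((norm (grad ph (x + s *R h)))^2) \<partial>lborel) = G"
   unfolding G_def by (rule nn_integral_lborel_shift) measurable
  finally show "(\<integral>\<^sup>+x. ennreal ((norm (grad ph (x + s *R h)))^2 * (norm h)^2) * ind {0..1} s \<partial>lborel)
   = ennreal ((norm h)^2) * G * ind {0..1} s" by (simp add: mult_ac)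
 qed
 also have "\<dots> = ennreal ((norm h)^2) * G"
  by (subst nn_integral_cmult) (auto simp: mult.assoc)
 finally show ?thesis by (simp add: G_def)
qed

text \<open>Expanding the square in \<open>translation_bound\<close> bounds \<open>2 * A\<close>
  minus twice the integral of \<open>ph x * ph (x + h)\<close> by \<open>t^2 * D\<close>;
  integrating over all \<open>h\<close> in the ball of radius \<open>t\<close> gives the claim. The
  last term sees \<open>ph\<close> only through its ball integrals, which is what
  \<open>faber_krahn\<close> and \<open>rellich\<close> exploit.\<close>

lemma test_nash_inequality:
 fixes ph :: "real ^ 'n => real"
 assumes ph: "ph \<in> test_functions Om" and t: "t > 0"
 shows "measure lborel (ball (0::real ^ 'n) t) * (\<integral>x. (ph x)^2 \<partial>lborel)
  <= measure lborel (ball (0::real ^ 'n) t) * (t^2 / 2 * (\<integral>x. (norm (grad ph x))^2 \<partial>lborel))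
   + (\<integral>x. ph x * (\<integral>y. ind (ball x t) y * ph y \<partial>lborel) \<partial>lborel)"
proof -
 have sm: "smooth ph" using ph by (rule test_smooth)
 have [measurable]: "ph \<in> borel_measurable borel" "grad ph \<in> borel_measurable borel"
  using sm by (rule smooth_borel, rule grad_borel)
 obtain C where C: "\<And>x. \<bar>ph x\<bar> <= C" "\<And>x. norm (grad ph x) <= C" "C >= 0" using test_bounded[OF ph] by metis
 have i1: "integrable lborel ph" by (rule test_integrable[OF ph, where C=C]) (use C in auto)
 have i3: "integrable lborel (%x. (norm (grad ph x))^2)"
  by (rule test_integrable[OF ph, where C="C^2"]) (use C in \<open>auto simp: power_mono\<close>)
 define B where "B = ball (0::real^'n) t"
 have [measurable]: "B \<in> sets borel" by (simp add: B_def)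
 have iB: "integrable lborel (%h. c * ind B h :: real)" for c
  unfolding B_def using emeasure_lborel_ball_finite[of "0::real^'n" t] by (intro integrable_mult_right integrable_real_indicator) auto
 define A D where "A = (\<integral>x. (ph x)^2 \<partial>lborel)" and "D = (\<integral>x. (norm (grad ph x))^2 \<partial>lborel)"
 have D0: "D >= 0" by (simp add: D_def)
 have ip: "integrable lborel (%x. ph (x + h) * ph (x + k))" for h k
 proof (rule Bochner_Integration.integrable_bound[where f="%x. C * ph (x + k)"])
  show "integrable lborel (%x. C * ph (x + k))"
   using i1 nn_integral_lborel_shift[of "%x. ennreal (norm (ph x))" k] by (intro integrable_mult_right) (simp add: integrable_iff_bounded)
  show "AE x in lborel. norm (ph (x + h) * ph (x + k)) <= norm (C * ph (x + k))"
   using C(1,3) by (intro AE_I2) (simp add: abs_mult mult_right_mono)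
 qed simp
 have key: "A - t^2 / 2 * D <= (\<integral>x. ph x * ph (x + h) \<partial>lborel)" if "h \<in> B" for h
 proof -
  have id: "integrable lborel (%x. ph (x + h) * ph (x + h) - 2 * (ph x * ph (x + h)) + ph x * ph x)"
   using ip[of h h] ip[of 0 h] ip[of 0 0] by simp
  have eq: "(ph (x + h) - ph x)^2 = ph (x + h) * ph (x + h) - 2 * (ph x * ph (x + h)) + ph x * ph x" for x
   by (simp add: power2_eq_square algebra_simps)
  have "ennreal (\<integral>x. (ph (x + h) - ph x)^2 \<partial>lborel) = (\<integral>\<^sup>+x. ennreal ((ph (x + h) - ph x)^2) \<partial>lborel)"
   using id unfolding eq[symmetric] by (intro nn_integral_eq_integral[symmetric]) auto
  also have "\<dots> <= ennreal ((norm h)^2) * (\<integral>\<^sup>+x. ennreal ((norm (grad ph x))^2) \<partial>lborel)" by (rule translation_bound[OF sm])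
  also have "(\<integral>\<^sup>+x. ennreal ((norm (grad ph x))^2) \<partial>lborel) = ennreal D"
   unfolding D_def using i3 by (intro nn_integral_eq_integral) auto
  finally have "(\<integral>x. (ph (x + h) - ph x)^2 \<partial>lborel) <= (norm h)^2 * D"
   using D0 by (simp flip: ennreal_mult add: ennreal_le_iff)
  also have "\<dots> <= t^2 * D" using that D0 by (intro mult_right_mono power_mono) (auto simp: B_def)
  also have "(\<integral>x. (ph (x + h) - ph x)^2 \<partial>lborel) = 2 * A - 2 * (\<integral>x. ph x * ph (x + h) \<partial>lborel)"
   unfolding eq A_def using ip[of h h] ip[of 0 h] ip[of 0 0] integral_lborel_shift[of "%x. ph x * ph x" h]
   by (simp add: power2_eq_square)
  finally show ?thesis by simp
 qed
 \<comment> \<open>Integrability on the product space permits the exchange of integrals; one of the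
   two factors \<open>ph\<close> is bounded by \<open>C\<close>.\<close>
 have I: "integrable (lborel \<Otimes>\<^sub>M lborel) (%(h, x). ind B h * (ph x * ph (x + h)))"
 proof (rule Bochner_Integration.integrable_bound)
  show "integrable (lborel \<Otimes>\<^sub>M lborel) (%(h, x). C * ind B h * norm (ph x))"
  proof (rule lborel_pair.Fubini_integrable)
   show "integrable lborel (%h. \<integral>x. norm (case (h, x) of (h, x) => C * ind B h * norm (ph x)) \<partial>lborel)"
    using iB[of "C * (\<integral>x. norm (ph x) \<partial>lborel)"] C(3) by (simp add: abs_mult mult_ac)
  qed (use i1 in auto)
  show "AE z in lborel \<Otimes>\<^sub>M lborel. norm (case z of (h, x) => ind B h * (ph x * ph (x + h)))
   <= norm (case z of (h, x) => C * ind B h * norm (ph x))"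
   using C(3) mult_left_mono[OF C(1) abs_ge_zero] by (intro AE_I2) (auto simp: abs_mult indicator_def mult.commute)
 qed measurable
 have "measure lborel B * (A - t^2 / 2 * D) = (\<integral>h. (A - t^2 / 2 * D) * ind B h \<partial>lborel)" by simp
 also have "\<dots> <= (\<integral>h. (\<integral>x. ind B h * (ph x * ph (x + h)) \<partial>lborel) \<partial>lborel)"
  using lborel_pair.integrable_fst'[OF I] key by (intro integral_mono iB) (auto simp: indicator_def)
 also have "\<dots> = (\<integral>x. (\<integral>h. ind B h * (ph x * ph (x + h)) \<partial>lborel) \<partial>lborel)"
  using lborel_pair.Fubini_integral[OF I] by simp
 also have "\<dots> = (\<integral>x. ph x * (\<integral>y. ind (ball x t) y * ph y \<partial>lborel) \<partial>lborel)"
 proof (rule Bochner_Integration.integral_cong[OF refl])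
  fix x :: "real ^ 'n"
  have [measurable]: "ball x t \<in> sets borel" by simp
  have "(\<integral>h. ind B h * (ph x * ph (x + h)) \<partial>lborel) = (\<integral>h. ph x * (ind (ball x t) (h + x) * ph (h + x)) \<partial>lborel)"
   by (intro Bochner_Integration.integral_cong refl) (auto simp: B_def indicator_def dist_norm add.commute)
  also have "\<dots> = ph x * (\<integral>y. ind (ball x t) y * ph y \<partial>lborel)"
   using integral_lborel_shift[of "%y. ind (ball x t) y * ph y" x] by simp
  finally show "(\<integral>h. ind B h * (ph x * ph (x + h)) \<partial>lborel) = ph x * (\<integral>y. ind (ball x t) y * ph y \<partial>lborel)" .
 qed
 finally show ?thesis by (simp add: A_def D_def B_def algebra_simps)
qed

text \<open>Difference quotients integrate to zero by translation invariance. They converge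
  dominatedly, since the increments are at most 1 and all quotients therefore live in
  \<open>cball 0 (R + 1)\<close>.\<close>

lemma integral_partial_deriv_zero:
 assumes f: "f \<in> test_functions Om"
 shows "(\<integral>x. pd i f x \<partial>lborel) = 0"
proof -
 have sm: "smooth f" using f by (rule test_smooth)
 have [measurable]: "f \<in> borel_measurable borel" "pd i f \<in> borel_measurable borel"
  using sm smooth_partial_deriv[OF sm] by (auto intro: smooth_borel)
 obtain K where K: "compact K" "\<forall>x. x \<notin> K --> f x = 0 \<and> grad f x = 0" using test_support[OF f] by blast
 obtain C where C: "\<And>x. \<bar>f x\<bar> <= C" "\<And>x. norm (grad f x) <= C" "C >= 0" using test_bounded[OF f] by metis
 obtain R where R: "\<And>x. x \<in> K ==> norm x <= R" using compact_imp_bounded[OF K(1)] by (auto simp: bounded_iff)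
 define e :: "real ^ 'a" where "e = axis i 1"
 have ne: "norm e = 1" by (simp add: e_def norm_axis_1)
 define h where "h n = 1 / real (Suc n)" for n
 have h: "h n > 0" "h n <= 1" for n by (auto simp: h_def)
 define q where "q n x = (f (x + h n *R e) - f x) / h n" for n x
 have qb: "\<bar>q n x\<bar> <= C * ind (cball 0 (R + 1)) x" for n x
 proof (cases "x \<in> cball 0 (R + 1)")
  case True
  have "norm (f (x + h n *R e) - f x) <= C * norm (x + h n *R e - x)"
  proof (rule differentiable_bound[of UNIV f "%x v. grad f x \<bullet> v"])
   show "onorm ((\<bullet>) (grad f x)) <= C" for x
    using C(2)[of x] by (intro onorm_le order_trans[OF Cauchy_Schwarz_ineq2[folded real_norm_def]] mult_right_mono) auto
  qed (auto simp: smooth_has_derivative_grad[OF sm])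
  hence "\<bar>f (x + h n *R e) - f x\<bar> <= C * h n" using h(1)[of n] by (simp add: ne)
  thus ?thesis using True h(1)[of n] by (simp add: q_def field_simps)
 next
  case False
  have "x \<notin> K" using False R by fastforce
  moreover have "x + h n *R e \<notin> K"
  proof
   assume "x + h n *R e \<in> K"
   hence "norm (x + h n *R e) <= R" by (rule R)
   moreover have "norm x <= norm (x + h n *R e) + norm (h n *R e)" using norm_triangle_ineq4[of "x + h n *R e" "h n *R e"] by simp
   ultimately show False using False h[of n] by (simp add: ne)
  qed
  ultimately show ?thesis using K(2) False by (simp add: q_def)
 qed
 have q0: "(\<integral>x. q n x \<partial>lborel) = 0" for n
 proof -
  have i: "integrable lborel f" by (rule test_integrable[OF f, where C=C]) (use C in auto)
  hence "integrable lborel (%x. f (x + h n *R e))"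
   using nn_integral_lborel_shift[of "%x. ennreal (norm (f x))" "h n *R e"] unfolding integrable_iff_bounded by auto
  thus ?thesis using i integral_lborel_shift[of f "h n *R e"] by (simp add: q_def)
 qed
 have "(%n. \<integral>x. q n x \<partial>lborel) ~~> (\<integral>x. pd i f x \<partial>lborel)"
 proof (rule integral_dominated_convergence[where w="%x. C * ind (cball 0 (R + 1)) x"])
  show "AE x in lborel. (%n. q n x) ~~> pd i f x"
  proof (intro AE_I2)
   fix x
   have "((%s. f (x + s *R e)) has_derivative (%v. grad f (x + 0 *R e) \<bullet> (v *R e))) (at 0)"
    by (rule has_derivative_compose[OF _ smooth_has_derivative_grad[OF sm]]) (auto intro!: derivative_eq_intros)
   hence "((%s. f (x + s *R e)) has_real_derivative pd i f x) (at 0)"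
    by (simp add: has_field_derivative_def e_def inner_axis mult.commute)
     (metis (no_types, lifting) ext mult.commute)
   hence "((%s. (f (x + s *R e) - f x) / s) \<longlongrightarrow> pd i f x) (at 0)" by (simp add: DERIV_def)
   moreover have "filterlim h (at 0) sequentially"
   proof -
    have "h ~~> 0" unfolding h_def[abs_def] using LIMSEQ_inverse_real_of_nat by (simp only: inverse_eq_divide)
    thus ?thesis unfolding filterlim_at using h(1) by (simp add: less_imp_neq[symmetric])
   qed
   ultimately show "(%n. q n x) ~~> pd i f x"
    unfolding q_def by (rule filterlim_compose)
  qed
  show "integrable lborel (%x. C * ind (cball (0::real^'a) (R + 1)) x)"
   using emeasure_lborel_cball_finite[of "0::real^'a" "R+1"] by (auto intro!: integrable_mult_right)
  show "AE x in lborel. norm (q n x) <= C * ind (cball 0 (R + 1)) x" for n using qb by simp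
 qed (auto simp: q_def)
 thus ?thesis using q0 by (simp add: LIMSEQ_const_iff)
qed

lemma test_integration_by_parts:
 assumes f: "f \<in> test_functions Om" and g: "g \<in> test_functions Om"
 shows "(\<integral>x. f x * pd i g x \<partial>lborel) = - (\<integral>x. pd i f x * g x \<partial>lborel)"
proof -
 have sm: "smooth f" "smooth g" using f g by (auto intro: test_smooth)
 have [measurable]: "f \<in> borel_measurable borel" "g \<in> borel_measurable borel"
  "pd i f \<in> borel_measurable borel" "pd i g \<in> borel_measurable borel"
  using sm smooth_partial_deriv by (auto intro: smooth_borel)
 obtain C where C: "\<And>x. \<bar>f x\<bar> <= C" "\<And>x. norm (grad f x) <= C" "C >= 0" using test_bounded[OF f] by metis
 obtain D where D: "\<And>x. \<bar>g x\<bar> <= D" "\<And>x. norm (grad g x) <= D" "D >= 0" using test_bounded[OF g] by metis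
 have p: "\<bar>pd i f x\<bar> <= C" "\<bar>pd i g x\<bar> <= D" for x
  using C(2)[of x] D(2)[of x] component_le_norm_cart[of "grad f x" i] component_le_norm_cart[of "grad g x" i] by auto
 have z: "pd i f x = 0" if "grad f x = 0" for x using that by (metis grad_nth zero_index)
 have i1: "integrable lborel (%x. f x * pd i g x)"
  by (rule test_integrable[OF f, where C="C*D"]) (use C(1,3) p D(3) in \<open>auto simp: abs_mult intro!: mult_mono\<close>)
 have i2: "integrable lborel (%x. pd i f x * g x)"
  by (rule test_integrable[OF f, where C="C*D"]) (use C(3) p D(1,3) z in \<open>auto simp: abs_mult intro!: mult_mono\<close>)
 have "(\<integral>x. pd i (%x. f x * g x) x \<partial>lborel) = 0"
  by (rule integral_partial_deriv_zero[OF test_mult[OF g sm(1)]])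
 moreover have "pd i (%x. f x * g x) = (%x. f x * pd i g x + pd i f x * g x)"
  using sm by (intro ext differentiable_partial_deriv_mult smooth_differentiable)
 ultimately show ?thesis using i1 i2 by simp
qed

text \<open>The segment from \<open>x\<close> to \<open>z\<close> is split at its midpoint. On the
  half next to \<open>z\<close>, the map taking \<open>z\<close> to \<open>x + s (z - x)\<close> has
  Jacobian \<open>s ^ CARD('n)\<close> with \<open>s >= 1/2\<close>, so the change of variables
  costs at most \<open>2 ^ CARD('n)\<close>; the half next to \<open>x\<close> is the same with the
  roles exchanged. The splitting keeps away from \<open>s = 0\<close>, where the Jacobian
  degenerates.\<close>

lemma double_difference_bound:
 fixes ph :: "real ^ 'n => real"
 assumes sm: "smooth ph" and Q: "Q \<in> sets borel" "convex Q" "\<And>x y. x \<in> Q ==> y \<in> Q ==> dist x y <= d" "d >= 0"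
 shows "(\<integral>\<^sup>+x. (\<integral>\<^sup>+z. ennreal \<bar>ph z - ph x\<bar> * ind Q z \<partial>lborel) * ind Q x \<partial>lborel)
  <= ennreal (2 ^ CARD('n) * d) * emeasure lborel Q * (\<integral>\<^sup>+x. ennreal (norm (grad ph x)) * ind Q x \<partial>lborel)"
proof -
 have [measurable]: "ph \<in> borel_measurable borel" "grad ph \<in> borel_measurable borel" "Q \<in> sets borel"
  using sm Q(1) by (auto intro: smooth_borel grad_borel)
 define g where "g x = ennreal (norm (grad ph x)) * ind Q x" for x
 have [measurable]: "g \<in> borel_measurable borel" unfolding g_def by measurable
 define G where "G = (\<integral>\<^sup>+x. g x \<partial>lborel)"
 define H where "H x z = (\<integral>\<^sup>+s. g (x + s *R (z - x)) * ind {1/2..1} s \<partial>lborel)" for x z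
 have [measurable]: "(%(x, z). H x z) \<in> borel_measurable (borel \<Otimes>\<^sub>M borel)" unfolding H_def by measurable
 have half: "ennreal \<bar>ph z - ph (midpoint x z)\<bar> <= ennreal d * H x z" if xz: "x \<in> Q" "z \<in> Q" for x z
 proof -
  have "ennreal \<bar>ph (x + 1 *R (z - x)) - ph (x + (1/2) *R (z - x))\<bar>
   <= (\<integral>\<^sup>+s. ennreal (norm (grad ph (x + s *R (z - x))) * norm (z - x)) * ind {1/2..1} s \<partial>lborel)"
   by (rule segment_bound[OF sm]) simp
  also have "\<dots> <= (\<integral>\<^sup>+s. ennreal d * (g (x + s *R (z - x)) * ind {1/2..1} s) \<partial>lborel)"
  proof (rule nn_integral_mono)
   fix s :: real
   have "x + s *R (z - x) \<in> Q" if "s \<in> {1/2..1}"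
    using convexD_alt[OF Q(2) xz, of s] that by (simp add: algebra_simps)
   moreover have "norm (grad ph (x + s *R (z - x))) * norm (z - x) <= d * norm (grad ph (x + s *R (z - x)))"
    using Q(3)[OF xz] by (subst mult.commute, intro mult_right_mono) (auto simp: dist_norm norm_minus_commute)
   ultimately show "ennreal (norm (grad ph (x + s *R (z - x))) * norm (z - x)) * ind {1/2..1} s
     <= ennreal d * (g (x + s *R (z - x)) * ind {1/2..1} s)"
    using Q(4) by (auto simp: indicator_def g_def ennreal_mult[symmetric] intro: ennreal_leI)
  qed
  also have "\<dots> = ennreal d * H x z" unfolding H_def by (rule nn_integral_cmult) measurable
  also have "x + (1/2) *R (z - x) = midpoint x z" by (simp add: midpoint_def vec_eq_iff field_simps)
  finally show ?thesis by simp
 qed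
 \<comment> \<open>The division by 2 is the length of the interval \<open>{1/2..1}\<close>; it is
   compensated later by the two halves of the segment.\<close>
 have Hint: "(\<integral>\<^sup>+x. (\<integral>\<^sup>+z. H x z * ind Q z \<partial>lborel) * ind Q x \<partial>lborel)
   <= ennreal (2 ^ CARD('n) / 2) * emeasure lborel Q * G"
 proof -
  have inner: "(\<integral>\<^sup>+z. g (x + s *R (z - x)) \<partial>lborel) <= ennreal (2 ^ CARD('n)) * G" if s: "s \<in> {1/2..1}" for s and x :: "real^'n"
  proof -
   have "G = ennreal (\<bar>s\<bar> ^ CARD('n)) * (\<integral>\<^sup>+z. g ((x - s *R x) + s *R z) \<partial>lborel)"
    unfolding G_def using s by (subst nn_integral_lborel_affine[of g s "x - s *R x"]) auto
   hence "ennreal (2 ^ CARD('n)) * G = ennreal ((2 * s) ^ CARD('n)) * (\<integral>\<^sup>+z. g (x + s *R (z - x)) \<partial>lborel)"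
    using s by (simp add: mult.assoc[symmetric] ennreal_mult[symmetric] power_mult_distrib algebra_simps)
   moreover have "1 <= ennreal ((2 * s) ^ CARD('n))"
    using s one_le_power[of "2 * s"] by (simp add: ennreal_ge_1)
   ultimately show ?thesis using mult_right_mono[of 1 "ennreal ((2 * s) ^ CARD('n))"] by fastforce
  qed
  have "(\<integral>\<^sup>+z. H x z * ind Q z \<partial>lborel) <= ennreal (2 ^ CARD('n) / 2) * G" for x
  proof -
   have "(\<integral>\<^sup>+z. H x z * ind Q z \<partial>lborel) <= (\<integral>\<^sup>+z. H x z \<partial>lborel)"
    by (intro nn_integral_mono) (auto simp: indicator_def)
   also have "\<dots> = (\<integral>\<^sup>+s. (\<integral>\<^sup>+z. g (x + s *R (z - x)) * ind {1/2..1} s \<partial>lborel) \<partial>lborel)"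
    unfolding H_def by (rule lborel_pair.Fubini') measurable
   also have "\<dots> <= (\<integral>\<^sup>+s. ennreal (2 ^ CARD('n)) * G * ind {1/2..1::real} s \<partial>lborel)"
   proof (rule nn_integral_mono)
    fix s :: real
    show "(\<integral>\<^sup>+z. g (x + s *R (z - x)) * ind {1/2..1} s \<partial>lborel) <= ennreal (2 ^ CARD('n)) * G * ind {1/2..1} s"
     using inner[of s x] by (auto simp: indicator_def)
   qed
   also have "\<dots> = ennreal (2 ^ CARD('n) / 2) * G"
   proof -
    have "emeasure lborel {1/2..1::real} = ennreal (1/2)" by (subst emeasure_lborel_Icc) auto
    moreover have "ennreal (2 ^ CARD('n) / 2) = ennreal (2 ^ CARD('n)) * ennreal (1/2)"
     by (subst ennreal_mult[symmetric]) auto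
    ultimately show ?thesis by (subst nn_integral_cmult_indicator) (simp_all only: mult_ac sets_lborel atLeastAtMost_borel)
   qed
   finally show ?thesis .
  qed
  hence "(\<integral>\<^sup>+x. (\<integral>\<^sup>+z. H x z * ind Q z \<partial>lborel) * ind Q x \<partial>lborel)
    <= (\<integral>\<^sup>+x. ennreal (2 ^ CARD('n) / 2) * G * ind Q x \<partial>lborel)"
   by (intro nn_integral_mono mult_right_mono) auto
  also have "\<dots> = ennreal (2 ^ CARD('n) / 2) * emeasure lborel Q * G"
   by (subst nn_integral_cmult_indicator) (simp_all add: mult_ac)
  finally show ?thesis .
 qed
 have "(\<integral>\<^sup>+x. (\<integral>\<^sup>+z. ennreal \<bar>ph z - ph x\<bar> * ind Q z \<partial>lborel) * ind Q x \<partial>lborel)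
   <= (\<integral>\<^sup>+x. (\<integral>\<^sup>+z. (ennreal d * (H x z * ind Q z * ind Q x) + ennreal d * (H z x * ind Q z * ind Q x)) \<partial>lborel) \<partial>lborel)"
  (is "_ <= (\<integral>\<^sup>+x. (\<integral>\<^sup>+z. (?A x z + ?B x z) \<partial>lborel) \<partial>lborel)")
 proof (subst nn_integral_multc[symmetric], measurable, intro nn_integral_mono)
  fix x z
  show "ennreal \<bar>ph z - ph x\<bar> * ind Q z * ind Q x <= ?A x z + ?B x z"
  proof (cases "x \<in> Q \<and> z \<in> Q")
   case True
   have "\<bar>ph z - ph x\<bar> <= \<bar>ph z - ph (midpoint x z)\<bar> + \<bar>ph x - ph (midpoint z x)\<bar>" by (simp add: midpoint_sym)
   hence "ennreal \<bar>ph z - ph x\<bar> <= ennreal \<bar>ph z - ph (midpoint x z)\<bar> + ennreal \<bar>ph x - ph (midpoint z x)\<bar>"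
    by (subst ennreal_plus[symmetric]) (auto intro!: ennreal_leI simp del: ennreal_plus)
   also have "\<dots> <= ennreal d * H x z + ennreal d * H z x" using half True by (intro add_mono) auto
   finally show ?thesis using True by simp
  qed (auto simp: indicator_def)
 qed
 also have "\<dots> = (\<integral>\<^sup>+x. (\<integral>\<^sup>+z. ?A x z \<partial>lborel) \<partial>lborel) + (\<integral>\<^sup>+x. (\<integral>\<^sup>+z. ?B x z \<partial>lborel) \<partial>lborel)"
  by (simp add: nn_integral_add)
 also have "(\<integral>\<^sup>+x. (\<integral>\<^sup>+z. ?B x z \<partial>lborel) \<partial>lborel) = (\<integral>\<^sup>+x. (\<integral>\<^sup>+z. ?A x z \<partial>lborel) \<partial>lborel)"
  by (subst lborel_pair.Fubini') (measurable, simp add: mult_ac)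
 also have "(\<integral>\<^sup>+x. (\<integral>\<^sup>+z. ?A x z \<partial>lborel) \<partial>lborel)
   = ennreal d * (\<integral>\<^sup>+x. (\<integral>\<^sup>+z. H x z * ind Q z \<partial>lborel) * ind Q x \<partial>lborel)"
  by (simp add: nn_integral_cmult nn_integral_multc)
 finally have fin: "(\<integral>\<^sup>+x. (\<integral>\<^sup>+z. ennreal \<bar>ph z - ph x\<bar> * ind Q z \<partial>lborel) * ind Q x \<partial>lborel)
   <= ennreal d * (\<integral>\<^sup>+x. (\<integral>\<^sup>+z. H x z * ind Q z \<partial>lborel) * ind Q x \<partial>lborel)
    + ennreal d * (\<integral>\<^sup>+x. (\<integral>\<^sup>+z. H x z * ind Q z \<partial>lborel) * ind Q x \<partial>lborel)" .
 have "(\<integral>\<^sup>+x. (\<integral>\<^sup>+z. ennreal \<bar>ph z - ph x\<bar> * ind Q z \<partial>lborel) * ind Q x \<partial>lborel)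
   <= ennreal (2 * d) * (\<integral>\<^sup>+x. (\<integral>\<^sup>+z. H x z * ind Q z \<partial>lborel) * ind Q x \<partial>lborel)"
 proof -
  have "ennreal (2 * d) = ennreal d + ennreal d" using Q(4) by (simp flip: ennreal_plus)
  thus ?thesis using fin by (simp only: distrib_right)
 qed
 also have "\<dots> <= ennreal (2 * d) * (ennreal (2 ^ CARD('n) / 2) * emeasure lborel Q * G)"
  by (intro mult_left_mono Hint) simp
 also have "\<dots> = ennreal (2 ^ CARD('n) * d) * emeasure lborel Q * G"
 proof -
  have "ennreal (2 ^ CARD('n) * d) = ennreal (2 * d) * ennreal (2 ^ CARD('n) / 2)"
   using Q(4) by (subst ennreal_mult[symmetric]) auto
  thus ?thesis by (simp only: mult.assoc)
 qed
 finally show ?thesis by (simp add: G_def g_def)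
qed

section \<open>The space of functions with zero boundary values\<close>

text \<open>From here on functions on \<open>Om\<close> are extended by zero, so that all integrals are over the whole
 space. \<open>h10 Om u G\<close> says that \<open>u\<close> is in \<open>H\<^sup>1\<^sub>0(Om)\<close> with gradient \<open>G\<close>.\<close>

definition sqv :: "(real ^ 'n => real ^ 'n) => bool" where
 "sqv G \<longleftrightarrow> (\<forall>i. sqi (%x. G x $ i))"

definition pr :: "(real ^ 'n => real) => (real ^ 'n => real ^ 'n) => (real ^ 'n) l2 \<times> ((real ^ 'n) l2 ^ 'n)" where
 "pr u G = (cls u, \<chi> i. cls (%x. G x $ i))"

text \<open>The graph form of the space: pairs of a function and its gradient inside a product of L2
  spaces. As a closed subspace of a complete type it admits the projection, Riesz and weak
  compactness theorems directly, and convergence in it is componentwise L2 convergence.\<close>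

definition W :: "(real ^ 'n) set => ((real ^ 'n) l2 \<times> ((real ^ 'n) l2 ^ 'n)) set" where
 "W Om = closure ((%ph. pr ph (grad ph)) ` test_functions Om)"

definition h10 :: "(real ^ 'n) set => (real ^ 'n => real) => (real ^ 'n => real ^ 'n) => bool" where
 "h10 Om u G \<longleftrightarrow> sqi u \<and> sqv G \<and> pr u G \<in> W Om"

lemma pr_tendsto_iff:
 "(%n. pr (u n) (G n)) ~~> pr v H \<longleftrightarrow>
  (%n. cls (u n)) ~~> cls v \<and> (\<forall>i. (%n. cls (%x. G n x $ i)) ~~> cls (%x. H x $ i))"
 unfolding pr_def
proof (intro iffI conjI allI)
 assume a: "(%n. (cls (u n), \<chi> i. cls (%x. G n x $ i))) ~~> (cls v, \<chi> i. cls (%x. H x $ i))"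
 show "(%n. cls (u n)) ~~> cls v" using tendsto_fst[OF a] by simp
 show "(%n. cls (%x. G n x $ i)) ~~> cls (%x. H x $ i)" for i
  using tendsto_vec_nth[OF tendsto_snd[OF a], of i] by simp
qed (auto intro!: tendsto_Pair tendsto_vec_lambda)

lemma sqi_test:
 assumes "ph \<in> test_functions Om" shows "sqi ph" "sqv (grad ph)"
proof -
 have sm: "smooth ph" using assms by (rule test_smooth)
 have [measurable]: "ph \<in> borel_measurable borel" "pd i ph \<in> borel_measurable borel" for i
  using sm smooth_partial_deriv[OF sm] by (auto intro: smooth_borel)
 obtain C where C: "\<And>x. \<bar>ph x\<bar> <= C" "\<And>x. norm (grad ph x) <= C" "C >= 0" using test_bounded[OF assms] by metis
 have p: "\<bar>pd i ph x\<bar> <= C" for i x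
  using C(2)[of x] component_le_norm_cart[of "grad ph x" i] by simp
 have sq: "\<bar>a\<bar> <= C ==> \<bar>a^2\<bar> <= C^2" for a :: real using power_mono[of "\<bar>a\<bar>" C 2] by simp
 have z: "pd i ph x = 0" if "grad ph x = 0" for i x using that by (metis grad_nth zero_index)
 have "integrable lborel (%x. (ph x)^2)"
  by (rule test_integrable[OF assms _ _ sq[OF C(1)]]) auto
 thus "sqi ph" unfolding sqi_def by (simp add: integrable_completion borel_lebesgue)
 have "integrable lborel (%x. (pd i ph x)^2)" for i
  by (rule test_integrable[OF assms _ _ sq[OF p]]) (auto simp: z)
 thus "sqv (grad ph)" unfolding sqv_def sqi_def by (simp add: integrable_completion borel_lebesgue)
qed

lemma pr_add: "sqi u ==> sqv G ==> sqi v ==> sqv H ==> pr u G + pr v H = pr (%x. u x + v x) (%x. G x + H x)"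
 by (simp add: pr_def sqv_def cls_simps vec_eq_iff)

lemma pr_scale: "sqi u ==> sqv G ==> c *R pr u G = pr (%x. c * u x) (%x. c *R G x)"
 by (simp add: pr_def sqv_def cls_simps vec_eq_iff)

lemma subspace_test:
 fixes Om :: "(real ^ 'n) set"
 shows "subspace ((%ph. pr ph (grad ph)) ` test_functions Om)"
 unfolding subspace_def
proof (intro conjI ballI allI)
 have "grad (%x :: real ^ 'n. 0) = (%x. 0)" by (rule ext) (rule grad_const)
 hence "0 = pr (%x. 0) (grad (%x :: real ^ 'n. 0))" by (simp add: pr_def zero_prod_def vec_eq_iff cls_simps)
 thus "0 \<in> (%ph. pr ph (grad ph)) ` test_functions Om" by (rule image_eqI[OF _ test_zero])
next
 fix x y assume "x \<in> (%ph. pr ph (grad ph)) ` test_functions Om" "y \<in> (%ph. pr ph (grad ph)) ` test_functions Om"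
 then obtain f g where fg: "f \<in> test_functions Om" "g \<in> test_functions Om" "x = pr f (grad f)" "y = pr g (grad g)" by blast
 have "grad (%x. f x + g x) = (%x. grad f x + grad g x)"
  using fg test_smooth by (intro ext grad_add) auto
 hence "x + y = pr (%x. f x + g x) (grad (%x. f x + g x))"
  using fg(3,4) sqi_test[OF fg(1)] sqi_test[OF fg(2)] by (simp add: pr_add)
 thus "x + y \<in> (%ph. pr ph (grad ph)) ` test_functions Om" using test_add[OF fg(1,2)] by blast
next
 fix c x assume "x \<in> (%ph. pr ph (grad ph)) ` test_functions Om"
 then obtain f where f: "f \<in> test_functions Om" "x = pr f (grad f)" by blast
 have "grad (%x. c * f x) = (%x. c *R grad f x)"
  using grad_mult[OF smooth_const test_smooth[OF f(1)], of c] by (auto simp: grad_const)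
 hence "c *R x = pr (%x. c * f x) (grad (%x. c * f x))"
  using f(2) sqi_test[OF f(1)] by (simp add: pr_scale)
 thus "c *R x \<in> (%ph. pr ph (grad ph)) ` test_functions Om" using test_mult[OF f(1) smooth_const] by blast
qed

lemma subspace_closure:
 fixes S :: "'a::real_normed_vector set" assumes "subspace S" shows "subspace (closure S)"
 unfolding subspace_def
proof (intro conjI ballI allI)
 show "0 \<in> closure S" using subspace_0[OF assms] closure_subset by blast
next
 fix x y assume xy: "x \<in> closure S" "y \<in> closure S"
 obtain f where f: "\<And>n. f n \<in> S" "f ~~> x" using closure_seqE[OF xy(1)] by blast
 obtain g where g: "\<And>n. g n \<in> S" "g ~~> y" using closure_seqE[OF xy(2)] by blast
 show "x + y \<in> closure S"
  by (rule closure_seqI[OF subspace_add[OF assms f(1) g(1)] tendsto_add[OF f(2) g(2)]])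
next
 fix c x assume x: "x \<in> closure S"
 obtain f where f: "\<And>n. f n \<in> S" "f ~~> x" using closure_seqE[OF x] by blast
 show "c *R x \<in> closure S"
  by (rule closure_seqI[OF subspace_scale[OF assms f(1)] tendsto_scaleR[OF tendsto_const f(2)]])
qed

lemma W_closed: "closed (W Om)" and W_subspace: "subspace (W Om)"
 unfolding W_def by (simp_all add: subspace_closure subspace_test)

lemma h10D: "h10 Om u G ==> sqi u" "h10 Om u G ==> sqv G" "h10 Om u G ==> sqi (%x. G x $ i)"
 by (auto simp: h10_def sqv_def)

lemma h10_test: "ph \<in> test_functions Om ==> h10 Om ph (grad ph)"
 unfolding h10_def W_def by (intro conjI sqi_test subsetD[OF closure_subset] imageI)

lemma W_repr:
 assumes "p \<in> W Om" shows "\<exists>u G. p = pr u G \<and> h10 Om u G"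
proof -
 obtain u where u: "fst p = cls u" "sqi u" by (cases "fst p")
 have "\<exists>g. snd p $ i = cls g \<and> sqi g" for i by (cases "snd p $ i") blast
 then obtain g where g: "\<And>i. snd p $ i = cls (g i)" "\<And>i. sqi (g i)" by metis
 have "p = pr u (%x. \<chi> i. g i x)" by (simp add: pr_def prod_eq_iff u g vec_eq_iff)
 moreover have "sqv (%x. \<chi> i. g i x)" by (simp add: sqv_def g)
 ultimately show ?thesis using u assms unfolding h10_def by metis
qed

lemma h10_approx:
 assumes "h10 Om u G"
 shows "\<exists>ph. (\<forall>n. ph n \<in> test_functions Om) \<and> (%n::nat. cls (ph n)) ~~> cls u \<and>
  (\<forall>i. (%n. cls (pd i (ph n))) ~~> cls (%x. G x $ i))"
proof -
 have "pr u G \<in> closure ((%ph. pr ph (grad ph)) ` test_functions Om)" using assms by (simp add: h10_def W_def)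
 then obtain f where f: "\<forall>n. f n \<in> (%ph. pr ph (grad ph)) ` test_functions Om" "f ~~> pr u G"
  unfolding closure_sequential by blast
 hence "\<forall>n. \<exists>ph. ph \<in> test_functions Om \<and> f n = pr ph (grad ph)" by blast
 then obtain ph where ph: "\<forall>n. ph n \<in> test_functions Om \<and> f n = pr (ph n) (grad (ph n))" by metis
 have fe: "f = (%n. pr (ph n) (grad (ph n)))" using ph by (intro ext) blast
 have "(%n. pr (ph n) (grad (ph n))) ~~> pr u G" using f(2) unfolding fe .
 thus ?thesis using ph by (auto simp: pr_tendsto_iff)
qed

text \<open>Products, compositions and truncations are shown below to lie in the space by exhibiting
  them as componentwise limits.\<close>

lemma h10_limit:
 assumes "\<And>n::nat. h10 Om (u n) (G n)" "sqi v" "sqv H" "(%n. cls (u n)) ~~> cls v"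
  "\<And>i. (%n. cls (%x. G n x $ i)) ~~> cls (%x. H x $ i)"
 shows "h10 Om v H"
proof -
 have lim: "(%n. pr (u n) (G n)) ~~> pr v H" using assms(4,5) unfolding pr_tendsto_iff by blast
 have "pr (u n) (G n) \<in> W Om" for n using assms(1) by (simp add: h10_def)
 from closed_sequentially[OF W_closed this lim] have "pr v H \<in> W Om" .
 thus ?thesis using assms by (simp add: h10_def)
qed

lemma h10_AE_cong:
 assumes "h10 Om u G" "ae x. v x = u x" "ae x. H x = G x" "sqi v" "sqv H"
 shows "h10 Om v H"
proof (rule h10_limit[where u="%n. u" and G="%n. G"])
 have "cls u = cls v" by (rule cls_eqI) (use assms in \<open>auto intro: h10D elim: AE_mp\<close>)
 thus "(%n. cls u) ~~> cls v" by simp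
 have "cls (%x. G x $ i) = cls (%x. H x $ i)" for i
 proof (rule cls_eqI)
  show "ae x. G x $ i = H x $ i" using assms(3) by eventually_elim simp
 qed (use assms in \<open>auto simp: sqv_def intro: h10D\<close>)
 thus "(%n. cls (%x. G x $ i)) ~~> cls (%x. H x $ i)" for i by simp
qed (use assms in auto)

lemma h10_add:
 assumes "h10 Om u G" "h10 Om v H" shows "h10 Om (%x. u x + v x) (%x. G x + H x)"
proof -
 have "pr u G + pr v H \<in> W Om" using assms by (intro subspace_add[OF W_subspace]) (simp_all add: h10_def)
 moreover have "sqv (%x. G x + H x)" using assms by (simp add: h10_def sqv_def sqi_add)
 ultimately show ?thesis using assms by (simp add: h10_def pr_add sqi_add)
qed

lemma h10_scale:
 assumes "h10 Om u G" shows "h10 Om (%x. c * u x) (%x. c *R G x)"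
proof -
 have "c *R pr u G \<in> W Om" using assms by (intro subspace_scale[OF W_subspace]) (simp_all add: h10_def)
 moreover have "sqv (%x. c *R G x)" using assms by (simp add: h10_def sqv_def sqi_cmult)
 ultimately show ?thesis using assms by (simp add: h10_def pr_scale sqi_cmult)
qed

lemma h10_uminus: "h10 Om u G ==> h10 Om (%x. - u x) (%x. - G x)"
 using h10_scale[of Om u G "-1"] by simp

lemma h10_diff: "h10 Om u G ==> h10 Om v H ==> h10 Om (%x. u x - v x) (%x. G x - H x)"
 using h10_add[OF _ h10_uminus] by simp

text \<open>Test functions and their gradients vanish at every point off \<open>Om\<close>; a
  subsequence converging almost everywhere passes this to the limit.\<close>

lemma h10_zero_outside:
 assumes "h10 Om u G" shows "ae x. x \<notin> Om --> u x = 0 \<and> G x = 0"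
proof -
 obtain ph where ph: "\<And>n. ph n \<in> test_functions Om" "(%n::nat. cls (ph n)) ~~> cls u"
  "\<And>i. (%n. cls (pd i (ph n))) ~~> cls (%x. G x $ i)"
  using h10_approx[OF assms] by blast
 have s: "sqi (ph n)" "sqi (pd i (ph n))" for n i
  using sqi_test[OF ph(1)] by (auto simp: sqv_def)
 have z: "ph n x = 0" "pd i (ph n) x = 0" if "x \<notin> Om" for n x i
  using test_zero_outside[OF ph(1) that] by (auto simp: vec_eq_iff)
 obtain r where "ae x. (%n. ph (r n) x) ~~> u x"
  using cls_AE_subseq[OF ph(2) s(1) h10D(1)[OF assms]] by blast
 hence 1: "ae x. x \<notin> Om --> u x = 0"
  by eventually_elim (auto simp: z LIMSEQ_const_iff)
 have 2: "ae x. x \<notin> Om --> G x $ i = 0" for i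
 proof -
  obtain r where "ae x. (%n. pd i (ph (r n)) x) ~~> G x $ i"
   using cls_AE_subseq[OF ph(3) s(2) h10D(3)[OF assms]] by blast
  thus ?thesis by eventually_elim (auto simp: z LIMSEQ_const_iff)
 qed
 hence "ae x. \<forall>i\<in>UNIV. x \<notin> Om --> G x $ i = 0" by (subst AE_finite_all) auto
 with 1 show ?thesis by eventually_elim (auto simp: vec_eq_iff)
qed

section \<open>Products, chain rule and truncation\<close>

lemma smooth_bounded_on:
 assumes "smooth et" "bounded Om"
 shows "\<exists>C\<ge>0. \<forall>x\<in>Om. \<bar>et x\<bar> <= C \<and> norm (grad et x) <= C"
proof -
 have "continuous_on (closure Om) et" "continuous_on (closure Om) (grad et)"
  using assms(1) by (auto intro: continuous_on_subset[OF smooth_continuous] continuous_grad)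
 hence "bounded (et ` closure Om)" "bounded (grad et ` closure Om)"
  using assms(2) by (auto intro!: compact_imp_bounded compact_continuous_image)
 then obtain A B where AB: "\<forall>x\<in>closure Om. \<bar>et x\<bar> <= A" "\<forall>x\<in>closure Om. norm (grad et x) <= B"
  unfolding bounded_iff by auto
 show ?thesis
  by (rule exI[of _ "max 0 (max A B)"]) (use AB closure_subset[of Om] in \<open>fastforce simp: le_max_iff_disj\<close>)
qed

lemma sqv_scale_bounded:
 assumes "sqv G" "b \<in> BM" "ae x. \<bar>b x\<bar> <= C"
 shows "sqv (%x. b x *R G x)"
 using assms by (auto simp: sqv_def intro: sqi_mult_bounded)

text \<open>The multiplier \<open>b\<close> is controlled only on \<open>Om\<close>; this suffices
  because the sequence and its limit vanish outside.\<close>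

lemma cls_mult_tendsto:
 assumes "(%n. cls (f n)) ~~> cls g" "\<And>n. sqi (f n)" "sqi g" "b \<in> BM"
  "\<And>x. x \<in> Om ==> \<bar>b x\<bar> <= C" "C >= 0" "\<And>n x. x \<notin> Om ==> f n x = 0" "ae x. x \<notin> Om --> g x = 0"
 shows "sqi (%x. b x * g x)" "sqi (%x. b x * f n x)" "(%n. cls (%x. b x * f n x)) ~~> cls (%x. b x * g x)"
proof -
 have [measurable]: "b \<in> BM" "g \<in> BM" "f n \<in> BM" for n
  using assms by (auto intro: sqi_measurable)
 have 1: "ae x. \<bar>b x * g x\<bar> <= C * \<bar>g x\<bar>"
  using assms(8)
 proof eventually_elim
  case (elim x)
  thus ?case using assms(5)[of x] by (cases "x \<in> Om") (auto simp: abs_mult intro!: mult_right_mono)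
 qed
 show g: "sqi (%x. b x * g x)" by (rule sqi_bound[OF assms(3) _ 1]) simp
 have 2: "\<bar>b x * f n x\<bar> <= C * \<bar>f n x\<bar>" for n x
  using assms(5)[of x] assms(7)[of x n] by (cases "x \<in> Om") (auto simp: abs_mult intro!: mult_right_mono)
 show f: "sqi (%x. b x * f n x)" for n by (rule sqi_bound[OF assms(2)[of n]]) (use 2 in auto)
 show "(%n. cls (%x. b x * f n x)) ~~> cls (%x. b x * g x)"
 proof (rule cls_tendsto_lipschitz[OF assms(1-3) f g _ assms(6)])
  show "ae x. \<bar>b x * f n x - b x * g x\<bar> <= C * \<bar>f n x - g x\<bar>" for n
   using assms(8)
  proof eventually_elim
   case (elim x)
   have "b x * f n x - b x * g x = b x * (f n x - g x)" by (simp add: algebra_simps)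
   thus ?case using elim assms(5)[of x] assms(7)[of x n]
    by (cases "x \<in> Om") (auto simp: abs_mult intro!: mult_right_mono)
  qed
 qed
qed

lemma h10_mult_smooth:
 assumes h: "h10 Om u G" and et: "smooth et" and Om: "bounded Om"
 shows "h10 Om (%x. et x * u x) (%x. et x *R G x + u x *R grad et x)"
proof -
 obtain ph where ph: "\<And>n. ph n \<in> test_functions Om" "(%n::nat. cls (ph n)) ~~> cls u"
  "\<And>i. (%n. cls (pd i (ph n))) ~~> cls (%x. G x $ i)"
  using h10_approx[OF h] by blast
 have s: "sqi (ph n)" "sqi (pd i (ph n))" for n i
  using sqi_test[OF ph(1)] by (auto simp: sqv_def)
 have z: "ph n x = 0" "pd i (ph n) x = 0" if "x \<notin> Om" for n x i
  using test_zero_outside[OF ph(1) that] by (auto simp: vec_eq_iff)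
 obtain C where C: "C >= 0" "\<And>x. x \<in> Om ==> \<bar>et x\<bar> <= C" "\<And>x. x \<in> Om ==> norm (grad et x) <= C"
  using smooth_bounded_on[OF et Om] by blast
 have p: "x \<in> Om ==> \<bar>pd i et x\<bar> <= C" for x i
  using C(3)[of x] component_le_norm_cart[of "grad et x" i] by simp
 have zo: "ae x. x \<notin> Om --> u x = 0" "ae x. x \<notin> Om --> G x $ i = 0" for i
  using h10_zero_outside[OF h] by (eventually_elim; simp)+
 have m: "et \<in> BM" "pd i et \<in> BM" for i
  using et smooth_partial_deriv[OF et] by (auto intro!: borel_lebesgue smooth_borel)
 note 1 = cls_mult_tendsto[OF ph(2) s(1) h10D(1)[OF h] m(1) C(2) C(1) z(1) zo(1)]
 note 2 = cls_mult_tendsto[OF ph(3) s(2) h10D(3)[OF h] m(1) C(2) C(1) z(2) zo(2)]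
 note 3 = cls_mult_tendsto[OF ph(2) s(1) h10D(1)[OF h] m(2) p C(1) z(1) zo(1)]
 have g: "grad (%x. et x * ph n x) = (%x. et x *R grad (ph n) x + ph n x *R grad et x)" for n
  by (intro ext grad_mult et test_smooth[OF ph(1)])
 show ?thesis
 proof (rule h10_limit)
  show "h10 Om (%x. et x * ph n x) (%x. et x *R grad (ph n) x + ph n x *R grad et x)" for n
   using h10_test[OF test_mult[OF ph(1) et]] by (simp add: g)
  show "sqi (%x. et x * u x)" by (rule 1)
  show "sqv (%x. et x *R G x + u x *R grad et x)"
   unfolding sqv_def using sqi_add[OF 2(1) 3(1)] by (simp add: mult.commute)
  show "(%n. cls (%x. et x * ph n x)) ~~> cls (%x. et x * u x)" by (rule 1)
  show "(%n. cls (%x. (et x *R grad (ph n) x + ph n x *R grad et x) $ i))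
    ~~> cls (%x. (et x *R G x + u x *R grad et x) $ i)" for i
   using tendsto_add[OF 2(3)[of i] 3(3)[of i]] 2(1,2) 3(1,2)
   by (simp add: cls_simps mult.commute)
 qed
qed

text \<open>The gradient error splits in two. \<open>psi' d (ph n x - k)\<close> times the
  difference of the gradients is small in L2 because \<open>psi'\<close> is at most 1; the change of
  the factor in front of the fixed \<open>G\<close> is handled by dominated convergence along a
  subsequence converging almost everywhere.\<close>

lemma h10_psi:
 assumes h: "h10 Om u G" and d: "d > 0"
 shows "h10 Om (%x. psi d (u x - k) - psi d (- k)) (%x. psi' d (u x - k) *R G x)"
proof -
 obtain ph' where ph': "\<And>n. ph' n \<in> test_functions Om" "(%n::nat. cls (ph' n)) ~~> cls u"
  "\<And>i. (%n. cls (pd i (ph' n))) ~~> cls (%x. G x $ i)"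
  using h10_approx[OF h] by blast
 have su: "sqi u" using h by (rule h10D)
 obtain r where r: "strict_mono r" "ae x. (%n. ph' (r n) x) ~~> u x"
  using cls_AE_subseq[OF ph'(2) sqi_test(1)[OF ph'(1)] su] by blast
 define ph where "ph n = ph' (r n)" for n
 have ph: "\<And>n. ph n \<in> test_functions Om" "(%n::nat. cls (ph n)) ~~> cls u"
  "\<And>i. (%n. cls (pd i (ph n))) ~~> cls (%x. G x $ i)"
  using ph' LIMSEQ_subseq_LIMSEQ[OF _ r(1)] by (fastforce simp: ph_def o_def)+
 have s: "sqi (ph n)" "sqi (pd i (ph n))" for n i
  using sqi_test[OF ph(1)] by (auto simp: sqv_def)
 have sG: "sqi (%x. G x $ i)" for i using h by (rule h10D)
 have cont: "continuous_on UNIV (psi' d)" "continuous_on UNIV (psi d)"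
  using isCont_psi'[OF d] DERIV_isCont[OF psi_deriv[OF d]] by (auto intro: continuous_at_imp_continuous_on)
 have [measurable]: "psi' d \<in> borel_measurable borel" "psi d \<in> borel_measurable borel"
  using cont by (auto intro: borel_measurable_continuous_onI)
 have [measurable]: "u \<in> BM" "ph n \<in> BM" 
  "(%x. G x $ i) \<in> BM" "pd i (ph n) \<in> BM" for n i
  using su s sG by (auto intro: sqi_measurable)
 have b: "\<bar>psi' d t\<bar> <= 1" for t using psi'_bounds[OF d] by simp
 have psil: "\<bar>psi d (t - k) - psi d (- k)\<bar> <= \<bar>t\<bar>" for t using psi_lipschitz[OF d, of "t - k" "- k"] by simp
 have sv: "sqi (%x. psi d (v x - k) - psi d (- k))" if v: "sqi v" for v :: "real ^ 'a => real"
 proof (rule sqi_bound[OF v])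
  have [measurable]: "v \<in> BM" using v by (rule sqi_measurable)
  show "(%x. psi d (v x - k) - psi d (- k)) \<in> BM" by measurable
  show "ae x. \<bar>psi d (v x - k) - psi d (- k)\<bar> <= 1 * \<bar>v x\<bar>" by (simp add: psil)
 qed
 have m1: "sqi w ==> v \<in> BM ==> sqi (%x. psi' d (v x - k) * w x)" for v w :: "real ^ 'a => real"
  by (rule sqi_mult_bounded[where C=1]) (simp_all add: b)
 have gr: "grad (%x. psi d (ph n x - k) - psi d (- k)) = (%x. psi' d (ph n x - k) *R grad (ph n) x)" for n
 proof
  fix x
  have "((%t. psi d (t - k) - psi d (- k)) has_real_derivative psi' d (ph n x - k)) (at (ph n x))"
   by (auto intro!: derivative_eq_intros DERIV_chain2[OF psi_deriv[OF d]])
  from grad_compose[OF test_smooth[OF ph(1)] this]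
  show "grad (%x. psi d (ph n x - k) - psi d (- k)) x = psi' d (ph n x - k) *R grad (ph n) x" .
 qed
 show ?thesis
 proof (rule h10_limit)
  show "h10 Om (%x. psi d (ph n x - k) - psi d (- k)) (%x. psi' d (ph n x - k) *R grad (ph n) x)" for n
   by (subst gr[symmetric]) (rule h10_test[OF test_psi[OF ph(1) d]])
  show "sqi (%x. psi d (u x - k) - psi d (- k))" using su by (rule sv)
  show "sqv (%x. psi' d (u x - k) *R G x)" unfolding sqv_def using m1[OF sG] by simp
  show "(%n. cls (%x. psi d (ph n x - k) - psi d (- k))) ~~> cls (%x. psi d (u x - k) - psi d (- k))"
  proof (rule cls_tendsto_lipschitz[OF ph(2) s(1) su sv[OF s(1)] sv[OF su], where C=1])
   show "ae x. \<bar>psi d (ph n x - k) - psi d (- k) - (psi d (u x - k) - psi d (- k))\<bar> <= 1 * \<bar>ph n x - u x\<bar>" for n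
   proof (intro AE_I2)
    fix x
    show "\<bar>psi d (ph n x - k) - psi d (- k) - (psi d (u x - k) - psi d (- k))\<bar> <= 1 * \<bar>ph n x - u x\<bar>"
     using psi_lipschitz[OF d, of "ph n x - k" "u x - k"] by simp
   qed
  qed simp
  show "(%n. cls (%x. (psi' d (ph n x - k) *R grad (ph n) x) $ i)) ~~> cls (%x. (psi' d (u x - k) *R G x) $ i)" for i
  proof -
   have A: "(%n. cls (%x. psi' d (ph n x - k) * (pd i (ph n) x - G x $ i))) ~~> cls (%x. 0)"
   proof (rule cls_tendsto_lipschitz[where f="%n. pd i (ph n)" and f'="%x. G x $ i" and C=1])
    show "sqi (%x. psi' d (ph n x - k) * (pd i (ph n) x - G x $ i))" for n
     by (intro m1 sqi_diff s sG) simp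
    show "ae x. \<bar>psi' d (ph n x - k) * (pd i (ph n) x - G x $ i) - 0\<bar>
      <= 1 * \<bar>pd i (ph n) x - G x $ i\<bar>" for n
     using b by (intro AE_I2) (auto simp: abs_mult intro!: mult_left_le_one_le)
   qed (use ph(3) s sG in auto)
   have B: "(%n. cls (%x. psi' d (ph n x - k) * G x $ i)) ~~> cls (%x. psi' d (u x - k) * G x $ i)"
   proof (rule cls_dominated_convergence(3)[where h="%x. G x $ i" and C=1])
    show "ae x. (%n. psi' d (ph n x - k) * G x $ i) ~~> psi' d (u x - k) * G x $ i"
     using r(2)
    proof eventually_elim
     case (elim x)
     hence l: "(%n. ph n x) ~~> u x" by (simp add: ph_def)
     show ?case by (intro tendsto_mult tendsto_const isCont_tendsto_compose[OF isCont_psi'[OF d]] tendsto_diff l)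
    qed
    show "ae x. \<bar>psi' d (ph n x - k) * G x $ i\<bar> <= 1 * \<bar>G x $ i\<bar>" for n
     using b by (intro AE_I2) (auto simp: abs_mult intro!: mult_left_le_one_le)
   qed (use sG in auto)
   have "cls (%x. psi' d (ph n x - k) * (pd i (ph n) x - G x $ i)) + cls (%x. psi' d (ph n x - k) * G x $ i)
     = cls (%x. psi' d (ph n x - k) * pd i (ph n) x)" for n
    by (subst cls_simps(1)[OF m1[OF sqi_diff[OF s(2) sG]] m1[OF sG]]) (simp_all add: algebra_simps)
   moreover have "cls (%x. 0) + cls (%x. psi' d (u x - k) * G x $ i) = cls (%x. psi' d (u x - k) * G x $ i)"
    by (simp add: cls_simps(6)[symmetric])
   ultimately show ?thesis using tendsto_add[OF A B] by simp
  qed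
 qed
qed

text \<open>Limit of \<open>h10_psi\<close> as \<open>d\<close> tends to 0. The constant
  \<open>max 0 (- k)\<close> is subtracted because for \<open>k < 0\<close> the positive part of
  \<open>u - k\<close> does not vanish where \<open>u\<close> does.\<close>

lemma h10_trunc:
 assumes h: "h10 Om u G"
 shows "h10 Om (%x. max 0 (u x - k) - max 0 (- k)) (%x. if u x > k then G x else 0)"
proof -
 define d where "d n = 1 / real (Suc n)" for n
 have d: "d n > 0" for n by (simp add: d_def)
 have su: "sqi u" and sG: "\<And>i. sqi (%x. G x $ i)" using h by (auto intro: h10D)
 have [measurable]: "u \<in> BM" "(%x. G x $ i) \<in> BM" for i
  using su sG by (auto intro: sqi_measurable)
 have hn: "h10 Om (%x. psi (d n) (u x - k) - psi (d n) (- k)) (%x. psi' (d n) (u x - k) *R G x)" for n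
  by (rule h10_psi[OF h d])
 have A: "sqi (%x. max 0 (u x - k) - max 0 (- k))"
  "(%n. cls (%x. psi (d n) (u x - k) - psi (d n) (- k))) ~~> cls (%x. max 0 (u x - k) - max 0 (- k))"
 proof -
  have 1: "(%x. psi (d n) (u x - k) - psi (d n) (- k)) \<in> BM" for n
   using h10D(1)[OF hn] by (rule sqi_measurable)
  have 2: "ae x. (%n. psi (d n) (u x - k) - psi (d n) (- k)) ~~> max 0 (u x - k) - max 0 (- k)"
   unfolding d_def by (intro AE_I2 tendsto_diff psi_tendsto)
  have 3: "ae x. \<bar>psi (d n) (u x - k) - psi (d n) (- k)\<bar> <= 1 * \<bar>u x\<bar>" for n
  proof (intro AE_I2)
   fix x show "\<bar>psi (d n) (u x - k) - psi (d n) (- k)\<bar> <= 1 * \<bar>u x\<bar>"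
    using psi_lipschitz[OF d, of n "u x - k" "- k"] by simp
  qed
  have 0: "(%x. max 0 (u x - k) - max 0 (- k)) \<in> BM" by measurable
  show "sqi (%x. max 0 (u x - k) - max 0 (- k))"
   "(%n. cls (%x. psi (d n) (u x - k) - psi (d n) (- k))) ~~> cls (%x. max 0 (u x - k) - max 0 (- k))"
   using cls_dominated_convergence[OF 1 0 su 2 3] by blast+
 qed
 have B: "sqi (%x. (if u x > k then G x else 0) $ i)"
  "(%n. cls (%x. (psi' (d n) (u x - k) *R G x) $ i)) ~~> cls (%x. (if u x > k then G x else 0) $ i)" for i
 proof -
  have 1: "(%x. (psi' (d n) (u x - k) *R G x) $ i) \<in> BM" for n
   using h10D(3)[OF hn] by (rule sqi_measurable)
  have 2: "ae x. (%n. (psi' (d n) (u x - k) *R G x) $ i) ~~> (if u x > k then G x else 0) $ i"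
  proof (intro AE_I2)
   fix x
   have "(%n. psi' (d n) (u x - k) * G x $ i) ~~> (if u x - k > 0 then 1 else 0) * G x $ i"
    unfolding d_def by (intro tendsto_mult psi'_tendsto tendsto_const)
   thus "(%n. (psi' (d n) (u x - k) *R G x) $ i) ~~> (if u x > k then G x else 0) $ i"
    by (auto split: if_splits)
  qed
  have 3: "ae x. \<bar>(psi' (d n) (u x - k) *R G x) $ i\<bar> <= 1 * \<bar>G x $ i\<bar>" for n
   using psi'_bounds[OF d[of n]] by (intro AE_I2) (auto simp: abs_mult intro!: mult_left_le_one_le)
  have "(%x. if u x > k then G x $ i else 0) \<in> BM" by measurable
  hence 0: "(%x. (if u x > k then G x else 0) $ i) \<in> BM"
   by (simp add: if_distrib[of "%v. v $ i"] cong: if_cong)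
  show "sqi (%x. (if u x > k then G x else 0) $ i)"
   "(%n. cls (%x. (psi' (d n) (u x - k) *R G x) $ i)) ~~> cls (%x. (if u x > k then G x else 0) $ i)"
   using cls_dominated_convergence[OF 1 0 sG 2 3] by blast+
 qed
 show ?thesis by (rule h10_limit[OF hn A(1) _ A(2) B(2)]) (simp add: sqv_def B(1))
qed

section \<open>Quadratic cut-off functions\<close>

definition cutf :: "real => real ^ 'n => real ^ 'n => real" where
 "cutf R x0 x = max 0 (R^2 - (norm (x - x0))^2)"

definition dcutf :: "real => real ^ 'n => real ^ 'n => real ^ 'n" where
 "dcutf R x0 x = (if norm (x - x0) < R then (-2) *R (x - x0) else 0)"

text \<open>Written in coordinates so that smoothness follows from that of sums and products of
  coordinates; estimates use the form in \<open>qcut_eq\<close>.\<close>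

definition qcut :: "real => real ^ 'n => real ^ 'n => real" where
 "qcut R x0 x = R^2 - (\<Sum>i\<in>UNIV. (x $ i - x0 $ i) * (x $ i - x0 $ i))"

lemma qcut_eq: "qcut R x0 x = R^2 - (norm (x - x0))^2"
 by (simp add: qcut_def power2_norm_eq_inner inner_vec_def)

lemma smooth_qcut: "smooth (qcut R x0)"
 unfolding qcut_def[abs_def] by (intro smooth_diff smooth_const smooth_sum smooth_mult smooth_coord)

lemma grad_qcut: "grad (qcut R x0) x = (-2) *R (x - x0)"
proof -
 have "((%x. R^2 - (x - x0) \<bullet> (x - x0)) has_derivative (%h. - (2 * ((x - x0) \<bullet> h)))) (at x)"
  by (auto intro!: derivative_eq_intros simp: inner_commute)
 moreover have "qcut R x0 = (%x. R^2 - (x - x0) \<bullet> (x - x0))" by (auto simp: qcut_eq power2_norm_eq_inner)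
 ultimately show ?thesis by (simp add: vec_eq_iff partial_deriv_eq inner_axis)
qed

lemma cut_bounds:
 assumes "R > 0" shows "0 <= cutf R x0 x" "cutf R x0 x <= R^2" "norm (dcutf R x0 x) <= 2 * R"
  "norm (x - x0) >= R ==> cutf R x0 x = 0" "norm (x - x0) >= R ==> dcutf R x0 x = 0"
proof -
 show "norm (x - x0) >= R ==> cutf R x0 x = 0"
  using assms power_mono[of R "norm (x - x0)" 2] by (simp add: cutf_def)
qed (use assms in \<open>auto simp: cutf_def dcutf_def\<close>)

lemma cut_borel[measurable]: "cutf R x0 \<in> borel_measurable borel" "(%x. dcutf R x0 x $ i) \<in> borel_measurable borel"
proof -
 show "cutf R x0 \<in> borel_measurable borel" unfolding cutf_def by measurable
 have "(%x. if norm (x - x0) < R then (-2) * (x $ i - x0 $ i) else 0) \<in> borel_measurable borel" by measurable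
 thus "(%x. dcutf R x0 x $ i) \<in> borel_measurable borel"
  by (simp add: dcutf_def if_distrib[of "%v. v $ i"] cong: if_cong)
qed

text \<open>\<open>cutf\<close> is not normalised: its height is \<open>R^2\<close> and its gradient
  is at most \<open>2 * R\<close>. It has a kink at the sphere, so it is reached as the limit of
  these smooth functions.\<close>

definition ecut :: "real => real ^ 'n => nat => real ^ 'n => real" where
 "ecut R x0 n x = psi (1 / real (Suc n)) (qcut R x0 x)"

lemma cut_approx:
 assumes "R > 0"
 shows "(%n. ecut R x0 n x) ~~> cutf R x0 x"
  "(%n. grad (ecut R x0 n) x $ i) ~~> dcutf R x0 x $ i"
  "\<bar>ecut R x0 n x\<bar> <= R^2" "\<bar>grad (ecut R x0 n) x $ i\<bar> <= 2 * R"
  "smooth (ecut R x0 n)"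
  "norm (x - x0) >= R ==> ecut R x0 n x = 0"
  "norm (x - x0) >= R ==> grad (ecut R x0 n) x $ i = 0"
proof -
 define d where "d n = 1 / real (Suc n)" for n
 have d: "d n > 0" for n by (simp add: d_def)
 have e: "ecut R x0 n = (%x. psi (d n) (qcut R x0 x))" for n by (simp add: ecut_def d_def fun_eq_iff)
 show "(%n. ecut R x0 n x) ~~> cutf R x0 x"
  using psi_tendsto[of "qcut R x0 x"] by (simp add: ecut_def cutf_def qcut_eq)
 have g: "grad (ecut R x0 n) x = psi' (d n) (qcut R x0 x) *R ((-2) *R (x - x0))" for n
  unfolding e using grad_compose[OF smooth_qcut psi_deriv[OF d]] by (simp only: grad_qcut)
 have pos: "qcut R x0 x > 0 \<longleftrightarrow> norm (x - x0) < R"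
 proof (cases "norm (x - x0) < R")
  case True
  thus ?thesis using power_strict_mono[of "norm (x - x0)" R 2] by (simp add: qcut_eq)
 next
  case False
  hence "R^2 <= (norm (x - x0))^2" using assms(1) by (intro power_mono) auto
  with False show ?thesis by (simp add: qcut_eq)
 qed
 show "(%n. grad (ecut R x0 n) x $ i) ~~> dcutf R x0 x $ i"
 proof -
  have "(%n. psi' (d n) (qcut R x0 x) *R ((-2) *R (x - x0))) ~~> (if qcut R x0 x > 0 then 1 else 0) *R ((-2) *R (x - x0))"
   unfolding d_def by (intro tendsto_scaleR psi'_tendsto tendsto_const)
  also have "(if qcut R x0 x > 0 then 1 else 0) *R ((-2) *R (x - x0)) = dcutf R x0 x"
   by (simp add: pos dcutf_def)
  finally show ?thesis unfolding g by (rule tendsto_vec_nth)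
 qed
 show out1: "ecut R x0 n x = 0" if "norm (x - x0) >= R"
  unfolding e using that pos by (intro psi_nonpos) auto
 show out2: "grad (ecut R x0 n) x $ i = 0" if "norm (x - x0) >= R"
  using that pos by (simp add: g psi'_def)
 show "\<bar>ecut R x0 n x\<bar> <= R^2"
 proof (cases "norm (x - x0) < R")
  case True
  hence "0 < qcut R x0 x" "qcut R x0 x <= R^2" using pos by (auto simp: qcut_eq)
  thus ?thesis using psi_lipschitz[OF d, of n "qcut R x0 x" 0] by (simp add: e)
 qed (use out1 in simp)
 show "\<bar>grad (ecut R x0 n) x $ i\<bar> <= 2 * R"
 proof (cases "norm (x - x0) < R")
  case True
  have "\<bar>grad (ecut R x0 n) x $ i\<bar> <= norm (grad (ecut R x0 n) x)"
   by (rule component_le_norm_cart)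
  also have "\<dots> = psi' (d n) (qcut R x0 x) * (2 * norm (x - x0))" using psi'_bounds(1)[OF d] by (simp add: g)
  also have "\<dots> <= 1 * (2 * R)" using psi'_bounds[OF d] True assms(1) by (intro mult_mono) auto
  finally show ?thesis by simp
 qed (use out2 assms(1) in simp)
 show "smooth (ecut R x0 n)" unfolding e by (intro smooth_psi d smooth_qcut)
qed

lemma h10_mult_cut:
 assumes h: "h10 Om u G" and R: "R > 0" and Om: "bounded Om"
 shows "h10 Om (%x. cutf R x0 x * u x) (%x. cutf R x0 x *R G x + u x *R dcutf R x0 x)"
proof -
 define e where "e = ecut R x0"
 note ca = cut_approx[OF R, where ?x0.0=x0, folded e_def]
 have su: "sqi u" and sG: "\<And>i. sqi (%x. G x $ i)" using h by (auto intro: h10D)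
 have m[measurable]: "u \<in> BM" "(%x. G x $ i) \<in> BM"
  "e n \<in> BM" "(%x. grad (e n) x $ i) \<in> BM"
  "cutf R x0 \<in> BM" "(%x. dcutf R x0 x $ i) \<in> BM" for i n
  using su sG ca(5)[of n] by (auto intro!: sqi_measurable borel_lebesgue smooth_borel smooth_partial_deriv cut_borel)
 have hn: "h10 Om (%x. e n x * u x) (%x. e n x *R G x + u x *R grad (e n) x)" for n
  by (rule h10_mult_smooth[OF h _ Om]) (rule ca(5))
 have dom: "sqi (%x. b x * w x)" "\<And>n. sqi (%x. f n x * w x)" "(%n. cls (%x. f n x * w x)) ~~> cls (%x. b x * w x)"
  if w: "sqi w" and f: "\<And>n. f n \<in> BM" "b \<in> BM"
   "\<And>n x. \<bar>f n x\<bar> <= C" "\<And>x. (%n. f n x) ~~> b x" for f b w and C :: real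
 proof -
  have [measurable]: "w \<in> BM" "\<And>n. f n \<in> BM" "b \<in> BM"
   using w f by (auto intro: sqi_measurable)
  have 1: "(%x. f n x * w x) \<in> BM" for n by measurable
  have 2: "(%x. b x * w x) \<in> BM" by measurable
  have 3: "ae x. (%n. f n x * w x) ~~> b x * w x" by (intro AE_I2 tendsto_mult f tendsto_const)
  have 4: "ae x. \<bar>f n x * w x\<bar> <= C * \<bar>w x\<bar>" for n
   by (intro AE_I2) (simp add: abs_mult mult_right_mono f(3))
  show "sqi (%x. b x * w x)" "\<And>n. sqi (%x. f n x * w x)" "(%n. cls (%x. f n x * w x)) ~~> cls (%x. b x * w x)"
   using cls_dominated_convergence[OF 1 2 w 3 4] by blast+
 qed
 have e1: "e n \<in> BM" "cutf R x0 \<in> BM" "\<bar>e n x\<bar> <= R^2" "(%n. e n x) ~~> cutf R x0 x" for n x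
  using ca(1,3) by simp_all
 have e2: "(%x. grad (e n) x $ i) \<in> BM" "(%x. dcutf R x0 x $ i) \<in> BM"
   "\<bar>grad (e n) x $ i\<bar> <= 2 * R" "(%n. grad (e n) x $ i) ~~> dcutf R x0 x $ i" for n x i
  using ca(2,4) m(4,6) by simp_all
 note A = dom[OF su e1] and B = dom[OF sG e1] and C = dom[OF su e2]
 show ?thesis
 proof (rule h10_limit[OF hn A(1) _ A(3)])
  show "sqv (%x. cutf R x0 x *R G x + u x *R dcutf R x0 x)"
   unfolding sqv_def using sqi_add[OF B(1) C(1)] by (simp add: mult.commute)
  show "(%n. cls (%x. (e n x *R G x + u x *R grad (e n) x) $ i))
   ~~> cls (%x. (cutf R x0 x *R G x + u x *R dcutf R x0 x) $ i)" for i
   using tendsto_add[OF B(3)[of i] C(3)[of i]] B(1,2) C(1,2) by (simp add: cls_simps mult.commute)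
 qed
qed

lemma h10_cut:
 assumes R: "R > 0" and Om: "cball x0 R \<subseteq> Om"
 shows "h10 Om (cutf R x0) (dcutf R x0)"
proof -
 define e where "e = ecut R x0"
 note ca = cut_approx[OF R, where ?x0.0=x0, folded e_def]
 have t: "e n \<in> test_functions Om" for n
 proof (rule test_functionI[OF ca(5) compact_cball Om])
  fix x assume "x \<notin> cball x0 R"
  thus "e n x = 0" using ca(6)[of x n] by (simp add: dist_norm norm_minus_commute)
 qed
 have si: "sqi (ind (cball x0 R))" by (intro sqi_indicator) simp
 have m: "e n \<in> BM" "(%x. grad (e n) x $ i) \<in> BM" for n i
  using sqi_test[OF t] by (auto simp: sqv_def intro: sqi_measurable)
 have m': "cutf R x0 \<in> BM" "(%x. dcutf R x0 x $ i) \<in> BM" for i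
  by (intro borel_lebesgue cut_borel)+
 have b1: "ae x. \<bar>e n x\<bar> <= R^2 * \<bar>ind (cball x0 R) x\<bar>" for n
 proof (intro AE_I2)
  fix x show "\<bar>e n x\<bar> <= R^2 * \<bar>ind (cball x0 R) x\<bar>"
   using ca(3)[of n x] ca(6)[of x n] by (cases "norm (x - x0) >= R") (auto simp: indicator_def dist_norm norm_minus_commute)
 qed
 have b2: "ae x. \<bar>grad (e n) x $ i\<bar> <= 2 * R * \<bar>ind (cball x0 R) x\<bar>" for n i
 proof (intro AE_I2)
  fix x show "\<bar>grad (e n) x $ i\<bar> <= 2 * R * \<bar>ind (cball x0 R) x\<bar>"
   using ca(4)[of n x i] ca(7)[of x n i] R by (cases "norm (x - x0) >= R") (auto simp: indicator_def dist_norm norm_minus_commute)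
 qed
 note A = cls_dominated_convergence[OF m(1) m'(1) si AE_I2[OF ca(1)] b1]
  and B = cls_dominated_convergence[OF m(2) m'(2) si AE_I2[OF ca(2)] b2]
 show ?thesis by (rule h10_limit[OF h10_test[OF t] A(1) _ A(3) B(3)]) (simp add: sqv_def B(1))
qed

text \<open>The summand \<open>c\<close> restores the constant that \<open>h10_trunc\<close>
  subtracts at negative levels. This is possible only if the ball of the cut-off lies inside
  \<open>Om\<close>, the interior case of the local estimates.\<close>

lemma h10_mult_cut':
 assumes h: "h10 Om u G" and R: "R > 0" and Om: "bounded Om" and c: "c = 0 \<or> cball x0 R \<subseteq> Om"
 shows "h10 Om (%x. cutf R x0 x * (u x + c)) (%x. cutf R x0 x *R G x + (u x + c) *R dcutf R x0 x)"
proof (cases "c = 0")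
 case True
 thus ?thesis using h10_mult_cut[OF h R Om] by simp
next
 case False
 with c have "cball x0 R \<subseteq> Om" by simp
 from h10_add[OF h10_mult_cut[OF h R Om] h10_scale[OF h10_cut[OF R this], of c]]
 show ?thesis by (simp add: algebra_simps)
qed

section \<open>Weak derivatives\<close>

text \<open>Products of \<open>exp (- d / t)\<close>, with \<open>t\<close> running over the signed
  distances to the faces, vanish off the open box and tend to its indicator as \<open>d\<close>
  tends to 0.\<close>

lemma box_test_functions:
 fixes a b :: "real ^ 'n"
 assumes "cbox a b \<subseteq> Om"
 shows "\<exists>et. (\<forall>n. et n \<in> test_functions Om) \<and> (%n::nat. cls (et n)) ~~> cls (ind (box a b))"
proof -
 define h where "h n t = flat (1 / real (Suc n)) 1 t" for n t
 have h0: "h n t >= 0" "h n t <= 1" "t <= 0 ==> h n t = 0" for n t by (auto simp: h_def flat_def)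
 have hl: "(%n. h n t) ~~> (if t > 0 then 1 else 0)" for t
 proof (cases "t > 0")
  case True
  have "(%n. exp (- (inverse (real (Suc n))) / t)) ~~> exp (- 0 / t)"
   using True by (intro tendsto_intros LIMSEQ_inverse_real_of_nat) auto
  thus ?thesis using True by (simp add: h_def flat_def inverse_eq_divide)
 qed (simp add: h_def flat_def)
 define et where "et n x = (\<Prod>i\<in>UNIV. h n (x $ i - a $ i) * h n (b $ i - x $ i))" for n and x :: "real^'n"
 have sm: "smooth (et n)" for n unfolding et_def[abs_def] h_def
  by (intro smooth_prod smooth_mult smooth_flat smooth_diff smooth_coord smooth_const) auto
 have zero: "et n x = 0" if x: "x \<notin> box a b" for n x
 proof -
  obtain i where "x $ i <= a $ i \<or> b $ i <= x $ i" using x by (auto simp: mem_box_cart not_less)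
  hence "h n (x $ i - a $ i) * h n (b $ i - x $ i) = 0" using h0(3) by auto
  thus ?thesis unfolding et_def by (intro prod_zero) auto
 qed
 have t: "et n \<in> test_functions Om" for n
  by (rule test_functionI[OF sm compact_cbox assms]) (use zero box_subset_cbox in blast)
 have le1: "\<bar>et n x\<bar> <= 1" for n x
  unfolding et_def using h0 by (simp add: abs_prod abs_mult) (intro prod_le_1 conjI mult_le_one, auto)
 have lim: "(%n. et n x) ~~> ind (box a b) x" for x
 proof (cases "x \<in> box a b")
  case True
  have "(%n. et n x) ~~> (\<Prod>i\<in>UNIV. (if x $ i - a $ i > 0 then 1 else 0) * (if b $ i - x $ i > 0 then 1 else 0))"
   unfolding et_def by (intro tendsto_prod tendsto_mult hl)
  also have "(\<Prod>i\<in>UNIV. (if x $ i - a $ i > 0 then 1 else 0) * (if b $ i - x $ i > 0 then 1 else 0)) = (1::real)"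
   using True by (intro prod.neutral) (auto simp: mem_box_cart)
  finally show ?thesis using True by simp
 qed (simp add: zero)
 have "(%n. cls (et n)) ~~> cls (ind (box a b))"
 proof (rule cls_dominated_convergence(3)[where h="ind (box a b)" and C=1])
  show "et n \<in> BM" for n by (intro borel_lebesgue smooth_borel sm)
  show "ae x. \<bar>et n x\<bar> <= 1 * \<bar>ind (box a b) x\<bar>" for n
   using le1 zero by (intro AE_I2) (auto simp: indicator_def)
 qed (use lim in \<open>auto intro: borel_measurable_indicator sqi_indicator\<close>)
 with t show ?thesis by blast
qed

lemma l2_zero_if_orthogonal_boxes:
 assumes f: "sqi f" and z: "\<And>a b. inner (cls f) (cls (ind (box a b))) = 0"
 shows "ae x. f x = (0::real)"
proof -
 have "{z. inner (cls f) z = 0} = UNIV"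
 proof (rule l2_dense_boxes)
  show "closed {z. inner (cls f) z = 0}" by (intro closed_Collect_eq continuous_intros)
  show "subspace {z. inner (cls f) z = 0}" by (auto simp: subspace_def inner_add_right)
 qed (use z in auto)
 hence "inner (cls f) (cls f) = 0" by blast
 thus ?thesis using f by (simp add: cls_simps(6) cls_eq_iff)
qed

text \<open>Cut off by a box whose closure lies in \<open>Om\<close>, the function \<open>g\<close>
  is orthogonal to the indicators of all boxes, hence zero there. Countably many boxes with rational
  corners cover \<open>Om\<close>.\<close>

lemma fundamental_lemma:
 fixes g :: "real ^ 'n => real"
 assumes Om: "open Om" and g: "sqi g" and z: "\<And>ph. ph \<in> test_functions Om ==> (lint x. g x * ph x) = 0"
 shows "ae x. x \<in> Om --> g x = 0"
proof -
 have [measurable]: "g \<in> BM" using g by (rule sqi_measurable)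
 have bx: "inner (cls g) (cls (ind (box a b))) = 0" if ab: "cbox a b \<subseteq> Om" for a b
 proof -
  obtain et where et: "\<And>n. et n \<in> test_functions Om" "(%n::nat. cls (et n)) ~~> cls (ind (box a b))"
   using box_test_functions[OF ab] by blast
  have "inner (cls g) (cls (et n)) = 0" for n
   using z[OF et(1)] sqi_test(1)[OF et(1)] g by (simp add: cls_simps)
  moreover have "(%n. inner (cls g) (cls (et n))) ~~> inner (cls g) (cls (ind (box a b)))"
   by (intro tendsto_intros et(2))
  ultimately show ?thesis by (simp add: LIMSEQ_const_iff)
 qed
 have loc: "ae x. x \<in> box c d --> g x = 0" if cd: "cbox c d \<subseteq> Om" for c d
 proof -
  have s: "sqi (%x. ind (box c d) x * g x)"
   by (rule sqi_mult_bounded[OF g, where C=1]) (simp_all add: borel_measurable_indicator split: split_indicator)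
  have "ae x. ind (box c d) x * g x = 0"
  proof (rule l2_zero_if_orthogonal_boxes[OF s])
   fix a b
   define a' b' :: "real^'n" where "a' = (\<chi> i. max (c $ i) (a $ i))" and "b' = (\<chi> i. min (d $ i) (b $ i))"
   have eq: "box a' b' = box c d \<inter> box a b" by (auto simp: mem_box_cart a'_def b'_def)
   have "cbox a' b' \<subseteq> cbox c d" by (auto simp: mem_box_cart a'_def b'_def)
   hence "inner (cls g) (cls (ind (box a' b'))) = 0" using cd by (intro bx) auto
   thus "inner (cls (%x. ind (box c d) x * g x)) (cls (ind (box a b))) = 0"
    using g s sqi_indicator[OF lmeasurable_box, of a b] sqi_indicator[OF lmeasurable_box, of a' b']
    by (simp add: cls_simps eq indicator_inter_arith mult_ac)
  qed
  thus ?thesis by eventually_elim (auto simp: indicator_def split: if_splits)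
 qed
 have cover: "\<exists>c d. x \<in> box c d \<and> cbox c d \<subseteq> Om \<and> (\<forall>i. c $ i \<in> \<rat> \<and> d $ i \<in> \<rat>)" if x: "x \<in> Om" for x
 proof -
  obtain e where e: "e > 0" "cball x e \<subseteq> Om" using Om x open_contains_cball by blast
  obtain a b where ab: "x \<in> box a b" "box a b \<subseteq> ball x e" "\<forall>i\<in>Basis. a \<bullet> i \<in> \<rat> \<and> b \<bullet> i \<in> \<rat>"
   using rational_boxes[OF e(1), of x] by metis
  have "closure (box a b) \<subseteq> cball x e" using ab(2) by (metis closure_mono closure_ball e(1) less_numeral_extra(3))
  moreover have "closure (box a b) = cbox a b" using ab(1) by (intro closure_box) auto
  moreover have "a $ i \<in> \<rat> \<and> b $ i \<in> \<rat>" for i using ab(3) axis_in_Basis_iff[of i "1::real"] by (auto simp: cart_eq_inner_axis)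
  ultimately show ?thesis using ab(1) e(2) by blast
 qed
 define I where "I = {(c, d). cbox c d \<subseteq> Om \<and> (\<forall>i. c $ i \<in> \<rat> \<and> d $ i \<in> (\<rat>::real set))}"
 have "countable {c :: real ^ 'n. \<forall>i. c $ i \<in> \<rat>}"
 proof -
  have "{c :: real ^ 'n. \<forall>i. c $ i \<in> \<rat>} \<subseteq> vec_lambda ` (UNIV \<rightarrow>\<^sub>E \<rat>)"
   by (auto intro!: image_eqI[of _ vec_lambda "vec_nth _"])
  moreover have "countable ((UNIV :: 'n set) \<rightarrow>\<^sub>E (\<rat> :: real set))" by (intro countable_PiE countable_rat) auto
  ultimately show ?thesis by (meson countable_image countable_subset)
 qed
 hence "countable ({c :: real ^ 'n. \<forall>i. c $ i \<in> \<rat>} \<times> {c :: real ^ 'n. \<forall>i. c $ i \<in> \<rat>})" by (intro countable_SIGMA)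
 hence "countable I" by (rule countable_subset[rotated]) (auto simp: I_def)
 hence "ae x. \<forall>p\<in>I. x \<in> box (fst p) (snd p) --> g x = 0"
  by (subst AE_ball_countable) (auto simp: I_def intro: loc)
 thus ?thesis
 proof eventually_elim
  case (elim x)
  thus ?case using cover[of x] by (fastforce simp: I_def)
 qed
qed

section \<open>The Sobolev space of the statement and extension by zero\<close>

definition ext :: "(real ^ 'n) set => (real ^ 'n => real) => real ^ 'n => real" where
 "ext Om f x = ind Om x * f x"

lemma ext_simps: "x \<in> Om ==> ext Om f x = f x" "x \<notin> Om ==> ext Om f x = 0" by (auto simp: ext_def)

context
 fixes Om :: "(real ^ 'n) set"
 assumes Om: "open Om"
begin

lemma open_sets_lebesgue: "Om \<in> sets lebesgue" using Om by (simp add: borel_open)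

lemma measurable_ext_iff: "f \<in> borel_measurable (lebesgue_on Om) \<longleftrightarrow> ext Om f \<in> BM"
 using open_sets_lebesgue by (simp add: ext_def[abs_def] borel_measurable_restrict_space_iff)

lemma integrable_ext_iff: "integrable (lebesgue_on Om) f \<longleftrightarrow> integrable lebesgue (ext Om f)"
 using open_sets_lebesgue by (simp add: ext_def[abs_def] integrable_restrict_space)

lemma integral_ext: "(\<integral>x. f x \<partial>lebesgue_on Om) = (lint x. ext Om f x)"
 using open_sets_lebesgue by (simp add: ext_def[abs_def] integral_restrict_space)

lemma AE_ext_iff: "(AE x in lebesgue_on Om. P x) \<longleftrightarrow> (ae x. x \<in> Om --> P x)"
 using open_sets_lebesgue by (simp add: AE_restrict_space_iff)

lemma L2_iff: "f \<in> L2_space Om \<longleftrightarrow> sqi (ext Om f)"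
proof -
 have "ext Om (%x. (f x)^2) = (%x. (ext Om f x)^2)" by (auto simp: ext_def indicator_def)
 thus ?thesis by (simp add: L2_space_def sqi_def measurable_ext_iff integrable_ext_iff)
qed

lemma L2_norm_eq: "f \<in> L2_space Om ==> L2_norm Om f = norm (cls (ext Om f))"
proof -
 assume "f \<in> L2_space Om"
 hence s: "sqi (ext Om f)" by (simp add: L2_iff)
 have "ext Om (%x. (f x)^2) = (%x. (ext Om f x)^2)" by (auto simp: ext_def indicator_def)
 hence "L2_norm Om f = sqrt ((norm (cls (ext Om f)))^2)"
  by (simp add: L2_norm_def integral_ext norm_cls[OF s])
 thus ?thesis by simp
qed

lemma ext_test: "ph \<in> test_functions Om ==> ext Om ph = ph" "ph \<in> test_functions Om ==> ext Om (pd i ph) = pd i ph"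
proof -
 assume t: "ph \<in> test_functions Om"
 have "pd i ph x = 0" if "x \<notin> Om" for x
  using test_zero_outside[OF t that] by (metis grad_nth zero_index)
 thus "ext Om ph = ph" "ext Om (pd i ph) = pd i ph"
  using test_zero_outside[OF t] by (auto simp: ext_def indicator_def fun_eq_iff)
qed

lemma has_weak_deriv_iff:
 assumes "y \<in> L2_space Om" "g \<in> L2_space Om"
 shows "has_weak_deriv Om i y g \<longleftrightarrow> (\<forall>ph\<in>test_functions Om.
  inner (cls (ext Om y)) (cls (pd i ph)) = - inner (cls (ext Om g)) (cls ph))"
 unfolding has_weak_deriv_def
proof (intro ball_cong refl)
 fix ph assume ph: "ph \<in> test_functions Om"
 have s: "sqi ph" "sqi (pd i ph)" using sqi_test[OF ph] by (auto simp: sqv_def)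
 have "(\<integral>x. y x * pd i ph x \<partial>lebesgue_on Om) = inner (cls (ext Om y)) (cls (pd i ph))"
  using assms s by (simp add: integral_ext cls_simps L2_iff) (simp add: ext_def mult.assoc)
 moreover have "(\<integral>x. g x * ph x \<partial>lebesgue_on Om) = inner (cls (ext Om g)) (cls ph)"
  using assms s by (simp add: integral_ext cls_simps L2_iff) (simp add: ext_def mult.assoc)
 ultimately show "((\<integral>x. y x * pd i ph x \<partial>lebesgue_on Om) = - (\<integral>x. g x * ph x \<partial>lebesgue_on Om)) \<longleftrightarrow>
  inner (cls (ext Om y)) (cls (pd i ph)) = - inner (cls (ext Om g)) (cls ph)" by simp
qed

lemma weak_deriv_unique:
 assumes "y \<in> L2_space Om" "g \<in> L2_space Om" "has_weak_deriv Om i y g" "g' \<in> L2_space Om" "has_weak_deriv Om i y g'"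
 shows "cls (ext Om g) = cls (ext Om g')"
proof (rule cls_eqI)
 show s: "sqi (ext Om g)" "sqi (ext Om g')" using assms by (auto simp: L2_iff)
 have "ae x. x \<in> Om --> ext Om g x - ext Om g' x = 0"
 proof (rule fundamental_lemma[OF Om sqi_diff[OF s]])
  fix ph assume ph: "ph \<in> test_functions Om"
  have "inner (cls (ext Om g) - cls (ext Om g')) (cls ph) = 0"
   using assms ph by (simp add: has_weak_deriv_iff inner_diff_left)
  thus "(lint x. (ext Om g x - ext Om g' x) * ph x) = 0"
   using s sqi_test(1)[OF ph] by (simp add: cls_simps sqi_diff)
 qed
 thus "ae x. ext Om g x = ext Om g' x" by eventually_elim (auto simp: ext_def)
qed

lemma weak_deriv_eq:
 assumes "y \<in> L2_space Om" "g \<in> L2_space Om" "has_weak_deriv Om i y g"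
 shows "weak_deriv Om i y \<in> L2_space Om" "has_weak_deriv Om i y (weak_deriv Om i y)"
  "cls (ext Om (weak_deriv Om i y)) = cls (ext Om g)"
proof -
 have "\<exists>g. g \<in> L2_space Om \<and> has_weak_deriv Om i y g" using assms by blast
 from someI_ex[OF this] show 1: "weak_deriv Om i y \<in> L2_space Om" "has_weak_deriv Om i y (weak_deriv Om i y)"
  by (simp_all add: weak_deriv_def)
 show "cls (ext Om (weak_deriv Om i y)) = cls (ext Om g)" by (rule weak_deriv_unique[OF assms(1) 1 assms(2,3)])
qed

lemma test_weak_deriv:
 assumes "f \<in> test_functions Om"
 shows "f \<in> L2_space Om" "pd i f \<in> L2_space Om" "has_weak_deriv Om i f (pd i f)"
proof -
 have s: "sqi f" "sqi (pd i f)" using sqi_test[OF assms] by (auto simp: sqv_def)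
 show 1: "f \<in> L2_space Om" "pd i f \<in> L2_space Om" using s by (simp_all add: L2_iff ext_test assms)
 show "has_weak_deriv Om i f (pd i f)" unfolding has_weak_deriv_iff[OF 1]
 proof
  fix ph assume ph: "ph \<in> test_functions Om"
  have s': "sqi ph" "sqi (pd i ph)" using sqi_test[OF ph] by (auto simp: sqv_def)
  have m: "\<psi> \<in> borel_measurable borel" "pd i \<psi> \<in> borel_measurable borel" if "\<psi> \<in> test_functions Om" for \<psi>
   using test_smooth[OF that] smooth_partial_deriv by (auto intro: smooth_borel)
  note [measurable] = m[OF assms] m[OF ph]
  have "(lint x. f x * pd i ph x) = - (lint x. pd i f x * ph x)"
   using test_integration_by_parts[OF assms ph, of i] by (simp add: integral_completion)
  thus "inner (cls (ext Om f)) (cls (pd i ph)) = - inner (cls (ext Om (pd i f))) (cls ph)"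
   by (simp add: ext_test assms cls_simps s s')
 qed
qed

text \<open>Integration by parts holds for the approximating test functions, and both of its sides
  are continuous in L2.\<close>

lemma h10_weak_deriv:
 assumes h: "h10 Om (ext Om y) G"
 shows "y \<in> L2_space Om" "(%x. G x $ i) \<in> L2_space Om" "has_weak_deriv Om i y (%x. G x $ i)"
  "cls (ext Om (%x. G x $ i)) = cls (%x. G x $ i)"
proof -
 have sG: "sqi (%x. G x $ i)" using h by (rule h10D)
 hence [measurable]: "(%x. G x $ i) \<in> BM" by (rule sqi_measurable)
 show 1: "y \<in> L2_space Om" using h by (simp add: L2_iff h10D)
 have s: "sqi (ext Om (%x. G x $ i))" unfolding ext_def
  by (rule sqi_mult_bounded[OF sG, where C=1]) (use open_sets_lebesgue in \<open>auto simp: indicator_def intro: borel_measurable_indicator\<close>)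
 thus 2: "(%x. G x $ i) \<in> L2_space Om" by (simp add: L2_iff)
 show 4: "cls (ext Om (%x. G x $ i)) = cls (%x. G x $ i)"
 proof (rule cls_eqI[OF s sG])
  show "ae x. ext Om (%x. G x $ i) x = G x $ i"
   using h10_zero_outside[OF h] by eventually_elim (auto simp: ext_def indicator_def)
 qed
 obtain ph where ph: "\<And>n. ph n \<in> test_functions Om" "(%n::nat. cls (ph n)) ~~> cls (ext Om y)"
  "\<And>i. (%n. cls (pd i (ph n))) ~~> cls (%x. G x $ i)"
  using h10_approx[OF h] by blast
 show "has_weak_deriv Om i y (%x. G x $ i)" unfolding has_weak_deriv_iff[OF 1 2]
 proof
  fix \<psi> assume \<psi>: "\<psi> \<in> test_functions Om"
  have "(%n. inner (cls (ph n)) (cls (pd i \<psi>))) ~~> inner (cls (ext Om y)) (cls (pd i \<psi>))"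
   by (intro tendsto_intros ph(2))
  moreover have "(%n. - inner (cls (pd i (ph n))) (cls \<psi>)) ~~> - inner (cls (%x. G x $ i)) (cls \<psi>)"
   by (intro tendsto_intros ph(3))
  moreover have "inner (cls (ph n)) (cls (pd i \<psi>)) = - inner (cls (pd i (ph n))) (cls \<psi>)" for n
  proof -
   note t = test_weak_deriv[OF ph(1)[of n]]
   have "has_weak_deriv Om i (ph n) (pd i (ph n))" by (rule t(3))
   thus ?thesis using \<psi> unfolding has_weak_deriv_iff[OF t(1,2)] by (simp add: ext_test ph(1))
  qed
  ultimately show "inner (cls (ext Om y)) (cls (pd i \<psi>)) = - inner (cls (ext Om (%x. G x $ i))) (cls \<psi>)"
   unfolding 4 using LIMSEQ_unique by simp
 qed
qed

lemma L2_diff: "f \<in> L2_space Om ==> g \<in> L2_space Om ==> (%x. f x - g x) \<in> L2_space Om"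
proof -
 have "ext Om (%x. f x - g x) = (%x. ext Om f x - ext Om g x)" by (auto simp: ext_def algebra_simps)
 thus "f \<in> L2_space Om ==> g \<in> L2_space Om ==> (%x. f x - g x) \<in> L2_space Om" by (simp add: L2_iff sqi_diff)
qed

lemma cls_ext_diff: "f \<in> L2_space Om ==> g \<in> L2_space Om ==> cls (ext Om (%x. f x - g x)) = cls (ext Om f) - cls (ext Om g)"
proof -
 have "ext Om (%x. f x - g x) = (%x. ext Om f x - ext Om g x)" by (auto simp: ext_def algebra_simps)
 thus "f \<in> L2_space Om ==> g \<in> L2_space Om ==> ?thesis" by (simp add: L2_iff cls_simps)
qed

lemma has_weak_deriv_diff:
 assumes "f \<in> L2_space Om" "f' \<in> L2_space Om" "has_weak_deriv Om i f f'" "g \<in> L2_space Om" "g' \<in> L2_space Om" "has_weak_deriv Om i g g'"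
 shows "has_weak_deriv Om i (%x. f x - g x) (%x. f' x - g' x)"
 using assms by (simp add: has_weak_deriv_iff L2_diff cls_ext_diff inner_diff_left)

text \<open>\<open>H1_norm\<close> refers to the chosen function \<open>weak_deriv\<close>;
  uniqueness of weak derivatives allows any known weak derivative to be used in its place.\<close>

lemma H1_norm_diff:
 assumes ph: "ph \<in> test_functions Om" and y: "y \<in> L2_space Om" and g: "\<And>i. g i \<in> L2_space Om" "\<And>i. has_weak_deriv Om i y (g i)"
 shows "(H1_norm Om (%x. ph x - y x))^2 = (norm (cls ph - cls (ext Om y)))^2
   + (\<Sum>i\<in>UNIV. (norm (cls (pd i ph) - cls (ext Om (g i))))^2)"
proof -
 note t = test_weak_deriv[OF ph]
 have d: "(%x. ph x - y x) \<in> L2_space Om" by (rule L2_diff[OF t(1) y])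
 have wd: "cls (ext Om (weak_deriv Om i (%x. ph x - y x))) = cls (pd i ph) - cls (ext Om (g i))"
   "weak_deriv Om i (%x. ph x - y x) \<in> L2_space Om" for i
  using weak_deriv_eq[OF d L2_diff[OF t(2) g(1)] has_weak_deriv_diff[OF t(1,2,3) y g]] t(2) g(1)
  by (simp_all add: cls_ext_diff ext_test ph)
 show ?thesis unfolding H1_norm_def
  by (subst real_sqrt_pow2) (auto simp: sum_nonneg L2_norm_eq d wd cls_ext_diff t(1) y ext_test ph)
qed

text \<open>Bridge between the space in the statement, defined by approximation in
  \<open>H1_norm\<close>, and the closed subspace \<open>W Om\<close>: approximation in that norm is
  componentwise L2 approximation of the function and its gradient.\<close>

theorem H10_iff: "y \<in> H10_space Om \<longleftrightarrow> (\<exists>G. h10 Om (ext Om y) G)"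
proof
 assume "\<exists>G. h10 Om (ext Om y) G"
 then obtain G where h: "h10 Om (ext Om y) G" by blast
 note w = h10_weak_deriv[OF h]
 have "y \<in> H1_space Om" unfolding H1_space_def using w by blast
 moreover have "\<exists>ph\<in>test_functions Om. H1_norm Om (%x. ph x - y x) < e" if e: "e > 0" for e
 proof -
  obtain ph where ph: "\<And>n. ph n \<in> test_functions Om" "(%n::nat. cls (ph n)) ~~> cls (ext Om y)"
   "\<And>i. (%n. cls (pd i (ph n))) ~~> cls (%x. G x $ i)"
   using h10_approx[OF h] by blast
  have "(%n. (norm (cls (ph n) - cls (ext Om y)))^2 + (\<Sum>i\<in>UNIV. (norm (cls (pd i (ph n)) - cls (%x. G x $ i)))^2))
    ~~> (norm (cls (ext Om y) - cls (ext Om y)))^2 + (\<Sum>i\<in>UNIV. (norm (cls (%x. G x $ i) - cls (%x. G x $ i)))^2)"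
   by (intro tendsto_intros ph(2,3))
  hence "(%n. (H1_norm Om (%x. ph n x - y x))^2) ~~> 0"
   by (simp add: H1_norm_diff[OF ph(1) w(1,2,3)] w(4))
  from order_tendstoD(2)[OF this, of "e^2"] e have "\<forall>\<^sub>F n in sequentially. (H1_norm Om (%x. ph n x - y x))^2 < e^2" by simp
  then obtain n where "(H1_norm Om (%x. ph n x - y x))^2 < e^2" using eventually_happens'[OF sequentially_bot] by blast
  hence "H1_norm Om (%x. ph n x - y x) < e" using e by (simp add: power2_less_imp_less)
  thus ?thesis using ph(1) by blast
 qed
 ultimately show "y \<in> H10_space Om" by (simp add: H10_space_def)
next
 assume y: "y \<in> H10_space Om"
 hence yL: "y \<in> L2_space Om" and "\<forall>i. \<exists>g \<in> L2_space Om. has_weak_deriv Om i y g"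
  by (auto simp: H10_space_def H1_space_def)
 then obtain g where g: "\<And>i. g i \<in> L2_space Om" "\<And>i. has_weak_deriv Om i y (g i)" by metis
 have "\<forall>n::nat. \<exists>ph\<in>test_functions Om. H1_norm Om (%x. ph x - y x) < 1 / real (Suc n)"
  using y by (simp add: H10_space_def)
 then obtain ph where ph: "\<And>n. ph n \<in> test_functions Om" "\<And>n. H1_norm Om (%x. ph n x - y x) < 1 / real (Suc n)" by metis
 note N = H1_norm_diff[OF ph(1) yL g]
 have nn: "H1_norm Om f >= 0" for f by (auto simp: H1_norm_def intro!: add_nonneg_nonneg sum_nonneg)
 have b1: "norm (cls (ph n) - cls (ext Om y)) <= inverse (real (Suc n))" for n
 proof -
  have "(norm (cls (ph n) - cls (ext Om y)))^2 <= (H1_norm Om (%x. ph n x - y x))^2"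
   unfolding N by (simp add: sum_nonneg)
  hence "norm (cls (ph n) - cls (ext Om y)) <= H1_norm Om (%x. ph n x - y x)" using nn by (rule power2_le_imp_le)
  thus ?thesis using ph(2)[of n] by (simp add: inverse_eq_divide)
 qed
 have b2: "norm (cls (pd i (ph n)) - cls (ext Om (g i))) <= inverse (real (Suc n))" for n i
 proof -
  have "(norm (cls (pd i (ph n)) - cls (ext Om (g i))))^2
    <= (\<Sum>i\<in>UNIV. (norm (cls (pd i (ph n)) - cls (ext Om (g i))))^2)"
   by (rule member_le_sum[of i UNIV "%i. (norm (cls (pd i (ph n)) - cls (ext Om (g i))))^2"]) auto
  also have "\<dots> <= (H1_norm Om (%x. ph n x - y x))^2" unfolding N by simp
  finally have "norm (cls (pd i (ph n)) - cls (ext Om (g i))) <= H1_norm Om (%x. ph n x - y x)" using nn by (rule power2_le_imp_le)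
  thus ?thesis using ph(2)[of n] by (simp add: inverse_eq_divide)
 qed
 have lim: "z ~~> l" if "\<And>n. norm (z n - l) <= inverse (real (Suc n))" for z :: "nat => (real^'n) l2" and l
  by (rule LIM_zero_cancel, rule Lim_null_comparison[OF always_eventually LIMSEQ_inverse_real_of_nat]) (use that in blast)
 have "h10 Om (ext Om y) (%x. \<chi> i. ext Om (g i) x)"
 proof (rule h10_limit[OF h10_test[OF ph(1)]])
  show "sqi (ext Om y)" using yL by (simp add: L2_iff)
  show "sqv (%x. \<chi> i. ext Om (g i) x)" using g(1) by (simp add: sqv_def L2_iff)
  show "(%n. cls (ph n)) ~~> cls (ext Om y)" by (rule lim[OF b1])
  show "(%n. cls (%x. grad (ph n) x $ i)) ~~> cls (%x. (\<chi> i. ext Om (g i) x) $ i)" for i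
   using lim[OF b2[of i]] by simp
 qed
 thus "\<exists>G. h10 Om (ext Om y) G" by blast
qed

lemma h10_weak_deriv_AE:
 assumes h: "h10 Om (ext Om y) G"
 shows "ae x. x \<in> Om --> weak_deriv Om i y x = G x $ i"
proof -
 note w = h10_weak_deriv[OF h]
 note wd = weak_deriv_eq[OF w(1) w(2)[of i] w(3)]
 have "ae x. ext Om (weak_deriv Om i y) x = ext Om (%x. G x $ i) x"
  using wd w(2)[of i] by (subst (asm) cls_eq_iff) (auto simp: L2_iff)
 thus ?thesis by eventually_elim (auto simp: ext_simps)
qed

end

section \<open>Nash and Poincare inequalities\<close>

lemma sqv_measurable:
 assumes "sqv G" shows "G \<in> BM"
proof (subst borel_measurable_euclidean_space, intro ballI)
 fix b :: "real ^ 'a" assume "b \<in> Basis"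
 then obtain i where "b = axis i 1" by (auto simp: Basis_vec_def)
 thus "(%x. G x \<bullet> b) \<in> BM"
  using assms by (simp add: inner_axis sqv_def sqi_measurable)
qed

lemma sqi_norm: "sqv G ==> sqi (%x. norm (G x))"
proof -
 assume G: "sqv G"
 have [measurable]: "(%x. norm (G x)) \<in> BM"
  using sqv_measurable[OF G] by measurable
 show ?thesis
 proof (rule sqi_bound[where g="%x. \<Sum>i\<in>UNIV. \<bar>G x $ i\<bar>" and C=1])
  show "sqi (%x. \<Sum>i\<in>UNIV. \<bar>G x $ i\<bar>)" using G by (intro sqi_sum sqi_abs) (simp add: sqv_def)
  show "ae x. \<bar>norm (G x)\<bar> <= 1 * \<bar>\<Sum>i\<in>UNIV. \<bar>G x $ i\<bar>\<bar>"
   using norm_le_l1_cart by (intro AE_I2) (auto simp: sum_nonneg)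
 qed simp
qed

lemma sqv_diff: "sqv G ==> sqv H ==> sqv (%x. G x - H x)"
 by (simp add: sqv_def sqi_diff)

text \<open>Pointwise, the difference of the norms is at most the sum of the absolute component
  differences, whose class tends to zero.\<close>

lemma cls_norm_tendsto:
 fixes G :: "nat => real ^ 'n => real ^ 'n"
 assumes "\<And>n. sqv (G n)" "sqv H" "\<And>i. (%n. cls (%x. G n x $ i)) ~~> cls (%x. H x $ i)"
 shows "(%n. cls (%x. norm (G n x))) ~~> cls (%x. norm (H x))"
proof -
 have s: "sqi (%x. \<bar>G n x $ i - H x $ i\<bar>)" for n i
  using assms by (intro sqi_abs sqi_diff) (auto simp: sqv_def)
 have "(%n. cls (%x. \<bar>G n x $ i - H x $ i\<bar>)) ~~> cls (%x. 0)" for i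
 proof (rule cls_tendsto_lipschitz[OF assms(3)[of i], where C=1])
  show "ae x. \<bar>\<bar>G n x $ i - H x $ i\<bar> - 0\<bar> <= 1 * \<bar>G n x $ i - H x $ i\<bar>" for n by simp
 qed (use assms s in \<open>auto simp: sqv_def\<close>)
 hence "(%n. \<Sum>i\<in>UNIV. cls (%x. \<bar>G n x $ i - H x $ i\<bar>)) ~~> (\<Sum>i\<in>(UNIV::'n set). cls (%x::real^'n. 0))"
  by (intro tendsto_sum)
 hence lim: "(%n. cls (%x. \<Sum>i\<in>UNIV. \<bar>G n x $ i - H x $ i\<bar>)) ~~> 0"
  using s by (simp add: cls_sum cls_simps(6)[symmetric])
 show ?thesis
 proof (rule LIM_zero_cancel, rule Lim_null_comparison)
  show "\<forall>\<^sub>F n in sequentially. norm (cls (%x. norm (G n x)) - cls (%x. norm (H x)))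
    <= norm (cls (%x. \<Sum>i\<in>UNIV. \<bar>G n x $ i - H x $ i\<bar>))"
  proof (rule always_eventually, rule allI)
   fix n
   have "norm (cls (%x. norm (G n x) - norm (H x))) <= 1 * norm (cls (%x. \<Sum>i\<in>UNIV. \<bar>G n x $ i - H x $ i\<bar>))"
   proof (rule norm_cls_mono)
    show "ae x. \<bar>norm (G n x) - norm (H x)\<bar> <= 1 * \<bar>\<Sum>i\<in>UNIV. \<bar>G n x $ i - H x $ i\<bar>\<bar>"
    proof (intro AE_I2)
     fix x
     have "\<bar>norm (G n x) - norm (H x)\<bar> <= norm (G n x - H x)" by (rule norm_triangle_ineq3)
     also have "\<dots> <= (\<Sum>i\<in>UNIV. \<bar>(G n x - H x) $ i\<bar>)" by (rule norm_le_l1_cart)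
     finally show "\<bar>norm (G n x) - norm (H x)\<bar> <= 1 * \<bar>\<Sum>i\<in>UNIV. \<bar>G n x $ i - H x $ i\<bar>\<bar>"
      by simp
    qed
   qed (intro sqi_diff sqi_norm sqi_sum s assms | simp)+
   thus "norm (cls (%x. norm (G n x)) - cls (%x. norm (H x))) <= norm (cls (%x. \<Sum>i\<in>UNIV. \<bar>G n x $ i - H x $ i\<bar>))"
    using assms by (simp add: cls_simps sqi_norm)
  qed
  show "(%n. norm (cls (%x. \<Sum>i\<in>UNIV. \<bar>G n x $ i - H x $ i\<bar>))) ~~> 0"
   using tendsto_norm[OF lim] by simp
 qed
qed

lemma h10_approx_norm:
 assumes "h10 Om u G"
 shows "\<exists>ph. (\<forall>n. ph n \<in> test_functions Om) \<and> (%n::nat. cls (ph n)) ~~> cls u \<and>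
  (%n. cls (%x. norm (grad (ph n) x))) ~~> cls (%x. norm (G x))"
proof -
 obtain ph where ph: "\<And>n. ph n \<in> test_functions Om" "(%n::nat. cls (ph n)) ~~> cls u"
  "\<And>i. (%n. cls (pd i (ph n))) ~~> cls (%x. G x $ i)"
  using h10_approx[OF assms] by blast
 have "(%n. cls (%x. norm (grad (ph n) x))) ~~> cls (%x. norm (G x))"
  by (rule cls_norm_tendsto[OF sqi_test(2)[OF ph(1)] h10D(2)[OF assms]]) (simp add: ph(3))
 thus ?thesis using ph by blast
qed

lemma inner_indicator:
 assumes "S \<in> lmeasurable" "sqi f"
 shows "inner (cls (ind S)) (cls f) = (lint x. ind S x * f x)"
 using assms by (simp add: cls_simps sqi_indicator)

lemma sqi_indicator_mult:
 assumes "S \<in> sets lebesgue" "sqi f" shows "sqi (%x. ind S x * f x)"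
 by (rule sqi_mult_bounded[OF assms(2), where C=1]) (use assms in \<open>auto simp: indicator_def intro: borel_measurable_indicator\<close>)

lemma integrable_indicator_mult:
 assumes "S \<in> lmeasurable" "sqi f" shows "integrable lebesgue (%x. ind S x * f x)"
 by (rule sqi_mult_integrable[OF sqi_indicator[OF assms(1)] assms(2)])

section \<open>Averages over balls and their consequences\<close>

definition ballvol :: "'n::finite itself => real => real" where
 "ballvol _ t = vol (ball (0 :: real ^ 'n) t)"

lemma measure_ball: "vol (ball (x :: real ^ 'n) t) = ballvol TYPE('n) t"
 by (cases "t >= 0") (simp_all add: ballvol_def content_ball ball_empty)

lemma ballvol_scale: fixes t :: real shows "t >= 0 ==> s >= 0 ==> ballvol TYPE('n::finite) (s * t) = s ^ CARD('n) * ballvol TYPE('n) t"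
 by (simp add: ballvol_def content_ball power_mult_distrib)

lemma ballvol_pos: "t > 0 ==> ballvol TYPE('n::finite) t > 0"
 by (simp add: ballvol_def content_ball_pos)

text \<open>The integral of \<open>p\<close> over a ball, written as an inner product: it is thereby
  defined on classes and continuous under weak convergence.\<close>

definition bint :: "real => (real ^ 'n) l2 => real ^ 'n => real" where
 "bint t p x = inner p (cls (ind (ball x t)))"

lemma bint_bound:
 fixes p :: "(real ^ 'n) l2"
 shows "\<bar>bint t p x\<bar> <= norm p * sqrt (ballvol TYPE('n) t)"
proof -
 have "(norm (cls (ind (ball x t))))^2 = ballvol TYPE('n) t"
  using norm_cls[OF sqi_indicator[OF lmeasurable_ball[of x t]]] by (simp add: measure_ball power2_eq_square flip: indicator_inter_arith)
 hence "norm (cls (ind (ball x t))) = sqrt (ballvol TYPE('n) t)" using real_sqrt_unique by fastforce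
 thus ?thesis unfolding bint_def using Cauchy_Schwarz_ineq2[of p "cls (ind (ball x t))"] by simp
qed

text \<open>The compactness behind \<open>rellich\<close>: weak convergence makes the ball integrals
  converge pointwise, Cauchy-Schwarz bounds them uniformly, and on a set of finite measure this
  gives strong convergence.\<close>

lemma bint_tendsto:
 fixes p :: "nat => (real ^ 'n) l2"
 assumes w: "weakly_to p q" and R: "\<And>n. norm (p n) <= R" and m: "\<And>n. bint t (p n) \<in> BM" and A: "A \<in> lmeasurable"
 shows "bint t q \<in> BM" "\<And>n. sqi (%x. ind A x * bint t (p n) x)" "sqi (%x. ind A x * bint t q x)"
  "(%n. cls (%x. ind A x * bint t (p n) x)) ~~> cls (%x. ind A x * bint t q x)"
proof -
 have l: "(%n. bint t (p n) x) ~~> bint t q x" for x using w by (simp add: weakly_to_def bint_def)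
 show mq: "bint t q \<in> BM" by (rule borel_measurable_LIMSEQ_real[OF l m])
 have [measurable]: "A \<in> sets lebesgue" using A by (rule fmeasurableD)
 note [measurable] = m mq
 have b: "ae x. \<bar>ind A x * bint t (p n) x\<bar> <= (R * sqrt (ballvol TYPE('n) t)) * \<bar>ind A x\<bar>" for n
 proof (intro AE_I2)
  fix x
  have "\<bar>bint t (p n) x\<bar> <= R * sqrt (ballvol TYPE('n) t)"
   by (rule order_trans[OF bint_bound mult_right_mono[OF R]]) (simp add: ballvol_def)
  thus "\<bar>ind A x * bint t (p n) x\<bar> <= (R * sqrt (ballvol TYPE('n) t)) * \<bar>ind A x\<bar>" by (simp add: indicator_def)
 qed
 have "ae x. (%n. ind A x * bint t (p n) x) ~~> ind A x * bint t q x"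
  by (intro AE_I2 tendsto_mult tendsto_const l)
 note dc = cls_dominated_convergence[OF _ _ sqi_indicator[OF A] this b]
 show "\<And>n. sqi (%x. ind A x * bint t (p n) x)" "sqi (%x. ind A x * bint t q x)"
  "(%n. cls (%x. ind A x * bint t (p n) x)) ~~> cls (%x. ind A x * bint t q x)"
  by (rule dc; measurable)+
qed

text \<open>Limit of \<open>test_nash_inequality\<close>. The factor \<open>ind Om\<close> makes the
  ball integrals square integrable, and it is harmless because the other factor vanishes off
  \<open>Om\<close>.\<close>

lemma nash_inequality:
 fixes u :: "real ^ 'n => real"
 assumes h: "h10 Om u G" and Om: "bounded Om" "open Om" and t: "t > 0"
 shows "bint t (cls u) \<in> BM"
  "ballvol TYPE('n) t * (norm (cls u))^2 <= ballvol TYPE('n) t * (t^2 / 2 * (norm (cls (%x. norm (G x))))^2)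
   + inner (cls u) (cls (%x. ind Om x * bint t (cls u) x))"
proof -
 obtain ph where ph: "\<And>n. ph n \<in> test_functions Om" "(%n::nat. cls (ph n)) ~~> cls u"
  "(%n. cls (%x. norm (grad (ph n) x))) ~~> cls (%x. norm (G x))"
  using h10_approx_norm[OF h] by blast
 have s: "sqi (ph n)" "sqi (%x. norm (grad (ph n) x))" for n
  using sqi_test[OF ph(1)] by (auto intro: sqi_norm)
 have m[measurable]: "ph n \<in> borel_measurable borel" "grad (ph n) \<in> borel_measurable borel" for n
  using test_smooth[OF ph(1)] by (auto intro: smooth_borel grad_borel)
 have O: "Om \<in> lmeasurable" using Om by (simp add: lmeasurable_open)
 obtain R where R: "\<And>n. norm (cls (ph n)) <= R" using ph(2) by (meson convergentI convergent_imp_Bseq BseqE)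
 have b: "bint t (cls (ph n)) x = (\<integral>y. ind (ball x t) y * ph n y \<partial>lborel)" for n x
 proof -
  have [measurable]: "ball x t \<in> sets borel" by simp
  show ?thesis using inner_indicator[OF lmeasurable_ball s(1), of x t n] by (simp only: bint_def inner_commute) (simp add: integral_completion)
 qed
 have "bint t (cls (ph n)) = (%x. \<integral>y. (if dist x y < t then ph n y else 0) \<partial>lborel)" for n
  unfolding b[abs_def] by (intro HOL.ext Bochner_Integration.integral_cong) (auto simp: indicator_def)
 hence bb: "bint t (cls (ph n)) \<in> borel_measurable borel" for n by simp
 hence bm: "bint t (cls (ph n)) \<in> BM" for n by (rule borel_lebesgue)
 note lim = bint_tendsto[OF strongly_to_weakly_to[OF ph(2)] R bm O]
 show "bint t (cls u) \<in> BM" by (rule lim(1))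
 have tn: "ballvol TYPE('n) t * (norm (cls (ph n)))^2 <= ballvol TYPE('n) t * (t^2 / 2 * (norm (cls (%x. norm (grad (ph n) x))))^2)
   + inner (cls (ph n)) (cls (%x. ind Om x * bint t (cls (ph n)) x))" for n
 proof -
  have e: "ph n x * (ind Om x * bint t (cls (ph n)) x) = ph n x * bint t (cls (ph n)) x" for x
   using test_zero_outside[OF ph(1), of x] by (cases "x \<in> Om") auto
  note [measurable] = bb
  show ?thesis using test_nash_inequality[OF ph(1) t, of n]
   unfolding norm_cls[OF s(1)] norm_cls[OF s(2)] cls_simps(5)[OF s(1) lim(2)] e b[symmetric]
   by (simp add: ballvol_def integral_completion)
 qed
 show "ballvol TYPE('n) t * (norm (cls u))^2 <= ballvol TYPE('n) t * (t^2 / 2 * (norm (cls (%x. norm (G x))))^2)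
   + inner (cls u) (cls (%x. ind Om x * bint t (cls u) x))"
  by (rule LIMSEQ_le[OF tendsto_mult[OF tendsto_const tendsto_power[OF tendsto_norm[OF ph(2)]]]
     tendsto_add[OF tendsto_mult[OF tendsto_const tendsto_mult[OF tendsto_const tendsto_power[OF tendsto_norm[OF ph(3)]]]]
      tendsto_inner[OF ph(2) lim(4)]]]) (use tn in blast)
qed

lemma L1_le_L2:
 fixes u :: "real ^ 'n => real"
 assumes "sqi u" "A \<in> lmeasurable" "ae x. x \<notin> A --> u x = 0"
 shows "(lint x. \<bar>u x\<bar>)^2 <= vol A * (lint x. (u x)^2)"
proof -
 have [measurable]: "u \<in> BM" "A \<in> sets lebesgue" using assms by (auto intro: sqi_measurable fmeasurableD)
 have "ae x. \<bar>u x\<bar> = ind A x * \<bar>u x\<bar>" using assms(3) by eventually_elim (auto simp: indicator_def)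
 hence "(lint x. \<bar>u x\<bar>) = (lint x. ind A x * \<bar>u x\<bar>)"
  by (intro integral_cong_AE) simp_all
 also have "\<dots> = inner (cls (ind A)) (cls (%x. \<bar>u x\<bar>))" using assms by (simp add: inner_indicator sqi_abs)
 finally have "(lint x. \<bar>u x\<bar>)^2 <= (norm (cls (ind A)))^2 * (norm (cls (%x. \<bar>u x\<bar>)))^2"
  using Cauchy_Schwarz_ineq[of "cls (ind A)" "cls (%x. \<bar>u x\<bar>)"] by (simp add: power2_norm_eq_inner)
 moreover have "(norm (cls (ind A)))^2 = vol A"
 proof -
  have "(ind A x :: real)^2 = ind A x" for x by (simp add: indicator_def)
  thus ?thesis by (simp add: norm_cls sqi_indicator assms)
 qed
 moreover have "(norm (cls (%x. \<bar>u x\<bar>)))^2 = (lint x. (u x)^2)" using assms by (simp add: norm_cls sqi_abs)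
 ultimately show ?thesis by simp
qed

text \<open>Every ball integral of \<open>u\<close> is at most its L1 norm, whose square is at most
  the measure of \<open>A\<close> times the squared L2 norm. Since \<open>A\<close> has at most half
  the volume of a ball of radius \<open>t\<close>, the last term of \<open>nash_inequality\<close>
  is at most half of the left side and is absorbed.\<close>

lemma faber_krahn:
 fixes u :: "real ^ 'n => real"
 assumes h: "h10 Om u G" and Om: "bounded Om" "open Om" and t: "t > 0"
  and A: "A \<in> lmeasurable" "ae x. x \<notin> A --> u x = 0" "2 * vol A <= ballvol TYPE('n) t"
 shows "(lint x. (u x)^2) <= t^2 * (lint x. (norm (G x))^2)"
proof -
 define V X D where "V = ballvol TYPE('n) t" and "X = (norm (cls u))^2" and "D = (norm (cls (%x. norm (G x))))^2"
 have V: "V > 0" using t by (simp add: V_def ballvol_pos)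
 have su: "sqi u" and sa: "sqi (%x. \<bar>u x\<bar>)" using h by (auto intro: h10D sqi_abs)
 have [measurable]: "u \<in> BM" "A \<in> sets lebesgue" using su A by (auto intro: sqi_measurable fmeasurableD)
 define L where "L = (lint x. \<bar>u x\<bar>)"
 have iu: "integrable lebesgue (%x. \<bar>u x\<bar>)"
  using integrable_indicator_mult[OF A(1) sa] A(2)
  by (subst integrable_cong_AE[where g="%x. ind A x * \<bar>u x\<bar>"]) (auto elim!: eventually_mono simp: indicator_def)
 have b: "\<bar>bint t (cls u) x\<bar> <= L" for x
 proof -
  have "bint t (cls u) x = (lint y. ind (ball x t) y * u y)"
   using inner_indicator[OF lmeasurable_ball su] by (simp add: bint_def inner_commute)
  also have "\<bar>\<dots>\<bar> <= (lint y. \<bar>ind (ball x t) y * u y\<bar>)" by (rule integral_abs_bound)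
  also have "\<dots> <= L" unfolding L_def by (rule integral_mono'[OF iu]) (auto simp: indicator_def)
  finally show ?thesis .
 qed
 note n = nash_inequality[OF h Om t]
 have [measurable]: "bint t (cls u) \<in> BM" "Om \<in> sets lebesgue" using n(1) Om(2) by (auto simp: borel_open)
 have sb: "sqi (%x. ind Om x * bint t (cls u) x)"
  by (rule sqi_bound[where g="ind Om" and C=L]) (use sqi_indicator[of Om] Om b in \<open>auto simp: lmeasurable_open indicator_def\<close>)
 have "inner (cls u) (cls (%x. ind Om x * bint t (cls u) x)) <= (lint x. L * \<bar>u x\<bar>)"
  unfolding cls_simps(5)[OF su sb]
 proof (rule integral_mono)
  fix x
  have "u x * (ind Om x * bint t (cls u) x) <= \<bar>u x\<bar> * \<bar>ind Om x * bint t (cls u) x\<bar>" by (metis abs_ge_self abs_mult)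
  also have "\<dots> <= \<bar>u x\<bar> * L" using b[of x] order_trans[OF abs_ge_zero b[of x]] by (intro mult_left_mono) (auto simp: indicator_def)
  finally show "u x * (ind Om x * bint t (cls u) x) <= L * \<bar>u x\<bar>" by (simp add: mult.commute)
 qed (use iu sqi_mult_integrable[OF su sb] in auto)
 also have "\<dots> = L^2" by (simp add: L_def power2_eq_square)
 also have "\<dots> <= vol A * X" using L1_le_L2[OF su A(1,2)] by (simp add: L_def X_def norm_cls su)
 also have "\<dots> <= V / 2 * X" using A(3) by (intro mult_right_mono) (auto simp: V_def X_def)
 finally have "V * X <= V * (t^2 * D)" using n(2) by (simp add: V_def X_def D_def algebra_simps)
 hence "X <= t^2 * D" using V by simp
 thus ?thesis by (simp add: X_def D_def norm_cls su sqi_norm[OF h10D(2)[OF h]])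
qed

text \<open>For small \<open>t\<close> the gradient term of \<open>nash_inequality\<close> is small
  uniformly in \<open>n\<close>; for that fixed \<open>t\<close> the averaging term tends to zero by
  \<open>bint_tendsto\<close>.\<close>

lemma rellich:
 fixes u :: "nat => real ^ 'n => real"
 assumes h: "\<And>n. h10 Om (u n) (G n)" and Om: "bounded Om" "open Om" and w: "weakly_to (%n. cls (u n)) 0"
  and R: "\<And>n. norm (cls (u n)) <= R" and D: "\<And>n. norm (cls (%x. norm (G n x))) <= D"
 shows "(%n. cls (u n)) ~~> 0"
proof -
 have O: "Om \<in> lmeasurable" using Om by (simp add: lmeasurable_open)
 have "\<forall>\<^sub>F n in sequentially. (norm (cls (u n)))^2 < e" if e: "e > 0" for e
 proof -
  have De: "D^2 / e + 1 > 0" using e by (simp add: add_nonneg_pos)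
  \<comment> \<open>This makes \<open>t^2 * D^2 <= e\<close>; the summand 1 covers the case
    \<open>D = 0\<close>.\<close>
  define t where "t = 1 / sqrt (D^2 / e + 1)"
  have t: "t > 0" "t^2 * D^2 <= e" using e De by (auto simp: t_def power_divide field_simps)
  define V where "V = ballvol TYPE('n) t"
  have V: "V > 0" using t by (simp add: V_def ballvol_pos)
  define K where "K n = inner (cls (u n)) (cls (%x. ind Om x * bint t (cls (u n)) x))" for n
  note n = nash_inequality[OF h Om t(1)]
  have z: "bint t (0 :: (real ^ 'n) l2) x = 0" for x by (simp add: bint_def)
  have "(%n. cls (%x. ind Om x * bint t (cls (u n)) x)) ~~> 0"
   using bint_tendsto(4)[OF w R n(1) O] by (simp only: z mult_zero_right cls_simps(6)[symmetric])
  hence "(%n. R * norm (cls (%x. ind Om x * bint t (cls (u n)) x))) ~~> R * norm (0 :: (real ^ 'n) l2)" by (intro tendsto_intros)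
  hence "(%n. R * norm (cls (%x. ind Om x * bint t (cls (u n)) x))) ~~> 0" by simp
  moreover have "V * (e / 2) > 0" using V e by simp
  ultimately have "\<forall>\<^sub>F n in sequentially. R * norm (cls (%x. ind Om x * bint t (cls (u n)) x)) < V * (e / 2)" by (rule order_tendstoD(2))
  thus ?thesis
  proof eventually_elim
   case (elim n)
   have "K n <= norm (cls (u n)) * norm (cls (%x. ind Om x * bint t (cls (u n)) x))" unfolding K_def by (rule norm_cauchy_schwarz)
   also have "\<dots> <= R * norm (cls (%x. ind Om x * bint t (cls (u n)) x))" by (intro mult_right_mono R) simp
   finally have K: "K n < V * (e / 2)" using elim by simp
   have "(norm (cls (%x. norm (G n x))))^2 <= D^2" using D by (intro power_mono) auto
   hence "t^2 / 2 * (norm (cls (%x. norm (G n x))))^2 <= t^2 / 2 * D^2" by (intro mult_left_mono) auto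
   hence "V * (t^2 / 2 * (norm (cls (%x. norm (G n x))))^2) <= V * (e / 2)" using t(2) V by (intro mult_left_mono) auto
   hence "V * (norm (cls (u n)))^2 < V * e" using n(2)[of n] K by (simp add: V_def K_def)
   thus ?case using V by simp
  qed
 qed
 hence "(%n. (norm (cls (u n)))^2) ~~> 0" by (intro order_tendstoI) (auto intro!: always_eventually intro: less_le_trans[OF _ zero_le_power2])
 from tendsto_real_sqrt[OF this] show ?thesis by (simp add: tendsto_norm_zero_iff)
qed

text \<open>For test functions, integrate \<open>\<bar>u z + c\<bar> <= \<bar>u z - u x\<bar> +
  \<bar>u x + c\<bar>\<close> over \<open>z\<close> in \<open>Q\<close> and \<open>x\<close> in
  \<open>E\<close>, and use \<open>double_difference_bound\<close>. In the application
  \<open>E\<close> is a set on which \<open>u + c\<close> vanishes, and \<open>c\<close> compensates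
  the constants subtracted by truncation.\<close>

lemma poincare_inequality:
 fixes u :: "real ^ 'n => real"
 assumes h: "h10 Om u G"
  and Q: "Q \<in> sets borel" "bounded Q" "convex Q" "\<And>x y. x \<in> Q ==> y \<in> Q ==> dist x y <= d" "d >= 0"
  and E: "E \<in> sets lebesgue" "E \<subseteq> Q"
 shows "vol E * (lint x. ind Q x * \<bar>u x + c\<bar>)
  <= 2 ^ CARD('n) * d * vol Q * (lint x. ind Q x * norm (G x))
   + vol Q * (lint x. ind E x * \<bar>u x + c\<bar>)"
proof -
 have Ql: "Q \<in> lmeasurable" using Q(1,2) by (intro bounded_set_imp_lmeasurable) auto
 have El: "E \<in> lmeasurable" using E Q(2) by (meson bounded_set_imp_lmeasurable bounded_subset)
 have [measurable]: "Q \<in> sets borel" "E \<in> sets lebesgue" "Q \<in> sets lebesgue" using Q E Ql by (auto simp: fmeasurableD)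
 have test: "vol E * (lint x. ind Q x * \<bar>ph x + c\<bar>)
  <= 2 ^ CARD('n) * d * vol Q * (lint x. ind Q x * norm (grad ph x))
   + vol Q * (lint x. ind E x * \<bar>ph x + c\<bar>)" if ph: "ph \<in> test_functions Om" for ph
 proof -
  have sm: "smooth ph" using ph by (rule test_smooth)
  have m[measurable]: "ph \<in> borel_measurable borel" "grad ph \<in> borel_measurable borel"
   using sm by (rule smooth_borel, rule grad_borel)
  have ml[measurable]: "ph \<in> BM" "(%x. norm (grad ph x)) \<in> BM"
   by (auto intro!: borel_lebesgue)
  define F where "F x = (\<integral>\<^sup>+z. ennreal \<bar>ph z - ph x\<bar> * ind Q z \<partial>lborel)" for x
  have Fm: "F \<in> borel_measurable borel" unfolding F_def by measurable
  hence [measurable]: "F \<in> BM" by (intro measurable_completion) simp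
  define S where "S = (\<integral>\<^sup>+z. ennreal \<bar>ph z + c\<bar> * ind Q z \<partial>lborel)"
  have eQ: "emeasure lborel Q = ennreal (vol Q)"
   using emeasure_eq_measure2[OF Ql] Q(1) by simp
  have "S <= F x + ennreal (vol Q) * ennreal \<bar>ph x + c\<bar>" for x
  proof -
   have "S <= (\<integral>\<^sup>+z. ennreal \<bar>ph z - ph x\<bar> * ind Q z + ennreal \<bar>ph x + c\<bar> * ind Q z \<partial>lborel)"
    unfolding S_def
   proof (intro nn_integral_mono)
    fix z
    have "ennreal \<bar>ph z + c\<bar> <= ennreal \<bar>ph z - ph x\<bar> + ennreal \<bar>ph x + c\<bar>"
     by (subst ennreal_plus[symmetric]) (auto intro!: ennreal_leI simp del: ennreal_plus)
    thus "ennreal \<bar>ph z + c\<bar> * ind Q z <= ennreal \<bar>ph z - ph x\<bar> * ind Q z + ennreal \<bar>ph x + c\<bar> * ind Q z"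
     by (auto simp: indicator_def)
   qed
   also have "\<dots> = F x + ennreal \<bar>ph x + c\<bar> * emeasure lborel Q"
    unfolding F_def by (subst nn_integral_add) (auto simp: nn_integral_cmult_indicator)
   finally show ?thesis by (simp add: eQ mult.commute)
  qed
  hence "(\<integral>\<^sup>+x. S * ind E x \<partial>lebesgue)
    <= (\<integral>\<^sup>+x. F x * ind Q x + ennreal (vol Q) * (ennreal (ind E x * \<bar>ph x + c\<bar>)) \<partial>lebesgue)"
   using E(2) by (intro nn_integral_mono) (auto simp: indicator_def)
  also have "\<dots> = (\<integral>\<^sup>+x. F x * ind Q x \<partial>lebesgue)
    + ennreal (vol Q) * (\<integral>\<^sup>+x. ennreal (ind E x * \<bar>ph x + c\<bar>) \<partial>lebesgue)"
   by (subst nn_integral_add) (auto simp: nn_integral_cmult)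
  also have "(\<integral>\<^sup>+x. F x * ind Q x \<partial>lebesgue) = (\<integral>\<^sup>+x. F x * ind Q x \<partial>lborel)"
   by (rule nn_integral_completion) (use Fm in measurable)
  also have "\<dots> <= ennreal (2 ^ CARD('n) * d) * emeasure lborel Q * (\<integral>\<^sup>+x. ennreal (norm (grad ph x)) * ind Q x \<partial>lborel)"
   unfolding F_def by (rule double_difference_bound[OF sm Q(1,3,4,5)])
  also have "(\<integral>\<^sup>+x. S * ind E x \<partial>lebesgue) = S * ennreal (vol E)"
   using El by (simp add: nn_integral_cmult_indicator emeasure_eq_measure2)
  finally have main: "S * ennreal (vol E) <= ennreal (2 ^ CARD('n) * d) * emeasure lborel Q * (\<integral>\<^sup>+x. ennreal (norm (grad ph x)) * ind Q x \<partial>lborel)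
    + ennreal (vol Q) * (\<integral>\<^sup>+x. ennreal (ind E x * \<bar>ph x + c\<bar>) \<partial>lebesgue)"
   by (simp add: add_right_mono)
  have i1: "integrable lebesgue (%x. ind Q x * \<bar>ph x + c\<bar>)" "integrable lebesgue (%x. ind E x * \<bar>ph x + c\<bar>)"
   "integrable lebesgue (%x. ind Q x * norm (grad ph x))"
  proof -
   have "integrable lebesgue (%x. ind P x * \<bar>ph x + c\<bar>)" if P: "P \<in> lmeasurable" for P
   proof (rule Bochner_Integration.integrable_bound[where f="%x. ind P x * \<bar>ph x\<bar> + \<bar>c\<bar> * ind P x"])
    show "integrable lebesgue (%x. ind P x * \<bar>ph x\<bar> + \<bar>c\<bar> * ind P x)"
     using P integrable_indicator_mult[OF P sqi_abs[OF sqi_test(1)[OF ph]]]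
     by (intro Bochner_Integration.integrable_add integrable_mult_right) (auto simp: fmeasurable_def)
    show "(%x. ind P x * \<bar>ph x + c\<bar>) \<in> BM"
     using fmeasurableD[OF P] by measurable
   qed (auto simp: indicator_def)
   thus "integrable lebesgue (%x. ind Q x * \<bar>ph x + c\<bar>)" "integrable lebesgue (%x. ind E x * \<bar>ph x + c\<bar>)"
    using Ql El by auto
   show "integrable lebesgue (%x. ind Q x * norm (grad ph x))"
    by (intro integrable_indicator_mult Ql sqi_norm sqi_test[OF ph])
  qed
  have "S = (\<integral>\<^sup>+z. ennreal (ind Q z * \<bar>ph z + c\<bar>) \<partial>lebesgue)"
   unfolding S_def by (subst nn_integral_completion) (auto intro!: nn_integral_cong simp: indicator_def)
  hence S: "S = ennreal (lint x. ind Q x * \<bar>ph x + c\<bar>)"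
   using i1(1) by (simp add: nn_integral_eq_integral)
  have T: "(\<integral>\<^sup>+x. ennreal (ind E x * \<bar>ph x + c\<bar>) \<partial>lebesgue) = ennreal (lint x. ind E x * \<bar>ph x + c\<bar>)"
   using i1(2) by (simp add: nn_integral_eq_integral)
  have "(\<integral>\<^sup>+x. ennreal (norm (grad ph x)) * ind Q x \<partial>lborel) = (\<integral>\<^sup>+x. ennreal (ind Q x * norm (grad ph x)) \<partial>lebesgue)"
   by (subst nn_integral_completion) (auto intro!: nn_integral_cong simp: indicator_def)
  also have "\<dots> = ennreal (lint x. ind Q x * norm (grad ph x))"
   using i1(3) by (simp add: nn_integral_eq_integral)
  finally have R: "(\<integral>\<^sup>+x. ennreal (norm (grad ph x)) * ind Q x \<partial>lborel) = ennreal (lint x. ind Q x * norm (grad ph x))" .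
  have nn: "0 <= (lint x. ind Q x * \<bar>ph x + c\<bar>)" "0 <= (lint x. ind E x * \<bar>ph x + c\<bar>)"
   "0 <= (lint x. ind Q x * norm (grad ph x))" by (auto intro!: integral_nonneg_AE)
  show ?thesis using main nn Q(5) unfolding S T R eQ
   by (simp add: ennreal_mult[symmetric] ennreal_plus[symmetric] mult.commute del: ennreal_plus)
 qed
 obtain ph where ph: "\<And>n. ph n \<in> test_functions Om" "(%n::nat. cls (ph n)) ~~> cls u"
  "(%n. cls (%x. norm (grad (ph n) x))) ~~> cls (%x. norm (G x))"
  using h10_approx_norm[OF h] by blast
 have s: "sqi (ph n)" "sqi (%x. norm (grad (ph n) x))" for n
  using sqi_test[OF ph(1)] by (auto intro: sqi_norm)
 have su: "sqi u" "sqi (%x. norm (G x))" using h10D[OF h] by (auto intro: sqi_norm)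
 have si: "sqi (%x. ind P x * \<bar>v x + c\<bar>)" if P: "P \<in> lmeasurable" and v: "sqi v" for v P
 proof -
  have [measurable]: "v \<in> BM" "P \<in> sets lebesgue" using P v by (auto intro: sqi_measurable fmeasurableD)
  show ?thesis
   by (rule sqi_bound[where g="%x. \<bar>v x\<bar> + \<bar>c\<bar> * ind P x" and C=1])
    (use sqi_add[OF sqi_abs[OF v] sqi_cmult[OF sqi_indicator[OF P], of "\<bar>c\<bar>"]] in \<open>auto simp: indicator_def\<close>)
 qed
 have ii: "(lint x. ind P x * \<bar>v x + c\<bar>) = inner (cls (ind P)) (cls (%x. ind P x * \<bar>v x + c\<bar>))"
  if P: "P \<in> lmeasurable" and v: "sqi v" for v P
  using inner_indicator[OF P si[OF P v]] by (simp add: mult.assoc[symmetric] indicator_inter_arith[symmetric])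
 have lim1: "(%n. (lint x. ind P x * \<bar>ph n x + c\<bar>)) ~~> (lint x. ind P x * \<bar>u x + c\<bar>)"
  if P: "P \<in> lmeasurable" for P
 proof -
  have "(%n. cls (%x. ind P x * \<bar>ph n x + c\<bar>)) ~~> cls (%x. ind P x * \<bar>u x + c\<bar>)"
   by (rule cls_tendsto_lipschitz[OF ph(2) s(1) su(1) si[OF P s(1)] si[OF P su(1)], where C=1]) (auto simp: indicator_def)
  thus ?thesis unfolding ii[OF P s(1)] ii[OF P su(1)] by (intro tendsto_intros)
 qed
 have lim2: "(%n. (lint x. ind Q x * norm (grad (ph n) x))) ~~> (lint x. ind Q x * norm (G x))"
  unfolding inner_indicator[OF Ql s(2), symmetric] inner_indicator[OF Ql su(2), symmetric] by (intro tendsto_intros ph(3))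
 show ?thesis
  by (rule LIMSEQ_le[OF tendsto_mult[OF tendsto_const lim1[OF Ql]]
     tendsto_add[OF tendsto_mult[OF tendsto_const lim2] tendsto_mult[OF tendsto_const lim1[OF El]]]])
   (use test[OF ph(1)] in blast)
qed

section \<open>Elliptic forms\<close>

text \<open>The coefficients are thought of as extended by zero, so the lower bound is asked for on
  \<open>Om\<close> only; \<open>form_elliptic\<close> still holds because gradients in the space
  vanish off \<open>Om\<close>.\<close>

locale elliptic =
 fixes Om :: "(real ^ 'n) set" and A :: "'n => 'n => real ^ 'n => real" and lam Lam :: real
 assumes open_Om: "open Om" and bounded_Om: "bounded Om"
  and A_measurable: "\<And>i j. A i j \<in> BM"
  and A_bounded: "ae x. \<forall>\<xi> et. \<bar>\<Sum>i\<in>UNIV. \<Sum>j\<in>UNIV. A i j x * \<xi> $ i * et $ j\<bar> <= Lam * norm \<xi> * norm et"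
  and A_elliptic: "ae x. x \<in> Om --> (\<forall>\<xi>. lam * (norm \<xi>)^2 <= (\<Sum>i\<in>UNIV. \<Sum>j\<in>UNIV. A i j x * \<xi> $ i * \<xi> $ j))"
  and lam: "lam > 0" and Lam: "Lam >= 0"
begin

definition bil :: "real ^ 'n => real ^ 'n => real ^ 'n => real" where
 "bil x \<xi> et = (\<Sum>i\<in>UNIV. \<Sum>j\<in>UNIV. A i j x * \<xi> $ i * et $ j)"

definition form :: "(real ^ 'n => real ^ 'n) => (real ^ 'n => real ^ 'n) => real" where
 "form G H = (lint x. bil x (G x) (H x))"

lemma bil_bounded: "ae x. \<forall>\<xi> et. \<bar>bil x \<xi> et\<bar> <= Lam * norm \<xi> * norm et"
 using A_bounded by (simp add: bil_def)

lemma bil_elliptic: "ae x. x \<in> Om --> (\<forall>\<xi>. lam * (norm \<xi>)^2 <= bil x \<xi> \<xi>)"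
 using A_elliptic by (simp add: bil_def)

lemma bil_simps:
 "bil x (a + b) c = bil x a c + bil x b c" "bil x a (b + c) = bil x a b + bil x a c"
 "bil x (s *R a) b = s * bil x a b" "bil x a (s *R b) = s * bil x a b" "bil x 0 b = 0" "bil x a 0 = 0"
 "bil x (a - b) c = bil x a c - bil x b c" "bil x a (b - c) = bil x a b - bil x a c"
 by (simp_all add: bil_def sum.distrib sum_subtractf sum_distrib_left algebra_simps)

lemma bil_measurable:
 assumes "G \<in> BM" "H \<in> BM"
 shows "(%x. bil x (G x) (H x)) \<in> BM"
proof -
 have c: "(%x. G' x $ i) \<in> BM" if "G' \<in> BM" for G' :: "real^'n => real^'n" and i
  using borel_measurable_inner[OF that borel_measurable_const[of "axis i 1"]] by (simp add: inner_axis)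
 note [measurable] = c[OF assms(1)] c[OF assms(2)] A_measurable
 show ?thesis unfolding bil_def by measurable
qed

lemma bil_integrable:
 assumes "sqv G" "sqv H"
 shows "integrable lebesgue (%x. bil x (G x) (H x))"
proof (rule Bochner_Integration.integrable_bound)
 show "integrable lebesgue (%x. Lam * (norm (G x) * norm (H x)))"
  using sqi_mult_integrable[OF sqi_norm[OF assms(1)] sqi_norm[OF assms(2)]] by simp
 show "ae x. norm (bil x (G x) (H x)) <= norm (Lam * (norm (G x) * norm (H x)))"
  using bil_bounded by eventually_elim (use Lam in \<open>simp add: mult.assoc\<close>)
qed (intro bil_measurable sqv_measurable assms)

lemma form_add_right: "sqv G ==> sqv H ==> sqv K ==> form G (%x. H x + K x) = form G H + form G K"
 unfolding form_def by (simp add: bil_simps bil_integrable)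

lemma form_scale_right: "form G (%x. c *R H x) = c * form G H"
 unfolding form_def by (simp add: bil_simps)

lemma form_diff_left: "sqv G ==> sqv H ==> sqv K ==> form (%x. G x - H x) K = form G K - form H K"
 unfolding form_def by (simp add: bil_simps bil_integrable)

lemma form_uminus_left: "form (%x. - G x) K = - form G K"
proof -
 have "bil x (- a) b = - bil x a b" for x a b using bil_simps(3)[of x "-1" a b] by simp
 thus ?thesis unfolding form_def by simp
qed

lemma form_bound:
 assumes "sqv G" "sqv H"
 shows "\<bar>form G H\<bar> <= Lam * (norm (cls (%x. norm (G x))) * norm (cls (%x. norm (H x))))"
proof -
 have s: "sqi (%x. norm (G x))" "sqi (%x. norm (H x))" using assms by (auto intro: sqi_norm)
 have "\<bar>form G H\<bar> <= (lint x. \<bar>bil x (G x) (H x)\<bar>)" unfolding form_def by (rule integral_abs_bound)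
 also have "\<dots> <= (lint x. Lam * (norm (G x) * norm (H x)))"
 proof (rule integral_mono_AE)
  show "ae x. \<bar>bil x (G x) (H x)\<bar> <= Lam * (norm (G x) * norm (H x))"
   using bil_bounded by eventually_elim (simp add: mult.assoc)
 qed (use bil_integrable[OF assms] sqi_mult_integrable[OF s] in auto)
 also have "\<dots> = Lam * inner (cls (%x. norm (G x))) (cls (%x. norm (H x)))" using s by (simp add: cls_simps)
 also have "\<dots> <= Lam * (norm (cls (%x. norm (G x))) * norm (cls (%x. norm (H x))))"
  by (intro mult_left_mono Lam norm_cauchy_schwarz)
 finally show ?thesis .
qed

lemma form_elliptic:
 assumes "h10 Om u G" shows "lam * (lint x. (norm (G x))^2) <= form G G"
proof -
 have "(lint x. lam * (norm (G x))^2) <= form G G" unfolding form_def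
 proof (rule integral_mono_AE)
  show "ae x. lam * (norm (G x))^2 <= bil x (G x) (G x)"
   using bil_elliptic h10_zero_outside[OF assms]
  proof eventually_elim
   case (elim x) thus ?case by (cases "x \<in> Om") (auto simp: bil_simps)
  qed
 qed (use sqi_square_integrable[OF sqi_norm[OF h10D(2)[OF assms]]] bil_integrable[OF h10D(2)[OF assms] h10D(2)[OF assms]] in auto)
 thus ?thesis by simp
qed

definition subsol :: "(real ^ 'n => real) => (real ^ 'n => real ^ 'n) => (real ^ 'n => real) => bool" where
 "subsol z Z g \<longleftrightarrow> h10 Om z Z \<and> sqi g \<and>
  (\<forall>ph Ph. h10 Om ph Ph --> (\<forall>x. 0 <= ph x) --> (\<forall>x. z x <= 0 --> ph x = 0) -->
   form Z Ph <= (lint x. g x * ph x))"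

lemma h10_pos_part:
 assumes "h10 Om u U" "k >= 0"
 shows "h10 Om (%x. max 0 (u x - k)) (%x. if u x > k then U x else 0)"
 using h10_trunc[OF assms(1), of k] assms(2) by (simp add: max_absorb1)

lemma form_trunc:
 "form Z (%x. if z x > k then Z x else 0) = form (%x. if z x > k then Z x else 0) (%x. if z x > k then Z x else 0)"
 unfolding form_def by (intro Bochner_Integration.integral_cong) (auto simp: bil_simps)

lemma Om_lmeasurable: "Om \<in> lmeasurable"
 using open_Om bounded_Om by (simp add: lmeasurable_open)

section \<open>Superlevel sets and global bounds for subsolutions\<close>

lemma superlevel_lmeasurable:
 fixes u :: "real ^ 'n => real" and k :: real
 assumes "u \<in> BM" "B \<in> lmeasurable" shows "{x \<in> B. u x > k} \<in> lmeasurable"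
proof (rule fmeasurableI2[OF assms(2)])
 have [measurable]: "u \<in> BM" "B \<in> sets lebesgue" using assms by (auto simp: fmeasurableD)
 have "{x \<in> space lebesgue. x \<in> B \<and> u x > k} \<in> sets lebesgue" by measurable
 thus "{x \<in> B. u x > k} \<in> sets lebesgue" by simp
qed auto

lemma chebyshev_L2:
 assumes "sqi w" "S \<in> lmeasurable" "ae x. x \<in> S --> c <= w x" "c >= 0"
 shows "c^2 * vol S <= (lint x. (w x)^2)"
proof -
 have "(lint x. c^2 * ind S x) <= (lint x. (w x)^2)"
 proof (rule integral_mono_AE)
  show "ae x. c^2 * ind S x <= (w x)^2" using assms(3)
   by eventually_elim (use assms(4) in \<open>auto simp: indicator_def intro: power_mono\<close>)
 qed (use assms in \<open>auto simp: fmeasurable_def sqi_def intro!: integrable_mult_right\<close>)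
 thus ?thesis using assms(2) by (simp add: fmeasurableD)
qed

text \<open>Common end of the two level iterations, in \<open>stampacchia\<close> and in
  \<open>small_measure_bound\<close>.\<close>

lemma null_if_small:
 fixes S :: "(real ^ 'n) set"
 assumes "S \<in> lmeasurable" "\<And>j. 2 * vol S <= ballvol TYPE('n) (t / 4 ^ j)" "t > 0"
 shows "ae x. x \<notin> S"
proof -
 have "(%j. ballvol TYPE('n) ((1/4) ^ j * t)) ~~> 0 ^ CARD('n) * ballvol TYPE('n) t"
 proof -
  have "(%j. ((1/4 :: real) ^ j) ^ CARD('n) * ballvol TYPE('n) t) ~~> 0 ^ CARD('n) * ballvol TYPE('n) t"
   by (intro tendsto_intros LIMSEQ_power_zero) auto
  thus ?thesis using assms(3) by (simp add: ballvol_scale)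
 qed
 hence "(%j. ballvol TYPE('n) (t / 4 ^ j)) ~~> 0" by (simp add: power_one_over field_simps power_0_left)
 hence "2 * vol S <= 0" using assms(2) by (intro LIMSEQ_le_const) auto
 hence "emeasure lebesgue S = 0" using assms(1) by (simp add: emeasure_eq_measure2 measure_le_0_iff)
 thus ?thesis using assms(1) by (intro AE_not_in) (auto simp: null_sets_def fmeasurableD)
qed

text \<open>Stampacchia's iteration on the levels \<open>k + d (1 - 2\<^sup>-\<^sup>j)\<close>.  The measure of the
 superlevel sets is compared with balls of radii \<open>t / 4\<^sup>j\<close>.\<close>

lemma stampacchia:
 assumes z: "subsol z Z g" and k: "k >= 0" and t: "t > 0" and d: "d > 0" and N: "CARD('n) <= 3"
  and start: "2 * vol {x \<in> Om. z x > k} <= ballvol TYPE('n) t"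
  and large: "512 * t ^ 4 * (norm (cls g))^2 <= d^2 * lam^2 * ballvol TYPE('n) t"
 shows "ae x. z x <= k + d"
proof -
 have hz: "h10 Om z Z" and sg: "sqi g" using z by (auto simp: subsol_def)
 have zm: "z \<in> BM" using h10D(1)[OF hz] by (rule sqi_measurable)
 define kk where "kk j = k + d * (1 - (1/2) ^ j)" for j
 have kk: "kk j >= 0" for j using k d by (simp add: kk_def power_le_one)
 define S where "S j = {x \<in> Om. z x > kk j}" for j
 have Sl: "S j \<in> lmeasurable" for j unfolding S_def by (rule superlevel_lmeasurable[OF zm Om_lmeasurable])
 define V where "V = ballvol TYPE('n) t"
 have V: "V > 0" using t by (simp add: V_def ballvol_pos)
 have bv: "ballvol TYPE('n) (t / 4 ^ j) = (1 / 4 ^ j) ^ CARD('n) * V" for j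
  using ballvol_scale[of t "1 / 4 ^ j", where 'n='n] t by (simp add: V_def)
 have claim: "2 * vol (S j) <= ballvol TYPE('n) (t / 4 ^ j)" for j
 proof (induction j)
  case 0
  thus ?case using start by (simp add: S_def kk_def)
 next
  case (Suc j)
  define v where "v x = max 0 (z x - kk j)" for x
  define G where "G x = (if z x > kk j then Z x else 0)" for x
  have hv: "h10 Om v G" unfolding v_def G_def by (rule h10_pos_part[OF hz kk])
  have sv: "sqi v" using hv by (rule h10D)
  define X D where "X = (lint x. (v x)^2)" and "D = (lint x. (norm (G x))^2)"
  define s where "s = t / 4 ^ j"
  have s: "s > 0" using t by (simp add: s_def)
  have "\<forall>x. z x <= 0 --> v x = 0" "\<forall>x. 0 <= v x" using kk[of j] by (simp_all add: v_def)
  \<comment> \<open>The truncation \<open>v\<close> is itself an admissible test function because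
    the level \<open>kk j\<close> is nonnegative.\<close>
  hence "form Z G <= (lint x. g x * v x)" using z hv unfolding subsol_def by blast
  also have "\<dots> = inner (cls g) (cls v)" using sg sv by (simp add: cls_simps)
  also have "\<dots> <= norm (cls g) * norm (cls v)" by (rule norm_cauchy_schwarz)
  finally have "lam * D <= norm (cls g) * norm (cls v)"
   using form_elliptic[OF hv] form_trunc[where Z=Z and z=z and k="kk j"] by (simp add: D_def G_def[abs_def])
  moreover have "X <= s^2 * D" unfolding X_def D_def
  proof (rule faber_krahn[OF hv bounded_Om open_Om s Sl])
   show "ae x. x \<notin> S j --> v x = 0" using h10_zero_outside[OF hv]
    by eventually_elim (auto simp: S_def v_def)
   show "2 * vol (S j) <= ballvol TYPE('n) s" using Suc.IH by (simp add: s_def)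
  qed
  moreover have X: "X = (norm (cls v))^2" by (simp add: X_def norm_cls sv)
  ultimately have "lam * (norm (cls v))^2 <= s^2 * (norm (cls g) * norm (cls v))"
   using lam s by (smt (verit) mult.left_commute mult_left_mono zero_le_power2)
  hence "lam * norm (cls v) <= s^2 * norm (cls g)"
   by (cases "norm (cls v) = 0") (auto simp: power2_eq_square mult.assoc[symmetric])
  hence "(lam * norm (cls v))^2 <= (s^2 * norm (cls g))^2" using lam by (intro power_mono) auto
  hence vX: "lam^2 * X <= s ^ 4 * (norm (cls g))^2" by (simp add: X power_mult_distrib)
  define h where "h = d * (1/2) ^ Suc j"
  have h: "h >= 0" "h^2 = d^2 * (1/4) ^ Suc j" using d by (auto simp: h_def power_mult_distrib power2_eq_square power_mult_distrib[symmetric])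
  have "h^2 * vol (S (Suc j)) <= X" unfolding X_def
  proof (rule chebyshev_L2[OF sv Sl _ h(1)])
   show "ae x. x \<in> S (Suc j) --> h <= v x"
   proof (intro AE_I2 impI)
    fix x assume "x \<in> S (Suc j)"
    hence "z x > kk (Suc j)" by (simp add: S_def)
    moreover have "kk (Suc j) - kk j = h" by (simp add: kk_def h_def algebra_simps)
    ultimately show "h <= v x" unfolding v_def by linarith
   qed
  qed
  hence "lam^2 * (d^2 * (1/4) ^ Suc j * vol (S (Suc j))) <= s ^ 4 * (norm (cls g))^2"
   using vX lam by (smt (verit) h(2) mult_left_mono zero_le_power2)
  hence "512 * t ^ 4 * (lam^2 * d^2 * vol (S (Suc j))) <= 4 ^ Suc j * s ^ 4 * (512 * t ^ 4 * (norm (cls g))^2)"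
   using t by (simp add: field_simps power_one_over)
  also have "\<dots> <= 4 ^ Suc j * s ^ 4 * (d^2 * lam^2 * V)"
   using large s by (intro mult_left_mono) (auto simp: V_def)
  finally have "(lam^2 * d^2) * (512 * t ^ 4 * vol (S (Suc j))) <= (lam^2 * d^2) * (4 ^ Suc j * s ^ 4 * V)"
   by (simp add: algebra_simps)
  hence "512 * t ^ 4 * vol (S (Suc j)) <= 4 ^ Suc j * s ^ 4 * V"
   using lam d by (subst (asm) mult_le_cancel_left_pos) auto
  also have "\<dots> = 4 ^ Suc j * (1 / 4 ^ j) ^ 4 * V * t ^ 4" by (simp add: s_def power_divide)
  finally have "512 * vol (S (Suc j)) <= 4 ^ Suc j * (1 / 4 ^ j) ^ 4 * V"
   using t by (simp add: mult.commute mult.left_commute)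
  \<comment> \<open>The level gap contributes \<open>4 ^ Suc j\<close> and the radius
    \<open>t / 4 ^ j\<close> enters with its fourth power, which leaves the third power of
    \<open>1 / 4 ^ Suc j\<close>. The constant 512 in \<open>large\<close> is twice this 256 and so
    yields the factor 2 of the claim.\<close>
  also have "4 ^ Suc j * (1 / 4 ^ j) ^ 4 = 256 * (1 / (4 ^ Suc j :: real)) ^ 3"
  proof -
   have "4 * p * (1 / p) ^ 4 = 256 * (1 / (4 * p)) ^ 3" if "p > 0" for p :: real
    using that by (simp add: field_simps power3_eq_cube power4_eq_xxxx)
   from this[of "4 ^ j"] show ?thesis by simp
  qed
  finally have "2 * vol (S (Suc j)) <= (1 / 4 ^ Suc j) ^ 3 * V" by linarith
  moreover have le1: "1 / 4 ^ Suc j <= (1::real)" using one_le_power[of "4::real" "Suc j"] by (simp del: power_Suc)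
  \<comment> \<open>The dimension restriction enters here: decay with the third power of the radius
    is at least as fast as the decay of the ball volumes.\<close>
  moreover have "(1 / 4 ^ Suc j) ^ 3 * V <= (1 / 4 ^ Suc j) ^ CARD('n) * V"
   using V N le1 by (intro mult_right_mono power_decreasing) auto
  ultimately show ?case unfolding bv by linarith
 qed
 define T where "T = {x \<in> Om. z x > k + d}"
 have Tl: "T \<in> lmeasurable" unfolding T_def by (rule superlevel_lmeasurable[OF zm Om_lmeasurable])
 have "T \<subseteq> S j" for j
 proof
  fix x assume "x \<in> T"
  moreover have "kk j <= k + d" using d by (simp add: kk_def)
  ultimately show "x \<in> S j" by (auto simp: T_def S_def)
 qed
 hence "vol T <= vol (S j)" for j
  using Tl Sl by (intro measure_mono_fmeasurable) (auto simp: fmeasurableD)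
 hence "2 * vol T <= ballvol TYPE('n) (t / 4 ^ j)" for j using claim[of j] by (meson mult_left_mono order_trans zero_le_numeral)
 from null_if_small[OF Tl this t] h10_zero_outside[OF hz] show ?thesis
  by eventually_elim (use k d in \<open>auto simp: T_def not_less intro: add_nonneg_nonneg\<close>)
qed

text \<open>\<open>stampacchia\<close> is started at level 0 with a ball of at least twice the
  volume of \<open>Om\<close>, so its starting condition is automatic; \<open>K\<close> is the value
  for which \<open>large\<close> becomes an equality. The summands \<open>1 / real (Suc n)\<close>
  keep \<open>d\<close> positive when \<open>g\<close> is zero.\<close>

lemma ess_bound:
 assumes N: "CARD('n) <= 3"
 shows "\<exists>K\<ge>0. \<forall>z Z g. subsol z Z g --> (ae x. z x <= K * norm (cls g))"
proof -
 define b where "b = ballvol TYPE('n) 1"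
 have b: "b > 0" by (simp add: b_def ballvol_pos)
 define t where "t = max 1 (2 * vol Om / b)"
 have t: "t >= 1" by (simp add: t_def)
 have bt: "ballvol TYPE('n) t = t ^ CARD('n) * b" using ballvol_scale[of 1 t, where 'n='n] t by (simp add: b_def)
 have "2 * vol Om <= t * b" using b by (simp add: t_def field_simps max_def)
 also have "\<dots> <= t ^ CARD('n) * b" using b t self_le_power[of t "CARD('n)"] by (intro mult_right_mono) auto
 finally have st: "2 * vol Om <= ballvol TYPE('n) t" by (simp add: bt)
 have V: "ballvol TYPE('n) t > 0" using t by (simp add: ballvol_pos)
 define K where "K = sqrt (512 * t ^ 4 / (lam^2 * ballvol TYPE('n) t))"
 have K0: "K >= 0"
  unfolding K_def by (intro real_sqrt_ge_zero divide_nonneg_pos mult_pos_pos) (use V lam t in auto)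
 have K2: "K^2 * (lam^2 * ballvol TYPE('n) t) = 512 * t ^ 4" unfolding K_def by (subst real_sqrt_pow2) (use V lam t in \<open>auto intro!: divide_nonneg_pos mult_pos_pos\<close>)
 have "ae x. z x <= K * norm (cls g)" if z: "subsol z Z g" for z Z g
 proof -
  have zm: "z \<in> BM" using z by (auto simp: subsol_def intro: sqi_measurable h10D)
  have "ae x. z x <= 0 + (K * norm (cls g) + 1 / real (Suc n))" for n
  proof (rule stampacchia[OF z, of 0 t])
   show "K * norm (cls g) + 1 / real (Suc n) > 0" using K0 by (simp add: add_nonneg_pos)
   have "vol {x \<in> Om. 0 < z x} <= vol Om"
    using superlevel_lmeasurable[OF zm Om_lmeasurable] Om_lmeasurable by (intro measure_mono_fmeasurable) (auto simp: fmeasurableD)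
   thus "2 * vol {x \<in> Om. 0 < z x} <= ballvol TYPE('n) t" using st by simp
   have "512 * t ^ 4 * (norm (cls g))^2 = (K * norm (cls g))^2 * (lam^2 * ballvol TYPE('n) t)"
    unfolding K2[symmetric] by (simp add: power_mult_distrib)
   also have "\<dots> <= (K * norm (cls g) + 1 / real (Suc n))^2 * (lam^2 * ballvol TYPE('n) t)"
    using K0 V by (intro mult_right_mono power_mono) auto
   finally show "512 * t ^ 4 * (norm (cls g))^2 <= (K * norm (cls g) + 1 / real (Suc n))^2 * lam^2 * ballvol TYPE('n) t"
    by (simp add: mult.assoc)
  qed (use t N in auto)
  hence "ae x. \<forall>n. z x <= K * norm (cls g) + 1 / real (Suc n)" by (simp add: AE_all_countable)
  thus ?thesis
  proof eventually_elim
   case (elim x)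
   show ?case
   proof (rule field_le_epsilon)
    fix e :: real assume "e > 0"
    then obtain n where "1 / real (Suc n) < e" using nat_approx_posE by blast
    thus "z x <= K * norm (cls g) + e" using elim by (smt (verit))
   qed
  qed
 qed
 thus ?thesis using K0 by blast
qed

text \<open>Now \<open>t\<close> is chosen small, so that \<open>large\<close> holds with
  \<open>d = e/2\<close>; this is possible because \<open>t ^ 4\<close> is of smaller order than
  \<open>t ^ CARD('n)\<close>. The starting condition at level \<open>e/2\<close> then follows from
  a small L2 norm of \<open>z\<close> by Chebyshev's inequality.\<close>

lemma ess_bound_small:
 assumes N: "CARD('n) <= 3" and e: "e > 0" and R: "R >= 0"
 shows "\<exists>\<delta>>0. \<forall>z Z g. subsol z Z g --> norm (cls g) <= R --> norm (cls z) <= \<delta> --> (ae x. z x <= e)"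
proof -
 define b where "b = ballvol TYPE('n) 1"
 have b: "b > 0" by (simp add: b_def ballvol_pos)
 define c where "c = (e/2)^2 * lam^2 * b"
 have c: "c > 0" using e lam b by (simp add: c_def)
 define t where "t = min 1 (c / (512 * R^2 + 1))"
 have t: "0 < t" "t <= 1" using c by (auto simp: t_def intro!: divide_pos_pos add_nonneg_pos)
 have bt: "ballvol TYPE('n) t = t ^ CARD('n) * b" using ballvol_scale[of 1 t, where 'n='n] t by (simp add: b_def)
 have small: "512 * t ^ 4 * R^2 <= (e/2)^2 * lam^2 * ballvol TYPE('n) t"
 proof -
  have "t * (512 * R^2) <= t * (512 * R^2 + 1)" using t by (intro mult_left_mono) auto
  also have "\<dots> <= c"
  proof -
   have "512 * R^2 + 1 > 0" by (simp add: add_nonneg_pos)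
   moreover have "t <= c / (512 * R^2 + 1)" by (simp add: t_def)
   ultimately show ?thesis by (simp only: pos_le_divide_eq)
  qed
  finally have "t ^ 3 * (t * (512 * R^2)) <= t ^ 3 * c" using t by (intro mult_left_mono) auto
  also have "\<dots> <= t ^ CARD('n) * c" using t N c by (intro mult_right_mono power_decreasing) auto
  finally show ?thesis by (simp add: bt c_def algebra_simps power_Suc numeral_eq_Suc)
 qed
 define V where "V = ballvol TYPE('n) t"
 have V: "V > 0" using t by (simp add: V_def ballvol_pos)
 define \<delta> where "\<delta> = sqrt ((e/2)^2 * (V/2))"
 have \<delta>: "\<delta> > 0" using e V by (simp add: \<delta>_def)
 have "ae x. z x <= e" if z: "subsol z Z g" and g: "norm (cls g) <= R" and zd: "norm (cls z) <= \<delta>" for z Z g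
 proof -
  have sz: "sqi z" using z by (auto simp: subsol_def intro: h10D)
  have zm: "z \<in> BM" using sz by (rule sqi_measurable)
  have "ae x. z x <= e/2 + e/2"
  proof (rule stampacchia[OF z, of "e/2" t "e/2"])
   have "(e/2)^2 * vol {x \<in> Om. e/2 < z x} <= (lint x. (z x)^2)"
    using e by (intro chebyshev_L2[OF sz superlevel_lmeasurable[OF zm Om_lmeasurable]]) auto
   also have "\<dots> = (norm (cls z))^2" by (simp add: norm_cls sz)
   also have "\<dots> <= \<delta>^2" using zd by (intro power_mono) auto
   also have "\<dots> = (e/2)^2 * (V/2)" using V by (simp add: \<delta>_def)
   finally have "vol {x \<in> Om. e/2 < z x} <= V / 2" using e by simp
   thus "2 * vol {x \<in> Om. e/2 < z x} <= ballvol TYPE('n) t" by (simp add: V_def)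
   have "512 * t ^ 4 * (norm (cls g))^2 <= 512 * t ^ 4 * R^2" using g t by (intro mult_left_mono power_mono) auto
   thus "512 * t ^ 4 * (norm (cls g))^2 <= (e/2)^2 * lam^2 * ballvol TYPE('n) t" using small by linarith
  qed (use e t N in auto)
  thus ?thesis by simp
 qed
 thus ?thesis using \<delta> by blast
qed

end

section \<open>Local estimates\<close>

context elliptic
begin

text \<open>Variant of \<open>subsol\<close> for the local estimates: the right-hand side is a
  constant, but every nonnegative test function is allowed, so that in balls inside
  \<open>Om\<close> levels of either sign can be used.\<close>

definition lsub :: "(real ^ 'n => real) => (real ^ 'n => real ^ 'n) => real => bool" where
 "lsub u U Gam \<longleftrightarrow> h10 Om u U \<and>
  (\<forall>ph Ph. h10 Om ph Ph --> (\<forall>x. 0 <= ph x) --> form U Ph <= Gam * (lint x. ph x))"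

text \<open>In \<open>caccioppoli\<close> the weighted gradient is bounded by
  \<open>c0 = 2 / lam * (1 + 8 * Lam^2 / lam)\<close> times \<open>R^2 * H^2 * vol S\<close>, and
  the gradient of the product by twice this plus 8, the latter from the derivative of the
  cut-off.\<close>

definition C1 :: real where "C1 = 2 * (2 / lam * (1 + 8 * Lam^2 / lam)) + 8"

lemma C1_pos: "C1 > 0"
proof -
 have "0 <= 2 / lam * (1 + 8 * Lam^2 / lam)" using lam by simp
 thus ?thesis unfolding C1_def by linarith
qed

text \<open>The test function is \<open>et^2 * v\<close>. With a cut-off of height
  \<open>R^2\<close> and gradient at most \<open>2 * R\<close>, every term scales like
  \<open>R^2 * H^2 * vol S\<close>, and \<open>Gam * R^2 <= H\<close> brings the right-hand side to
  the same order. The alternative for \<open>k\<close> guarantees that the test function has zero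
  boundary values.\<close>

lemma caccioppoli:
 fixes u U x0 R k
 assumes u: "lsub u U Gam" and R: "R > 0" and H: "H > 0" and Gam: "Gam >= 0" "Gam * R^2 <= H"
  and k: "k >= 0 \<or> cball x0 R \<subseteq> Om"
  and le: "ae x. x \<in> ball x0 R --> u x <= k + H"
 defines "v \<equiv> %x. max 0 (u x - k)" and "V \<equiv> %x. if u x > k then U x else 0"
  and "S \<equiv> {x \<in> ball x0 R. u x > k}"
 shows "h10 Om (%x. cutf R x0 x * v x) (%x. cutf R x0 x *R V x + v x *R dcutf R x0 x)"
  "(lint x. (norm (cutf R x0 x *R V x + v x *R dcutf R x0 x))^2) <= C1 * R^2 * H^2 * vol S"
  "integrable lebesgue (%x. (cutf R x0 x)^2 * (norm (V x))^2)"
  "(lint x. (cutf R x0 x)^2 * (norm (V x))^2) <= C1 * R^2 * H^2 * vol S"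
proof -
 define et where "et = cutf R x0"
 define det where "det = dcutf R x0"
 have hu: "h10 Om u U" using u by (simp add: lsub_def)
 have um[measurable]: "u \<in> BM" using h10D(1)[OF hu] by (rule sqi_measurable)
 have ht: "h10 Om (%x. max 0 (u x - k) - max 0 (- k)) V" unfolding V_def by (rule h10_trunc[OF hu])
 define c where "c = max 0 (- k)"
 have c: "c = 0 \<or> cball x0 R \<subseteq> Om" using k by (auto simp: c_def max_def)
 have veq: "max 0 (u x - k) - max 0 (- k) + c = v x" for x by (simp add: v_def c_def)
 show hw: "h10 Om (%x. cutf R x0 x * v x) (%x. cutf R x0 x *R V x + v x *R dcutf R x0 x)"
  using h10_mult_cut'[OF ht R bounded_Om c] by (simp only: veq)
 define ph where "ph x = et x * (et x * v x)" for x
 define Ph where "Ph x = et x *R (et x *R V x + v x *R det x) + (et x * v x) *R det x" for x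
 have hph: "h10 Om ph Ph" unfolding ph_def[abs_def] Ph_def[abs_def] et_def det_def by (rule h10_mult_cut[OF hw R bounded_Om])
 have v0: "v x >= 0" for x by (simp add: v_def)
 have et0: "0 <= et x" "et x <= R^2" "norm (det x) <= 2 * R" for x using cut_bounds(1-3)[OF R, of x0 x] by (auto simp: et_def det_def)
 have out: "et x = 0" "det x = 0" if "x \<notin> ball x0 R" for x
  using cut_bounds(4,5)[OF R, of x x0] that by (auto simp: et_def det_def dist_norm norm_minus_commute)
 have ph0: "\<forall>x. 0 <= ph x" using v0 et0(1) by (simp add: ph_def)
 have Sl: "S \<in> lmeasurable" unfolding S_def by (rule superlevel_lmeasurable[OF um]) simp
 have iS: "integrable lebesgue (%x. cc * ind S x)" for cc :: real
  using Sl by (intro integrable_mult_right) (auto simp: fmeasurable_def)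
 have intS: "(lint x. cc * ind S x) = cc * vol S" for cc :: real
  using Sl by (simp add: fmeasurableD)
 have aeph: "ae x. ph x <= R ^ 4 * H * ind S x" using le
 proof eventually_elim
  case (elim x)
  show ?case
  proof (cases "x \<in> S")
   case True
   hence "v x <= H" using elim H by (auto simp: S_def v_def)
   hence "et x * (et x * v x) <= R^2 * (R^2 * H)" using et0 v0 by (intro mult_mono) auto
   thus ?thesis using True by (simp add: ph_def power2_eq_square power4_eq_xxxx mult.assoc)
  next
   case False
   hence "ph x = 0" using out(1)[of x] by (cases "x \<in> ball x0 R") (auto simp: ph_def S_def v_def)
   thus ?thesis using False by simp
  qed
 qed
 have iph: "integrable lebesgue ph"
 proof (rule Bochner_Integration.integrable_bound[OF iS[of "R ^ 4 * H"]])
  show "ph \<in> BM" using h10D(1)[OF hph] by (rule sqi_measurable)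
  show "ae x. norm (ph x) <= norm (R ^ 4 * H * ind S x)"
   using aeph by eventually_elim (use ph0 in auto)
 qed
 have "(lint x. ph x) <= R ^ 4 * H * vol S"
  using integral_mono_AE[OF iph iS aeph] by (simp only: intS)
 hence "Gam * (lint x. ph x) <= Gam * (R ^ 4 * H * vol S)" using Gam(1) by (rule mult_left_mono)
 also have "\<dots> = (Gam * R^2) * (R^2 * H * vol S)" by (simp add: power2_eq_square power4_eq_xxxx)
 also have "\<dots> <= H * (R^2 * H * vol S)" using Gam(2) H by (intro mult_right_mono) auto
 also have "\<dots> = R^2 * H^2 * vol S" by (simp add: power2_eq_square)
 finally have le1: "Gam * (lint x. ph x) <= R^2 * H^2 * vol S" .
 have "form U Ph <= Gam * (lint x. ph x)" using u hph ph0 unfolding lsub_def by blast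
 hence gph: "form U Ph <= R^2 * H^2 * vol S" using le1 by (rule order_trans)
 have sV: "sqv V" using ht by (rule h10D)
 have s1: "sqv (%x. et x *R V x)"
  by (rule sqv_scale_bounded[OF sV, where C="R^2"]) (use et0 in \<open>auto simp: et_def intro!: borel_lebesgue\<close>)
 have "sqv (%x. (et x *R V x + v x *R det x) - et x *R V x)"
  by (rule sqv_diff[OF _ s1]) (use h10D(2)[OF hw] in \<open>simp add: et_def det_def\<close>)
 hence s2: "sqv (%x. v x *R det x)" by simp
 define P where "P x = (norm (et x *R V x))^2" for x
 define D where "D x = (norm (v x *R det x))^2" for x
 have iP: "integrable lebesgue P" and iD: "integrable lebesgue D"
  unfolding P_def[abs_def] D_def[abs_def] using sqi_square_integrable[OF sqi_norm[OF s1]] sqi_square_integrable[OF sqi_norm[OF s2]] by auto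
 have P_alt: "P = (%x. (cutf R x0 x)^2 * (norm (V x))^2)" by (auto simp: P_def et_def power_mult_distrib fun_eq_iff)
 show "integrable lebesgue (%x. (cutf R x0 x)^2 * (norm (V x))^2)" using iP by (simp only: P_alt)
 have "ae x. D x <= 4 * R^2 * H^2 * ind S x" using le
 proof eventually_elim
  case (elim x)
  show ?case
  proof (cases "x \<in> S")
   case True
   hence "v x <= H" using elim H by (auto simp: S_def v_def)
   hence "(norm (v x *R det x))^2 <= (H * (2 * R))^2"
    using et0(3)[of x] v0[of x] by (intro power_mono) (auto intro!: mult_mono)
   thus ?thesis using True by (simp add: D_def power_mult_distrib mult.commute mult.left_commute)
  next
   case False
   hence "v x *R det x = 0" using out(2)[of x] by (cases "x \<in> ball x0 R") (auto simp: S_def v_def)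
   thus ?thesis using False by (simp add: D_def)
  qed
 qed
 from integral_mono_AE[OF iD iS this] have Dle: "(lint x. D x) <= 4 * R^2 * H^2 * vol S" by (simp only: intS)
 \<comment> \<open>Young's inequality
   \<open>2 * Lam * p * q <= lam / 2 * p^2 + 2 * Lam^2 / lam * q^2\<close> absorbs the mixed term;
   where \<open>u x <= k\<close> both sides are zero.\<close>
 have "(lint x. lam / 2 * P x - 2 * Lam^2 / lam * D x) <= form U Ph" unfolding form_def
 proof (rule integral_mono_AE)
  show "integrable lebesgue (%x. bil x (U x) (Ph x))" by (rule bil_integrable[OF h10D(2)[OF hu] h10D(2)[OF hph]])
  show "ae x. lam / 2 * P x - 2 * Lam^2 / lam * D x <= bil x (U x) (Ph x)"
   using bil_bounded bil_elliptic h10_zero_outside[OF ht]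
  proof eventually_elim
   case (elim x)
   show ?case
   proof (cases "u x > k")
    case False
    hence "V x = 0" "v x = 0" by (auto simp: V_def v_def)
    thus ?thesis by (simp add: P_def D_def Ph_def bil_simps)
   next
    case True
    hence UV: "U x = V x" by (simp add: V_def)
    have e: "lam * (norm (V x))^2 <= bil x (V x) (V x)" using elim by (cases "x \<in> Om") (auto simp: bil_simps)
    define p q where "p = et x * norm (V x)" and "q = v x * norm (det x)"
    have Pp: "P x = p^2" "D x = q^2" by (simp_all add: P_def D_def p_def q_def power_mult_distrib)
    have "\<bar>bil x (V x) (det x)\<bar> <= Lam * norm (V x) * norm (det x)" using elim(1) by blast
    hence b0: "(et x * v x) * \<bar>bil x (V x) (det x)\<bar> <= (et x * v x) * (Lam * norm (V x) * norm (det x))"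
     using et0(1) v0 by (intro mult_left_mono) auto
    have b1: "et x * v x * bil x (V x) (det x) >= - (Lam * (p * q))"
    proof -
     have "0 <= et x * v x" using et0(1) v0 by simp
     hence "- (et x * v x * bil x (V x) (det x)) <= (et x * v x) * \<bar>bil x (V x) (det x)\<bar>"
      using mult_left_mono[of "- bil x (V x) (det x)" "\<bar>bil x (V x) (det x)\<bar>" "et x * v x"] by simp
     also note b0
     also have "(et x * v x) * (Lam * norm (V x) * norm (det x)) = Lam * (p * q)" by (simp add: p_def q_def)
     finally show ?thesis by simp
    qed
    have b2: "lam * p^2 <= (et x)^2 * bil x (V x) (V x)"
     using mult_left_mono[OF e, of "(et x)^2"] by (simp add: p_def power_mult_distrib mult.left_commute)
    have "bil x (U x) (Ph x) = (et x)^2 * bil x (V x) (V x) + 2 * (et x * v x * bil x (V x) (det x))"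
     unfolding UV Ph_def bil_simps power2_eq_square by algebra
    also have "\<dots> >= lam * p^2 - 2 * (Lam * (p * q))" using b1 b2 by linarith
    moreover have "lam / 2 * p^2 - 2 * Lam^2 / lam * q^2 <= lam * p^2 - 2 * (Lam * (p * q))"
    proof -
     have "0 <= (lam * p - 2 * Lam * q)^2 / (2 * lam)" using lam by simp
     also have "\<dots> = lam / 2 * p^2 - 2 * (Lam * (p * q)) + 2 * Lam^2 / lam * q^2"
      using lam by (simp add: power2_eq_square field_simps)
     finally show ?thesis by simp
    qed
    ultimately show ?thesis unfolding Pp by linarith
   qed
  qed
 qed (use iP iD in auto)
 hence "lam / 2 * (lint x. P x) <= R^2 * H^2 * vol S + 2 * Lam^2 / lam * (lint x. D x)"
  using gph iP iD by simp
 also have "\<dots> <= R^2 * H^2 * vol S + 2 * Lam^2 / lam * (4 * R^2 * H^2 * vol S)"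
  using Dle lam by (intro add_left_mono mult_left_mono) auto
 also have "\<dots> = (1 + 8 * Lam^2 / lam) * (R^2 * H^2 * vol S)" by (simp add: algebra_simps)
 finally have x1: "2 / lam * (lam / 2 * (lint x. P x)) <= 2 / lam * ((1 + 8 * Lam^2 / lam) * (R^2 * H^2 * vol S))"
  using lam by (intro mult_left_mono) auto
 have Ple: "(lint x. P x) <= 2 / lam * (1 + 8 * Lam^2 / lam) * (R^2 * H^2 * vol S)"
 proof -
  have "2 / lam * (lam / 2 * (lint x. P x)) = (lint x. P x)" using lam by simp
  thus ?thesis using x1 by (simp only: mult.assoc)
 qed
 define M where "M = R^2 * H^2 * vol S"
 have M: "M >= 0" by (simp add: M_def)
 define c0 where "c0 = 2 / lam * (1 + 8 * Lam^2 / lam)"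
 have c0: "c0 >= 0" using lam by (simp add: c0_def)
 have PM: "(lint x. P x) <= c0 * M" using Ple by (simp add: c0_def M_def)
 have C1M: "C1 * R^2 * H^2 * vol S = 2 * (c0 * M) + 8 * M" by (simp add: C1_def c0_def M_def algebra_simps)
 show "(lint x. (cutf R x0 x)^2 * (norm (V x))^2) <= C1 * R^2 * H^2 * vol S"
  unfolding P_alt[symmetric] C1M using PM M c0 mult_nonneg_nonneg[OF c0 M] by linarith
 have "(lint x. (norm (et x *R V x + v x *R det x))^2) <= (lint x. 2 * P x + 2 * D x)"
 proof (rule integral_mono)
  show "integrable lebesgue (%x. (norm (et x *R V x + v x *R det x))^2)"
   using sqi_square_integrable[OF sqi_norm[OF h10D(2)[OF hw]]] by (simp add: et_def det_def)
  fix x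
  have "norm (et x *R V x + v x *R det x) <= norm (et x *R V x) + norm (v x *R det x)" by (rule norm_triangle_ineq)
  hence "(norm (et x *R V x + v x *R det x))^2 <= (norm (et x *R V x) + norm (v x *R det x))^2" by (intro power_mono) auto
  also have "\<dots> <= 2 * P x + 2 * D x" unfolding P_def D_def using sum_squares_bound[of "norm (et x *R V x)" "norm (v x *R det x)"]
   by (simp only: power2_sum)
  finally show "(norm (et x *R V x + v x *R det x))^2 <= 2 * P x + 2 * D x" .
 qed (use iP iD in auto)
 also have "\<dots> = 2 * (lint x. P x) + 2 * (lint x. D x)" using iP iD by simp
 also have "\<dots> <= C1 * R^2 * H^2 * vol S" unfolding C1M using PM Dle by (simp add: M_def mult.assoc)
 finally show "(lint x. (norm (cutf R x0 x *R V x + v x *R dcutf R x0 x))^2) <= C1 * R^2 * H^2 * vol S"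
  by (simp only: et_def det_def)
qed

text \<open>Chosen so that \<open>th0^2 * (64 * C1)\<close> is \<open>(1/4) ^ CARD('n)\<close>, the
  volume ratio of the comparison balls in consecutive steps of
  \<open>small_measure_bound\<close>.\<close>

definition th0 :: real where "th0 = sqrt ((1/4) ^ CARD('n) / (64 * C1))"

lemma th0_pos: "th0 > 0" using C1_pos by (simp add: th0_def)

text \<open>De Giorgi's iteration on shrinking balls \<open>rr j\<close> and rising levels
  \<open>kk j\<close>: \<open>faber_krahn\<close> for the truncation times the cut-off, with
  \<open>caccioppoli\<close> for its gradient, bounds the measure of each superlevel set by a fixed
  fraction of the previous one.\<close>

lemma small_measure_bound:
 assumes u: "lsub u U Gam" and r: "r > 0" and H: "H > 0" and Gam: "Gam >= 0" "Gam * (2 * r)^2 <= H"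
  and k: "k >= 0 \<or> cball x0 (2 * r) \<subseteq> Om"
  and le: "ae x. x \<in> ball x0 (2 * r) --> u x <= k + H"
  and start: "2 * vol {x \<in> ball x0 (2 * r). u x > k} <= ballvol TYPE('n) (th0 * r)"
 shows "ae x. x \<in> ball x0 r --> u x <= k + H / 2"
proof -
 have hu: "h10 Om u U" using u by (simp add: lsub_def)
 have um: "u \<in> BM" using h10D(1)[OF hu] by (rule sqi_measurable)
 define rr where "rr j = r * (1 + (1/2) ^ j)" for j
 define kk where "kk j = k + H / 2 * (1 - (1/2) ^ j)" for j
 have rr: "rr j > 0" "rr j <= 2 * r" "r <= rr j" for j
  using r by (auto simp: rr_def power_le_one intro!: mult_pos_pos add_pos_nonneg)
 have kk: "k <= kk j" for j using H by (simp add: kk_def power_le_one)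
 define S where "S j = {x \<in> ball x0 (rr j). u x > kk j}" for j
 have Sl: "S j \<in> lmeasurable" for j unfolding S_def by (rule superlevel_lmeasurable[OF um]) simp
 define t where "t = th0 * r"
 have t: "t > 0" using th0_pos r by (simp add: t_def)
 have claim: "2 * vol (S j) <= ballvol TYPE('n) (t / 4 ^ j)" for j
 proof (induction j)
  case 0
  thus ?case using start by (simp add: S_def kk_def rr_def t_def mult.commute)
 next
  case (Suc j)
  define v where "v x = max 0 (u x - kk j)" for x
  define w where "w x = cutf (rr j) x0 x * v x" for x
  define G where "G x = cutf (rr j) x0 x *R (if u x > kk j then U x else 0) + v x *R dcutf (rr j) x0 x" for x
  have g1: "Gam * (rr j)^2 <= H"
  proof -
   have "Gam * (rr j)^2 <= Gam * (2 * r)^2" using rr[of j] Gam by (intro mult_left_mono power_mono) auto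
   thus ?thesis using Gam by linarith
  qed
  have g2: "kk j >= 0 \<or> cball x0 (rr j) \<subseteq> Om"
   using k kk[of j] rr(2)[of j] subset_cball[of "rr j" "2 * r" x0] by (auto simp del: subset_iff)
  have g3: "ae x. x \<in> ball x0 (rr j) --> u x <= kk j + H" using le
  proof eventually_elim
   case (elim x)
   show ?case
   proof
    assume "x \<in> ball x0 (rr j)"
    hence "x \<in> ball x0 (2 * r)" using rr(2)[of j] by simp
    with elim kk[of j] show "u x <= kk j + H" by simp
   qed
  qed
  note cac = caccioppoli[OF u rr(1) H Gam(1) g1 g2 g3]
  have hw: "h10 Om w G" using cac(1) by (simp add: w_def[abs_def] G_def[abs_def] v_def)
  have GG: "(lint x. (norm (G x))^2) <= C1 * (rr j)^2 * H^2 * vol (S j)"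
   using cac(2) by (simp add: G_def v_def S_def)
  define s where "s = t / 4 ^ j"
  have s: "s > 0" using t by (simp add: s_def)
  have W1: "(lint x. (w x)^2) <= s^2 * (lint x. (norm (G x))^2)"
  proof (rule faber_krahn[OF hw bounded_Om open_Om s Sl])
   show "ae x. x \<notin> S j --> w x = 0"
   proof (intro AE_I2 impI)
    fix x assume "x \<notin> S j"
    thus "w x = 0" using cut_bounds(4)[OF rr(1)[of j], of x x0]
     by (cases "x \<in> ball x0 (rr j)") (auto simp: w_def v_def S_def dist_norm norm_minus_commute)
   qed
   show "2 * vol (S j) <= ballvol TYPE('n) s" using Suc.IH by (simp add: s_def)
  qed
  \<comment> \<open>A lower bound for \<open>w\<close> on the next superlevel set: the least height
    of the cut-off on the next smaller ball times the gap between the two levels.\<close>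
  define m where "m = (r^2 * (1/2) ^ j) * (H * (1/2) ^ j / 4)"
  have m: "m >= 0" using H by (simp add: m_def)
  have W2: "m^2 * vol (S (Suc j)) <= (lint x. (w x)^2)"
  proof (rule chebyshev_L2[OF h10D(1)[OF hw] Sl _ m], intro AE_I2 impI)
   fix x assume x: "x \<in> S (Suc j)"
   have "norm (x - x0) < rr (Suc j)" using x by (simp add: S_def dist_norm norm_minus_commute)
   hence "(norm (x - x0))^2 <= (rr (Suc j))^2" by (intro power_mono) auto
   moreover have "(rr j)^2 - (rr (Suc j))^2 >= r^2 * (1/2) ^ j"
   proof -
    have "(rr j)^2 - (rr (Suc j))^2 = (rr j - rr (Suc j)) * (rr j + rr (Suc j))" by (simp add: power2_eq_square algebra_simps)
    also have "rr j - rr (Suc j) = r * (1/2) ^ j / 2" by (simp add: rr_def algebra_simps)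
    also have "r * (1/2) ^ j / 2 * (rr j + rr (Suc j)) >= r * (1/2) ^ j / 2 * (2 * r)"
     using rr(3)[of j] rr(3)[of "Suc j"] r by (intro mult_left_mono) auto
    finally show ?thesis by (simp add: power2_eq_square algebra_simps)
   qed
   ultimately have c: "r^2 * (1/2) ^ j <= cutf (rr j) x0 x" unfolding cutf_def by linarith
   have "u x > kk (Suc j)" using x by (simp add: S_def)
   moreover have "kk (Suc j) - kk j = H * (1/2) ^ j / 4" by (simp add: kk_def algebra_simps)
   ultimately have "H * (1/2) ^ j / 4 <= v x" unfolding v_def by linarith
   thus "m <= w x" unfolding m_def w_def using c H by (intro mult_mono) (auto intro: order_trans[OF _ c])
  qed
  have "m^2 * vol (S (Suc j)) <= s^2 * (C1 * (rr j)^2 * H^2 * vol (S j))"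
   using W1 W2 mult_left_mono[OF GG, of "s^2"] by (meson order_trans zero_le_power2)
  also have "\<dots> <= s^2 * (C1 * (2 * r)^2 * H^2 * vol (S j))"
   using rr[of j] C1_pos by (intro mult_left_mono mult_right_mono power_mono) auto
  finally have main: "m^2 * vol (S (Suc j)) <= s^2 * (C1 * (2 * r)^2 * H^2 * vol (S j))" .
  \<comment> \<open>The powers of 1/2 in \<open>m^2\<close>, from cut-off height and level gap, and
    in \<open>s^2\<close>, from the radius, are both \<open>p\<close> and cancel; this is why radii
    are divided by 4. What remains is \<open>64 * C1 * th0^2\<close>, where 64 is 16 from
    \<open>m^2\<close> times 4 from \<open>(2 * r)^2\<close>.\<close>
  define p where "p = ((1/2 :: real) ^ j) ^ 4"
  have p: "p > 0" by (simp add: p_def)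
  have m2: "m^2 = p * (r ^ 4 * H^2 / 16)" by (simp add: m_def p_def power2_eq_square power4_eq_xxxx)
  have s2: "s^2 = p * (th0^2 * r^2)"
  proof -
   have "(1/4 :: real) ^ j = (1/2) ^ j * (1/2) ^ j" by (simp add: power_mult_distrib[symmetric])
   hence "s = th0 * r * ((1/2) ^ j * (1/2) ^ j)" by (simp add: s_def t_def power_one_over)
   thus ?thesis by (simp add: p_def power2_eq_square power4_eq_xxxx)
  qed
  have th: "th0^2 * (64 * C1) = (1/4) ^ CARD('n)" using C1_pos by (simp add: th0_def)
  have "(p * r ^ 4 * H^2) * vol (S (Suc j)) <= (p * r ^ 4 * H^2) * (th0^2 * (64 * C1) * vol (S j))"
   using main unfolding m2 s2 by (simp add: power2_eq_square power4_eq_xxxx field_simps)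
  hence "vol (S (Suc j)) <= (1/4) ^ CARD('n) * vol (S j)"
   unfolding th using p r H by (subst (asm) mult_le_cancel_left_pos) auto
  hence "2 * vol (S (Suc j)) <= (1/4) ^ CARD('n) * (2 * vol (S j))" by simp
  also have "\<dots> <= (1/4) ^ CARD('n) * ballvol TYPE('n) (t / 4 ^ j)" by (intro mult_left_mono Suc.IH) auto
  also have "\<dots> = ballvol TYPE('n) (t / 4 ^ Suc j)"
   using ballvol_scale[of "t / 4 ^ j" "1/4", where 'n='n] t by simp
  finally show ?case .
 qed
 define T where "T = {x \<in> ball x0 r. u x > k + H / 2}"
 have Tl: "T \<in> lmeasurable" unfolding T_def by (rule superlevel_lmeasurable[OF um]) simp
 have "T \<subseteq> S j" for j
 proof
  fix x assume "x \<in> T"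
  moreover have "kk j <= k + H / 2" using H by (simp add: kk_def)
  ultimately show "x \<in> S j" using rr(3)[of j] by (auto simp: T_def S_def)
 qed
 hence "vol T <= vol (S j)" for j
  using Tl Sl by (intro measure_mono_fmeasurable) (auto simp: fmeasurableD)
 hence "2 * vol T <= ballvol TYPE('n) (t / 4 ^ j)" for j using claim[of j] by (meson mult_left_mono order_trans zero_le_numeral)
 from null_if_small[OF Tl this t] show ?thesis by eventually_elim (auto simp: T_def not_less)
qed


section \<open>Reduction of the oscillation\<close>

definition C2 :: real where "C2 = 64 * 8 ^ CARD('n) * C1"

lemma C2_pos: "C2 > 0" using C1_pos by (simp add: C2_def)

text \<open>The Poincare inequality for the truncation of \<open>u\<close> between two consecutive levels.\<close>

lemma level_step:
 assumes u: "lsub u U Gam" and r: "r > 0" and h: "h > 0" and Gam: "Gam >= 0" "Gam * (2 * r)^2 <= h"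
  and k: "k >= 0 \<or> cball x0 (2 * r) \<subseteq> Om"
  and le: "ae x. x \<in> ball x0 (2 * r) --> u x <= k + h"
  and \<theta>: "\<theta> > 0" "\<theta> * ballvol TYPE('n) r <= vol {x \<in> ball x0 r. u x <= k}"
 shows "\<theta>^2 * (vol {x \<in> ball x0 r. u x > k + h / 2})^2
  <= C2 * ballvol TYPE('n) r * (vol {x \<in> ball x0 r. u x > k} - vol {x \<in> ball x0 r. u x > k + h / 2})"
proof -
 define b where "b = ballvol TYPE('n) r"
 have b: "b > 0" using r by (simp add: b_def ballvol_pos)
 have hu: "h10 Om u U" using u by (simp add: lsub_def)
 have um[measurable]: "u \<in> BM" using h10D(1)[OF hu] by (rule sqi_measurable)
 define S S1 E D where "S = {x \<in> ball x0 r. u x > k}" and "S1 = {x \<in> ball x0 r. u x > k + h / 2}"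
  and "E = {x \<in> ball x0 r. u x <= k}" and "D = S - S1"
 have Sl: "S \<in> lmeasurable" "S1 \<in> lmeasurable" unfolding S_def S1_def by (rule superlevel_lmeasurable[OF um], simp)+
 have sub: "S1 \<subseteq> S" using h by (auto simp: S_def S1_def)
 have Dl: "D \<in> lmeasurable" unfolding D_def using Sl by (rule fmeasurable_Diff[OF _ fmeasurableD])
 have Dm: "vol D = vol S - vol S1"
  unfolding D_def using Sl sub by (intro measurable_measure_Diff) (auto simp: fmeasurableD)
 have "E = ball x0 r - S" by (auto simp: E_def S_def)
 hence Es: "E \<in> sets lebesgue" using Sl by (auto simp: fmeasurableD)
 define V where "V x = (if u x > k then U x else 0)" for x
 \<comment> \<open>\<open>w + c\<close> is \<open>u - k\<close> cut to the interval from 0 to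
   \<open>h / 2\<close>: it vanishes on \<open>E\<close>, equals \<open>h / 2\<close> on
   \<open>S1\<close>, and its gradient in the ball lives on \<open>D\<close>.\<close>
 define w where "w x = (max 0 (u x - k) - max 0 (- k)) - (max 0 (u x - (k + h / 2)) - max 0 (- (k + h / 2)))" for x
 define G where "G x = V x - (if u x > k + h / 2 then U x else 0)" for x
 define c where "c = max 0 (- k) - max 0 (- (k + h / 2))"
 have hw: "h10 Om w G" unfolding w_def[abs_def] G_def[abs_def] V_def by (rule h10_diff[OF h10_trunc[OF hu] h10_trunc[OF hu]])
 have sG: "sqv G" using hw by (rule h10D)
 have wc: "w x + c = max 0 (u x - k) - max 0 (u x - (k + h / 2))" for x by (simp add: w_def c_def)
 have "vol E * (lint x. ind (ball x0 r) x * \<bar>w x + c\<bar>)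
  <= 2 ^ CARD('n) * (2 * r) * vol (ball x0 r) * (lint x. ind (ball x0 r) x * norm (G x))
   + vol (ball x0 r) * (lint x. ind E x * \<bar>w x + c\<bar>)"
 proof (rule poincare_inequality[OF hw])
  fix x y assume "x \<in> ball x0 r" "y \<in> ball x0 r"
  thus "dist x y <= 2 * r" using dist_triangle3[of x y x0] by simp
 qed (use r Es in \<open>auto simp: E_def\<close>)
 moreover have "(lint x. ind E x * \<bar>w x + c\<bar>) = 0"
 proof -
  have "ind E x * \<bar>w x + c\<bar> = 0" for x unfolding wc using h by (auto simp: E_def indicator_def)
  hence "(%x. ind E x * \<bar>w x + c\<bar>) = (%x. 0)" by (rule ext)
  thus ?thesis by (simp only:) simp
 qed
 ultimately have P: "vol E * (lint x. ind (ball x0 r) x * \<bar>w x + c\<bar>)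
  <= 2 ^ CARD('n) * (2 * r) * b * (lint x. ind (ball x0 r) x * norm (G x))"
  by (simp add: measure_ball b_def)
 define X where "X = (lint x. ind D x * norm (V x))"
 have "ind (ball x0 r) x * norm (G x) = ind D x * norm (V x)" for x
  using h by (auto simp: indicator_def D_def S_def S1_def G_def V_def)
 hence XG: "(lint x. ind (ball x0 r) x * norm (G x)) = X" by (simp add: X_def)
 have iw: "integrable lebesgue (%x. ind (ball x0 r) x * \<bar>w x + c\<bar>)"
 proof -
  have "integrable lebesgue (%x. ind (ball x0 r) x * w x + c * ind (ball x0 r) x)"
   using integrable_indicator_mult[OF lmeasurable_ball h10D(1)[OF hw]] lmeasurable_ball[of x0 r]
   by (intro Bochner_Integration.integrable_add integrable_mult_right) (auto simp: fmeasurable_def)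
  from integrable_abs[OF this] show ?thesis
   by (rule Bochner_Integration.integrable_cong[THEN iffD1, rotated -1]) (auto simp: indicator_def)
 qed
 have "h / 2 * vol S1 <= (lint x. ind (ball x0 r) x * \<bar>w x + c\<bar>)"
 proof -
  have "(lint x. h / 2 * ind S1 x) <= (lint x. ind (ball x0 r) x * \<bar>w x + c\<bar>)"
  proof (rule integral_mono[OF _ iw])
   show "integrable lebesgue (%x. h / 2 * ind S1 x)" using Sl by (intro integrable_mult_right) (auto simp: fmeasurable_def)
   show "h / 2 * ind S1 x <= ind (ball x0 r) x * \<bar>w x + c\<bar>" for x
    unfolding wc using h by (auto simp: indicator_def S1_def)
  qed
  thus ?thesis using Sl by (simp add: fmeasurableD)
 qed
 hence "(\<theta> * b) * (h / 2 * vol S1) <= vol E * (lint x. ind (ball x0 r) x * \<bar>w x + c\<bar>)"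
  using \<theta> h by (intro mult_mono) (auto simp: E_def b_def)
 also note P
 finally have "(b * (1/2)) * (\<theta> * h * vol S1) <= (b * (1/2)) * (4 * 2 ^ CARD('n) * r * X)"
  unfolding XG by (simp add: mult_ac)
 hence "\<theta> * h * vol S1 <= 4 * 2 ^ CARD('n) * r * X" using b by (subst (asm) mult_le_cancel_left_pos) auto
 hence main: "(\<theta> * h * vol S1)^2 <= (4 * 2 ^ CARD('n) * r * X)^2" using \<theta> h by (intro power_mono) auto
 have r2: "2 * r > 0" using r by simp
 note cac = caccioppoli[OF u r2 h Gam k le]
 define et where "et = cutf (2 * r) x0"
 have sV: "sqv V" using h10_trunc[OF hu] unfolding V_def[abs_def] by (rule h10D)
 have sV': "sqi (%x. norm (V x))" using sV by (rule sqi_norm)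
 have sDV: "sqi (%x. ind D x * norm (V x))" using Dl sV' by (intro sqi_indicator_mult) (auto simp: fmeasurableD)
 have "X^2 = (lint x. \<bar>ind D x * norm (V x)\<bar>)^2" by (simp add: X_def)
 also have "\<dots> <= vol D * (lint x. (ind D x * norm (V x))^2)"
  by (rule L1_le_L2[OF sDV Dl]) (auto simp: indicator_def)
 finally have X2: "X^2 <= vol D * (lint x. (ind D x * norm (V x))^2)" .
 \<comment> \<open>On the ball of radius \<open>r\<close>, which contains \<open>D\<close>, the
   cut-off of radius \<open>2 * r\<close> is at least \<open>r^2\<close>.\<close>
 have "(lint x. (r^2)^2 * (ind D x * norm (V x))^2) <= (lint x. (et x)^2 * (norm (V x))^2)"
 proof (rule integral_mono)
  show "integrable lebesgue (%x. (r^2)^2 * (ind D x * norm (V x))^2)"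
   using sqi_square_integrable[OF sDV] by simp
  show "integrable lebesgue (%x. (et x)^2 * (norm (V x))^2)" using cac(3) by (simp add: et_def V_def)
  fix x
  show "(r^2)^2 * (ind D x * norm (V x))^2 <= (et x)^2 * (norm (V x))^2"
  proof (cases "x \<in> D")
   case True
   hence "norm (x - x0) < r" by (auto simp: D_def S_def dist_norm norm_minus_commute)
   hence "(norm (x - x0))^2 <= r^2" by (intro power_mono) auto
   hence "r^2 <= et x" unfolding et_def cutf_def by (simp add: power_mult_distrib)
   hence "(r^2)^2 <= (et x)^2" by (intro power_mono) auto
   hence "(r^2)^2 * (norm (V x))^2 <= (et x)^2 * (norm (V x))^2" by (rule mult_right_mono) simp
   thus ?thesis using True by simp
  qed simp
 qed
 also have "\<dots> <= C1 * (2 * r)^2 * h^2 * vol {x \<in> ball x0 (2 * r). u x > k}" using cac(4) by (simp add: et_def V_def)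
 also have "\<dots> <= C1 * (2 * r)^2 * h^2 * (2 ^ CARD('n) * b)"
 proof -
  have "vol {x \<in> ball x0 (2 * r). u x > k} <= vol (ball x0 (2 * r))"
   using superlevel_lmeasurable[OF um lmeasurable_ball] by (intro measure_mono_fmeasurable) (auto simp: fmeasurableD)
  also have "\<dots> = 2 ^ CARD('n) * b" unfolding measure_ball b_def using r by (intro ballvol_scale) auto
  finally show ?thesis using C1_pos by (intro mult_left_mono) auto
 qed
 finally have V2: "r ^ 4 * (lint x. (ind D x * norm (V x))^2) <= 4 * r^2 * (C1 * h^2 * (2 ^ CARD('n) * b))"
  by (simp add: power_mult_distrib mult_ac)
 have "r ^ 4 * X^2 <= vol D * (r ^ 4 * (lint x. (ind D x * norm (V x))^2))"
  using mult_left_mono[OF X2, of "r ^ 4"] by (simp add: mult.left_commute)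
 also have "\<dots> <= vol D * (4 * r^2 * (C1 * h^2 * (2 ^ CARD('n) * b)))" using V2 by (rule mult_left_mono) simp
 finally have "r^2 * (r^2 * X^2) <= r^2 * (4 * C1 * h^2 * 2 ^ CARD('n) * b * vol D)"
  by (simp add: mult_ac power2_eq_square power4_eq_xxxx)
 hence X3: "r^2 * X^2 <= 4 * C1 * h^2 * 2 ^ CARD('n) * b * vol D"
  using r by (subst (asm) mult_le_cancel_left_pos) auto
 have "h^2 * (\<theta>^2 * (vol S1)^2) <= 16 * 4 ^ CARD('n) * (r^2 * X^2)"
 proof -
  have e: "(4 * 2 ^ CARD('n) * r * X)^2 = 16 * 4 ^ CARD('n) * (r^2 * X^2)"
   by (simp add: power_mult_distrib power_mult[symmetric] mult.commute[of _ 2]) (simp add: power_mult)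
  show ?thesis using main unfolding e by (simp add: power_mult_distrib mult_ac)
 qed
 also have "\<dots> <= 16 * 4 ^ CARD('n) * (4 * C1 * h^2 * 2 ^ CARD('n) * b * vol D)"
  using X3 by (intro mult_left_mono) auto
 \<comment> \<open>\<open>C2\<close> collects \<open>16 * 4 ^ CARD('n)\<close> from the squared
   Poincare constant and \<open>4 * C1 * 2 ^ CARD('n)\<close> from the Caccioppoli estimate on the
   ball of twice the radius.\<close>
 also have "\<dots> = h^2 * (C2 * b * vol D)"
 proof -
  have "(8::real) ^ CARD('n) = 4 ^ CARD('n) * 2 ^ CARD('n)" by (simp add: power_mult_distrib[symmetric])
  thus ?thesis by (simp add: C2_def)
 qed
 finally have "\<theta>^2 * (vol S1)^2 <= C2 * b * vol D"
  using h by (subst (asm) mult_le_cancel_left_pos) auto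
 thus ?thesis unfolding Dm by (simp add: S_def S1_def b_def)
qed

text \<open>Summing \<open>level_step\<close> over \<open>J\<close> levels telescopes to
  \<open>J * (\<theta>^2 * (M J)^2) <= C2 * b * b\<close>, so for large \<open>J\<close> the highest
  superlevel set is small enough for \<open>small_measure_bound\<close>. \<open>J\<close> is chosen
  before the solution, the ball and the levels, and this is what allows the step to be
  iterated.\<close>

lemma oscillation_step:
 assumes \<theta>: "\<theta> > 0"
 shows "\<exists>J. \<forall>u U Gam x0 r k H. lsub u U Gam --> r > 0 --> H > 0 --> Gam >= 0 --> Gam * (2 * r)^2 <= H / 2 ^ J -->
  k >= 0 \<or> cball x0 (2 * r) \<subseteq> Om -->
  (ae x. x \<in> ball x0 (2 * r) --> u x <= k + H) -->
  \<theta> * ballvol TYPE('n) r <= vol {x \<in> ball x0 r. u x <= k} -->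
  (ae x. x \<in> ball x0 (r / 2) --> u x <= k + (1 - 1 / 2 ^ Suc J) * H)"
proof -
 \<comment> \<open>The relative measure tolerated by \<open>small_measure_bound\<close> when it is
   applied with radius \<open>r / 2\<close>.\<close>
 define \<tau> where "\<tau> = (th0 / 2) ^ CARD('n) / 2"
 have \<tau>: "\<tau> > 0" using th0_pos by (simp add: \<tau>_def)
 obtain J :: nat where J: "real J > C2 / (\<theta>^2 * \<tau>^2)" using reals_Archimedean2 by blast
 have J2: "C2 < real J * (\<theta>^2 * \<tau>^2)" using J \<theta> \<tau> by (simp add: pos_divide_less_eq)
 show ?thesis
 proof (rule exI[of _ J], intro allI impI)
  fix u U Gam x0 r k H
  assume u: "lsub u U Gam" and r: "r > 0" and H: "H > 0" and Gam: "Gam >= 0" "Gam * (2 * r)^2 <= H / 2 ^ J"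
   and k: "k >= 0 \<or> cball x0 (2 * r) \<subseteq> Om"
   and le: "ae x. x \<in> ball x0 (2 * r) --> u x <= k + H"
   and E: "\<theta> * ballvol TYPE('n) r <= vol {x \<in> ball x0 r. u x <= k}"
  have hu: "h10 Om u U" using u by (simp add: lsub_def)
  have um[measurable]: "u \<in> BM" using h10D(1)[OF hu] by (rule sqi_measurable)
  define b where "b = ballvol TYPE('n) r"
  have b: "b > 0" using r by (simp add: b_def ballvol_pos)
  define kk where "kk j = k + H * (1 - 1 / 2 ^ j)" for j
  define hh where "hh j = H / 2 ^ j" for j
  have hh: "hh j > 0" "kk j + hh j = k + H" "kk (Suc j) = kk j + hh j / 2" "k <= kk j" for j
   using H by (simp_all add: kk_def hh_def field_simps)
  define M where "M j = vol {x \<in> ball x0 r. u x > kk j}" for j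
  have step: "\<theta>^2 * (M (Suc j))^2 <= C2 * b * (M j - M (Suc j))" if j: "j <= J" for j
  proof -
   have "hh J <= hh j" using j H by (simp add: hh_def frac_le)
   hence a1: "Gam * (2 * r)^2 <= hh j" using Gam(2) by (simp add: hh_def)
   have a2: "kk j >= 0 \<or> cball x0 (2 * r) \<subseteq> Om" using k hh(4)[of j] by auto
   have a3: "ae x. x \<in> ball x0 (2 * r) --> u x <= kk j + hh j" using le by (simp only: hh(2))
   have s: "{x \<in> ball x0 r. u x <= i} \<in> lmeasurable" for i
   proof (rule fmeasurableI2[OF lmeasurable_ball])
    have "{x \<in> ball x0 r. u x <= i} = ball x0 r - {x \<in> ball x0 r. u x > i}" by auto
    also have "\<dots> \<in> sets lebesgue"
     using superlevel_lmeasurable[OF um lmeasurable_ball, of x0 r i] by (intro sets.Diff) (auto simp: fmeasurableD)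
    finally show "{x \<in> ball x0 r. u x <= i} \<in> sets lebesgue" .
   qed auto
   have "vol {x \<in> ball x0 r. u x <= k} <= vol {x \<in> ball x0 r. u x <= kk j}"
    using s hh(4)[of j] by (intro measure_mono_fmeasurable) (auto simp: fmeasurableD)
   hence a4: "\<theta> * ballvol TYPE('n) r <= vol {x \<in> ball x0 r. u x <= kk j}" using E by linarith
   from level_step[OF u r hh(1) Gam(1) a1 a2 a3 \<theta> a4] show ?thesis by (simp add: M_def b_def hh(3))
  qed
  have mono: "M (Suc j) <= M j" for j
   unfolding M_def using superlevel_lmeasurable[OF um lmeasurable_ball] hh(1)[of j]
   by (intro measure_mono_fmeasurable) (auto simp: fmeasurableD hh(3))
  have M0: "M j >= 0" "M 0 <= b" for j
  proof -
   have "M 0 <= vol (ball x0 r)"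
    unfolding M_def using superlevel_lmeasurable[OF um lmeasurable_ball]
    by (intro measure_mono_fmeasurable) (auto simp: fmeasurableD)
   thus "M 0 <= b" by (simp add: measure_ball b_def)
  qed (simp add: M_def)
  have anti: "M J <= M (Suc j)" if "j < J" for j
   using lift_Suc_antimono_le[of M, OF mono, of "Suc j" J] that by simp
  have "real J * (\<theta>^2 * (M J)^2) = (\<Sum>j<J. \<theta>^2 * (M J)^2)" by simp
  also have "\<dots> <= (\<Sum>j<J. C2 * b * (M j - M (Suc j)))"
  proof (rule sum_mono)
   fix j assume "j \<in> {..<J}"
   hence j: "j < J" by simp
   have "\<theta>^2 * (M J)^2 <= \<theta>^2 * (M (Suc j))^2" using anti[OF j] M0 by (intro mult_left_mono power_mono) auto
   also have "\<dots> <= C2 * b * (M j - M (Suc j))" using j by (intro step) simp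
   finally show "\<theta>^2 * (M J)^2 <= C2 * b * (M j - M (Suc j))" .
  qed
  also have "\<dots> = C2 * b * (M 0 - M J)" by (simp only: sum_distrib_left[symmetric] sum_lessThan_telescope')
  also have "\<dots> <= C2 * b * b" using M0(1)[of J] M0(2) C2_pos b by (intro mult_left_mono) auto
  finally have MJ: "real J * (\<theta>^2 * (M J)^2) <= C2 * b * b" .
  have small: "M J <= \<tau> * b"
  proof (rule ccontr)
   assume "\<not> M J <= \<tau> * b"
   hence "(\<tau> * b)^2 <= (M J)^2" using \<tau> b by (intro power_mono) auto
   hence "real J * (\<theta>^2 * (\<tau> * b)^2) <= real J * (\<theta>^2 * (M J)^2)" by (intro mult_left_mono) auto
   also note MJ
   finally have "(real J * (\<theta>^2 * \<tau>^2)) * b^2 <= C2 * b^2" by (simp add: power_mult_distrib power2_eq_square mult_ac)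
   hence "real J * (\<theta>^2 * \<tau>^2) <= C2" using b by (subst (asm) mult_le_cancel_right_pos) auto
   thus False using J2 by linarith
  qed
  have r2: "r / 2 > 0" "2 * (r / 2) = r" using r by auto
  have "ae x. x \<in> ball x0 (r / 2) --> u x <= kk J + hh J / 2"
  proof (rule small_measure_bound[OF u r2(1) hh(1) Gam(1)], unfold r2(2))
   have "Gam * r^2 <= Gam * (2 * r)^2" using Gam(1) r by (intro mult_left_mono power_mono) auto
   thus "Gam * r^2 <= hh J" using Gam(2) by (simp add: hh_def)
   show "kk J >= 0 \<or> cball x0 r \<subseteq> Om" using k hh(4)[of J] subset_cball[of r "2 * r" x0] r by (auto simp del: subset_iff)
   show "ae x. x \<in> ball x0 r --> u x <= kk J + hh J" using le
   proof eventually_elim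
    case (elim x)
    thus ?case unfolding hh(2) using r by auto
   qed
   have "ballvol TYPE('n) ((th0 / 2) * r) = (th0 / 2) ^ CARD('n) * b"
    unfolding b_def using th0_pos r by (intro ballvol_scale) auto
   thus "2 * vol {x \<in> ball x0 r. u x > kk J} <= ballvol TYPE('n) (th0 * (r / 2))"
    using small by (simp add: M_def \<tau>_def)
  qed
  moreover have "kk J + hh J / 2 = k + (1 - 1 / 2 ^ Suc J) * H" by (simp add: kk_def hh_def field_simps)
  ultimately show "ae x. x \<in> ball x0 (r / 2) --> u x <= k + (1 - 1 / 2 ^ Suc J) * H" by simp
 qed
qed

end

section \<open>Continuity of solutions\<close>

lemma continuous_le_if_AE:
 fixes g :: "real ^ 'n => real"
 assumes g: "continuous_on S g" "open S" and ae: "ae x. x \<in> S --> g x <= c" and p: "p \<in> S"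
 shows "g p <= c"
proof (rule ccontr)
 assume "\<not> g p <= c"
 define T where "T = S \<inter> g -` {c<..}"
 have "open T" unfolding T_def by (rule continuous_open_preimage[OF g]) simp
 moreover have "p \<in> T" using p \<open>\<not> g p <= c\<close> by (simp add: T_def)
 moreover have "negligible T"
 proof -
  have "ae x. x \<notin> T" using ae by eventually_elim (auto simp: T_def)
  thus ?thesis using AE_iff_null_sets[of T lebesgue] \<open>open T\<close> by (simp add: negligible_iff_null_sets)
 qed
 ultimately show False using open_not_negligible by blast
qed

lemma AE_ball_nontrivial:
 fixes p :: "real ^ 'n"
 assumes "ae x. x \<in> ball p r --> P" "r > 0" shows P
proof (rule ccontr)
 assume "\<not> P"
 hence "ae x. x \<notin> ball p r" using assms(1) by simp
 hence "negligible (ball p r)" using AE_iff_null_sets[of "ball p r" lebesgue] by (simp add: negligible_iff_null_sets)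
 thus False using open_not_negligible[of "ball p r"] assms(2) by auto
qed

text \<open>The representative is the infimum of the essential upper bounds on balls around the
  point. Its agreement with \<open>f\<close> is shown up to \<open>e\<close> on each ball of small
  oscillation, and Lindelof's theorem reduces these balls to countably many.\<close>

lemma continuous_representative:
 fixes f :: "real ^ 'n => real"
 assumes osc: "\<forall>p. \<forall>e>0. \<exists>\<rho>>0. \<exists>m. ae x. x \<in> ball p \<rho> --> m <= f x \<and> f x <= m + e"
 shows "\<exists>g. continuous_on UNIV g \<and> (ae x. g x = f x)"
proof -
 define T where "T p = {M. \<exists>\<rho>>0. ae x. x \<in> ball p \<rho> --> f x <= M}" for p
 define g where "g p = Inf (T p)" for p
 have bounds: "m <= g x \<and> g x <= m'" if ae: "ae x. x \<in> ball p \<rho> --> m <= f x \<and> f x <= m'" and x: "x \<in> ball p \<rho>" for m m' p \<rho> x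
 proof -
  define s where "s = \<rho> - dist p x"
  have s: "s > 0" using x by (simp add: s_def)
  have sub: "y \<in> ball p \<rho>" if "y \<in> ball x s" for y using that dist_triangle[of p y x] by (simp add: s_def)
  have "ae y. y \<in> ball x s --> f y <= m'" using ae by eventually_elim (use sub in blast)
  with s have "\<exists>s>0. ae y. y \<in> ball x s --> f y <= m'" by (intro exI[of _ s] conjI)
  hence mem: "m' \<in> T x" unfolding T_def by (rule CollectI)
  have lb: "m <= M" if MT: "M \<in> T x" for M
  proof -
   obtain \<rho>' where r: "\<rho>' > 0" "ae y. y \<in> ball x \<rho>' --> f y <= M" using MT unfolding T_def mem_Collect_eq by (elim exE conjE) (rule that, assumption+)
   have "ae y. y \<in> ball x (min s \<rho>') --> m <= M" using ae r(2)
   proof eventually_elim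
    case (elim y)
    show ?case
    proof
     assume "y \<in> ball x (min s \<rho>')"
     hence "y \<in> ball x s" "y \<in> ball x \<rho>'" by auto
     thus "m <= M" using elim sub[of y] by auto
    qed
   qed
   thus ?thesis by (rule AE_ball_nontrivial) (use s r in auto)
  qed
  have "m <= g x" unfolding g_def using mem lb by (intro cInf_greatest) auto
  moreover have "g x <= m'" unfolding g_def using mem lb by (intro cInf_lower bdd_belowI[of _ m]) auto
  ultimately show ?thesis ..
 qed
 have "continuous_on UNIV g"
 proof (rule continuous_onI)
  fix p e assume e: "e > (0::real)"
  then obtain \<rho> m where r: "\<rho> > 0" "ae x. x \<in> ball p \<rho> --> m <= f x \<and> f x <= m + e" using osc by blast
  show "\<exists>d>0. \<forall>x'\<in>UNIV. dist x' p < d --> dist (g x') (g p) <= e"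
  proof (intro exI conjI ballI impI)
   fix x' assume "dist x' p < \<rho>"
   hence "x' \<in> ball p \<rho>" by (simp add: dist_commute)
   thus "dist (g x') (g p) <= e" using bounds[OF r(2), of x'] bounds[OF r(2), of p] r(1) by (auto simp: dist_real_def)
  qed (rule r)
 qed
 moreover have "ae x. g x = f x"
 proof -
  have "ae x. \<bar>f x - g x\<bar> <= e" if e: "e > 0" for e
  proof -
   define F where "F = {ball p \<rho> | p \<rho>. \<rho> > 0 \<and> (\<exists>m. ae x. x \<in> ball p \<rho> --> m <= f x \<and> f x <= m + e)}"
   have "open S" if "S \<in> F" for S using that by (auto simp: F_def)
   then obtain F' where F': "F' \<subseteq> F" "countable F'" "\<Union>F' = \<Union>F" using Lindelof[of F] by metis
   have cover: "x \<in> \<Union>F" for x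
   proof -
    obtain \<rho> m where r: "\<rho> > 0" "ae y. y \<in> ball x \<rho> --> m <= f y \<and> f y <= m + e" using osc e by blast
    have "ball x \<rho> \<in> F" unfolding F_def using r by blast
    thus ?thesis using r(1) centre_in_ball by blast
   qed
   have "ae x. \<forall>S\<in>F'. x \<in> S --> \<bar>f x - g x\<bar> <= e"
   proof (rule AE_ball_countable'[OF _ F'(2)])
    fix S assume "S \<in> F'"
    then obtain p \<rho> m where S: "S = ball p \<rho>" and ae: "ae x. x \<in> ball p \<rho> --> m <= f x \<and> f x <= m + e"
     using F'(1) unfolding F_def by blast
    show "ae x. x \<in> S --> \<bar>f x - g x\<bar> <= e" using ae
    proof eventually_elim
     case (elim x)
     show ?case
     proof
      assume "x \<in> S"
      thus "\<bar>f x - g x\<bar> <= e" using elim bounds[OF ae, of x] S by auto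
     qed
    qed
   qed
   thus ?thesis
   proof eventually_elim
    case (elim x)
    thus ?case using cover[of x] F'(3) by blast
   qed
  qed
  hence "ae x. \<forall>n. \<bar>f x - g x\<bar> <= 1 / real (Suc n)" by (simp add: AE_all_countable)
  thus ?thesis
  proof eventually_elim
   case (elim x)
   have "\<bar>f x - g x\<bar> <= 0"
   proof (rule field_le_epsilon)
    fix e :: real assume "e > 0"
    then obtain n where "1 / real (Suc n) < e" using nat_approx_posE by blast
    thus "\<bar>f x - g x\<bar> <= 0 + e" using elim by (smt (verit))
   qed
   thus ?case by simp
  qed
 qed
 ultimately show ?thesis by blast
qed

text \<open>Replaces an explicit sequence of radii: \<open>S\<close> will be the set of bounds that
  are valid on some ball around a point, and it suffices that every positive bound can be improved
  by a fixed factor.\<close>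

lemma geometric_shrink:
 fixes S :: "real set"
 assumes "d \<in> S" "\<forall>d\<in>S. d > 0 --> q * d \<in> S" "0 <= q" "q < 1" "e > 0"
 shows "\<exists>d\<in>S. d < e"
proof (rule ccontr)
 assume "\<not> ?thesis"
 hence no: "e <= d" if "d \<in> S" for d using that by force
 have "q ^ n * d \<in> S" for n
 proof (induction n)
  case (Suc n)
  hence "q ^ n * d > 0" using no[of "q ^ n * d"] assms(5) by linarith
  thus ?case using Suc assms(2) by (auto simp: mult.assoc)
 qed (use assms in simp)
 hence "e <= q ^ n * d" for n using no by blast
 moreover have "(%n. q ^ n * d) ~~> 0 * d" using assms by (intro tendsto_mult LIMSEQ_power_zero) auto
 ultimately have "e <= 0" by (intro LIMSEQ_le_const[of "%n. q ^ n * d" 0 e]) auto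
 thus False using assms by simp
qed

lemma small_radius:
 fixes G \<epsilon> \<rho> :: real
 assumes "\<epsilon> > 0" "\<rho> > 0" "G >= 0"
 shows "\<exists>r>0. 2 * r <= \<rho> \<and> G * (2 * r)^2 <= \<epsilon>"
proof -
 define s where "s = min \<rho> (min 1 (\<epsilon> / (G + 1)))"
 have s: "s > 0" "s <= \<rho>" "s <= 1" "s <= \<epsilon> / (G + 1)" using assms by (auto simp: s_def)
 have "G * s^2 <= (G + 1) * s" using s assms by (intro mult_mono) (auto simp: power2_eq_square mult_left_le_one_le)
 also have "\<dots> <= \<epsilon>" using s(4) assms by (simp add: pos_le_divide_eq mult.commute)
 finally show ?thesis using s by (intro exI[of _ "s / 2"]) auto
qed

section \<open>Density of the complement and boundary behaviour\<close>

definition exterior_density :: "(real ^ 'n) set => real ^ 'n => real => bool" where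
 "exterior_density Om p \<theta> \<longleftrightarrow> (\<exists>r0>0. \<forall>r. 0 < r --> r <= r0 --> \<theta> * ballvol TYPE('n) r <= vol (ball p r - Om))"

text \<open>A ball of radius \<open>\<kappa> / 2 * r\<close> around \<open>p + (r/2) e\<close> lies
  above the graph. Moving from its centre by \<open>v\<close> lowers the height by at most
  \<open>norm v\<close> and raises the graph by at most \<open>2 * C * norm v\<close>, so
  \<open>(1 + 2 * C) * norm v <= r / 2\<close> is sufficient, and this fixes \<kappa>.\<close>

lemma lipschitz_exterior_density:
 fixes Om :: "(real ^ 'n) set"
 assumes l: "lipschitz_boundary Om" and o: "open Om" and p: "p \<in> frontier Om"
 shows "\<exists>\<theta>>0. exterior_density Om p \<theta>"
proof -
 obtain Z e \<gamma> C where Z: "open Z" "p \<in> Z" "norm e = 1" "C-lipschitz_on {z. z \<bullet> e = 0} \<gamma>"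
  "Om \<inter> Z = {x \<in> Z. x \<bullet> e < \<gamma> (x - (x \<bullet> e) *R e)}" using bspec[OF l[unfolded lipschitz_boundary_def] p] by (elim exE conjE) (rule that, assumption+)
 have C: "C >= 0" using Z(4) by (rule lipschitz_on_nonneg)
 obtain r0 where r0: "r0 > 0" "ball p r0 \<subseteq> Z" using Z(1,2) open_contains_ball by blast
 have ee: "e \<bullet> e = 1" using Z(3) by (simp add: norm_eq_1)
 define P where "P x = x - (x \<bullet> e) *R e" for x
 have Pe: "P x \<bullet> e = 0" for x by (simp add: P_def inner_diff_left ee)
 have "p \<notin> Om" using p o by (simp add: frontier_def interior_open)
 hence pe: "\<gamma> (P p) <= p \<bullet> e" using Z(2,5) unfolding P_def by force
 define \<kappa> where "\<kappa> = 1 / (1 + 2 * C)"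
 have k: "0 < \<kappa>" "\<kappa> <= 1" "\<kappa> * (1 + 2 * C) = 1" using C by (auto simp: \<kappa>_def)
 have "(\<kappa> / 2) ^ CARD('n) * ballvol TYPE('n) r <= vol (ball p r - Om)" if r: "0 < r" "r <= r0" for r
 proof -
  define c where "c = p + (r / 2) *R e"
  have "ball c (\<kappa> / 2 * r) \<subseteq> ball p r - Om"
  proof
   fix y assume "y \<in> ball c (\<kappa> / 2 * r)"
   define v where "v = y - c"
   have v: "norm v < \<kappa> / 2 * r" using \<open>y \<in> _\<close> by (simp add: v_def dist_norm norm_minus_commute)
   have y: "y = p + (r / 2) *R e + v" by (simp add: v_def c_def)
   have "norm (y - p) <= norm ((r / 2) *R e) + norm v" unfolding y using norm_triangle_ineq[of "(r / 2) *R e" v] by (simp add: add.assoc)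
   also have "\<dots> = r / 2 + norm v" using Z(3) r by simp
   finally have yr1: "norm (y - p) <= r / 2 + norm v" .
   have "\<kappa> / 2 * r <= r / 2" using k r by simp
   hence yr: "norm (y - p) < r" using v yr1 by linarith
   hence yb: "y \<in> ball p r" by (simp add: dist_norm norm_minus_commute)
   hence yZ: "y \<in> Z" using r r0 by auto
   have ye: "y \<bullet> e = p \<bullet> e + r / 2 + v \<bullet> e" by (simp add: y inner_add_left ee)
   have ve: "\<bar>v \<bullet> e\<bar> <= norm v" using Cauchy_Schwarz_ineq2[of v e] Z(3) by simp
   have "P y - P p = v - (v \<bullet> e) *R e" by (simp add: P_def y inner_add_left ee algebra_simps)
   hence "norm (P y - P p) <= norm v + \<bar>v \<bullet> e\<bar>" using norm_triangle_ineq4[of v "(v \<bullet> e) *R e"] Z(3) by simp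
   hence Pn: "norm (P y - P p) <= 2 * norm v" using ve by simp
   have "dist (\<gamma> (P y)) (\<gamma> (P p)) <= C * dist (P y) (P p)" using Pe by (intro lipschitz_onD[OF Z(4)]) auto
   hence "\<gamma> (P y) <= \<gamma> (P p) + C * norm (P y - P p)" by (simp add: dist_real_def dist_norm)
   also have "C * norm (P y - P p) <= C * (2 * norm v)" using Pn C by (rule mult_left_mono)
   finally have g: "\<gamma> (P y) <= p \<bullet> e + 2 * C * norm v" using pe by simp
   have "(1 + 2 * C) * norm v <= (1 + 2 * C) * (\<kappa> / 2 * r)" using v C by (intro mult_left_mono) auto
   also have "\<dots> = (\<kappa> * (1 + 2 * C)) * (r / 2)" by simp
   also have "\<dots> = r / 2" by (simp only: k(3))
   finally have "2 * C * norm v <= r / 2 - norm v" by (simp add: algebra_simps)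
   hence "\<gamma> (P y) <= y \<bullet> e" using g ye ve by linarith
   hence "y \<notin> Om" using Z(5) yZ unfolding P_def by force
   thus "y \<in> ball p r - Om" using yb by simp
  qed
  moreover have "ball p r - Om \<in> lmeasurable" using o by (intro fmeasurable_Diff) auto
  ultimately have "vol (ball c (\<kappa> / 2 * r)) <= vol (ball p r - Om)"
   by (intro measure_mono_fmeasurable) auto
  moreover have "vol (ball c (\<kappa> / 2 * r)) = (\<kappa> / 2) ^ CARD('n) * ballvol TYPE('n) r"
   unfolding measure_ball using k r by (intro ballvol_scale) auto
  ultimately show ?thesis by simp
 qed
 hence "exterior_density Om p ((\<kappa> / 2) ^ CARD('n))" unfolding exterior_density_def using r0 by blast
 moreover have "(\<kappa> / 2) ^ CARD('n) > 0" using k by simp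
 ultimately show ?thesis by blast
qed

context elliptic
begin

text \<open>At the middle level \<open>k\<close>, one of \<open>u <= k\<close> and
  \<open>u >= k\<close> holds on at least half of a small ball; \<open>oscillation_step\<close> with
  \<theta> equal to 1/2, applied to \<open>u\<close> or to \<open>- u\<close>, lowers the upper
  bound or raises the lower one.\<close>

lemma oscillation_interior:
 assumes u: "lsub u U Gam" "lsub (%x. - u x) (%x. - U x) Gam" and Gam: "Gam >= 0" and K: "ae x. \<bar>u x\<bar> <= K"
  and p: "p \<in> Om" and e: "e > 0"
 shows "\<exists>\<rho>>0. \<exists>m. ae x. x \<in> ball p \<rho> --> m <= u x \<and> u x <= m + e"
proof -
 have "1 / 2 > (0 :: real)" by simp
 from oscillation_step[OF this] obtain J where J: "\<forall>u U Gam x0 r k H. lsub u U Gam --> r > 0 --> H > 0 --> Gam >= 0 --> Gam * (2 * r)^2 <= H / 2 ^ J -->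
  k >= 0 \<or> cball x0 (2 * r) \<subseteq> Om -->
  (ae x. x \<in> ball x0 (2 * r) --> u x <= k + H) -->
  1 / 2 * ballvol TYPE('n) r <= vol {x \<in> ball x0 r. u x <= k} -->
  (ae x. x \<in> ball x0 (r / 2) --> u x <= k + (1 - 1 / 2 ^ Suc J) * H)" by blast
 have um: "u \<in> BM" using u(1) unfolding lsub_def by (meson h10D(1) sqi_measurable)
 define S where "S = {d. \<exists>\<rho>>0. \<exists>m. ae x. x \<in> ball p \<rho> --> m <= u x \<and> u x <= m + d}"
 \<comment> \<open>\<open>oscillation_step\<close> acts on half of the oscillation,
   \<open>H = d / 2\<close>, which costs one more power of 2 than its own factor.\<close>
 define q :: real where "q = 1 - 1 / 2 ^ Suc (Suc J)"
 have q: "0 <= q" "q < 1" using one_le_power[of "2::real" J] by (simp_all add: q_def divide_le_eq) (auto intro: order_trans[of 1 "2 ^ J"])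
 have "\<exists>d\<in>S. d < e"
 proof (rule geometric_shrink[OF _ _ q e])
  have "ae x. x \<in> ball p 1 --> - K <= u x \<and> u x <= - K + 2 * K" using K by eventually_elim auto
  hence "\<exists>m. ae x. x \<in> ball p 1 --> m <= u x \<and> u x <= m + 2 * K" by (rule exI)
  with zero_less_one show "2 * K \<in> S" unfolding S_def mem_Collect_eq by blast
  show "\<forall>d\<in>S. d > 0 --> q * d \<in> S"
  proof (intro ballI impI)
   fix d assume "d \<in> S" and d: "d > 0"
   then obtain \<rho> m where r: "\<rho> > 0" and ae: "ae x. x \<in> ball p \<rho> --> m <= u x \<and> u x <= m + d" unfolding S_def by blast
   obtain \<rho>' where r': "\<rho>' > 0" "cball p \<rho>' \<subseteq> Om" using open_Om p open_contains_cball by blast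
   have "d / 2 / 2 ^ J > 0" "min \<rho> \<rho>' > 0" using d r r' by auto
   from small_radius[OF this Gam] obtain s where s: "s > 0" "2 * s <= min \<rho> \<rho>'" "Gam * (2 * s)^2 <= d / 2 / 2 ^ J" by blast
   \<comment> \<open>The middle level may be negative, so the interior alternative of the local
     estimates is needed.\<close>
   have cb: "c >= 0 \<or> cball p (2 * s) \<subseteq> Om" for c :: real using r'(2) s(2) subset_cball[of "2 * s" \<rho>' p] by auto
   have d2: "d / 2 > 0" using d by simp
   define k where "k = m + d / 2"
   have qd: "k + (1 - 1 / 2 ^ Suc J) * (d / 2) = m + q * d" by (simp add: k_def q_def field_simps)
   have ae2: "ae x. x \<in> ball p (2 * s) --> m <= u x \<and> u x <= m + d" using ae
    by eventually_elim (use s(2) in auto)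
   define E1 E2 where "E1 = {x \<in> ball p s. u x <= k}" and "E2 = {x \<in> ball p s. - u x <= - k}"
   have Gl: "{x \<in> ball p s. u x > k} \<in> lmeasurable" by (rule superlevel_lmeasurable[OF um]) simp
   have El: "E1 \<in> lmeasurable" 
   proof -
    have "E1 = ball p s - {x \<in> ball p s. u x > k}" by (auto simp: E1_def)
    thus ?thesis using Gl by (auto intro!: fmeasurable_Diff simp: fmeasurableD)
   qed
   have El2: "E2 \<in> lmeasurable"
   proof -
    have "(%x. - u x) \<in> BM" using um by simp
    from superlevel_lmeasurable[OF this, of "ball p s" "- k"]
    have "{x \<in> ball p s. - u x > - k} \<in> lmeasurable" by simp
    moreover have "E2 = ball p s - {x \<in> ball p s. - u x > - k}" by (auto simp: E2_def)
    ultimately show ?thesis by (auto intro!: fmeasurable_Diff simp: fmeasurableD)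
   qed
   have "ballvol TYPE('n) s <= vol (E1 \<union> E2)"
    unfolding measure_ball[symmetric, of _ p] using El El2
    by (intro measure_mono_fmeasurable) (auto simp: E1_def E2_def fmeasurableD intro: fmeasurable.Un)
   also have "\<dots> <= vol E1 + vol E2" using El El2 by (intro measure_Un_le) (auto simp: fmeasurableD)
   finally have "1 / 2 * ballvol TYPE('n) s <= vol E1 \<or> 1 / 2 * ballvol TYPE('n) s <= vol E2" by linarith
   thus "q * d \<in> S"
   proof
    assume E: "1 / 2 * ballvol TYPE('n) s <= vol E1"
    have "ae x. x \<in> ball p (2 * s) --> u x <= k + d / 2" using ae2 by eventually_elim (auto simp: k_def)
    from J[rule_format, OF u(1) s(1) d2 Gam s(3) cb this E[unfolded E1_def]]
    have "ae x. x \<in> ball p (s / 2) --> u x <= k + (1 - 1 / 2 ^ Suc J) * (d / 2)" .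
    with ae2 have "ae x. x \<in> ball p (s / 2) --> m <= u x \<and> u x <= m + q * d" unfolding qd
    proof eventually_elim
     case (elim x)
     have "ball p (s / 2) \<subseteq> ball p (2 * s)" using s(1) by (intro subset_ball) simp
     thus ?case using elim by blast
    qed
    moreover have "s / 2 > 0" using s(1) by simp
    ultimately show "q * d \<in> S" unfolding S_def mem_Collect_eq by (intro exI conjI)
   next
    assume E: "1 / 2 * ballvol TYPE('n) s <= vol E2"
    have "ae x. x \<in> ball p (2 * s) --> - u x <= - k + d / 2" using ae2 by eventually_elim (auto simp: k_def)
    from J[rule_format, OF u(2) s(1) d2 Gam s(3) cb this E[unfolded E2_def]]
    have "ae x. x \<in> ball p (s / 2) --> - u x <= - k + (1 - 1 / 2 ^ Suc J) * (d / 2)" .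
    with ae2 have "ae x. x \<in> ball p (s / 2) --> (m + d - q * d) <= u x \<and> u x <= (m + d - q * d) + q * d"
    proof eventually_elim
     case (elim x)
     have "ball p (s / 2) \<subseteq> ball p (2 * s)" using s(1) by (intro subset_ball) simp
     moreover have "k - (1 - 1 / 2 ^ Suc J) * (d / 2) = m + d - q * d" by (simp add: k_def q_def field_simps)
     ultimately show ?case using elim by auto
    qed
    moreover have "s / 2 > 0" using s(1) by simp
    ultimately show "q * d \<in> S" unfolding S_def mem_Collect_eq by (intro exI conjI)
   qed
  qed
 qed
 then obtain d \<rho> m where d: "d < e" "\<rho> > 0" "ae x. x \<in> ball p \<rho> --> m <= u x \<and> u x <= m + d"
  unfolding S_def bex_simps mem_Collect_eq by (elim bexE CollectE exE conjE)
 have "ae x. x \<in> ball p \<rho> --> m <= u x \<and> u x <= m + e" using d(3) by eventually_elim (use d(1) in auto)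
 thus ?thesis using d(2) by blast
qed

text \<open>Since \<open>u\<close> vanishes off \<open>Om\<close>, the set where
  \<open>u <= 0\<close> contains almost all of the complement, whose density replaces the half-ball
  alternative of the interior. The level stays at 0, where no ball inside \<open>Om\<close> is
  required.\<close>

lemma boundary_upper:
 assumes u: "lsub u U Gam" and Gam: "Gam >= 0" and K: "ae x. u x <= K"
  and \<theta>: "\<theta> > 0" "exterior_density Om p \<theta>" and e: "e > 0"
 shows "\<exists>\<rho>>0. ae x. x \<in> ball p \<rho> --> u x <= e"
proof -
 from oscillation_step[OF \<theta>(1)] obtain J where J: "\<forall>u U Gam x0 r k H. lsub u U Gam --> r > 0 --> H > 0 --> Gam >= 0 --> Gam * (2 * r)^2 <= H / 2 ^ J -->
  k >= 0 \<or> cball x0 (2 * r) \<subseteq> Om -->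
  (ae x. x \<in> ball x0 (2 * r) --> u x <= k + H) -->
  \<theta> * ballvol TYPE('n) r <= vol {x \<in> ball x0 r. u x <= k} -->
  (ae x. x \<in> ball x0 (r / 2) --> u x <= k + (1 - 1 / 2 ^ Suc J) * H)" by blast
 have hu: "h10 Om u U" using u by (simp add: lsub_def)
 have um: "u \<in> BM" using h10D(1)[OF hu] by (rule sqi_measurable)
 obtain r0 where r0: "r0 > 0" "\<forall>r. 0 < r --> r <= r0 --> \<theta> * ballvol TYPE('n) r <= vol (ball p r - Om)"
  using \<theta>(2) unfolding exterior_density_def by blast
 define S where "S = {d. \<exists>\<rho>>0. ae x. x \<in> ball p \<rho> --> u x <= d}"
 define q :: real where "q = 1 - 1 / 2 ^ Suc J"
 have q: "0 <= q" "q < 1" using one_le_power[of "2::real" J] by (simp_all add: q_def divide_le_eq) (auto intro: order_trans[of 1 "2 ^ J"])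
 have "\<exists>d\<in>S. d < e"
 proof (rule geometric_shrink[OF _ _ q e])
  have "ae x. x \<in> ball p 1 --> u x <= K" using K by eventually_elim auto
  with zero_less_one show "K \<in> S" unfolding S_def mem_Collect_eq by blast
  show "\<forall>d\<in>S. d > 0 --> q * d \<in> S"
  proof (intro ballI impI)
   fix d assume "d \<in> S" and d: "d > 0"
   then obtain \<rho> where r: "\<rho> > 0" and ae: "ae x. x \<in> ball p \<rho> --> u x <= d" unfolding S_def by blast
   have "d / 2 ^ J > 0" "min \<rho> r0 > 0" using d r r0 by auto
   from small_radius[OF this Gam] obtain s where s: "s > 0" "2 * s <= min \<rho> r0" "Gam * (2 * s)^2 <= d / 2 ^ J" by blast
   have cb: "(0::real) >= 0 \<or> cball p (2 * s) \<subseteq> Om" by simp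
   have ae2: "ae x. x \<in> ball p (2 * s) --> u x <= 0 + d" using ae by eventually_elim (use s(2) in auto)
   have Gl: "{x \<in> ball p s. u x > 0} \<in> lmeasurable" by (rule superlevel_lmeasurable[OF um]) simp
   have El: "{x \<in> ball p s. u x <= 0} \<in> lmeasurable"
   proof -
    have "{x \<in> ball p s. u x <= 0} = ball p s - {x \<in> ball p s. u x > 0}" by auto
    thus ?thesis using Gl by (auto intro!: fmeasurable_Diff simp: fmeasurableD)
   qed
   have "\<theta> * ballvol TYPE('n) s <= vol (ball p s - Om)" using r0(2) s by simp
   also have "\<dots> <= vol {x \<in> ball p s. u x <= 0}"
   proof -
    have "emeasure lebesgue (ball p s - Om) <= emeasure lebesgue {x \<in> ball p s. u x <= 0}"
    proof (rule emeasure_mono_AE)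
     show "ae x. x \<in> ball p s - Om --> x \<in> {x \<in> ball p s. u x <= 0}"
      using h10_zero_outside[OF hu] by eventually_elim auto
    qed (use El in \<open>simp add: fmeasurableD\<close>)
    thus ?thesis unfolding measure_def using El by (intro enn2real_mono) (auto simp: fmeasurable_def)
   qed
   finally have E: "\<theta> * ballvol TYPE('n) s <= vol {x \<in> ball p s. u x <= 0}" .
   have "ae x. x \<in> ball p (s / 2) --> u x <= 0 + (1 - 1 / 2 ^ Suc J) * d"
    by (rule J[rule_format, OF u s(1) d Gam s(3) cb ae2 E])
   hence "ae x. x \<in> ball p (s / 2) --> u x <= q * d" by (simp add: q_def)
   moreover have "s / 2 > 0" using s(1) by simp
   ultimately show "q * d \<in> S" unfolding S_def mem_Collect_eq by (intro exI conjI)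
  qed
 qed
 then obtain d \<rho> where d: "d < e" "\<rho> > 0" "ae x. x \<in> ball p \<rho> --> u x <= d" unfolding S_def by blast
 have "ae x. x \<in> ball p \<rho> --> u x <= e" using d(3) by eventually_elim (use d(1) in auto)
 thus ?thesis using d(2) by blast
qed

definition regular_boundary :: bool where
 "regular_boundary \<longleftrightarrow> (\<forall>p \<in> frontier Om. \<exists>\<theta>>0. exterior_density Om p \<theta>)"

text \<open>Continuity expressed without choosing a representative. At points outside
  \<open>Om\<close> the range is centred at 0, which encodes the zero boundary values; this form is
  stable under uniform limits.\<close>

definition ess_continuous :: "(real ^ 'n => real) => bool" where
 "ess_continuous u \<longleftrightarrow>
  (\<forall>p. \<forall>e>0. \<exists>\<rho>>0. \<exists>m. (ae x. x \<in> ball p \<rho> --> m <= u x \<and> u x <= m + e) \<and> (p \<notin> Om --> m = - (e / 2)))"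

text \<open>Three kinds of points: interior points by the oscillation estimate, boundary points by
  \<open>boundary_upper\<close> for \<open>u\<close> and \<open>- u\<close>, and points off the
  closure, where \<open>u\<close> is zero nearby.\<close>

lemma ess_continuous_bounded_rhs:
 assumes u: "lsub u U Gam" "lsub (%x. - u x) (%x. - U x) Gam" and Gam: "Gam >= 0" and K: "ae x. \<bar>u x\<bar> <= K"
  and b: regular_boundary
 shows "ess_continuous u"
 unfolding ess_continuous_def
proof (intro allI impI)
 fix p and e :: real assume e: "e > 0"
 have hu: "h10 Om u U" using u by (simp add: lsub_def)
 show "\<exists>\<rho>>0. \<exists>m. (ae x. x \<in> ball p \<rho> --> m <= u x \<and> u x <= m + e) \<and> (p \<notin> Om --> m = - (e / 2))"
 proof (cases "p \<in> Om")
  case True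
  with oscillation_interior[OF u Gam K True e] show ?thesis by auto
 next
  case False
  have "\<exists>\<rho>>0. ae x. x \<in> ball p \<rho> --> - (e / 2) <= u x \<and> u x <= - (e / 2) + e"
  proof (cases "p \<in> frontier Om")
   case True
   then obtain \<theta> where \<theta>: "\<theta> > 0" "exterior_density Om p \<theta>" using b unfolding regular_boundary_def by blast
   have e2: "e / 2 > 0" using e by simp
   have K1: "ae x. u x <= K" using K by eventually_elim auto
   have K2: "ae x. - u x <= K" using K by eventually_elim auto
   obtain \<rho>1 where r1: "\<rho>1 > 0" "ae x. x \<in> ball p \<rho>1 --> u x <= e / 2"
    using boundary_upper[OF u(1) Gam K1 \<theta> e2] by blast
   obtain \<rho>2 where r2: "\<rho>2 > 0" "ae x. x \<in> ball p \<rho>2 --> - u x <= e / 2"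
    using boundary_upper[OF u(2) Gam K2 \<theta> e2] by blast
   have "ae x. x \<in> ball p (min \<rho>1 \<rho>2) --> - (e / 2) <= u x \<and> u x <= - (e / 2) + e"
    using r1(2) r2(2) by eventually_elim auto
   moreover have "min \<rho>1 \<rho>2 > 0" using r1 r2 by simp
   ultimately show ?thesis by blast
  next
   case nf: False
   hence "p \<in> - closure Om" using False open_Om by (simp add: frontier_def interior_open)
   then obtain \<rho> where r: "\<rho> > 0" "ball p \<rho> \<subseteq> - closure Om" using open_contains_ball[of "- closure Om"] by auto
   have "ae x. x \<in> ball p \<rho> --> - (e / 2) <= u x \<and> u x <= - (e / 2) + e"
    using h10_zero_outside[OF hu]
   proof eventually_elim
    case (elim x)
    thus ?case using r(2) closure_subset[of Om] e by auto
   qed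
   thus ?thesis using r(1) by blast
  qed
  thus ?thesis using False by blast
 qed
qed

lemma ess_continuous_representative:
 assumes "ess_continuous u"
 shows "\<exists>g. continuous_on UNIV g \<and> (ae x. g x = u x) \<and> (\<forall>x. x \<notin> Om --> g x = 0)"
proof -
 have "\<forall>p. \<forall>e>0. \<exists>\<rho>>0. \<exists>m. ae x. x \<in> ball p \<rho> --> m <= u x \<and> u x <= m + e"
  using assms unfolding ess_continuous_def by meson
 from continuous_representative[OF this] obtain g where g: "continuous_on UNIV g" "ae x. g x = u x" by blast
 have "g p = 0" if p: "p \<notin> Om" for p
 proof -
  have "\<bar>g p\<bar> <= e" if e: "e > 0" for e
  proof -
   have e2: "2 * e > 0" using e by simp
   then obtain \<rho> where r: "\<rho> > 0" "ae x. x \<in> ball p \<rho> --> - (2 * e / 2) <= u x \<and> u x <= - (2 * e / 2) + 2 * e"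
    using assms p unfolding ess_continuous_def by blast
   have "g p <= e"
   proof (rule continuous_le_if_AE[of "ball p \<rho>"])
    show "ae x. x \<in> ball p \<rho> --> g x <= e" using r(2) g(2) by eventually_elim auto
   qed (use g r in \<open>auto intro: continuous_on_subset\<close>)
   moreover have "- g p <= e"
   proof (rule continuous_le_if_AE[of "ball p \<rho>"])
    show "ae x. x \<in> ball p \<rho> --> - g x <= e" using r(2) g(2) by eventually_elim auto
   qed (use g r in \<open>auto intro!: continuous_on_minus intro: continuous_on_subset\<close>)
   ultimately show ?thesis by simp
  qed
  hence "\<bar>g p\<bar> <= 0 + e" if "e > 0" for e using that by simp
  hence "\<bar>g p\<bar> <= 0" by (rule field_le_epsilon)
  thus ?thesis by simp
 qed
 thus ?thesis using g by blast
qed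

end

section \<open>Existence of solutions\<close>

text \<open>Rounding \<open>u\<close> down to multiples of \<open>1 / real (Suc n)\<close> leaves
  countably many values, for which measurability is immediate; continuity in the second variable
  gives the limit. The exceptional null set is removed first so that the limit holds
  everywhere.\<close>

lemma caratheodory_measurable:
 fixes h :: "real ^ 'n => real => real"
 assumes h: "\<And>t. (%x. h x t) \<in> BM" and c: "ae x. continuous_on UNIV (h x)"
  and u: "u \<in> BM"
 shows "(%x. h x (u x)) \<in> BM"
proof -
 obtain N where N: "{x \<in> space lebesgue. \<not> continuous_on UNIV (h x)} \<subseteq> N" "N \<in> null_sets lebesgue"
  using c unfolding eventually_ae_filter by blast
 have Ns[measurable]: "N \<in> sets lebesgue" using N(2) by auto
 define h' where "h' x t = (if x \<in> N then 0 else h x t)" for x t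
 have h'c: "continuous_on UNIV (h' x)" for x using N(1) by (cases "x \<in> N") (auto simp: h'_def)
 have h'm: "(%x. h' x t) \<in> BM" for t
 proof -
  note [measurable] = h
  show ?thesis unfolding h'_def by measurable
 qed
 define s where "s n x = of_int \<lfloor>real (Suc n) * u x\<rfloor> / real (Suc n)" for n x
 have sl: "(%n. s n x) ~~> u x" for x
 proof (rule Lim_transform_bound[of _ "%n. 1 / real (Suc n)", THEN LIM_zero_cancel])
  show "(%n. 1 / real (Suc n)) ~~> 0" using LIMSEQ_inverse_real_of_nat by (simp add: inverse_eq_divide)
  show "\<forall>\<^sub>F n in sequentially. norm (s n x - u x) <= norm (1 / real (Suc n))"
  proof (intro always_eventually allI)
   fix n
   have "s n x - u x = (of_int \<lfloor>real (Suc n) * u x\<rfloor> - real (Suc n) * u x) / real (Suc n)"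
    by (simp add: s_def diff_divide_distrib)
   moreover have "\<bar>of_int \<lfloor>real (Suc n) * u x\<rfloor> - real (Suc n) * u x\<bar> <= 1" by linarith
   ultimately show "norm (s n x - u x) <= norm (1 / real (Suc n))" by (simp add: divide_right_mono)
  qed
 qed
 have "(%x. h' x (u x)) \<in> BM"
 proof (rule borel_measurable_LIMSEQ_real)
  show "(%n. h' x (s n x)) ~~> h' x (u x)" for x
   using continuous_on_tendsto_compose[OF h'c sl] by simp
  show "(%x. h' x (s n x)) \<in> BM" for n
  proof -
   note [measurable] = u
   have "(%x. \<lfloor>real (Suc n) * u x\<rfloor>) \<in> measurable lebesgue (count_space UNIV)" by measurable
   from measurable_compose_countable[OF h'm this] show ?thesis unfolding s_def .
  qed
 qed
 moreover have "ae x. h' x (u x) = h x (u x)" using AE_not_in[OF N(2)] by eventually_elim (simp add: h'_def)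
 ultimately show ?thesis by (rule borel_measurable_AE)
qed

lemma norm_pr:
 assumes "sqi u" "sqv G"
 shows "(norm (pr u G))^2 = (norm (cls u))^2 + (norm (cls (%x. norm (G x))))^2"
proof -
 have "(norm (\<chi> i. cls (%x. G x $ i)))^2 = (\<Sum>i\<in>UNIV. (lint x. (G x $ i)^2))"
  using assms(2) by (simp add: norm_vec_def L2_set_def sum_nonneg norm_cls sqv_def)
 also have "\<dots> = (lint x. (\<Sum>i\<in>UNIV. (G x $ i)^2))"
  using assms(2) by (intro Bochner_Integration.integral_sum[symmetric]) (auto simp: sqv_def sqi_square_integrable)
 also have "\<dots> = (lint x. (norm (G x))^2)" by (simp add: norm_vec_def L2_set_def sum_nonneg)
 also have "\<dots> = (norm (cls (%x. norm (G x))))^2" by (simp add: norm_cls sqi_norm[OF assms(2)])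
 finally show ?thesis by (simp add: pr_def norm_prod_def)
qed

lemma pr_eq_AE:
 assumes "h10 Om u U" "h10 Om v V" "pr u U = pr v V"
 shows "ae x. u x = v x \<and> U x = V x"
proof -
 have "cls u = cls v" using assms(3) by (simp add: pr_def)
 hence a: "ae x. u x = v x" using cls_eq_iff[OF h10D(1)[OF assms(1)] h10D(1)[OF assms(2)]] by blast
 have "ae x. U x $ i = V x $ i" for i
 proof -
  have "cls (%x. U x $ i) = cls (%x. V x $ i)" using assms(3) by (simp add: pr_def vec_eq_iff)
  thus ?thesis using cls_eq_iff[OF h10D(3)[OF assms(1)] h10D(3)[OF assms(2)]] by blast
 qed
 hence "ae x. \<forall>i. U x $ i = V x $ i" by (simp add: AE_all_countable)
 with a show ?thesis by eventually_elim (simp add: vec_eq_iff)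
qed

context elliptic
begin

text \<open>\<open>faber_krahn\<close> with a ball of at least twice the volume of
  \<open>Om\<close>.\<close>

lemma poincare_friedrichs: "\<exists>t\<ge>1. \<forall>u U. h10 Om u U --> norm (cls u) <= t * norm (cls (%x. norm (U x)))"
proof -
 define b where "b = ballvol TYPE('n) 1"
 have b: "b > 0" by (simp add: b_def ballvol_pos)
 define t where "t = max 1 (2 * vol Om / b)"
 have t: "t >= 1" by (simp add: t_def)
 have bt: "ballvol TYPE('n) t = t ^ CARD('n) * b" using ballvol_scale[of 1 t, where 'n='n] t by (simp add: b_def)
 have "2 * vol Om <= t * b" using b by (simp add: t_def field_simps max_def)
 also have "\<dots> <= t ^ CARD('n) * b" using b t self_le_power[of t "CARD('n)"] by (intro mult_right_mono) auto
 finally have st: "2 * vol Om <= ballvol TYPE('n) t" by (simp add: bt)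
 have "norm (cls u) <= t * norm (cls (%x. norm (U x)))" if h: "h10 Om u U" for u U
 proof (rule power2_le_imp_le)
  have t0: "t > 0" using t by simp
  have z: "ae x. x \<notin> Om --> u x = 0" using h10_zero_outside[OF h] by eventually_elim simp
  from faber_krahn[OF h bounded_Om open_Om t0 Om_lmeasurable z st]
  show "(norm (cls u))^2 <= (t * norm (cls (%x. norm (U x))))^2"
   using h by (simp add: norm_cls h10D sqi_norm power_mult_distrib)
 qed (use t in auto)
 thus ?thesis using t by blast
qed

text \<open>The global Lipschitz condition together with \<open>h x 0 = 0\<close> makes the
  superposition with \<open>h\<close> map L2 into L2; local Lipschitz terms are reduced to this case
  in \<open>sol_exists\<close>.\<close>

definition nonlin :: "(real ^ 'n => real => real) => real => bool" where
 "nonlin h Lc \<longleftrightarrow> Lc >= 0 \<and> (\<forall>t. (%x. h x t) \<in> BM) \<and>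
  (ae x. h x 0 = 0 \<and> (\<forall>s t. s <= t --> h x s <= h x t) \<and> (\<forall>s t. \<bar>h x s - h x t\<bar> <= Lc * \<bar>s - t\<bar>))"

lemma nonlinD:
 assumes "nonlin h Lc"
 shows "Lc >= 0" "(%x. h x t) \<in> BM" "ae x. h x 0 = 0"
  "ae x. \<forall>s t. s <= t --> h x s <= h x t" "ae x. \<forall>s t. \<bar>h x s - h x t\<bar> <= Lc * \<bar>s - t\<bar>"
proof -
 have ae: "ae x. h x 0 = 0 \<and> (\<forall>s t. s <= t --> h x s <= h x t) \<and> (\<forall>s t. \<bar>h x s - h x t\<bar> <= Lc * \<bar>s - t\<bar>)"
  using assms unfolding nonlin_def by (elim conjE)
 show "ae x. h x 0 = 0" using ae by (rule eventually_mono) (elim conjE)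
 show "ae x. \<forall>s t. s <= t --> h x s <= h x t" using ae by (rule eventually_mono) (elim conjE)
 show "ae x. \<forall>s t. \<bar>h x s - h x t\<bar> <= Lc * \<bar>s - t\<bar>" using ae by (rule eventually_mono) (elim conjE)
qed (use assms in \<open>auto simp: nonlin_def\<close>)

lemma nonlin_sqi:
 assumes n: "nonlin h Lc" and u: "sqi u" shows "sqi (%x. h x (u x))"
proof (rule sqi_bound[OF u, where C=Lc])
 note ae = nonlinD(5)[OF n]
 show "(%x. h x (u x)) \<in> BM"
 proof (rule caratheodory_measurable[where h=h and u=u])
  show "ae x. continuous_on UNIV (h x)" using ae
  proof (rule eventually_mono)
   fix x assume "\<forall>s t. \<bar>h x s - h x t\<bar> <= Lc * \<bar>s - t\<bar>"
   hence "Lc-lipschitz_on UNIV (h x)" using nonlinD(1)[OF n] by (auto simp: lipschitz_on_def dist_real_def)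
   thus "continuous_on UNIV (h x)" by (rule lipschitz_on_continuous_on)
  qed
 qed (use nonlinD(2)[OF n] u in \<open>auto simp: sqi_measurable\<close>)
 show "ae x. \<bar>h x (u x)\<bar> <= Lc * \<bar>u x\<bar>" using ae nonlinD(3)[OF n]
 proof eventually_elim
  case (elim x)
  from elim(1)[rule_format, of "u x" 0] elim(2) show ?case by simp
 qed
qed

text \<open>\<open>strongly_monotone_solvable\<close> on \<open>W Om\<close>. Elements of
  \<open>W Om\<close> are pairs of classes, so the form is evaluated on chosen representatives;
  \<open>Fcong\<close> shows that the choice is immaterial, which gives linearity. Monotonicity of
  \<open>h\<close> contributes a nonnegative term, and \<open>poincare_friedrichs\<close> makes
  ellipticity coercive in the full norm with constant \<open>lam / (1 + t^2)\<close>.\<close>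

theorem nonlin_solution:
 assumes n: "nonlin h Lc" and w: "sqi w"
 shows "\<exists>u U. h10 Om u U \<and> (\<forall>ph Ph. h10 Om ph Ph --> form U Ph = (lint x. (w x - h x (u x)) * ph x))"
proof -
 have "\<forall>p\<in>W Om. \<exists>u U. p = pr u U \<and> h10 Om u U" using W_repr by blast
 then obtain ru rU where rep: "\<forall>p\<in>W Om. p = pr (ru p) (rU p) \<and> h10 Om (ru p) (rU p)" by metis
 have r1: "pr (ru p) (rU p) = p" and r2: "h10 Om (ru p) (rU p)" if "p \<in> W Om" for p using rep that by auto
 define Fh where "Fh u U ph Ph = form U Ph - (lint x. (w x - h x (u x)) * ph x)" for u U ph Ph
 define F where "F p q = Fh (ru p) (rU p) (ru q) (rU q)" for p q
 have Fcong: "Fh u U ph Ph = Fh u' U' ph' Ph'"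
  if a: "h10 Om u U" "h10 Om u' U'" "h10 Om ph Ph" "h10 Om ph' Ph'" "pr u U = pr u' U'" "pr ph Ph = pr ph' Ph'" for u U u' U' ph Ph ph' Ph'
 proof -
  note e = pr_eq_AE[OF a(1,2,5)] pr_eq_AE[OF a(3,4,6)]
  have s: "sqi (%x. w x - h x (u x))" "sqi (%x. w x - h x (u' x))"
   using nonlin_sqi[OF n h10D(1)[OF a(1)]] nonlin_sqi[OF n h10D(1)[OF a(2)]] w by (auto intro: sqi_diff)
  have "form U Ph = form U' Ph'" unfolding form_def
  proof (rule integral_cong_AE)
   show "ae x. bil x (U x) (Ph x) = bil x (U' x) (Ph' x)" using e by eventually_elim simp
  qed (intro bil_measurable sqv_measurable h10D(2)[OF a(1)] h10D(2)[OF a(2)] h10D(2)[OF a(3)] h10D(2)[OF a(4)])+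
  moreover have "(lint x. (w x - h x (u x)) * ph x) = (lint x. (w x - h x (u' x)) * ph' x)"
  proof (rule integral_cong_AE)
   show "ae x. (w x - h x (u x)) * ph x = (w x - h x (u' x)) * ph' x" using e by eventually_elim simp
  qed (use sqi_mult_integrable[OF s(1) h10D(1)[OF a(3)]] sqi_mult_integrable[OF s(2) h10D(1)[OF a(4)]] in auto)
  ultimately show ?thesis by (simp add: Fh_def)
 qed
 have FF: "F p (pr ph Ph) = Fh (ru p) (rU p) ph Ph" if "p \<in> W Om" "h10 Om ph Ph" for p ph Ph
 proof -
  have m: "pr ph Ph \<in> W Om" using that(2) by (simp add: h10_def)
  show ?thesis unfolding F_def by (rule Fcong[OF r2[OF that(1)] r2[OF that(1)] r2[OF m] that(2) refl r1[OF m]])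
 qed
 obtain t where t: "t >= 1" "\<forall>u U. h10 Om u U --> norm (cls u) <= t * norm (cls (%x. norm (U x)))" using poincare_friedrichs by blast
 have nle: "norm (cls u) <= norm (pr u U)" "norm (cls (%x. norm (U x))) <= norm (pr u U)" if "h10 Om u U" for u U
 proof -
  note e = norm_pr[OF h10D(1,2)[OF that]]
  show "norm (cls u) <= norm (pr u U)" by (rule power2_le_imp_le) (simp_all add: e)
  show "norm (cls (%x. norm (U x))) <= norm (pr u U)" by (rule power2_le_imp_le) (simp_all add: e)
 qed
 have ip: "(lint x. f x * g x) = inner (cls f) (cls g)" if "sqi f" "sqi g" for f g :: "real^'n => real" using that by (simp add: cls_simps)
 have sh: "sqi (%x. h x (ru p x))" if "p \<in> W Om" for p by (rule nonlin_sqi[OF n h10D(1)[OF r2[OF that]]])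
 have swh: "sqi (%x. w x - h x (ru p x))" if "p \<in> W Om" for p by (rule sqi_diff[OF w sh[OF that]])
 have Fdiff: "F p x - F q x = form (%x. rU p x - rU q x) (rU x) + (lint z. (h z (ru p z) - h z (ru q z)) * ru x z)"
  if "p \<in> W Om" "q \<in> W Om" "x \<in> W Om" for p q x
 proof -
  have "form (%x. rU p x - rU q x) (rU x) = form (rU p) (rU x) - form (rU q) (rU x)"
   using that by (intro form_diff_left h10D(2)[OF r2])
  moreover have "(lint z. (h z (ru p z) - h z (ru q z)) * ru x z)
   = (lint z. (w z - h z (ru q z)) * ru x z - (w z - h z (ru p z)) * ru x z)"
   by (simp add: algebra_simps)
  moreover have "\<dots> = (lint z. (w z - h z (ru q z)) * ru x z) - (lint z. (w z - h z (ru p z)) * ru x z)"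
   using that by (intro Bochner_Integration.integral_diff sqi_mult_integrable swh h10D(1)[OF r2])
  ultimately show ?thesis by (simp add: F_def Fh_def)
 qed
 have "\<exists>p. p \<in> W Om \<and> (\<forall>x\<in>W Om. F p x = 0)"
 proof (rule strongly_monotone_solvable[OF W_closed W_subspace, where F=F])
  fix p x y assume a: "p \<in> W Om" "x \<in> W Om" "y \<in> W Om"
  note hx = r2[OF a(2)] and hy = r2[OF a(3)]
  have "x + y = pr (%z. ru x z + ru y z) (%z. rU x z + rU y z)"
   using r1[OF a(2)] r1[OF a(3)] pr_add[OF h10D(1,2)[OF hx] h10D(1,2)[OF hy]] by simp
  hence "F p (x + y) = Fh (ru p) (rU p) (%z. ru x z + ru y z) (%z. rU x z + rU y z)"
   using FF[OF a(1) h10_add[OF hx hy]] by simp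
  also have "\<dots> = F p x + F p y"
   unfolding F_def Fh_def using form_add_right[OF h10D(2)[OF r2[OF a(1)]] h10D(2)[OF hx] h10D(2)[OF hy]]
    sqi_mult_integrable[OF swh[OF a(1)] h10D(1)[OF hx]] sqi_mult_integrable[OF swh[OF a(1)] h10D(1)[OF hy]]
   by (simp add: distrib_left)
  finally show "F p (x + y) = F p x + F p y" .
 next
  fix p c x assume a: "p \<in> W Om" "x \<in> W Om"
  note hx = r2[OF a(2)]
  have "c *R x = pr (%z. c * ru x z) (%z. c *R rU x z)"
   using r1[OF a(2)] pr_scale[OF h10D(1,2)[OF hx], of c] by simp
  hence "F p (c *R x) = Fh (ru p) (rU p) (%z. c * ru x z) (%z. c *R rU x z)"
   using FF[OF a(1) h10_scale[OF hx]] by simp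
  also have "\<dots> = c * F p x" unfolding F_def Fh_def by (simp add: form_scale_right right_diff_distrib mult.left_commute[of _ c])
  finally show "F p (c *R x) = c * F p x" .
 next
  fix x assume a: "x \<in> W Om"
  have z: "0 \<in> W Om" by (rule subspace_0[OF W_subspace])
  have h0: "h10 Om (%x. 0) (%x. 0)" using h10_scale[OF r2[OF z], of 0] by simp
  have "pr (%x. 0) (%x. 0 :: real ^ 'n) = 0" by (simp add: pr_def cls_simps zero_prod_def vec_eq_iff)
  hence "F 0 x = Fh (%x. 0) (%x. 0) (ru x) (rU x)"
   unfolding F_def using r1[OF z] by (intro Fcong[OF r2[OF z] h0 r2[OF a] r2[OF a]]) auto
  also have "\<dots> = - (lint z. (w z - h z 0) * ru x z)" by (simp add: Fh_def form_def bil_simps)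
  also have "\<dots> = - inner (cls (%z. w z - h z 0)) (cls (ru x))"
   using ip[OF sqi_diff[OF w nonlin_sqi[OF n sqi_zero]] h10D(1)[OF r2[OF a]]] by simp
  finally have "\<bar>F 0 x\<bar> <= norm (cls (%z. w z - h z 0)) * norm (cls (ru x))" by (simp add: Cauchy_Schwarz_ineq2)
  also have "\<dots> <= norm (cls (%z. w z - h z 0)) * norm x" using nle(1)[OF r2[OF a]] r1[OF a] by (intro mult_left_mono) auto
  finally show "\<bar>F 0 x\<bar> <= norm (cls (%z. w z - h z 0)) * norm x" .
 next
  fix p q x assume a: "p \<in> W Om" "q \<in> W Om" "x \<in> W Om"
  note hp = r2[OF a(1)] and hq = r2[OF a(2)] and hx = r2[OF a(3)]
  have hd: "h10 Om (%z. ru p z - ru q z) (%z. rU p z - rU q z)" by (rule h10_diff[OF hp hq])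
  have prd: "pr (%z. ru p z - ru q z) (%z. rU p z - rU q z) = p - q"
   using pr_add[OF h10D(1,2)[OF hp] h10D(1,2)[OF h10_scale[OF hq, of "-1"]]] pr_scale[OF h10D(1,2)[OF hq], of "-1"] r1[OF a(1)] r1[OF a(2)]
   by simp (metis diff_conv_add_uminus)
  have "\<bar>form (%z. rU p z - rU q z) (rU x)\<bar> <= Lam * (norm (cls (%z. norm (rU p z - rU q z))) * norm (cls (%z. norm (rU x z))))"
   by (rule form_bound[OF h10D(2)[OF hd] h10D(2)[OF hx]])
  also have "\<dots> <= Lam * (norm (p - q) * norm x)"
   using nle(2)[OF hd] nle(2)[OF hx] Lam by (intro mult_left_mono mult_mono) (auto simp: prd r1[OF a(3)])
  finally have b1: "\<bar>form (%z. rU p z - rU q z) (rU x)\<bar> <= Lam * (norm (p - q) * norm x)" .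
  have sd: "sqi (%z. h z (ru p z) - h z (ru q z))" by (rule sqi_diff[OF sh[OF a(1)] sh[OF a(2)]])
  have "\<bar>(lint z. (h z (ru p z) - h z (ru q z)) * ru x z)\<bar> <= norm (cls (%z. h z (ru p z) - h z (ru q z))) * norm (cls (ru x))"
   unfolding ip[OF sd h10D(1)[OF hx]] by (rule Cauchy_Schwarz_ineq2)
  also have "norm (cls (%z. h z (ru p z) - h z (ru q z))) <= Lc * norm (cls (%z. ru p z - ru q z))"
  proof (rule norm_cls_mono[OF sd h10D(1)[OF hd]])
   show "ae z. \<bar>h z (ru p z) - h z (ru q z)\<bar> <= Lc * \<bar>ru p z - ru q z\<bar>"
    using nonlinD(5)[OF n] by eventually_elim blast
  qed (rule nonlinD(1)[OF n])
  finally have "\<bar>(lint z. (h z (ru p z) - h z (ru q z)) * ru x z)\<bar> <= Lc * norm (cls (%z. ru p z - ru q z)) * norm (cls (ru x))"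
   by (simp add: mult_right_mono)
  also have "\<dots> <= Lc * norm (p - q) * norm x"
   using nle(1)[OF hd] nle(1)[OF hx] n by (intro mult_mono) (auto simp: prd r1[OF a(3)] nonlin_def)
  finally show "\<bar>F p x - F q x\<bar> <= (Lam + Lc) * norm (p - q) * norm x"
   unfolding Fdiff[OF a] using b1 by (simp add: algebra_simps)
 next
  fix p q assume a: "p \<in> W Om" "q \<in> W Om"
  note hp = r2[OF a(1)] and hq = r2[OF a(2)]
  have hd: "h10 Om (%z. ru p z - ru q z) (%z. rU p z - rU q z)" by (rule h10_diff[OF hp hq])
  have prd: "pr (%z. ru p z - ru q z) (%z. rU p z - rU q z) = p - q"
   using pr_add[OF h10D(1,2)[OF hp] h10D(1,2)[OF h10_scale[OF hq, of "-1"]]] pr_scale[OF h10D(1,2)[OF hq], of "-1"] r1[OF a(1)] r1[OF a(2)]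
   by simp (metis diff_conv_add_uminus)
  define D where "D = norm (cls (%z. norm (rU p z - rU q z)))"
  have "F p (p - q) - F q (p - q) = Fh (ru p) (rU p) (%z. ru p z - ru q z) (%z. rU p z - rU q z) - Fh (ru q) (rU q) (%z. ru p z - ru q z) (%z. rU p z - rU q z)"
   using FF[OF a(1) hd] FF[OF a(2) hd] by (simp add: prd)
  also have "\<dots> = form (%z. rU p z - rU q z) (%z. rU p z - rU q z) + (lint z. (h z (ru p z) - h z (ru q z)) * (ru p z - ru q z))"
  proof -
   have "form (%x. rU p x - rU q x) (%z. rU p z - rU q z) = form (rU p) (%z. rU p z - rU q z) - form (rU q) (%z. rU p z - rU q z)"
    by (intro form_diff_left h10D(2)[OF hp] h10D(2)[OF hq] h10D(2)[OF hd])
   moreover have "(lint z. (h z (ru p z) - h z (ru q z)) * (ru p z - ru q z))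
    = (lint z. (w z - h z (ru q z)) * (ru p z - ru q z) - (w z - h z (ru p z)) * (ru p z - ru q z))"
    by (simp add: algebra_simps)
   moreover have "\<dots> = (lint z. (w z - h z (ru q z)) * (ru p z - ru q z)) - (lint z. (w z - h z (ru p z)) * (ru p z - ru q z))"
    by (intro Bochner_Integration.integral_diff sqi_mult_integrable swh a h10D(1)[OF hd])
   ultimately show ?thesis by (simp add: Fh_def)
  qed
  finally have e: "F p (p - q) - F q (p - q) = \<dots>" .
  have "ae z. 0 <= (h z (ru p z) - h z (ru q z)) * (ru p z - ru q z)"
  proof -
   note nonlinD(4)[OF n]
   thus ?thesis
   proof eventually_elim
    case (elim z)
    thus ?case by (cases "ru p z <= ru q z") (auto intro: mult_nonneg_nonneg mult_nonpos_nonpos)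
   qed
  qed
  hence "0 <= (lint z. (h z (ru p z) - h z (ru q z)) * (ru p z - ru q z))" by (rule integral_nonneg_AE)
  hence "lam * D^2 <= F p (p - q) - F q (p - q)"
   using form_elliptic[OF hd] unfolding e D_def by (simp add: norm_cls sqi_norm[OF h10D(2)[OF hd]])
  moreover have "lam / (1 + t^2) * (norm (p - q))^2 <= lam * D^2"
  proof -
   have "norm (cls (%z. ru p z - ru q z)) <= t * D" unfolding D_def using t(2) hd by blast
   hence "(norm (cls (%z. ru p z - ru q z)))^2 <= (t * D)^2" by (intro power_mono) auto
   hence "(norm (p - q))^2 <= (1 + t^2) * D^2"
    using norm_pr[OF h10D(1,2)[OF hd]] by (simp add: prd D_def power_mult_distrib algebra_simps)
   hence "lam / (1 + t^2) * (norm (p - q))^2 <= lam / (1 + t^2) * ((1 + t^2) * D^2)" using lam by (intro mult_left_mono) auto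
   also have "\<dots> = lam * D^2"
   proof -
    have "1 + t^2 > 0" by (simp add: add_pos_nonneg)
    thus ?thesis by simp
   qed
   finally show ?thesis .
  qed
  ultimately show "lam / (1 + t^2) * (norm (p - q))^2 <= F p (p - q) - F q (p - q)" by linarith
 next
  show "lam / (1 + t^2) > 0" using lam by (simp add: add_pos_nonneg)
 qed blast
 then obtain p where p: "p \<in> W Om" "\<forall>x\<in>W Om. F p x = 0" by blast
 have "form (rU p) Ph = (lint x. (w x - h x (ru p x)) * ph x)" if ph: "h10 Om ph Ph" for ph Ph
 proof -
  have "pr ph Ph \<in> W Om" using ph by (simp add: h10_def)
  hence "Fh (ru p) (rU p) ph Ph = 0" using p(2) FF[OF p(1) ph] by simp
  thus ?thesis by (simp add: Fh_def)
 qed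
 thus ?thesis using r2[OF p(1)] by blast
qed


section \<open>Bounds, continuity and existence for the monotone equation\<close>

definition weak_eq :: "(real ^ 'n => real ^ 'n) => (real ^ 'n => real) => bool" where
 "weak_eq U g \<longleftrightarrow> (\<forall>ph Ph. h10 Om ph Ph --> form U Ph = (lint x. g x * ph x))"

lemma weak_eq_uminus: "weak_eq U g ==> weak_eq (%x. - U x) (%x. - g x)"
 unfolding weak_eq_def by (simp add: form_uminus_left)

lemma weak_eq_diff:
 assumes "weak_eq U f" "weak_eq V g" "sqv U" "sqv V" "sqi f" "sqi g"
 shows "weak_eq (%x. U x - V x) (%x. f x - g x)"
 unfolding weak_eq_def
proof (intro allI impI)
 fix ph Ph assume h: "h10 Om ph Ph"
 have e: "form U Ph = (lint x. f x * ph x)" "form V Ph = (lint x. g x * ph x)"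
  using assms(1,2) h unfolding weak_eq_def by auto
 show "form (%x. U x - V x) Ph = (lint x. (f x - g x) * ph x)"
  unfolding form_diff_left[OF assms(3,4) h10D(2)[OF h]] e left_diff_distrib
  by (rule Bochner_Integration.integral_diff[symmetric]) (rule sqi_mult_integrable[OF assms(5) h10D(1)[OF h]] sqi_mult_integrable[OF assms(6) h10D(1)[OF h]])+
qed

text \<open>A zero-order term with the sign of the solution does not affect the estimates.\<close>

lemma subsol_if_weak_eq:
 assumes u: "h10 Om u U" and e: "weak_eq U (%x. w x - H x)" and s: "sqi w" "sqi H"
  and sign: "ae x. u x > 0 --> H x >= 0"
 shows "subsol u U w"
 unfolding subsol_def
proof (intro conjI allI impI u s)
 fix ph Ph assume h: "h10 Om ph Ph" and p: "\<forall>x. 0 <= ph x" and z: "\<forall>x. u x <= 0 --> ph x = 0"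
 have "form U Ph = (lint x. (w x - H x) * ph x)" using e h unfolding weak_eq_def by blast
 also have "\<dots> <= (lint x. w x * ph x)"
 proof (rule integral_mono_AE)
  show "integrable lebesgue (%x. (w x - H x) * ph x)" by (rule sqi_mult_integrable[OF sqi_diff[OF s] h10D(1)[OF h]])
  show "integrable lebesgue (%x. w x * ph x)" by (rule sqi_mult_integrable[OF s(1) h10D(1)[OF h]])
  show "ae x. (w x - H x) * ph x <= w x * ph x" using sign
  proof eventually_elim
   case (elim x)
   show ?case
   proof (cases "u x > 0")
    case True
    thus ?thesis using elim p by (intro mult_right_mono) auto
   qed (use z in simp)
  qed
 qed
 finally show "form U Ph <= (lint x. w x * ph x)" .
qed

lemma two_sided_subsol:
 assumes u: "h10 Om u U" and e: "weak_eq U (%x. w x - H x)" and s: "sqi w" "sqi H"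
  and sign: "ae x. (u x > 0 --> H x >= 0) \<and> (u x < 0 --> H x <= 0)"
 shows "subsol u U w" "subsol (%x. - u x) (%x. - U x) (%x. - w x)"
proof -
 have 1: "ae x. u x > 0 --> H x >= 0" using sign by eventually_elim blast
 show "subsol u U w" by (rule subsol_if_weak_eq[OF u e s 1])
 have 2: "ae x. - u x > 0 --> - H x >= 0" using sign by eventually_elim simp
 have "weak_eq (%x. - U x) (%x. - w x - - H x)" using weak_eq_uminus[OF e] by simp
 from subsol_if_weak_eq[OF h10_uminus[OF u] this sqi_uminus[OF s(1)] sqi_uminus[OF s(2)] 2]
 show "subsol (%x. - u x) (%x. - U x) (%x. - w x)" .
qed

lemma two_sided_bound:
 assumes K: "\<forall>z Z g. subsol z Z g --> (ae x. z x <= K * norm (cls g))"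
  and z: "subsol z Z g" "subsol (%x. - z x) (%x. - Z x) (%x. - g x)"
 shows "ae x. \<bar>z x\<bar> <= K * norm (cls g)"
proof -
 have "sqi g" using z(1) by (simp add: subsol_def)
 hence "cls (%x. - g x) = - cls g" by (simp add: cls_simps)
 hence n: "norm (cls (%x. - g x)) = norm (cls g)" by simp
 have "ae x. z x <= K * norm (cls g)" using K z(1) by blast
 moreover have "ae x. - z x <= K * norm (cls g)" using K z(2) n by metis
 ultimately show ?thesis by eventually_elim simp
qed

text \<open>The Lipschitz condition is local, so the growth in \<open>t\<close> is arbitrary;
  solutions will be bounded.\<close>

definition monotone_term :: "(real ^ 'n => real => real) => bool" where
 "monotone_term h \<longleftrightarrow> (\<forall>t. (%x. h x t) \<in> BM) \<and>
  (ae x. h x 0 = 0) \<and> (ae x. \<forall>s t. s <= t --> h x s <= h x t) \<and>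
  (\<forall>M>0. \<exists>C\<ge>0. ae x. \<forall>s t. \<bar>s\<bar> <= M --> \<bar>t\<bar> <= M --> \<bar>h x s - h x t\<bar> <= C * \<bar>s - t\<bar>)"

lemma integrable_h10: assumes "h10 Om ph Ph" shows "integrable lebesgue ph"
proof -
 have i: "integrable lebesgue (%x. ind Om x * ph x)" by (rule integrable_indicator_mult[OF Om_lmeasurable h10D(1)[OF assms]])
 have "ae x. ind Om x * ph x = ph x" using h10_zero_outside[OF assms] by eventually_elim (auto simp: indicator_def)
 thus ?thesis
  using integrable_cong_AE[OF borel_measurable_integrable[OF i] sqi_measurable[OF h10D(1)[OF assms]]] i by blast
qed

lemma lsub_if_bounded:
 assumes u: "h10 Om u U" and e: "weak_eq U g" and s: "sqi g" and b: "ae x. g x <= Gam"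
 shows "lsub u U Gam"
 unfolding lsub_def
proof (intro conjI allI impI u)
 fix ph Ph assume h: "h10 Om ph Ph" and p: "\<forall>x. 0 <= ph x"
 have "form U Ph = (lint x. g x * ph x)" using e h unfolding weak_eq_def by blast
 also have "\<dots> <= (lint x. Gam * ph x)"
 proof (rule integral_mono_AE)
  show "integrable lebesgue (%x. g x * ph x)" by (rule sqi_mult_integrable[OF s h10D(1)[OF h]])
  show "integrable lebesgue (%x. Gam * ph x)" using integrable_h10[OF h] by simp
  show "ae x. g x * ph x <= Gam * ph x" using b by eventually_elim (use p in \<open>auto intro: mult_right_mono\<close>)
 qed
 finally show "form U Ph <= Gam * (lint x. ph x)" by simp
qed

lemma linear_solution:
 assumes "sqi g" shows "\<exists>u U. h10 Om u U \<and> weak_eq U g"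
proof -
 have "nonlin (%x t. 0) 0" by (simp add: nonlin_def)
 from nonlin_solution[OF this assms] show ?thesis by (simp add: weak_eq_def)
qed

lemma ess_continuous_uniform_limit:
 assumes "\<forall>e>0. \<exists>v. ess_continuous v \<and> (ae x. \<bar>u x - v x\<bar> <= e)"
 shows "ess_continuous u"
 unfolding ess_continuous_def
proof (intro allI impI)
 fix p and e :: real assume e: "e > 0"
 hence e4: "e / 4 > 0" "e / 2 > 0" by auto
 from assms e4(1) obtain v where v: "ess_continuous v" "ae x. \<bar>u x - v x\<bar> <= e / 4" by blast
 from v(1)[unfolded ess_continuous_def, rule_format, OF e4(2), of p]
 obtain \<rho> m where r: "\<rho> > 0" "ae x. x \<in> ball p \<rho> --> m <= v x \<and> v x <= m + e / 2" "p \<notin> Om --> m = - (e / 2 / 2)" by blast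
 have "ae x. x \<in> ball p \<rho> --> m - e / 4 <= u x \<and> u x <= (m - e / 4) + e" using r(2) v(2)
 proof eventually_elim
  case (elim x)
  show ?case
  proof
   assume "x \<in> ball p \<rho>"
   thus "m - e / 4 <= u x \<and> u x <= (m - e / 4) + e" using elim by argo
  qed
 qed
 moreover have "p \<notin> Om --> m - e / 4 = - (e / 2)" using r(3) by simp
 ultimately show "\<exists>\<rho>>0. \<exists>m. (ae x. x \<in> ball p \<rho> --> m <= u x \<and> u x <= m + e) \<and> (p \<notin> Om --> m = - (e / 2))"
  using r(1) by blast
qed

text \<open>The oscillation estimates ask for a bounded right-hand side. Truncating \<open>g\<close>
  at height \<open>n\<close> gives linear problems that they cover, and by \<open>ess_bound\<close>
  their solutions are uniformly close to \<open>u\<close>, since the truncations tend to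
  \<open>g\<close> in L2.\<close>

lemma ess_continuous_solution:
 assumes N: "CARD('n) <= 3" and b: regular_boundary and u: "h10 Om u U" "weak_eq U g" and g: "sqi g"
 shows "ess_continuous u"
proof (rule ess_continuous_uniform_limit, intro allI impI)
 fix e :: real assume e: "e > 0"
 obtain K where K: "K >= 0" "\<forall>z Z g. subsol z Z g --> (ae x. z x <= K * norm (cls g))" using ess_bound[OF N] by blast
 define G where "G n x = max (- real n) (min (real n) (g x))" for n x
 have gm[measurable]: "g \<in> BM" using g by (rule sqi_measurable)
 have Gm: "G n \<in> BM" for n unfolding G_def by measurable
 have Gl: "ae x. (%n. G n x) ~~> g x"
 proof (intro AE_I2)
  fix x
  obtain n0 :: nat where n0: "\<bar>g x\<bar> <= real n0" using real_arch_simple by blast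
  have "\<forall>n\<ge>n0. G n x = g x" using n0 by (auto simp: G_def max_def min_def)
  hence "\<forall>\<^sub>F n in sequentially. G n x = g x" by (auto simp: eventually_sequentially)
  thus "(%n. G n x) ~~> g x" by (rule tendsto_eventually)
 qed
 have Gb: "ae x. \<bar>G n x\<bar> <= 1 * \<bar>g x\<bar>" for n by (intro AE_I2) (auto simp: G_def max_def min_def)
 note dc = cls_dominated_convergence[OF Gm gm g Gl Gb]
 have "(%n. K * norm (cls g - cls (G n))) ~~> K * norm (cls g - cls g)" by (intro tendsto_intros dc(3))
 hence "(%n. K * norm (cls g - cls (G n))) ~~> 0" by simp
 hence "\<forall>\<^sub>F n in sequentially. K * norm (cls g - cls (G n)) < e" using e by (rule order_tendstoD(2))
 then obtain n where n: "K * norm (cls g - cls (G n)) < e" by (auto simp: eventually_sequentially)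
 obtain v V where v: "h10 Om v V" "weak_eq V (G n)" using linear_solution[OF dc(2)] by blast
 have v0: "weak_eq V (%x. G n x - 0)" using v(2) by simp
 have "ae x. \<bar>v x\<bar> <= K * norm (cls (G n))"
  by (rule two_sided_bound[OF K(2) two_sided_subsol[OF v(1) v0 dc(2) sqi_zero]]) simp_all
 moreover have "lsub v V (real n)" by (rule lsub_if_bounded[OF v dc(2)]) (simp add: G_def)
 moreover have "lsub (%x. - v x) (%x. - V x) (real n)"
  by (rule lsub_if_bounded[OF h10_uminus[OF v(1)] weak_eq_uminus[OF v(2)] sqi_uminus[OF dc(2)]]) (auto simp: G_def)
 ultimately have "ess_continuous v" by (intro ess_continuous_bounded_rhs[OF _ _ _ _ b]) auto
 moreover have "ae x. \<bar>u x - v x\<bar> <= e"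
 proof -
  have s: "sqi (%x. g x - G n x)" by (rule sqi_diff[OF g dc(2)])
  have "weak_eq (%x. U x - V x) (%x. (g x - G n x) - 0)"
   using weak_eq_diff[OF u(2) v(2) h10D(2)[OF u(1)] h10D(2)[OF v(1)] g dc(2)] by simp
  note t = two_sided_subsol[OF h10_diff[OF u(1) v(1)] this s sqi_zero]
  have "ae x. \<bar>u x - v x\<bar> <= K * norm (cls (%x. g x - G n x))"
   by (rule two_sided_bound[OF K(2) t]) simp_all
  moreover have "cls (%x. g x - G n x) = cls g - cls (G n)" by (simp add: cls_simps g dc(2))
  ultimately show ?thesis using n by (auto elim: eventually_mono)
 qed
 ultimately show "\<exists>v. ess_continuous v \<and> (ae x. \<bar>u x - v x\<bar> <= e)" by blast
qed

definition sol :: "(real ^ 'n => real => real) => (real ^ 'n => real) => (real ^ 'n => real) => (real ^ 'n => real ^ 'n) => bool" where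
 "sol h w y Y \<longleftrightarrow> h10 Om y Y \<and> sqi (%x. h x (y x)) \<and> weak_eq Y (%x. w x - h x (y x))"

text \<open>By monotonicity \<open>h x (y1 x) - h x (y2 x)\<close> has the sign of
  \<open>y1 x - y2 x\<close>, so it drops out of the subsolution inequalities and of the energy
  inequality, and only the difference of the data remains.\<close>

lemma sol_difference:
 assumes h: "monotone_term h" and 1: "sol h w1 y1 Y1" and 2: "sol h w2 y2 Y2" and s: "sqi w1" "sqi w2"
 shows "subsol (%x. y1 x - y2 x) (%x. Y1 x - Y2 x) (%x. w1 x - w2 x)"
  "subsol (%x. - (y1 x - y2 x)) (%x. - (Y1 x - Y2 x)) (%x. - (w1 x - w2 x))"
  "form (%x. Y1 x - Y2 x) (%x. Y1 x - Y2 x) <= (lint x. (w1 x - w2 x) * (y1 x - y2 x))"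
proof -
 have h1: "h10 Om y1 Y1" "h10 Om y2 Y2" and sh: "sqi (%x. h x (y1 x))" "sqi (%x. h x (y2 x))"
  and e: "weak_eq Y1 (%x. w1 x - h x (y1 x))" "weak_eq Y2 (%x. w2 x - h x (y2 x))"
  using 1 2 by (auto simp: sol_def)
 have "weak_eq (%x. Y1 x - Y2 x) (%x. (w1 x - h x (y1 x)) - (w2 x - h x (y2 x)))"
  by (rule weak_eq_diff[OF e h10D(2)[OF h1(1)] h10D(2)[OF h1(2)] sqi_diff[OF s(1) sh(1)] sqi_diff[OF s(2) sh(2)]])
 hence ed: "weak_eq (%x. Y1 x - Y2 x) (%x. (w1 x - w2 x) - (h x (y1 x) - h x (y2 x)))" by (simp add: algebra_simps)
 have "ae x. \<forall>s t. s <= t --> h x s <= h x t" using h unfolding monotone_term_def by blast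
 hence sign: "ae x. (y1 x - y2 x > 0 --> h x (y1 x) - h x (y2 x) >= 0) \<and> (y1 x - y2 x < 0 --> h x (y1 x) - h x (y2 x) <= 0)"
  by eventually_elim simp
 note t = two_sided_subsol[OF h10_diff[OF h1] ed sqi_diff[OF s] sqi_diff[OF sh] sign]
 show "subsol (%x. y1 x - y2 x) (%x. Y1 x - Y2 x) (%x. w1 x - w2 x)"
  "subsol (%x. - (y1 x - y2 x)) (%x. - (Y1 x - Y2 x)) (%x. - (w1 x - w2 x))" by (rule t)+
 have "form (%x. Y1 x - Y2 x) (%x. Y1 x - Y2 x) = (lint x. ((w1 x - w2 x) - (h x (y1 x) - h x (y2 x))) * (y1 x - y2 x))"
  using ed h10_diff[OF h1] unfolding weak_eq_def by blast
 also have "\<dots> <= (lint x. (w1 x - w2 x) * (y1 x - y2 x))"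
 proof (rule integral_mono_AE)
  note sz = h10D(1)[OF h10_diff[OF h1]]
  show "integrable lebesgue (%x. ((w1 x - w2 x) - (h x (y1 x) - h x (y2 x))) * (y1 x - y2 x))"
   by (rule sqi_mult_integrable[OF sqi_diff[OF sqi_diff[OF s] sqi_diff[OF sh]] sz])
  show "integrable lebesgue (%x. (w1 x - w2 x) * (y1 x - y2 x))" by (rule sqi_mult_integrable[OF sqi_diff[OF s] sz])
  show "ae x. ((w1 x - w2 x) - (h x (y1 x) - h x (y2 x))) * (y1 x - y2 x) <= (w1 x - w2 x) * (y1 x - y2 x)"
   using sign
  proof eventually_elim
   case (elim x)
   hence "0 <= (h x (y1 x) - h x (y2 x)) * (y1 x - y2 x)" by (cases "y1 x - y2 x" "0 :: real" rule: linorder_cases) (auto intro: mult_nonpos_nonpos)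
   thus ?case by (simp add: left_diff_distrib)
  qed
 qed
 finally show "form (%x. Y1 x - Y2 x) (%x. Y1 x - Y2 x) <= (lint x. (w1 x - w2 x) * (y1 x - y2 x))" .
qed

lemma sol_unique:
 assumes N: "CARD('n) <= 3" and h: "monotone_term h" and 1: "sol h w y1 Y1" and 2: "sol h w y2 Y2" and s: "sqi w"
 shows "ae x. y1 x = y2 x"
proof -
 obtain K where K: "K >= 0" "\<forall>z Z g. subsol z Z g --> (ae x. z x <= K * norm (cls g))" using ess_bound[OF N] by blast
 have "ae x. \<bar>y1 x - y2 x\<bar> <= K * norm (cls (%x. w x - w x))"
  by (rule two_sided_bound[OF K(2) sol_difference(1,2)[OF h 1 2 s s]])
 moreover have "cls (%x. w x - w x) = 0" by (simp add: cls_simps)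
 ultimately show ?thesis by simp
qed

text \<open>The nonlinearity is frozen outside the interval from \<open>- M\<close> to
  \<open>M\<close>, which makes it globally Lipschitz. The bound from \<open>ess_bound\<close> does
  not see the zero-order term and lies below \<open>M\<close>, so the solution of the modified
  problem solves the original one.\<close>

theorem sol_exists:
 assumes N: "CARD('n) <= 3" and b: regular_boundary and h: "monotone_term h" and K: "K >= 0" "\<forall>z Z g. subsol z Z g --> (ae x. z x <= K * norm (cls g))"
  and w: "sqi w"
 shows "\<exists>y Y. sol h w y Y \<and> continuous_on UNIV y \<and> (\<forall>x. x \<notin> Om --> y x = 0) \<and> (\<forall>x. \<bar>y x\<bar> <= K * norm (cls w))"
proof -
 \<comment> \<open>The summand 1 keeps \<open>M\<close> positive when \<open>w\<close> is
   zero.\<close>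
 define M where "M = K * norm (cls w) + 1"
 have M: "M > 0" using K(1) by (simp add: M_def add_nonneg_pos)
 have hm: "\<And>t. (%x. h x t) \<in> BM" and h0: "ae x. h x 0 = 0"
  and hmon: "ae x. \<forall>s t. s <= t --> h x s <= h x t" using h unfolding monotone_term_def by auto
 obtain C where C: "C >= 0" "ae x. \<forall>s t. \<bar>s\<bar> <= M --> \<bar>t\<bar> <= M --> \<bar>h x s - h x t\<bar> <= C * \<bar>s - t\<bar>"
  using h M unfolding monotone_term_def by meson
 define cl where "cl t = max (- M) (min M t)" for t
 have cl: "\<bar>cl t\<bar> <= M" "cl 0 = 0" "\<bar>cl s - cl t\<bar> <= \<bar>s - t\<bar>" "s <= t ==> cl s <= cl t" "\<bar>t\<bar> <= M ==> cl t = t" for s t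
  using M by (auto simp: cl_def max_def min_def)
 define hM where "hM x t = h x (cl t)" for x t
 have nl: "nonlin hM C" unfolding nonlin_def
 proof (intro conjI C(1) allI)
  show "(%x. hM x t) \<in> BM" for t unfolding hM_def by (rule hm)
  show "ae x. hM x 0 = 0 \<and> (\<forall>s t. s <= t --> hM x s <= hM x t) \<and> (\<forall>s t. \<bar>hM x s - hM x t\<bar> <= C * \<bar>s - t\<bar>)"
   using h0 hmon C(2)
  proof eventually_elim
   case (elim x)
   have "\<bar>h x (cl s) - h x (cl t)\<bar> <= C * \<bar>s - t\<bar>" for s t
   proof -
    have "\<bar>h x (cl s) - h x (cl t)\<bar> <= C * \<bar>cl s - cl t\<bar>" using elim(3) cl(1) by blast
    also have "\<dots> <= C * \<bar>s - t\<bar>" using cl(3) C(1) by (rule mult_left_mono)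
    finally show ?thesis .
   qed
   thus ?case using elim(1,2) cl(2,4) by (auto simp: hM_def)
  qed
 qed
 obtain u U where u: "h10 Om u U" "weak_eq U (%x. w x - hM x (u x))" using nonlin_solution[OF nl w] unfolding weak_eq_def by blast
 have sH: "sqi (%x. hM x (u x))" by (rule nonlin_sqi[OF nl h10D(1)[OF u(1)]])
 have sign: "ae x. (u x > 0 --> hM x (u x) >= 0) \<and> (u x < 0 --> hM x (u x) <= 0)"
  using nonlinD(3,4)[OF nl]
 proof eventually_elim
  case (elim x)
  from elim(2)[rule_format, of 0 "u x"] elim(2)[rule_format, of "u x" 0] elim(1) show ?case by auto
 qed
 have ub: "ae x. \<bar>u x\<bar> <= K * norm (cls w)" by (rule two_sided_bound[OF K(2) two_sided_subsol[OF u w sH sign]])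
 have "ess_continuous u" by (rule ess_continuous_solution[OF N b u sqi_diff[OF w sH]])
 from ess_continuous_representative[OF this] obtain y where y: "continuous_on UNIV y" "ae x. y x = u x" "\<forall>x. x \<notin> Om --> y x = 0" by blast
 have ym: "y \<in> BM" using y(1) by (simp add: borel_measurable_continuous_onI borel_lebesgue)
 have sy: "sqi y" by (rule sqi_bound[OF h10D(1)[OF u(1)] ym, where C=1]) (use y(2) in \<open>auto elim: eventually_mono\<close>)
 have hy: "h10 Om y U" by (rule h10_AE_cong[OF u(1) y(2) _ sy h10D(2)[OF u(1)]]) simp
 have e: "ae x. hM x (u x) = h x (y x)" using y(2) ub
 proof eventually_elim
  case (elim x)
  hence "\<bar>u x\<bar> <= M" by (simp add: M_def)
  thus ?case using elim(1) cl(5) by (simp add: hM_def)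
 qed
 have mh: "(%x. h x (y x)) \<in> BM" by (rule borel_measurable_AE[OF sqi_measurable[OF sH] e])
 have shy: "sqi (%x. h x (y x))" by (rule sqi_bound[OF sH mh, where C=1]) (use e in \<open>auto elim: eventually_mono\<close>)
 have "weak_eq U (%x. w x - h x (y x))" unfolding weak_eq_def
 proof (intro allI impI)
  fix ph Ph assume f: "h10 Om ph Ph"
  have "form U Ph = (lint x. (w x - hM x (u x)) * ph x)" using u(2) f unfolding weak_eq_def by blast
  also have "\<dots> = (lint x. (w x - h x (y x)) * ph x)"
  proof (rule integral_cong_AE)
   show "ae x. (w x - hM x (u x)) * ph x = (w x - h x (y x)) * ph x" using e by eventually_elim simp
  qed (rule borel_measurable_integrable, rule sqi_mult_integrable[OF sqi_diff[OF w] h10D(1)[OF f]], rule sH shy)+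
  finally show "form U Ph = (lint x. (w x - h x (y x)) * ph x)" .
 qed
 hence "sol h w y U" using hy shy by (simp add: sol_def)
 moreover have "\<bar>y x\<bar> <= K * norm (cls w)" for x
 proof -
  have "y x <= K * norm (cls w)"
  proof (rule continuous_le_if_AE[OF y(1) open_UNIV])
   show "ae x. x \<in> UNIV --> y x <= K * norm (cls w)" using y(2) ub by eventually_elim simp
  qed simp
  moreover have "- y x <= K * norm (cls w)"
  proof (rule continuous_le_if_AE[OF continuous_on_minus[OF y(1)] open_UNIV])
   show "ae x. x \<in> UNIV --> - y x <= K * norm (cls w)" using y(2) ub by eventually_elim simp
  qed simp
  ultimately show ?thesis by simp
 qed
 ultimately show ?thesis using y(1,3) by blast
qed

end

section \<open>Weak continuity of the solution operator\<close>

context elliptic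
begin

text \<open>A weakly null sequence paired with a strongly convergent one tends to zero. Strong
  convergence along a subsequence comes from weak compactness in \<open>W Om\<close> and
  \<open>rellich\<close> for \<open>z (r n) - y\<close>; the weak limit \<open>y\<close> need not be
  identified.\<close>

lemma compact_pairing:
 assumes h: "\<And>n. h10 Om (z n) (Z n)" and R: "\<And>n. norm (cls (z n)) <= R" and D: "\<And>n. norm (cls (%x. norm (Z n x))) <= D"
  and w: "weakly_to g 0" and g: "\<And>n :: nat. norm (g n) <= R'"
 shows "\<exists>r. strict_mono (r :: nat => nat) \<and> (%n. inner (g (r n)) (cls (z (r n)))) ~~> 0"
proof -
 have p: "norm (pr (z n) (Z n)) <= sqrt (R^2 + D^2)" for n
  using power_mono[OF R, of n 2] power_mono[OF D, of n 2] norm_pr[OF h10D(1,2)[OF h], of n] by (intro real_le_rsqrt) auto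
 obtain r l where r: "strict_mono (r :: nat => nat)" "weakly_to ((%n. pr (z n) (Z n)) \<circ> r) l" by (rule weak_compactness[of "%n. pr (z n) (Z n)", OF p])
 have "l \<in> W Om"
  by (rule weakly_closed_convex[OF W_closed subspace_imp_convex[OF W_subspace] r(2)]) (use h in \<open>simp add: h10_def\<close>)
 then obtain y Y where y: "l = pr y Y" "h10 Om y Y" using W_repr by blast
 define u where "u n x = z (r n) x - y x" for n x
 have hu: "h10 Om (u n) (%x. Z (r n) x - Y x)" for n unfolding u_def by (rule h10_diff[OF h y(2)])
 have cu: "cls (u n) = cls (z (r n)) - cls y" for n unfolding u_def by (simp add: cls_simps h10D(1)[OF h] h10D(1)[OF y(2)])
 have "weakly_to (%n. cls (u n)) 0" unfolding weakly_to_def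
 proof
  fix v
  have "(%n. inner (pr (z (r n)) (Z (r n))) (v, 0)) ~~> inner (pr y Y) (v, 0)" using r(2) by (simp add: weakly_to_def o_def y(1))
  hence "(%n. inner (cls (z (r n))) v - inner (cls y) v) ~~> inner (cls y) v - inner (cls y) v"
   by (intro tendsto_diff tendsto_const) (simp add: pr_def)
  thus "(%n. inner (cls (u n)) v) ~~> inner 0 v" by (simp add: cu inner_diff_left)
 qed
 moreover have "norm (cls (u n)) <= R + norm (cls y)" for n unfolding cu using norm_triangle_ineq4[of "cls (z (r n))" "cls y"] R[of "r n"] by simp
 moreover have "norm (cls (%x. norm (Z (r n) x - Y x))) <= D + norm (cls (%x. norm (Y x)))" for n
 proof -
  note s = sqi_norm[OF h10D(2)[OF h]] sqi_norm[OF h10D(2)[OF y(2)]]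
  have "norm (cls (%x. norm (Z (r n) x - Y x))) <= 1 * norm (cls (%x. norm (Z (r n) x) + norm (Y x)))"
   by (rule norm_cls_mono[OF sqi_norm[OF h10D(2)[OF hu]] sqi_add[OF s]]) (auto intro: norm_triangle_ineq4)
  also have "cls (%x. norm (Z (r n) x) + norm (Y x)) = cls (%x. norm (Z (r n) x)) + cls (%x. norm (Y x))" by (rule cls_simps(1)[OF s, symmetric])
  finally show ?thesis using norm_triangle_ineq[of "cls (%x. norm (Z (r n) x))" "cls (%x. norm (Y x))"] D[of "r n"] by simp
 qed
 ultimately have u0: "(%n. cls (u n)) ~~> 0" by (intro rellich[OF hu bounded_Om open_Om])
 have "R' >= 0" using g[of 0] norm_ge_zero order_trans by blast
 have "(%n. inner (g (r n)) (cls (u n))) ~~> 0"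
 proof (rule Lim_null_comparison[OF always_eventually])
  show "\<forall>n. norm (inner (g (r n)) (cls (u n))) <= R' * norm (cls (u n))"
   using Cauchy_Schwarz_ineq2 mult_right_mono[OF g norm_ge_zero] by (metis order_trans real_norm_def)
  show "(%n. R' * norm (cls (u n))) ~~> 0" using tendsto_mult[OF tendsto_const tendsto_norm[OF u0], of R'] by simp
 qed
 moreover have "(%n. inner (g (r n)) (cls y)) ~~> 0"
  using w LIMSEQ_subseq_LIMSEQ[OF _ r(1)] unfolding weakly_to_def by (fastforce simp: o_def)
 ultimately have "(%n. inner (g (r n)) (cls (u n)) + inner (g (r n)) (cls y)) ~~> 0 + 0" by (rule tendsto_add)
 hence "(%n. inner (g (r n)) (cls (z (r n)))) ~~> 0" by (simp add: cu inner_diff_right)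
 thus ?thesis using r(1) by blast
qed

text \<open>With \<open>g\<close> and \<open>z\<close> the differences of data and of solutions,
  \<open>lam * (G n)^2\<close> is at most the pairing of \<open>g n\<close> and \<open>z n\<close>.
  This first bounds the gradients of \<open>z\<close>; then \<open>compact_pairing\<close>, applied
  to any subsequence violating smallness, sends the pairing to zero, and with it the L2 norm
  required by \<open>ess_bound_small\<close>.\<close>

theorem weak_to_uniform:
 assumes N: "CARD('n) <= 3" and h: "monotone_term h"
  and w: "\<And>n. sqi (w n)" "sqi w0" and weak: "weakly_to (%n. cls (w n)) (cls w0)"
  and R: "\<And>n. norm (cls (w n) - cls w0) <= R"
  and sol: "\<And>n. sol h (w n) (y n) (Y n)" "sol h w0 y0 Y0" and e: "e > 0"
 shows "\<forall>\<^sub>F n in sequentially. ae x. \<bar>y n x - y0 x\<bar> <= e"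
proof -
 obtain K where K: "K >= 0" "\<forall>z Z g. subsol z Z g --> (ae x. z x <= K * norm (cls g))" using ess_bound[OF N] by blast
 obtain t where t: "t >= 1" "\<forall>u U. h10 Om u U --> norm (cls u) <= t * norm (cls (%x. norm (U x)))" using poincare_friedrichs by blast
 have R0: "R >= 0" using R[of 0] norm_ge_zero order_trans by blast
 define g where "g n x = w n x - w0 x" for n x
 have sg: "sqi (g n)" for n unfolding g_def by (rule sqi_diff[OF w])
 have cg: "cls (g n) = cls (w n) - cls w0" for n unfolding g_def by (simp add: cls_simps w)
 have gR: "norm (cls (g n)) <= R" for n using R by (simp add: cg)
 define z where "z n x = y n x - y0 x" for n x
 define Z where "Z n x = Y n x - Y0 x" for n x
 have sub: "subsol (z n) (Z n) (g n)" "subsol (%x. - z n x) (%x. - Z n x) (%x. - g n x)" for n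
  unfolding z_def Z_def g_def by (rule sol_difference[OF h sol w])+
 have hz: "h10 Om (z n) (Z n)" for n using sub(1)[of n] by (simp add: subsol_def)
 define G where "G n = norm (cls (%x. norm (Z n x)))" for n
 have energy: "lam * (G n)^2 <= inner (cls (g n)) (cls (z n))" for n
 proof -
  have "lam * (G n)^2 <= form (Z n) (Z n)"
   using form_elliptic[OF hz[of n]] by (simp add: G_def norm_cls sqi_norm[OF h10D(2)[OF hz]])
  also have "\<dots> <= (lint x. g n x * z n x)" using sol_difference(3)[OF h sol w] unfolding Z_def g_def z_def .
  also have "\<dots> = inner (cls (g n)) (cls (z n))" by (simp add: cls_simps sg h10D(1)[OF hz])
  finally show ?thesis .
 qed
 have zG: "norm (cls (z n)) <= t * G n" for n using t(2) hz unfolding G_def by blast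
 have G0: "G n >= 0" for n by (simp add: G_def)
 define D where "D = R * t / lam"
 have D: "D >= 0" using R0 t(1) lam by (simp add: D_def)
 have GD: "G n <= D" for n
 proof (cases "G n = 0")
  case False
  hence Gp: "G n > 0" using G0[of n] by simp
  have "lam * (G n)^2 <= norm (cls (g n)) * norm (cls (z n))" using energy[of n] norm_cauchy_schwarz order_trans by blast
  also have "\<dots> <= R * (t * G n)" using gR zG R0 by (intro mult_mono) auto
  finally have "(lam * G n) * G n <= (R * t) * G n" by (simp add: power2_eq_square mult.assoc)
  hence "lam * G n <= R * t" using Gp by (subst (asm) mult_le_cancel_right_pos) auto
  thus ?thesis using lam by (simp add: D_def pos_le_divide_eq mult.commute)
 qed (use D in simp)
 have inner0: "(%n. inner (cls (g n)) y) ~~> 0" for y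
 proof -
  have "(%n. inner (cls (w n)) y - inner (cls w0) y) ~~> inner (cls w0) y - inner (cls w0) y"
   using weak unfolding weakly_to_def by (intro tendsto_diff tendsto_const) auto
  thus ?thesis by (simp add: cg inner_diff_left)
 qed
 have zb: "norm (cls (z n)) <= t * D" for n using order_trans[OF zG mult_left_mono[OF GD]] t(1) by simp
 have small: "\<forall>\<^sub>F n in sequentially. inner (cls (g n)) (cls (z n)) <= \<epsilon>" if eps: "\<epsilon> > 0" for \<epsilon>
 proof (rule ccontr)
  define S where "S = {n. \<not> inner (cls (g n)) (cls (z n)) <= \<epsilon>}"
  assume "\<not> ?thesis"
  hence "infinite S"
   unfolding S_def cofinite_eq_sequentially[symmetric] eventually_cofinite .
  from infinite_enumerate[OF this] obtain r :: "nat => nat" where r: "strict_mono r" "\<forall>n. r n \<in> S" by (elim exE conjE) (rule that, assumption+)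
  have w': "weakly_to (%n. cls (g (r n))) 0"
   using LIMSEQ_subseq_LIMSEQ[OF inner0 r(1)] by (simp add: weakly_to_def o_def)
  obtain s where s: "strict_mono s" "(%n. inner (cls (g (r (s n)))) (cls (z (r (s n))))) ~~> 0"
   using compact_pairing[where z = "%n. z (r n)" and Z = "%n. Z (r n)", OF hz zb GD[unfolded G_def] w' gR] by (elim exE conjE) (rule that, assumption+)
  have "inner (cls (g (r (s n)))) (cls (z (r (s n)))) >= \<epsilon>" for n using r(2)[rule_format, of "s n"] by (simp add: S_def)
  hence "\<epsilon> <= 0" by (intro LIMSEQ_le_const[OF s(2)]) blast
  thus False using eps by simp
 qed
 obtain \<delta> where \<delta>: "\<delta> > 0" "\<forall>z Z g. subsol z Z g --> norm (cls g) <= R --> norm (cls z) <= \<delta> --> (ae x. z x <= e)"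
  using ess_bound_small[OF N e R0] by blast
 have "lam * (\<delta> / t)^2 > 0" using lam \<delta> t(1) by simp
 from small[OF this] show ?thesis
 proof eventually_elim
  case (elim n)
  hence "lam * (G n)^2 <= lam * (\<delta> / t)^2" using energy[of n] by linarith
  hence "(G n)^2 <= (\<delta> / t)^2" using lam by simp
  hence "G n <= \<delta> / t" by (rule power2_le_imp_le) (use \<delta> t in simp)
  hence "t * G n <= \<delta>" using t(1) by (simp add: pos_le_divide_eq mult.commute)
  hence zd: "norm (cls (z n)) <= \<delta>" using zG[of n] by linarith
  have "cls (%x. - z n x) = - cls (z n)" "cls (%x. - g n x) = - cls (g n)" by (simp_all add: cls_simps sg h10D(1)[OF hz])
  hence nn: "norm (cls (%x. - z n x)) <= \<delta>" "norm (cls (%x. - g n x)) <= R" using zd gR by simp_all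
  have "ae x. z n x <= e" by (rule \<delta>(2)[rule_format, OF sub(1) gR zd])
  moreover have "ae x. - z n x <= e" by (rule \<delta>(2)[rule_format, OF sub(2) nn(2,1)])
  ultimately have "ae x. \<bar>z n x\<bar> <= e" by eventually_elim simp
  thus ?case by (simp add: z_def)
 qed
qed

end

section \<open>Equilibria of games in Hilbert spaces\<close>

text \<open>Successive extractions, where \<open>sub\<close> preserves what earlier indices have
  gained. It serves the coordinates of the cube and the players of the game.\<close>

lemma common_subsequence:
 fixes Q :: "nat => (nat => nat) => bool"
 assumes ex: "\<And>i r. i < n ==> strict_mono r ==> \<exists>s. strict_mono (s :: nat => nat) \<and> Q i (r \<circ> s)"
  and sub: "\<And>i r s. i < n ==> Q i r ==> strict_mono (s :: nat => nat) ==> Q i (r \<circ> s)"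
 shows "\<exists>r. strict_mono (r :: nat => nat) \<and> (\<forall>i<n. Q i r)"
proof -
 have "\<exists>r. strict_mono (r :: nat => nat) \<and> (\<forall>i<l. Q i r)" if "l <= n" for l using that
 proof (induction l)
  case 0
  have "strict_mono (%x :: nat. x)" by (simp add: strict_mono_def)
  thus ?case by blast
 next
  case (Suc l)
  then obtain r where r: "strict_mono (r :: nat => nat)" "\<forall>i<l. Q i r" by auto
  obtain s where s: "strict_mono (s :: nat => nat)" "Q l (r \<circ> s)" using ex[of l r] Suc.prems r(1) by auto
  have "Q i (r \<circ> s)" if "i < Suc l" for i
   using that s sub[of i r s] r(2) Suc.prems by (cases "i = l") auto
  thus ?case using strict_mono_o[OF r(1) s(1)] by blast
 qed
 thus ?thesis by blast
qed

text \<open>Kuhn's combinatorial lemma on the grid of mesh \<open>1 / p\<close>, a vertex being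
  labelled in each coordinate by whether \<open>F\<close> moves it up or down. One cell has, for
  each coordinate, vertices of both labels; these are \<open>a\<close> and \<open>b\<close>.\<close>

lemma brouwer_grid:
 fixes F :: "(nat => real) => nat => real"
 assumes F: "\<And>x i. (\<And>j. j < n ==> 0 <= x j \<and> x j <= 1) ==> i < n ==> 0 <= F x i \<and> F x i <= 1" and p: "p > (0 :: nat)"
 shows "\<exists>q. (\<forall>j<n. 0 <= q j \<and> q j <= 1) \<and> (\<forall>i<n. \<exists>a b.
  (\<forall>j<n. 0 <= a j \<and> a j <= 1 \<and> \<bar>a j - q j\<bar> <= 1 / real p) \<and> (\<forall>j<n. 0 <= b j \<and> b j <= 1 \<and> \<bar>b j - q j\<bar> <= 1 / real p) \<and>
  a i <= F a i \<and> F b i <= b i)"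
proof -
 define sc where "sc x j = real (x j) / real p" for x :: "nat => nat" and j
 \<comment> \<open>On the faces \<open>x i = 0\<close> and \<open>x i = p\<close> the label is
   prescribed by \<open>kuhn_lemma\<close>; it agrees there with the direction of \<open>F\<close>
   because \<open>F\<close> maps into the cube.\<close>
 define label where "label x i = (if x i = 0 then 0 else if x i = p then 1 else if sc x i <= F (sc x) i then 0 else (1::nat))" for x i
 have sc: "0 <= sc x j \<and> sc x j <= 1" if "x j <= p" for x j using that p by (simp add: sc_def)
 have l1: "\<forall>x. (\<forall>i<n. x i <= p) --> (\<forall>i<n. label x i = 0 \<or> label x i = 1)" by (simp add: label_def)
 have l2: "\<forall>x. (\<forall>i<n. x i <= p) --> (\<forall>i<n. x i = 0 --> label x i = 0)" by (simp add: label_def)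
 have l3: "\<forall>x. (\<forall>i<n. x i <= p) --> (\<forall>i<n. x i = p --> label x i = 1)" using p by (simp add: label_def)
 obtain q where q: "\<forall>i<n. q i < p"
  "\<forall>i<n. \<exists>r s. (\<forall>j<n. q j <= r j \<and> r j <= q j + 1) \<and> (\<forall>j<n. q j <= s j \<and> s j <= q j + 1) \<and> label r i \<noteq> label s i"
  using kuhn_lemma[OF p l1 l2 l3] by blast
 have near: "0 <= sc r j \<and> sc r j <= 1 \<and> \<bar>sc r j - sc q j\<bar> <= 1 / real p" if "q j <= r j" "r j <= q j + 1" "j < n" for r j
 proof -
  have "r j <= p" using that q(1) by (metis Suc_eq_plus1 Suc_leI le_trans)
  moreover have "\<bar>sc r j - sc q j\<bar> = (real (r j) - real (q j)) / real p" using that p by (simp add: sc_def diff_divide_distrib[symmetric])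
  moreover have "\<dots> <= 1 / real p" using that by (intro divide_right_mono) auto
  ultimately show ?thesis using sc by simp
 qed
 have low: "sc r i <= F (sc r) i" if "label r i = 0" "i < n" "\<forall>j<n. r j <= p" for r i
  using that F[of "sc r" i] sc by (auto simp: label_def sc_def[of _ i] split: if_splits)
 have high: "F (sc r) i <= sc r i" if "label r i \<noteq> 0" "i < n" "\<forall>j<n. r j <= p" for r i
  using that F[of "sc r" i] sc p by (auto simp: label_def sc_def[of _ i] split: if_splits)
 have c1: "\<forall>j<n. 0 <= sc q j \<and> sc q j <= 1" using sc[of q] q(1) by (auto intro: less_imp_le)
 have c2: "\<exists>a b. (\<forall>j<n. 0 <= a j \<and> a j <= 1 \<and> \<bar>a j - sc q j\<bar> <= 1 / real p) \<and> (\<forall>j<n. 0 <= b j \<and> b j <= 1 \<and> \<bar>b j - sc q j\<bar> <= 1 / real p) \<and>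
   a i <= F a i \<and> F b i <= b i" if i: "i < n" for i
 proof -
  from i obtain r s where rs: "\<forall>j<n. q j <= r j \<and> r j <= q j + 1" "\<forall>j<n. q j <= s j \<and> s j <= q j + 1" "label r i \<noteq> label s i" using q(2) by blast
  have rp: "\<forall>j<n. r j <= p" "\<forall>j<n. s j <= p" using rs q(1) by (metis Suc_eq_plus1 Suc_leI le_trans)+
  have l: "label r i = 0 \<or> label r i = 1" "label s i = 0 \<or> label s i = 1" using l1 rp i by blast+
  have nr: "\<forall>j<n. 0 <= sc r j \<and> sc r j <= 1 \<and> \<bar>sc r j - sc q j\<bar> <= 1 / real p"
   and ns: "\<forall>j<n. 0 <= sc s j \<and> sc s j <= 1 \<and> \<bar>sc s j - sc q j\<bar> <= 1 / real p" using near rs(1,2) by blast+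
  show ?thesis
  proof (cases "label r i = 0")
   case True
   hence "label s i \<noteq> 0" using rs(3) by simp
   with low[OF True i rp(1)] high[OF _ i rp(2)] nr ns show ?thesis by blast
  next
   case False
   hence "label s i = 0" using rs(3) l by auto
   with low[OF _ i rp(2)] high[OF False i rp(1)] nr ns show ?thesis by blast
  qed
 qed
 show ?thesis using c1 c2 by blast
qed

text \<open>Brouwer's theorem for cubes whose dimension is not given by a type.\<close>

theorem brouwer_nat_cube:
 fixes F :: "(nat => real) => nat => real"
 assumes F: "\<And>x i. (\<And>j. j < n ==> 0 <= x j \<and> x j <= 1) ==> i < n ==> 0 <= F x i \<and> F x i <= 1"
  and cont: "\<And>X x i. (\<And>k j. j < n ==> 0 <= X k j \<and> X k j <= 1) ==> (\<And>j. j < n ==> (%k. X k j) ~~> x j) ==> i < n ==> (%k. F (X k) i) ~~> F x i"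
 shows "\<exists>x. \<forall>i<n. 0 <= x i \<and> x i <= 1 \<and> F x i = x i"
proof -
 have "\<forall>k. \<exists>q. (\<forall>j<n. 0 <= q j \<and> q j <= 1) \<and> (\<forall>i<n. \<exists>a b.
  (\<forall>j<n. 0 <= a j \<and> a j <= 1 \<and> \<bar>a j - q j\<bar> <= 1 / real (Suc k)) \<and> (\<forall>j<n. 0 <= b j \<and> b j <= 1 \<and> \<bar>b j - q j\<bar> <= 1 / real (Suc k)) \<and>
  a i <= F a i \<and> F b i <= b i)"
  using brouwer_grid[of n F, OF F] by blast
 from choice[OF this] obtain q where q: "\<forall>k. (\<forall>j<n. 0 <= q k j \<and> q k j <= 1) \<and> (\<forall>i<n. \<exists>a b.
  (\<forall>j<n. 0 <= a j \<and> a j <= 1 \<and> \<bar>a j - q k j\<bar> <= 1 / real (Suc k)) \<and> (\<forall>j<n. 0 <= b j \<and> b j <= 1 \<and> \<bar>b j - q k j\<bar> <= 1 / real (Suc k)) \<and>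
  a i <= F a i \<and> F b i <= b i)" ..
 have "\<exists>r. strict_mono (r :: nat => nat) \<and> (\<forall>i<n. convergent (%k. q (r k) i))"
 proof (rule common_subsequence)
  fix i r assume i: "i < n" and r: "strict_mono (r :: nat => nat)"
  have "\<forall>k. (%k. q (r k) i) k \<in> {0..1}" using q i by simp
  then obtain l s where "strict_mono (s :: nat => nat)" "((%k. q (r k) i) \<circ> s) ~~> l"
   by (rule seq_compactE[OF compact_imp_seq_compact[OF compact_Icc]])
  hence "strict_mono s \<and> convergent (%k. q ((r \<circ> s) k) i)" by (auto simp: convergent_def o_def)
  thus "\<exists>s. strict_mono (s :: nat => nat) \<and> convergent (%k. q ((r \<circ> s) k) i)" by blast
 next
  fix i r s assume "convergent (%k. q (r k) i)" "strict_mono (s :: nat => nat)"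
  thus "convergent (%k. q ((r \<circ> s) k) i)" using convergent_subseq_convergent[of "%k. q (r k) i" s] by (simp add: o_def)
 qed
 then obtain r where r: "strict_mono (r :: nat => nat)" "\<forall>i<n. convergent (%k. q (r k) i)" by blast
 define x where "x i = lim (%k. q (r k) i)" for i
 have x: "(%k. q (r k) i) ~~> x i" if "i < n" for i using r(2) that by (simp add: x_def convergent_LIMSEQ_iff)
 have x01: "0 <= x i \<and> x i <= 1" if "i < n" for i
  using LIMSEQ_le_const[OF x[OF that], of 0] LIMSEQ_le_const2[OF x[OF that], of 1] q that by blast
 have lim0: "(%k. 1 / real (Suc (r k))) ~~> 0"
  using LIMSEQ_subseq_LIMSEQ[OF LIMSEQ_inverse_real_of_nat r(1)] by (simp add: o_def inverse_eq_divide)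
 have conv: "(%k. a k j) ~~> x j" if "\<And>k. \<bar>a k j - q (r k) j\<bar> <= 1 / real (Suc (r k))" "j < n" for a :: "nat => nat => real" and j
 proof -
  have "(%k. a k j - q (r k) j) ~~> 0" by (rule Lim_null_comparison[OF _ lim0]) (use that in simp)
  from tendsto_add[OF this x[OF that(2)]] show ?thesis by simp
 qed
 have "F x i = x i" if i: "i < n" for i
 proof -
  have "\<forall>k. \<exists>a b. (\<forall>j<n. 0 <= a j \<and> a j <= 1 \<and> \<bar>a j - q (r k) j\<bar> <= 1 / real (Suc (r k))) \<and> (\<forall>j<n. 0 <= b j \<and> b j <= 1 \<and> \<bar>b j - q (r k) j\<bar> <= 1 / real (Suc (r k))) \<and>
   a i <= F a i \<and> F b i <= b i" using q i by blast
  from choice[OF this] obtain a where "\<forall>k. \<exists>b. (\<forall>j<n. 0 <= a k j \<and> a k j <= 1 \<and> \<bar>a k j - q (r k) j\<bar> <= 1 / real (Suc (r k))) \<and> (\<forall>j<n. 0 <= b j \<and> b j <= 1 \<and> \<bar>b j - q (r k) j\<bar> <= 1 / real (Suc (r k))) \<and>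
   a k i <= F (a k) i \<and> F b i <= b i" ..
  from choice[OF this] obtain b where ab: "\<forall>k. (\<forall>j<n. 0 <= a k j \<and> a k j <= 1 \<and> \<bar>a k j - q (r k) j\<bar> <= 1 / real (Suc (r k))) \<and> (\<forall>j<n. 0 <= b k j \<and> b k j <= 1 \<and> \<bar>b k j - q (r k) j\<bar> <= 1 / real (Suc (r k))) \<and>
   a k i <= F (a k) i \<and> F (b k) i <= b k i" ..
  have ca: "(%k. a k j) ~~> x j" and cb: "(%k. b k j) ~~> x j" if "j < n" for j using conv ab that by blast+
  have Fa: "(%k. F (a k) i) ~~> F x i" by (rule cont[OF _ ca i]) (use ab in blast)
  have Fb: "(%k. F (b k) i) ~~> F x i" by (rule cont[OF _ cb i]) (use ab in blast)
  have "x i <= F x i" by (rule LIMSEQ_le[OF ca[OF i] Fa]) (use ab in blast)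
  moreover have "F x i <= x i" by (rule LIMSEQ_le[OF Fb cb[OF i]]) (use ab in blast)
  ultimately show ?thesis by simp
 qed
 thus ?thesis using x01 by blast
qed

text \<open>Nash's map: each player shifts weight to the profitable deviations among finitely many.\<close>

lemma finite_deviations_equilibrium:
 fixes C :: "nat => 'h::real_normed_vector set" and J :: "nat => (nat => 'h) => real" and d :: "nat => nat => 'h"
 assumes conv: "\<And>k. k < m ==> convex (C k)"
  and Jconv: "\<And>k u. k < m ==> \<forall>i<m. u i \<in> C i ==> convex_on (C k) (%v. J k (u(k := v)))"
  and Jcont: "\<And>k u v. k < m ==> \<forall>l. \<forall>i<m. u l i \<in> C i ==> \<forall>i<m. v i \<in> C i ==> \<forall>i<m. (%l. u l i) ~~> v i ==> (%l. J k (u l)) ~~> J k v"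
  and d: "\<And>k j. k < m ==> d k j \<in> C k" and N: "N > 0"
 shows "\<exists>u. (\<forall>k<m. u k \<in> C k) \<and> (\<forall>k<m. \<forall>j<N. J k u <= J k (u(k := d k j)))"
proof -
 define s where "s x k = (\<Sum>j<N. x (k * N + j))" for x :: "nat => real" and k
 \<comment> \<open>A continuous retraction onto the simplex: missing mass is spread evenly when the
   total \<open>s x k\<close> is below 1, and an excess is divided out when it is above 1. A cube
   can thus be the domain although the weights of each player belong to a simplex; coordinate
   \<open>k * N + j\<close> is the weight of deviation \<open>j\<close> of player
   \<open>k\<close>.\<close>
 define \<rho> where "\<rho> x k j = (x (k * N + j) + max 0 (1 - s x k) / real N) / max 1 (s x k)" for x :: "nat => real" and k j
 define U where "U x k = (\<Sum>j<N. \<rho> x k j *R d k j)" for x :: "nat => real" and k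
 define g where "g x k j = max 0 (J k (U x) - J k ((U x)(k := d k j)))" for x :: "nat => real" and k j
 define F where "F x i = (\<rho> x (i div N) (i mod N) + g x (i div N) (i mod N)) / (1 + (\<Sum>j<N. g x (i div N) j))" for x :: "nat => real" and i
 have idx: "k * N + j < m * N" if "k < m" "j < N" for k j
 proof -
  have "k * N + j < Suc k * N" using that by simp
  also have "\<dots> <= m * N" using that by (intro mult_le_mono1) simp
  finally show ?thesis .
 qed
 have dm: "i div N < m" "i mod N < N" "(i div N) * N + i mod N = i" if "i < m * N" for i
  using that N by (auto simp: less_mult_imp_div_less)
 have rsum: "(\<Sum>j<N. \<rho> x k j) = 1" for x k
 proof -
  have "(\<Sum>j<N. \<rho> x k j) = (s x k + max 0 (1 - s x k)) / max 1 (s x k)"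
   using N by (simp add: \<rho>_def sum_divide_distrib[symmetric] sum.distrib s_def)
  also have "\<dots> = 1" by (simp add: max_def)
  finally show ?thesis .
 qed
 have r0: "\<rho> x k j >= 0" if "\<And>i. i < m * N ==> 0 <= x i" "k < m" "j < N" for x k j
  using that(1)[OF idx[OF that(2,3)]] by (simp add: \<rho>_def)
 have g0: "g x k j >= 0" for x k j by (simp add: g_def)
 have gs0: "(\<Sum>j<N. g x k j) >= 0" for x k by (intro sum_nonneg g0)
 have UC: "U x k \<in> C k" if "\<And>i. i < m * N ==> 0 <= x i" "k < m" for x k
  unfolding U_def using that by (intro convex_sum conv) (auto simp: rsum r0 d)
 have "\<exists>x. \<forall>i<m * N. 0 <= x i \<and> x i <= 1 \<and> F x i = x i"
 proof (rule brouwer_nat_cube)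
  fix x :: "nat => real" and i assume x: "\<And>j. j < m * N ==> 0 <= x j \<and> x j <= 1" and i: "i < m * N"
  have r: "\<rho> x (i div N) j >= 0" if "j < N" for j using r0 x dm(1)[OF i] that by blast
  have "\<rho> x (i div N) (i mod N) <= (\<Sum>j<N. \<rho> x (i div N) j)" using r dm(2)[OF i] by (intro member_le_sum) auto
  moreover have "g x (i div N) (i mod N) <= (\<Sum>j<N. g x (i div N) j)" using g0 dm(2)[OF i] by (intro member_le_sum) auto
  ultimately have "F x i <= 1" unfolding F_def using gs0[of x "i div N"] by (subst divide_le_eq_1_pos) (auto simp: rsum intro: add_pos_nonneg)
  moreover have "0 <= F x i" unfolding F_def using r[OF dm(2)[OF i]] g0 gs0 by (intro divide_nonneg_nonneg add_nonneg_nonneg) auto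
  ultimately show "0 <= F x i \<and> F x i <= 1" by simp
 next
  fix X :: "nat => nat => real" and x :: "nat => real" and i
  assume X: "\<And>k j. j < m * N ==> 0 <= X k j \<and> X k j <= 1" and lim: "\<And>j. j < m * N ==> (%k. X k j) ~~> x j" and i: "i < m * N"
  have x0: "0 <= x j" if "j < m * N" for j using LIMSEQ_le_const[OF lim[OF that], of 0] X[OF that] by blast
  have slim: "(%l. s (X l) k) ~~> s x k" if "k < m" for k
   unfolding s_def using idx[OF that] by (intro tendsto_sum lim) auto
  have rlim: "(%l. \<rho> (X l) k j) ~~> \<rho> x k j" if "k < m" "j < N" for k j
   unfolding \<rho>_def using idx[OF that] N
   by (intro tendsto_divide tendsto_add lim tendsto_max tendsto_diff tendsto_const slim that) auto
  have Ulim: "(%l. U (X l) k) ~~> U x k" if "k < m" for k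
   unfolding U_def using that by (intro tendsto_sum tendsto_scaleR rlim tendsto_const) auto
  have UX: "\<forall>l. \<forall>k<m. U (X l) k \<in> C k" using UC X by blast
  have Ux: "\<forall>k<m. U x k \<in> C k" using UC x0 by blast
  have glim: "(%l. g (X l) k j) ~~> g x k j" if k: "k < m" "j < N" for k j
  proof -
   have "(%l. J k (U (X l))) ~~> J k (U x)" using Jcont[OF k(1) UX Ux] Ulim by blast
   moreover have "(%l. J k ((U (X l))(k := d k j))) ~~> J k ((U x)(k := d k j))"
    using UX Ux d[OF k(1)] Ulim by (intro Jcont[OF k(1)]) auto
   ultimately show ?thesis unfolding g_def by (intro tendsto_max tendsto_diff tendsto_const)
  qed
  have "1 + (\<Sum>j<N. g x (i div N) j) \<noteq> 0" using gs0[of x "i div N"] by linarith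
  thus "(%l. F (X l) i) ~~> F x i"
   unfolding F_def using dm[OF i] by (intro tendsto_divide tendsto_add tendsto_sum rlim glim tendsto_const) auto
 qed
 then obtain x where x: "\<forall>i<m * N. 0 <= x i \<and> x i <= 1 \<and> F x i = x i" by blast
 have x0: "0 <= x i" if "i < m * N" for i using x that by blast
 have UxC: "\<forall>k<m. U x k \<in> C k" using UC x0 by blast
 have opt: "J k (U x) <= J k ((U x)(k := d k j))" if k: "k < m" and j: "j < N" for k j
 proof -
  define S where "S = (\<Sum>j<N. g x k j)"
  have S0: "S >= 0" unfolding S_def by (rule gs0)
  have fx: "x (k * N + j) = (\<rho> x k j + g x k j) / (1 + S)" if "j < N" for j
  proof -
   have "x (k * N + j) = F x (k * N + j)" using x idx[OF k that] by simp
   thus ?thesis using that by (simp add: F_def S_def)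
  qed
  have "s x k = (\<Sum>j<N. (\<rho> x k j + g x k j) / (1 + S))" unfolding s_def by (intro sum.cong refl fx) simp
  also have "\<dots> = ((\<Sum>j<N. \<rho> x k j) + S) / (1 + S)" by (simp add: sum_divide_distrib[symmetric] sum.distrib S_def)
  also have "\<dots> = 1" using S0 by (simp add: rsum)
  \<comment> \<open>A fixed point is automatically normalised, so \<rho> leaves it
    unchanged.\<close>
  finally have s1: "s x k = 1" .
  have rx: "\<rho> x k j = x (k * N + j)" for j by (simp add: \<rho>_def s1)
  \<comment> \<open>If the total gain \<open>S\<close> were positive, every deviation carrying
    weight would be strictly profitable, and convexity of the cost along the mixture would give
    \<open>J k (U x) < J k (U x)\<close>.\<close>
  have xS: "x (k * N + j) * S = g x k j" if "j < N" for j
   using fx[OF that] S0 by (simp add: rx field_simps)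
  have "S = 0"
  proof (rule ccontr)
   assume "S \<noteq> 0"
   hence Sp: "S > 0" using S0 by simp
   define c where "c j = J k ((U x)(k := d k j))" for j
   have le: "x (k * N + j) * c j <= x (k * N + j) * J k (U x)" and less: "x (k * N + j) > 0 ==> x (k * N + j) * c j < x (k * N + j) * J k (U x)" if j: "j < N" for j
   proof -
    have "c j < J k (U x)" if "x (k * N + j) > 0"
    proof -
     have "g x k j > 0" using xS[OF j] that Sp by (metis mult_pos_pos)
     thus ?thesis by (simp add: g_def c_def max_def split: if_splits)
    qed
    thus "x (k * N + j) > 0 ==> x (k * N + j) * c j < x (k * N + j) * J k (U x)" by simp
    thus "x (k * N + j) * c j <= x (k * N + j) * J k (U x)" using x0[OF idx[OF k j]] by (cases "x (k * N + j) = 0") auto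
   qed
   have "\<exists>j<N. x (k * N + j) > 0"
   proof (rule ccontr)
    assume "\<not> ?thesis"
    hence "s x k <= 0" unfolding s_def by (intro sum_nonpos) (metis lessThan_iff not_less)
    thus False using s1 by simp
   qed
   then obtain j0 where j0: "j0 < N" "x (k * N + j0) > 0" by blast
   have "J k (U x) = J k ((U x)(k := U x k))" by simp
   also have "\<dots> = J k ((U x)(k := (\<Sum>j<N. x (k * N + j) *R d k j)))" by (simp add: U_def rx)
   also have "\<dots> <= (\<Sum>j<N. x (k * N + j) * c j)" unfolding c_def
    using s1 x0 idx[OF k] d[OF k] N by (intro convex_on_sum[OF _ _ Jconv[OF k UxC]]) (auto simp: s_def)
   also have "\<dots> < (\<Sum>j<N. x (k * N + j) * J k (U x))"
   proof (rule sum_strict_mono_ex1)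
    show "\<exists>j\<in>{..<N}. x (k * N + j) * c j < x (k * N + j) * J k (U x)" using less[OF j0] j0(1) by blast
   qed (use le in auto)
   also have "\<dots> = J k (U x)" using s1 by (simp add: sum_distrib_right[symmetric] s_def)
   finally show False by simp
  qed
  hence "g x k j = 0" using xS[OF j] by simp
  thus ?thesis by (simp add: g_def max_def split: if_splits)
 qed
 show ?thesis using UxC opt by blast
qed

text \<open>\<open>u l\<close> is an equilibrium against the first \<open>Suc l\<close> members of a
  dense sequence of deviations. In the limit, lower semicontinuity of \<open>q\<close> suffices on
  the left, because on the right the player's own control is a fixed \<open>w\<close> and
  \<open>q k w\<close> is constant; \<open>Ph\<close> is weakly continuous on both sides. Strong
  continuity extends the inequality from the dense sequence to all deviations.\<close>

theorem nash_existence: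
 fixes C :: "nat => 'h::{real_inner, complete_space, second_countable_topology} set" and Ph :: "nat => (nat => 'h) => real" and q :: "nat => 'h => real"
 assumes C: "\<And>k. k < m ==> C k \<noteq> {} \<and> convex (C k) \<and> closed (C k) \<and> bounded (C k)"
  and conv: "\<And>k u. k < m ==> \<forall>i<m. u i \<in> C i ==> convex_on (C k) (%v. Ph k (u(k := v)) + q k v)"
  and weak: "\<And>k u v. k < m ==> \<forall>l. \<forall>i<m. u l i \<in> C i ==> \<forall>i<m. v i \<in> C i ==> \<forall>i<m. weakly_to (%l. u l i) (v i) ==> (%l. Ph k (u l)) ~~> Ph k v"
  and qcont: "\<And>k u v. k < m ==> \<forall>l. u l \<in> C k ==> v \<in> C k ==> u ~~> v ==> (%l. q k (u l)) ~~> q k v"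
  and qlsc: "\<And>k u v e. k < m ==> \<forall>l. u l \<in> C k ==> v \<in> C k ==> weakly_to u v ==> e > 0 ==> \<forall>\<^sub>F l in sequentially. q k v <= q k (u l) + e"
 shows "\<exists>u. (\<forall>k<m. u k \<in> C k) \<and> (\<forall>k<m. \<forall>v\<in>C k. Ph k u + q k (u k) <= Ph k (u(k := v)) + q k v)"
proof -
 have "\<exists>d :: nat => 'h. range d \<subseteq> C k \<and> C k \<subseteq> closure (range d)" if "k < m" for k
 proof -
  obtain T where T: "countable T" "T \<subseteq> C k" "C k \<subseteq> closure T" using separable by blast
  have "T \<noteq> {}" using T(3) C[OF that] by auto
  hence "range (from_nat_into T) = T" using T(1) by (rule range_from_nat_into)
  thus ?thesis using T by metis
 qed
 hence "\<forall>k. \<exists>d :: nat => 'h. k < m --> range d \<subseteq> C k \<and> C k \<subseteq> closure (range d)" by blast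
 from choice[OF this] obtain d :: "nat => nat => 'h" where d: "\<forall>k. k < m --> range (d k) \<subseteq> C k \<and> C k \<subseteq> closure (range (d k))" ..
 have dC: "d k j \<in> C k" if "k < m" for k j using d that by blast
 define J where "J k u = Ph k u + q k (u k)" for k u
 have Jcont: "(%l. J k (u l)) ~~> J k v"
  if "k < m" "\<forall>l. \<forall>i<m. u l i \<in> C i" "\<forall>i<m. v i \<in> C i" "\<forall>i<m. (%l. u l i) ~~> v i" for k u v
  unfolding J_def
 proof (intro tendsto_add)
  show "(%l. Ph k (u l)) ~~> Ph k v" using weak[OF that(1-3)] strongly_to_weakly_to that(4) by blast
  show "(%l. q k (u l k)) ~~> q k (v k)" using that by (intro qcont) auto
 qed
 have "\<forall>l. \<exists>u. (\<forall>k<m. u k \<in> C k) \<and> (\<forall>k<m. \<forall>j<Suc l. J k u <= J k (u(k := d k j)))"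
 proof
  fix l
  show "\<exists>u. (\<forall>k<m. u k \<in> C k) \<and> (\<forall>k<m. \<forall>j<Suc l. J k u <= J k (u(k := d k j)))"
  proof (rule finite_deviations_equilibrium[where C=C and J=J and d=d])
   fix k u assume "k < m" "\<forall>i<m. u i \<in> C i"
   from conv[OF this] show "convex_on (C k) (%v. J k (u(k := v)))" by (simp add: J_def)
  next
   fix k and u :: "nat => nat => 'h" and v
   assume "k < m" "\<forall>l. \<forall>i<m. u l i \<in> C i" "\<forall>i<m. v i \<in> C i" "\<forall>i<m. (%l. u l i) ~~> v i"
   thus "(%l. J k (u l)) ~~> J k v" by (rule Jcont)
  qed (use C dC in auto)
 qed
 from choice[OF this] obtain u where u: "\<forall>l. (\<forall>k<m. u l k \<in> C k) \<and> (\<forall>k<m. \<forall>j<Suc l. J k (u l) <= J k ((u l)(k := d k j)))" ..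
 have "\<exists>r. strict_mono (r :: nat => nat) \<and> (\<forall>i<m. \<exists>v. weakly_to (%l. u (r l) i) v)"
 proof (rule common_subsequence)
  fix i r assume i: "i < m" and r: "strict_mono (r :: nat => nat)"
  obtain R where R: "\<forall>x\<in>C i. norm x <= R" using C[OF i] bounded_iff by blast
  hence "norm (u (r l) i) <= R" for l using u i by blast
  then obtain s v where "strict_mono (s :: nat => nat)" "weakly_to ((%l. u (r l) i) \<circ> s) v" by (rule weak_compactness)
  thus "\<exists>s. strict_mono (s :: nat => nat) \<and> (\<exists>v. weakly_to (%l. u ((r \<circ> s) l) i) v)" by (auto simp: o_def)
 next
  fix i r s assume "\<exists>v. weakly_to (%l. u (r l) i) v" "strict_mono (s :: nat => nat)"
  thus "\<exists>v. weakly_to (%l. u ((r \<circ> s) l) i) v" using weakly_to_subseq by (fastforce simp: o_def)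
 qed
 then obtain r where r: "strict_mono (r :: nat => nat)" "\<forall>i<m. \<exists>v. weakly_to (%l. u (r l) i) v" by blast
 from r(2) have "\<forall>i. \<exists>v. i < m --> weakly_to (%l. u (r l) i) v" by blast
 from choice[OF this] obtain v where v: "\<forall>i. i < m --> weakly_to (%l. u (r l) i) (v i)" ..
 have vC: "\<forall>i<m. v i \<in> C i"
 proof (intro allI impI)
  fix i assume i: "i < m"
  show "v i \<in> C i" by (rule weakly_closed_convex[where x="%l. u (r l) i"]) (use C[OF i] v u i in auto)
 qed
 have urC: "\<forall>l. \<forall>i<m. u (r l) i \<in> C i" using u by blast
 have key: "J k v <= J k (v(k := d k j))" if k: "k < m" for k j
 proof -
  define w where "w = d k j"
  have wC: "w \<in> C k" using dC[OF k] by (simp add: w_def)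
  have l1: "(%l. Ph k (u (r l))) ~~> Ph k v" using weak[OF k urC vC] v by blast
  have l2: "(%l. Ph k ((u (r l))(k := w))) ~~> Ph k (v(k := w))"
  proof (rule weak[OF k])
   show "\<forall>i<m. weakly_to (%l. ((u (r l))(k := w)) i) ((v(k := w)) i)" using v by (auto simp: weakly_to_def)
  qed (use urC vC wC in auto)
  have "Ph k v + q k (v k) - e <= Ph k (v(k := w)) + q k w" if e: "e > 0" for e
  proof (rule tendsto_le[OF sequentially_bot])
   show "(%l. Ph k ((u (r l))(k := w)) + q k w) ~~> Ph k (v(k := w)) + q k w" by (intro tendsto_add l2 tendsto_const)
   show "(%l. Ph k (u (r l)) + q k (v k) - e) ~~> Ph k v + q k (v k) - e" by (intro tendsto_add tendsto_diff l1 tendsto_const)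
   have "\<forall>\<^sub>F l in sequentially. q k (v k) <= q k (u (r l) k) + e" using urC vC v k by (intro qlsc[OF k _ _ _ e]) auto
   moreover have "\<forall>\<^sub>F l in sequentially. l >= j" by (rule eventually_ge_at_top)
   ultimately show "\<forall>\<^sub>F l in sequentially. Ph k (u (r l)) + q k (v k) - e <= Ph k ((u (r l))(k := w)) + q k w"
   proof eventually_elim
    case (elim l)
    have "j < Suc (r l)" using elim(2) strict_mono_imp_increasing[OF r(1), of l] by linarith
    hence "J k (u (r l)) <= J k ((u (r l))(k := w))" using u k by (simp add: w_def)
    thus ?case using elim(1) by (simp add: J_def)
   qed
  qed
  hence "Ph k v + q k (v k) <= Ph k (v(k := w)) + q k w + e" if "e > 0" for e using that by (simp add: algebra_simps)
  hence "Ph k v + q k (v k) <= Ph k (v(k := w)) + q k w" by (rule field_le_epsilon)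
  thus ?thesis by (simp add: J_def w_def)
 qed
 have "J k v <= J k (v(k := w))" if k: "k < m" and w: "w \<in> C k" for k w
 proof -
  have "w \<in> closure (range (d k))" using d k w by blast
  then obtain f where f: "\<forall>l. f l \<in> range (d k)" "f ~~> w" unfolding closure_sequential by blast
  have "(%l. J k (v(k := f l))) ~~> J k (v(k := w))"
  proof (rule Jcont[OF k])
   have "f l \<in> C k" for l using f(1) d k by blast
   thus "\<forall>l. \<forall>i<m. (v(k := f l)) i \<in> C i" using vC by auto
  qed (use vC w f(2) in auto)
  moreover have "J k v <= J k (v(k := f l))" for l
  proof -
   obtain j where "f l = d k j" using f(1) by blast
   thus ?thesis using key[OF k] by simp
  qed
  ultimately show ?thesis by (intro LIMSEQ_le_const) auto
 qed
 thus ?thesis using vC by (intro exI[of _ v]) (auto simp: J_def)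
qed

section \<open>The state equation\<close>

lemma elliptic_coefficients_form:
 fixes Om :: "(real ^ 'n) set"
 assumes o: "open Om" "bounded Om" and a: "elliptic_coefficients Om a"
 shows "\<exists>lam Lam. elliptic Om (%i j. ext Om (a i j)) lam Lam"
proof -
 have "\<forall>i j. \<exists>C. ae x. x \<in> Om --> \<bar>a i j x\<bar> <= C"
  using a by (simp add: elliptic_coefficients_def Linf_space_def AE_ext_iff[OF o(1)])
 then obtain C where C: "\<forall>i j. ae x. x \<in> Om --> \<bar>a i j x\<bar> <= C i j" by metis
 obtain lam where lam: "lam > 0" "ae x. x \<in> Om --> (\<forall>\<xi> :: real ^ 'n. lam * (norm \<xi>)^2 <= (\<Sum>i\<in>UNIV. \<Sum>j\<in>UNIV. a i j x * \<xi> $ i * \<xi> $ j))"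
  using a unfolding elliptic_coefficients_def AE_ext_iff[OF o(1)] by blast
 define Lam where "Lam = (\<Sum>i\<in>UNIV. \<Sum>j\<in>UNIV. \<bar>C i j\<bar>)"
 have Cb: "ae x. \<forall>i j. \<bar>ext Om (a i j) x\<bar> <= \<bar>C i j\<bar>"
 proof -
  have "ae x. \<bar>ext Om (a i j) x\<bar> <= \<bar>C i j\<bar>" for i j
   using C[rule_format, of i j] by eventually_elim (auto simp: ext_def indicator_def)
  thus ?thesis by (simp add: AE_all_countable)
 qed
 have "elliptic Om (%i j. ext Om (a i j)) lam Lam"
 proof
  show "ext Om (a i j) \<in> BM" for i j
   using a by (simp add: elliptic_coefficients_def Linf_space_def measurable_ext_iff[OF o(1)])
  show "ae x. \<forall>\<xi> et. \<bar>\<Sum>i\<in>UNIV. \<Sum>j\<in>UNIV. ext Om (a i j) x * \<xi> $ i * et $ j\<bar> <= Lam * norm \<xi> * norm et"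
   using Cb
  proof eventually_elim
   case (elim x)
   show ?case
   proof (intro allI)
    fix \<xi> et :: "real ^ 'n"
    have "\<bar>\<Sum>i\<in>UNIV. \<Sum>j\<in>UNIV. ext Om (a i j) x * \<xi> $ i * et $ j\<bar> <= (\<Sum>i\<in>UNIV. \<Sum>j\<in>UNIV. \<bar>ext Om (a i j) x * \<xi> $ i * et $ j\<bar>)"
     by (intro order_trans[OF sum_abs] sum_mono sum_abs)
    also have "\<dots> <= (\<Sum>i\<in>UNIV. \<Sum>j\<in>UNIV. \<bar>C i j\<bar> * norm \<xi> * norm et)"
     unfolding abs_mult using elim by (intro sum_mono mult_mono component_le_norm_cart) auto
    also have "\<dots> = Lam * norm \<xi> * norm et" by (simp add: Lam_def sum_distrib_right)
    finally show "\<bar>\<Sum>i\<in>UNIV. \<Sum>j\<in>UNIV. ext Om (a i j) x * \<xi> $ i * et $ j\<bar> <= Lam * norm \<xi> * norm et" .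
   qed
  qed
  show "ae x. x \<in> Om --> (\<forall>\<xi>. lam * (norm \<xi>)^2 <= (\<Sum>i\<in>UNIV. \<Sum>j\<in>UNIV. ext Om (a i j) x * \<xi> $ i * \<xi> $ j))"
   using lam(2) by eventually_elim (simp add: ext_simps)
  show "Lam >= 0" by (simp add: Lam_def sum_nonneg)
 qed (use o lam in auto)
 thus ?thesis by blast
qed

lemma C2_real_mvt:
 fixes g :: "real => real"
 assumes g: "C2_real g" and st: "s < t"
 shows "\<exists>z. s < z \<and> z < t \<and> g t - g s = (t - s) * deriv g z"
proof -
 have d: "(g has_real_derivative deriv g z) (at z)" for z
  using g unfolding C2_real_def by (simp add: DERIV_deriv_iff_real_differentiable)
 from MVT2[OF st, of g "deriv g"] d show ?thesis by blast
qed

lemma C2_real_lipschitz: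
 fixes g :: "real => real"
 assumes g: "C2_real g" and b: "\<forall>y. \<bar>y\<bar> <= M --> \<bar>deriv g y\<bar> <= C" and st: "\<bar>s\<bar> <= M" "\<bar>t\<bar> <= M"
 shows "\<bar>g s - g t\<bar> <= C * \<bar>s - t\<bar>"
proof -
 have *: "\<bar>g s - g t\<bar> <= C * \<bar>s - t\<bar>" if st: "\<bar>s\<bar> <= M" "\<bar>t\<bar> <= M" "s < t" for s t
 proof -
  obtain z where z: "s < z" "z < t" "g t - g s = (t - s) * deriv g z" using C2_real_mvt[OF g st(3)] by blast
  have "\<bar>deriv g z\<bar> <= C" using b z st by auto
  hence "(t - s) * \<bar>deriv g z\<bar> <= (t - s) * C" using st(3) by (intro mult_left_mono) auto
  moreover have "\<bar>g s - g t\<bar> = (t - s) * \<bar>deriv g z\<bar>" using z(3) st(3) by (simp add: abs_minus_commute[of "g s"] abs_mult)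
  ultimately show ?thesis using st(3) by (simp add: mult.commute)
 qed
 show ?thesis using *[of s t] *[of t s] st by (cases s t rule: linorder_cases) (auto simp: abs_minus_commute)
qed

lemma C2_real_continuous: "C2_real g ==> continuous_on UNIV g"
 unfolding C2_real_def by (intro continuous_at_imp_continuous_on ballI differentiable_imp_continuous_within) auto

locale state_eq =
 fixes Om :: "(real ^ 'n) set" and a :: "'n => 'n => real ^ 'n => real" and lam Lam :: real and f :: "real ^ 'n => real => real"
 assumes ell: "elliptic Om (%i j. ext Om (a i j)) lam Lam" and lip: "lipschitz_boundary Om"
  and nonlinearity: "state_nonlinearity Om f" and dim: "CARD('n) <= 3"

sublocale state_eq \<subseteq> elliptic Om "%i j. ext Om (a i j)" lam Lam by (rule ell)

context state_eq
begin

lemma regular: regular_boundary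
 unfolding regular_boundary_def using lipschitz_exterior_density[OF lip open_Om] by blast

text \<open>Splitting off \<open>f x 0\<close>, which is square integrable and is moved to
  \<open>rhs\<close>, makes the nonlinearity vanish at 0, as \<open>monotone_term\<close>
  demands.\<close>

definition h :: "real ^ 'n => real => real" where "h x t = ext Om (%x. f x t - f x 0) x"

definition rhs :: "(real ^ 'n => real) => real ^ 'n => real" where "rhs w = ext Om (%x. w x - f x 0)"

lemma f_props:
 shows "(%x. f x 0) \<in> L2_space Om" "(%x. f x t) \<in> borel_measurable (lebesgue_on Om)"
  "ae x. x \<in> Om --> C2_real (f x)" "ae x. x \<in> Om --> (\<forall>y. deriv (f x) y >= 0)"
  "M > 0 ==> \<exists>C>0. ae x. x \<in> Om --> (\<forall>y. \<bar>y\<bar> <= M --> \<bar>deriv (f x) y\<bar> <= C)"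
proof -
 show "M > 0 ==> \<exists>C>0. ae x. x \<in> Om --> (\<forall>y. \<bar>y\<bar> <= M --> \<bar>deriv (f x) y\<bar> <= C)"
 proof -
  assume "M > 0"
  then obtain C where C: "C > 0" "AE x in lebesgue_on Om. (\<forall>y. \<bar>y\<bar> <= M --> \<bar>deriv (f x) y\<bar> + \<bar>deriv (deriv (f x)) y\<bar> <= C) \<and>
    (\<forall>y1 y2. \<bar>y1\<bar> <= M \<and> \<bar>y2\<bar> <= M --> \<bar>deriv (deriv (f x)) y2 - deriv (deriv (f x)) y1\<bar> <= C * \<bar>y2 - y1\<bar>)"
   using nonlinearity unfolding state_nonlinearity_def by blast
  have "ae x. x \<in> Om --> (\<forall>y. \<bar>y\<bar> <= M --> \<bar>deriv (f x) y\<bar> <= C)"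
   using C(2) unfolding AE_ext_iff[OF open_Om] by eventually_elim (smt (verit))
  thus ?thesis using C(1) by blast
 qed
qed (use nonlinearity in \<open>simp_all add: state_nonlinearity_def caratheodory_C2_def AE_ext_iff[OF open_Om]\<close>)

lemma h_simps: "h x 0 = 0" "x \<notin> Om ==> h x t = 0" "x \<in> Om ==> h x t = f x t - f x 0"
 by (simp_all add: h_def ext_def)

lemma h_measurable: "(%x. h x t) \<in> BM"
proof -
 have "(%x. f x t - f x 0) \<in> borel_measurable (lebesgue_on Om)" by (intro borel_measurable_diff f_props(2))
 thus ?thesis unfolding measurable_ext_iff[OF open_Om] h_def by (simp add: ext_def[abs_def])
qed

lemma h_local_lipschitz:
 assumes "M > 0"
 shows "\<exists>C\<ge>0. ae x. \<forall>s t. \<bar>s\<bar> <= M --> \<bar>t\<bar> <= M --> \<bar>h x s - h x t\<bar> <= C * \<bar>s - t\<bar>"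
proof -
 obtain C where C: "C > 0" "ae x. x \<in> Om --> (\<forall>y. \<bar>y\<bar> <= M --> \<bar>deriv (f x) y\<bar> <= C)" using f_props(5)[OF assms] by blast
 have "ae x. \<forall>s t. \<bar>s\<bar> <= M --> \<bar>t\<bar> <= M --> \<bar>h x s - h x t\<bar> <= C * \<bar>s - t\<bar>" using C(2) f_props(3)
 proof eventually_elim
  case (elim x)
  show ?case
  proof (cases "x \<in> Om")
   case True
   thus ?thesis using C2_real_lipschitz[of "f x" M C] elim by (simp add: h_simps)
  qed (use C in \<open>simp add: h_simps\<close>)
 qed
 thus ?thesis using C(1) by (intro exI[of _ C]) simp
qed

lemma monotone_h: "monotone_term h"
 unfolding monotone_term_def
proof (intro conjI allI impI h_measurable h_local_lipschitz)
 show "ae x. \<forall>s t. s <= t --> h x s <= h x t" using f_props(3,4)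
 proof eventually_elim
  case (elim x)
  have "f x s <= f x t" if x: "x \<in> Om" and st: "s <= t" for s t
  proof (cases "s = t")
   case False
   hence "s < t" using st by simp
   moreover have "C2_real (f x)" using elim x by blast
   ultimately obtain z where "f x t - f x s = (t - s) * deriv (f x) z" using C2_real_mvt by blast
   moreover have "0 <= (t - s) * deriv (f x) z" using elim x st by (intro mult_nonneg_nonneg) auto
   ultimately show ?thesis by linarith
  qed simp
  thus ?case by (cases "x \<in> Om") (auto simp: h_simps)
 qed
qed (simp add: h_simps)

lemma h_continuous: "ae x. continuous_on UNIV (h x)"
 using f_props(3)
proof eventually_elim
 case (elim x)
 show ?case
 proof (cases "x \<in> Om")
  case True
  hence "continuous_on UNIV (%t. f x t - f x 0)" using elim by (intro continuous_on_diff C2_real_continuous continuous_on_const) auto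
  thus ?thesis using True by (simp add: h_simps cong: continuous_on_cong)
 qed (simp add: h_simps cong: continuous_on_cong)
qed

lemma h_sqi:
 assumes y: "sqi y" and M: "ae x. \<bar>y x\<bar> <= M"
 shows "sqi (%x. h x (y x))"
proof -
 have "max M 1 > 0" by simp
 from h_local_lipschitz[OF this] obtain C where C: "C >= 0" "ae x. \<forall>s t. \<bar>s\<bar> <= max M 1 --> \<bar>t\<bar> <= max M 1 --> \<bar>h x s - h x t\<bar> <= C * \<bar>s - t\<bar>" by blast
 show ?thesis
 proof (rule sqi_bound[OF y, where C=C])
  show "(%x. h x (y x)) \<in> BM"
   by (rule caratheodory_measurable[where h=h and u=y, OF h_measurable h_continuous sqi_measurable[OF y]])
  show "ae x. \<bar>h x (y x)\<bar> <= C * \<bar>y x\<bar>" using C(2) M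
  proof eventually_elim
   case (elim x)
   from elim(1)[rule_format, of "y x" 0] elim(2) show ?case by (simp add: h_simps)
  qed
 qed
qed

lemma rhs_sqi: "w \<in> L2_space Om ==> sqi (rhs w)"
 unfolding rhs_def using L2_diff[OF open_Om _ f_props(1)] L2_iff[OF open_Om] by blast

lemma H10_ext: "y \<in> H10_space Om \<longleftrightarrow> (\<exists>G. h10 Om (ext Om y) G)"
 by (rule H10_iff[OF open_Om])

text \<open>The bound on \<open>y\<close> makes the nonlinear term square integrable, so that its
  integral splits. Without integrability the integrals would be 0 by convention and the equivalence
  could fail.\<close>

lemma weak_form_iff:
 assumes y: "h10 Om (ext Om y) Y" and ph: "h10 Om (ext Om ph) Ph" and w: "w \<in> L2_space Om" and M: "ae x. \<bar>ext Om y x\<bar> <= M"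
 shows "(\<integral>x. (\<Sum>i\<in>UNIV. \<Sum>j\<in>UNIV. a i j x * weak_deriv Om i y x * weak_deriv Om j ph x) \<partial>lebesgue_on Om)
    + (\<integral>x. f x (y x) * ph x \<partial>lebesgue_on Om) = (\<integral>x. w x * ph x \<partial>lebesgue_on Om) \<longleftrightarrow>
  form Y Ph = (lint x. (rhs w x - h x (ext Om y x)) * ext Om ph x)"
proof -
 have sph: "sqi (ext Om ph)" and sy: "sqi (ext Om y)" using y ph by (auto intro: h10D)
 have sh: "sqi (%x. h x (ext Om y x))" by (rule h_sqi[OF sy M])
 have sf0: "sqi (ext Om (%x. f x 0))" and sw: "sqi (ext Om w)" using f_props(1) w by (simp_all add: L2_iff[OF open_Om])
 have "ae x. \<forall>i. x \<in> Om --> weak_deriv Om i y x = Y x $ i" "ae x. \<forall>i. x \<in> Om --> weak_deriv Om i ph x = Ph x $ i"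
  by (intro AE_all_countable[THEN iffD2] allI h10_weak_deriv_AE[OF open_Om] y ph)+
 hence e: "ae x. bil x (Y x) (Ph x) = ext Om (%x. \<Sum>i\<in>UNIV. \<Sum>j\<in>UNIV. a i j x * weak_deriv Om i y x * weak_deriv Om j ph x) x"
 proof eventually_elim
  case (elim x)
  thus ?case by (cases "x \<in> Om") (simp_all add: bil_def ext_simps)
 qed
 have bm: "(%x. bil x (Y x) (Ph x)) \<in> BM" by (rule bil_measurable[OF sqv_measurable[OF h10D(2)[OF y]] sqv_measurable[OF h10D(2)[OF ph]]])
 have 1: "(\<integral>x. (\<Sum>i\<in>UNIV. \<Sum>j\<in>UNIV. a i j x * weak_deriv Om i y x * weak_deriv Om j ph x) \<partial>lebesgue_on Om) = form Y Ph"
  unfolding integral_ext[OF open_Om] form_def by (rule integral_cong_AE[symmetric, OF bm borel_measurable_AE[OF bm e] e])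
 have "ext Om (%x. f x (y x) * ph x) = (%x. h x (ext Om y x) * ext Om ph x + ext Om (%x. f x 0) x * ext Om ph x)"
  by (rule HOL.ext) (auto simp: h_def ext_def indicator_def algebra_simps)
 hence 2: "(\<integral>x. f x (y x) * ph x \<partial>lebesgue_on Om) = (lint x. h x (ext Om y x) * ext Om ph x) + (lint x. ext Om (%x. f x 0) x * ext Om ph x)"
  unfolding integral_ext[OF open_Om] using sqi_mult_integrable[OF sh sph] sqi_mult_integrable[OF sf0 sph] by simp
 have "ext Om (%x. w x * ph x) = (%x. ext Om w x * ext Om ph x)" by (auto simp: ext_def indicator_def)
 hence 3: "(\<integral>x. w x * ph x \<partial>lebesgue_on Om) = (lint x. ext Om w x * ext Om ph x)" unfolding integral_ext[OF open_Om] by simp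
 have "(%x. (rhs w x - h x (ext Om y x)) * ext Om ph x) = (%x. ext Om w x * ext Om ph x - ext Om (%x. f x 0) x * ext Om ph x - h x (ext Om y x) * ext Om ph x)"
  by (rule HOL.ext) (auto simp: rhs_def ext_def indicator_def algebra_simps)
 hence 4: "(lint x. (rhs w x - h x (ext Om y x)) * ext Om ph x) = (lint x. ext Om w x * ext Om ph x)
   - (lint x. ext Om (%x. f x 0) x * ext Om ph x) - (lint x. h x (ext Om y x) * ext Om ph x)"
  using sqi_mult_integrable[OF sh sph] sqi_mult_integrable[OF sf0 sph] sqi_mult_integrable[OF sw sph] by simp
 show ?thesis unfolding 1 2 3 4 by linarith
qed

text \<open>A function continuous on the compact closure is bounded there, which supplies the bound
  for \<open>weak_form_iff\<close>. A test pair of \<open>h10\<close> is first replaced by its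
  extension by zero, to which the definition in the statement applies.\<close>

lemma weak_solution_iff:
 assumes w: "w \<in> L2_space Om"
 shows "weak_solution Om a f w y \<longleftrightarrow> continuous_on (closure Om) y \<and> (\<exists>Y. sol h (rhs w) (ext Om y) Y)"
proof (cases "continuous_on (closure Om) y")
 case True
 have "compact (closure Om)" using bounded_Om by (simp add: compact_closure)
 hence "bounded (y ` closure Om)" using True compact_continuous_image compact_imp_bounded by blast
 then obtain M where M0: "\<forall>z\<in>closure Om. \<bar>y z\<bar> <= M" by (auto simp: bounded_iff)
 define M' where "M' = max M 0"
 have M: "ae x. \<bar>ext Om y x\<bar> <= M'"
 proof (intro AE_I2)
  fix x
  show "\<bar>ext Om y x\<bar> <= M'"
   using M0 closure_subset[of Om] by (cases "x \<in> Om") (auto simp: ext_simps M'_def le_max_iff_disj)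
 qed
 show ?thesis
 proof
  assume ws: "weak_solution Om a f w y"
  then obtain Y where Y: "h10 Om (ext Om y) Y" unfolding weak_solution_def H10_ext by blast
  have "form Y Ph = (lint x. (rhs w x - h x (ext Om y x)) * ph x)" if ph: "h10 Om ph Ph" for ph Ph
  proof -
   have ae: "ae x. ext Om ph x = ph x" using h10_zero_outside[OF ph] by eventually_elim (auto simp: ext_def indicator_def)
   have sph: "sqi ph" using ph by (rule h10D)
   have s: "sqi (ext Om ph)" unfolding ext_def using open_Om by (intro sqi_indicator_mult sph) (simp add: borel_open)
   have he: "h10 Om (ext Om ph) Ph" by (rule h10_AE_cong[OF ph ae _ s h10D(2)[OF ph]]) simp
   hence "ph \<in> H10_space Om" unfolding H10_ext by blast
   hence "form Y Ph = (lint x. (rhs w x - h x (ext Om y x)) * ext Om ph x)"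
    using ws weak_form_iff[OF Y he w M] unfolding weak_solution_def by blast
   also have "\<dots> = (lint x. (rhs w x - h x (ext Om y x)) * ph x)"
    using sqi_diff[OF rhs_sqi[OF w] h_sqi[OF h10D(1)[OF Y] M]] s sph ae
    by (intro integral_cong_AE borel_measurable_integrable[OF sqi_mult_integrable]) (auto elim: eventually_mono)
   finally show ?thesis .
  qed
  hence "sol h (rhs w) (ext Om y) Y" unfolding sol_def weak_eq_def using Y h_sqi[OF h10D(1)[OF Y] M] by blast
  thus "continuous_on (closure Om) y \<and> (\<exists>Y. sol h (rhs w) (ext Om y) Y)" using True by blast
 next
  assume "continuous_on (closure Om) y \<and> (\<exists>Y. sol h (rhs w) (ext Om y) Y)"
  then obtain Y where Y: "h10 Om (ext Om y) Y" "weak_eq Y (%x. rhs w x - h x (ext Om y x))" unfolding sol_def by blast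
  show "weak_solution Om a f w y" unfolding weak_solution_def
  proof (intro conjI ballI)
   show "y \<in> H10_space Om" unfolding H10_ext using Y(1) by blast
   fix ph assume "ph \<in> H10_space Om"
   then obtain Ph where ph: "h10 Om (ext Om ph) Ph" unfolding H10_ext by blast
   show "(\<integral>x. (\<Sum>i\<in>UNIV. \<Sum>j\<in>UNIV. a i j x * weak_deriv Om i y x * weak_deriv Om j ph x) \<partial>lebesgue_on Om)
    + (\<integral>x. f x (y x) * ph x \<partial>lebesgue_on Om) = (\<integral>x. w x * ph x \<partial>lebesgue_on Om)"
    unfolding weak_form_iff[OF Y(1) ph w M] using Y(2) ph unfolding weak_eq_def by blast
  qed (rule True)
 qed
qed (simp add: weak_solution_def)

text \<open>One constant for all right-hand sides, so that bounded sets of controls have uniformly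
  bounded states.\<close>

definition bound :: real where
 "bound = (SOME K. K >= 0 \<and> (\<forall>z Z g. subsol z Z g --> (ae x. z x <= K * norm (cls g))))"

lemma bound: "bound >= 0" "\<forall>z Z g. subsol z Z g --> (ae x. z x <= bound * norm (cls g))"
proof -
 have "bound >= 0 \<and> (\<forall>z Z g. subsol z Z g --> (ae x. z x <= bound * norm (cls g)))"
  unfolding bound_def by (rule someI_ex) (rule ess_bound[OF dim])
 thus "bound >= 0" "\<forall>z Z g. subsol z Z g --> (ae x. z x <= bound * norm (cls g))" by blast+
qed

lemma continuous_eq_on_closure:
 fixes y1 y2 :: "real ^ 'n => real"
 assumes c: "continuous_on (closure Om) y1" "continuous_on (closure Om) y2" and ae: "ae x. ext Om y1 x = ext Om y2 x" and x: "x \<in> closure Om"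
 shows "y1 x = y2 x"
proof -
 have c12: "continuous_on Om (%x. y1 x - y2 x)" "continuous_on Om (%x. y2 x - y1 x)"
  using c closure_subset by (auto intro!: continuous_on_diff intro: continuous_on_subset)
 have "y1 z - y2 z = 0" if z: "z \<in> Om" for z
 proof -
  have 1: "ae x. x \<in> Om --> y1 x - y2 x <= 0" using ae by eventually_elim (auto simp: ext_simps)
  have 2: "ae x. x \<in> Om --> y2 x - y1 x <= 0" using ae by eventually_elim (auto simp: ext_simps)
  from continuous_le_if_AE[OF c12(1) open_Om 1 z] continuous_le_if_AE[OF c12(2) open_Om 2 z] show ?thesis by simp
 qed
 hence "y1 x - y2 x = 0"
  by (intro continuous_constant_on_closure[OF continuous_on_diff[OF c] _ x]) auto
 thus ?thesis by simp
qed

text \<open>The description in \<open>state\<close> is resolved by existence from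
  \<open>sol_exists\<close> and by uniqueness almost everywhere, which continuity turns into
  equality on the closure; off the closure both functions are 0.\<close>

lemma state_props:
 assumes w: "w \<in> L2_space Om"
 shows "\<exists>Y. sol h (rhs w) (state Om a f w) Y" "\<bar>state Om a f w x\<bar> <= bound * norm (cls (rhs w))" "continuous_on UNIV (state Om a f w)"
  "ext Om (state Om a f w) = state Om a f w"
proof -
 obtain y Y where y: "sol h (rhs w) y Y" "continuous_on UNIV y" "\<forall>x. x \<notin> Om --> y x = 0" "\<forall>x. \<bar>y x\<bar> <= bound * norm (cls (rhs w))"
  using sol_exists[OF dim regular monotone_h bound rhs_sqi[OF w]] by blast
 have ey: "ext Om y = y" using y(3) by (auto simp: ext_def indicator_def fun_eq_iff)
 have wy: "weak_solution Om a f w y" unfolding weak_solution_iff[OF w] ey using y(1,2) continuous_on_subset by blast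
 have "state Om a f w = y" unfolding state_def
 proof (rule the_equality)
  show "weak_solution Om a f w y \<and> (\<forall>x. x \<notin> closure Om --> y x = 0)" using wy y(3) closure_subset by blast
  fix y' assume y': "weak_solution Om a f w y' \<and> (\<forall>x. x \<notin> closure Om --> y' x = 0)"
  then obtain Y' where Y': "continuous_on (closure Om) y'" "sol h (rhs w) (ext Om y') Y'" unfolding weak_solution_iff[OF w] by blast
  have ae: "ae x. ext Om y' x = ext Om y x"
   using sol_unique[OF dim monotone_h Y'(2) y(1) rhs_sqi[OF w]] by (simp add: ey)
  have "y' x = y x" for x
  proof (cases "x \<in> closure Om")
   case True
   show ?thesis by (rule continuous_eq_on_closure[OF Y'(1) continuous_on_subset[OF y(2)] ae True]) simp
  next
   case False
   hence "x \<notin> Om" using closure_subset by blast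
   thus ?thesis using y' y(3) False by simp
  qed
  thus "y' = y" by (rule HOL.ext)
 qed
 thus "\<exists>Y. sol h (rhs w) (state Om a f w) Y" "\<bar>state Om a f w x\<bar> <= bound * norm (cls (rhs w))" "continuous_on UNIV (state Om a f w)"
  "ext Om (state Om a f w) = state Om a f w" using y ey by auto
qed

text \<open>Controls of the same class have equal states at every point, so the game may be played
  on classes.\<close>

lemma state_cong:
 assumes w: "w1 \<in> L2_space Om" "w2 \<in> L2_space Om" and ae: "ae x. x \<in> Om --> w1 x = w2 x"
 shows "state Om a f w1 = state Om a f w2"
proof -
 obtain Y1 Y2 where Y: "sol h (rhs w1) (state Om a f w1) Y1" "sol h (rhs w2) (state Om a f w2) Y2"
  using state_props(1)[OF w(1)] state_props(1)[OF w(2)] by blast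
 note s = rhs_sqi[OF w(1)] rhs_sqi[OF w(2)]
 have aer: "ae x. rhs w1 x = rhs w2 x" using ae by eventually_elim (auto simp: rhs_def ext_def indicator_def)
 have z: "cls (%x. rhs w1 x - rhs w2 x) = 0"
  using cls_simps(2)[OF s] cls_eqI[OF s aer] by simp
 have "ae x. \<bar>state Om a f w1 x - state Om a f w2 x\<bar> <= bound * norm (cls (%x. rhs w1 x - rhs w2 x))"
  by (rule two_sided_bound[OF bound(2) sol_difference(1,2)[OF monotone_h Y s]])
 hence ae2: "ae x. ext Om (state Om a f w1) x = ext Om (state Om a f w2) x"
  unfolding z state_props(4)[OF w(1)] state_props(4)[OF w(2)] by (auto elim: eventually_mono)
 show ?thesis
 proof (rule HOL.ext)
  fix x
  show "state Om a f w1 x = state Om a f w2 x"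
  proof (cases "x \<in> Om")
   case True
   hence "x \<in> closure Om" using closure_subset by blast
   thus ?thesis
    by (intro continuous_eq_on_closure[OF _ _ ae2]) (auto intro: continuous_on_subset state_props(3)[OF w(1)] state_props(3)[OF w(2)])
  next
   case False
   thus ?thesis using fun_cong[OF state_props(4)[OF w(1)], of x] fun_cong[OF state_props(4)[OF w(2)], of x] by (simp add: ext_simps)
  qed
 qed
qed

end

section \<open>The game\<close>

text \<open>A section of \<open>cls\<close>: strategies live in the Hilbert space, whereas the state
  equation takes functions.\<close>

definition rep :: "(real ^ 'n) l2 => real ^ 'n => real" where "rep p = (SOME g. sqi g \<and> cls g = p)"

lemma rep: "sqi (rep p)" "cls (rep p) = p"
proof -
 have "\<exists>g. sqi g \<and> cls g = p" by (cases p) auto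
 from someI_ex[OF this] show "sqi (rep p)" "cls (rep p) = p" by (auto simp: rep_def)
qed

lemma rep_cls: "sqi g ==> ae x. rep (cls g) x = g x"
 using cls_eq_iff[OF rep(1), of g "cls g"] rep(2) by blast

definition mulop :: "(real ^ 'n) set => (real ^ 'n => real) => (real ^ 'n) l2 => (real ^ 'n) l2" where
 "mulop Om b p = cls (%x. ext Om b x * rep p x)"

context
 fixes Om :: "(real ^ 'n) set" and b :: "real ^ 'n => real"
 assumes Om: "open Om" and b: "b \<in> Linf_space Om"
begin

lemma Linf_bound: "\<exists>C\<ge>0. ae x. \<bar>ext Om b x\<bar> <= C"
proof -
 obtain C where C: "ae x. x \<in> Om --> \<bar>b x\<bar> <= C" using b by (auto simp: Linf_space_def AE_ext_iff[OF Om])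
 have "ae x. \<bar>ext Om b x\<bar> <= \<bar>C\<bar>" using C by eventually_elim (auto simp: ext_def indicator_def)
 thus ?thesis by (intro exI[of _ "\<bar>C\<bar>"]) simp
qed

lemma Linf_measurable: "ext Om b \<in> BM"
 using b by (simp add: Linf_space_def measurable_ext_iff[OF Om])

lemma mul_sqi: assumes "sqi g" shows "sqi (%x. ext Om b x * g x)"
proof -
 obtain C where "ae x. \<bar>ext Om b x\<bar> <= C" using Linf_bound by blast
 from sqi_mult_bounded[OF assms Linf_measurable this] show ?thesis .
qed

text \<open>Symmetry does the work of linearity: it moves the operator onto the fixed vector in weak
  limits, and by testing it yields \<open>mulop_zero\<close> and additivity.\<close>

lemma mulop_sym: "inner (mulop Om b p) y = inner p (mulop Om b y)"
proof -
 have "inner (mulop Om b p) (cls (rep y)) = (lint x. (ext Om b x * rep p x) * rep y x)"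
  unfolding mulop_def by (rule cls_simps(5)[OF mul_sqi[OF rep(1)] rep(1)])
 also have "\<dots> = (lint x. rep p x * (ext Om b x * rep y x))" by (simp add: mult_ac)
 also have "\<dots> = inner (cls (rep p)) (mulop Om b y)"
  unfolding mulop_def by (rule cls_simps(5)[OF rep(1) mul_sqi[OF rep(1)], symmetric])
 finally show ?thesis by (simp add: rep)
qed

lemma mulop_lipschitz: "\<exists>C\<ge>0. \<forall>p q. norm (mulop Om b p - mulop Om b q) <= C * norm (p - q)"
proof -
 obtain C where C: "C >= 0" "ae x. \<bar>ext Om b x\<bar> <= C" using Linf_bound by blast
 have "norm (mulop Om b p - mulop Om b q) <= C * norm (p - q)" for p q
 proof -
  have "mulop Om b p - mulop Om b q = cls (%x. ext Om b x * rep p x - ext Om b x * rep q x)"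
   unfolding mulop_def by (rule cls_simps(2)[OF mul_sqi[OF rep(1)] mul_sqi[OF rep(1)]])
  moreover have "norm (cls (%x. ext Om b x * rep p x - ext Om b x * rep q x)) <= C * norm (cls (%x. rep p x - rep q x))"
  proof (rule norm_cls_mono[OF sqi_diff[OF mul_sqi[OF rep(1)] mul_sqi[OF rep(1)]] sqi_diff[OF rep(1) rep(1)] _ C(1)])
   show "ae x. \<bar>ext Om b x * rep p x - ext Om b x * rep q x\<bar> <= C * \<bar>rep p x - rep q x\<bar>"
    using C(2) by eventually_elim (simp add: right_diff_distrib[symmetric] abs_mult mult_right_mono)
  qed
  moreover have "cls (%x. rep p x - rep q x) = p - q" using cls_simps(2)[OF rep(1) rep(1), of p q] by (simp add: rep)
  ultimately show ?thesis by simp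
 qed
 thus ?thesis using C(1) by blast
qed

lemma mulop_zero: "mulop Om b 0 = 0"
proof -
 have "inner (mulop Om b 0) (mulop Om b 0) = 0" by (subst mulop_sym) simp
 thus ?thesis by simp
qed

lemma mulop_tendsto: assumes "p ~~> q" shows "(%l. mulop Om b (p l)) ~~> mulop Om b q"
proof -
 obtain C where C: "\<forall>p q. norm (mulop Om b p - mulop Om b q) <= C * norm (p - q)" using mulop_lipschitz by blast
 have "(%l. C * norm (p l - q)) ~~> C * norm (q - q)" by (intro tendsto_intros assms)
 hence l: "(%l. C * norm (p l - q)) ~~> 0" by simp
 have "(%l. mulop Om b (p l) - mulop Om b q) ~~> 0" by (rule Lim_null_comparison[OF _ l]) (use C in simp)
 thus ?thesis by (rule LIM_zero_cancel)
qed

lemma quadratic_integral: "(\<integral>x. b x * (rep p x)^2 \<partial>lebesgue_on Om) = inner p (mulop Om b p)"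
proof -
 have "inner (cls (rep p)) (mulop Om b p) = (lint x. rep p x * (ext Om b x * rep p x))"
  unfolding mulop_def by (rule cls_simps(5)[OF rep(1) mul_sqi[OF rep(1)]])
 also have "\<dots> = (lint x. ext Om (%x. b x * (rep p x)^2) x)"
  by (intro Bochner_Integration.integral_cong refl) (simp add: ext_def power2_eq_square mult_ac)
 finally show ?thesis by (simp add: rep integral_ext[OF Om])
qed

lemma mulop_nonneg:
 assumes "AE x in lebesgue_on Om. b x >= 0" shows "inner p (mulop Om b p) >= 0"
 unfolding quadratic_integral[symmetric]
 by (rule integral_nonneg_AE) (use assms in \<open>eventually_elim, simp\<close>)

end

context
 fixes Om :: "(real ^ 'n) set" and l :: "real ^ 'n => real => real"
 assumes Om: "open Om" "bounded Om" and l: "cost_integrand Om l"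
begin

text \<open>Mean value theorem with the square integrable bound on the derivative; that bound is
  integrable because \<open>Om\<close> has finite measure.\<close>

lemma cost_integrand_lipschitz:
 assumes M: "M > 0"
 shows "\<exists>\<psi>. integrable lebesgue \<psi> \<and> (ae x. x \<in> Om --> (\<forall>s t. \<bar>s\<bar> <= M --> \<bar>t\<bar> <= M --> \<bar>l x s - l x t\<bar> <= \<psi> x * \<bar>s - t\<bar>))"
proof -
 obtain C \<psi> where p: "\<psi> \<in> L2_space Om" "AE x in lebesgue_on Om.
    (\<forall>y. \<bar>y\<bar> <= M --> \<bar>deriv (l x) y\<bar> <= \<psi> x \<and> \<bar>deriv (deriv (l x)) y\<bar> <= C) \<and>
    (\<forall>y1 y2. \<bar>y1\<bar> <= M \<and> \<bar>y2\<bar> <= M --> \<bar>deriv (deriv (l x)) y2 - deriv (deriv (l x)) y1\<bar> <= C * \<bar>y2 - y1\<bar>)"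
  using l M unfolding cost_integrand_def by blast
 have c2: "ae x. x \<in> Om --> C2_real (l x)" using l by (simp add: cost_integrand_def caratheodory_C2_def AE_ext_iff[OF Om(1)])
 have "Om \<in> lmeasurable" using Om by (simp add: lmeasurable_open)
 moreover have "sqi (ext Om \<psi>)" using p(1) L2_iff[OF Om(1)] by blast
 ultimately have "integrable lebesgue (%x. ind Om x * ext Om \<psi> x)" by (rule integrable_indicator_mult)
 hence i: "integrable lebesgue (ext Om \<psi>)" by (simp add: ext_def[abs_def] mult.assoc[symmetric] indicator_inter_arith[symmetric])
 have "ae x. x \<in> Om --> (\<forall>s t. \<bar>s\<bar> <= M --> \<bar>t\<bar> <= M --> \<bar>l x s - l x t\<bar> <= ext Om \<psi> x * \<bar>s - t\<bar>)"
  using p(2)[unfolded AE_ext_iff[OF Om(1)]] c2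
 proof eventually_elim
  case (elim x)
  show ?case
  proof (intro impI allI)
   fix s t assume x: "x \<in> Om" and st: "\<bar>s\<bar> <= M" "\<bar>t\<bar> <= M"
   have "\<forall>y. \<bar>y\<bar> <= M --> \<bar>deriv (l x) y\<bar> <= \<psi> x" "C2_real (l x)" using elim x by blast+
   from C2_real_lipschitz[OF this(2,1) st] show "\<bar>l x s - l x t\<bar> <= ext Om \<psi> x * \<bar>s - t\<bar>" using x by (simp add: ext_simps)
  qed
 qed
 with i show ?thesis by blast
qed

lemma cost_integrable:
 assumes y: "y \<in> BM" and M: "\<And>x. \<bar>y x\<bar> <= M"
 shows "integrable lebesgue (ext Om (%x. l x (y x)))"
proof -
 have M1: "max M 1 > 0" by simp
 obtain \<psi> where \<psi>: "integrable lebesgue \<psi>" "ae x. x \<in> Om --> (\<forall>s t. \<bar>s\<bar> <= max M 1 --> \<bar>t\<bar> <= max M 1 --> \<bar>l x s - l x t\<bar> <= \<psi> x * \<bar>s - t\<bar>)"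
  using cost_integrand_lipschitz[OF M1] by blast
 have i0: "integrable lebesgue (ext Om (%x. l x 0))" using l by (simp add: cost_integrand_def L1_space_def integrable_ext_iff[OF Om(1)])
 have c2: "ae x. x \<in> Om --> C2_real (l x)" using l by (simp add: cost_integrand_def caratheodory_C2_def AE_ext_iff[OF Om(1)])
 define H where "H x t = ext Om (%x. l x t) x" for x t
 have He: "ext Om (%x. l x (y x)) = (%x. H x (y x))" by (simp add: H_def ext_def fun_eq_iff)
 have m: "(%x. H x (y x)) \<in> BM"
 proof (rule caratheodory_measurable[where h=H and u=y])
  show "(%x. H x t) \<in> BM" for t
   using l unfolding H_def by (simp add: cost_integrand_def caratheodory_C2_def measurable_ext_iff[OF Om(1)] ext_def[abs_def])
  show "ae x. continuous_on UNIV (H x)" using c2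
  proof eventually_elim
   case (elim x)
   thus ?case by (cases "x \<in> Om") (simp_all add: H_def[abs_def] ext_simps C2_real_continuous cong: continuous_on_cong)
  qed
 qed (rule y)
 have "integrable lebesgue (%x. \<bar>ext Om (%x. l x 0) x\<bar> + \<bar>M\<bar> * \<bar>\<psi> x\<bar>)" using i0 \<psi>(1) by simp
 thus ?thesis unfolding He
 proof (rule Bochner_Integration.integrable_bound[OF _ m])
  show "ae x. norm (H x (y x)) <= norm (\<bar>ext Om (%x. l x 0) x\<bar> + \<bar>M\<bar> * \<bar>\<psi> x\<bar>)" using \<psi>(2)
  proof eventually_elim
   case (elim x)
   show ?case
   proof (cases "x \<in> Om")
    case True
    have "\<bar>y x\<bar> <= max M 1" using M[of x] by simp
    moreover have "\<bar>0 :: real\<bar> <= max M 1" by simp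
    ultimately have "\<bar>l x (y x) - l x 0\<bar> <= \<psi> x * \<bar>y x - 0\<bar>" using elim True by blast
    also have "\<dots> <= \<bar>\<psi> x\<bar> * \<bar>M\<bar>" using M[of x] by (intro mult_mono) auto
    finally show ?thesis using True by (simp add: H_def ext_simps mult.commute)
   qed (simp add: H_def ext_simps)
  qed
 qed
qed

text \<open>The uniform distance of the states is multiplied by an integrable Lipschitz factor, so
  the costs differ by at most \<open>e * P\<close>.\<close>

lemma cost_converges:
 assumes y: "\<And>n. y n \<in> BM" "y0 \<in> BM" and M: "\<And>n x. \<bar>y n x\<bar> <= M" "\<And>x. \<bar>y0 x\<bar> <= M"
  and lim: "\<And>e. e > 0 ==> \<forall>\<^sub>F n in sequentially. ae x. \<bar>y n x - y0 x\<bar> <= e"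
 shows "(%n. \<integral>x. l x (y n x) \<partial>lebesgue_on Om) ~~> (\<integral>x. l x (y0 x) \<partial>lebesgue_on Om)"
proof -
 have M1: "max M 1 > 0" by simp
 obtain \<psi> where \<psi>: "integrable lebesgue \<psi>" "ae x. x \<in> Om --> (\<forall>s t. \<bar>s\<bar> <= max M 1 --> \<bar>t\<bar> <= max M 1 --> \<bar>l x s - l x t\<bar> <= \<psi> x * \<bar>s - t\<bar>)"
  using cost_integrand_lipschitz[OF M1] by blast
 define P where "P = (lint x. \<bar>\<psi> x\<bar>)"
 have P0: "P >= 0" by (simp add: P_def)
 note i = cost_integrable[OF y(1) M(1)] and i0 = cost_integrable[OF y(2) M(2)]
 show ?thesis unfolding integral_ext[OF Om(1)]
 proof (rule LIMSEQ_I)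
  fix r :: real assume r: "r > 0"
  define e where "e = r / (P + 1)"
  have e: "e > 0" using r P0 by (simp add: e_def)
  have eP: "e * P < r"
  proof -
   have "e * P < e * (P + 1)" using e by simp
   also have "\<dots> = r" using P0 by (simp add: e_def)
   finally show ?thesis .
  qed
  obtain n0 where n0: "\<forall>n\<ge>n0. ae x. \<bar>y n x - y0 x\<bar> <= e" using lim[OF e] by (auto simp: eventually_sequentially)
  have "norm ((lint x. ext Om (%x. l x (y n x)) x) - (lint x. ext Om (%x. l x (y0 x)) x)) < r" if n: "n >= n0" for n
  proof -
   have "(lint x. ext Om (%x. l x (y n x)) x) - (lint x. ext Om (%x. l x (y0 x)) x)
    = (lint x. ext Om (%x. l x (y n x)) x - ext Om (%x. l x (y0 x)) x)"
    using i i0 by (intro Bochner_Integration.integral_diff[symmetric])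
   also have "norm \<dots> <= (lint x. norm (ext Om (%x. l x (y n x)) x - ext Om (%x. l x (y0 x)) x))" by (rule integral_norm_bound)
   also have "\<dots> <= (lint x. e * \<bar>\<psi> x\<bar>)"
   proof (rule integral_mono_AE)
    show "integrable lebesgue (%x. norm (ext Om (%x. l x (y n x)) x - ext Om (%x. l x (y0 x)) x))"
     by (rule integrable_norm[OF Bochner_Integration.integrable_diff[OF i i0]])
    show "integrable lebesgue (%x. e * \<bar>\<psi> x\<bar>)" using \<psi>(1) by simp
    show "ae x. norm (ext Om (%x. l x (y n x)) x - ext Om (%x. l x (y0 x)) x) <= e * \<bar>\<psi> x\<bar>"
     using \<psi>(2) n0[rule_format, OF n]
    proof eventually_elim
     case (elim x)
     show ?case
     proof (cases "x \<in> Om")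
      case True
      have "\<bar>y n x\<bar> <= max M 1" "\<bar>y0 x\<bar> <= max M 1" using M(1)[of n x] M(2)[of x] by auto
      hence "\<bar>l x (y n x) - l x (y0 x)\<bar> <= \<psi> x * \<bar>y n x - y0 x\<bar>" using elim(1) True by blast
      also have "\<dots> <= \<bar>\<psi> x\<bar> * e" using elim(2) by (intro mult_mono) auto
      finally show ?thesis using True by (simp add: ext_simps mult.commute)
     qed (use e in \<open>simp add: ext_simps\<close>)
    qed
   qed
   also have "\<dots> = e * P" by (simp add: P_def)
   finally show ?thesis using eP by simp
  qed
  thus "\<exists>n0. \<forall>n\<ge>n0. norm ((lint x. ext Om (%x. l x (y n x)) x) - (lint x. ext Om (%x. l x (y0 x)) x)) < r" by blast
 qed
qed

end

text \<open>For closedness, a representative \<open>g\<close> of the limit is approximated in the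
  seminorm by members of \<open>U\<close>, hence belongs to \<open>U\<close>. As \<open>g\<close>
  might differ from zero off \<open>Om\<close>, its extension by zero is compared with it, and
  uniqueness of limits identifies their classes.\<close>

lemma admissible_set:
 fixes Om :: "(real ^ 'n) set"
 assumes Om: "open Om" and U: "U \<subseteq> L2_space Om" "U \<noteq> {}" "convex_function_set U" "L2_closed Om U" "L2_bounded Om U"
 defines "C \<equiv> (%v. cls (ext Om v)) ` U"
 shows "C \<noteq> {} \<and> convex C \<and> closed C \<and> bounded C"
proof (intro conjI)
 have s: "sqi (ext Om v)" if "v \<in> U" for v using U(1) that L2_iff[OF Om] by blast
 show "C \<noteq> {}" using U(2) by (simp add: C_def)
 show "convex C" unfolding convex_alt
 proof (intro ballI allI impI)
  fix x y t assume "x \<in> C" "y \<in> C" and t: "(0::real) <= t \<and> t <= 1"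
  then obtain v w where vw: "v \<in> U" "w \<in> U" "x = cls (ext Om v)" "y = cls (ext Om w)" by (auto simp: C_def)
  have "(%x. (1 - t) * v x + t * w x) \<in> U" using U(3) vw t unfolding convex_function_set_def by auto
  moreover have "ext Om (%x. (1 - t) * v x + t * w x) = (%x. (1 - t) * ext Om v x + t * ext Om w x)" by (auto simp: ext_def algebra_simps)
  moreover have "(1 - t) *R x + t *R y = cls (%x. (1 - t) * ext Om v x + t * ext Om w x)"
   unfolding vw using s vw(1,2) by (simp add: cls_simps sqi_cmult)
  ultimately show "(1 - t) *R x + t *R y \<in> C" unfolding C_def by (intro image_eqI) auto
 qed
 show "bounded C"
 proof -
  obtain R where "\<forall>v\<in>U. L2_norm Om v <= R" using U(5) unfolding L2_bounded_def by blast
  hence "\<forall>x\<in>C. norm x <= R" using U(1) L2_norm_eq[OF Om] unfolding C_def by (metis (no_types, lifting) imageE subsetD)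
  thus ?thesis unfolding bounded_iff by blast
 qed
 show "closed C" unfolding closed_sequential_limits
 proof (intro allI impI)
  fix x p assume xp: "(\<forall>n. x n \<in> C) \<and> x ~~> p"
  hence "\<forall>n. \<exists>v. v \<in> U \<and> x n = cls (ext Om v)" unfolding C_def by blast
  from choice[OF this] obtain v where v: "\<forall>n. v n \<in> U \<and> x n = cls (ext Om (v n))" ..
  define g where "g = rep p"
  have g: "sqi g" "cls g = p" by (simp_all add: g_def rep)
  have sg: "sqi (ext Om g)" unfolding ext_def[abs_def] using Om by (intro sqi_indicator_mult g) (simp add: borel_open)
  hence gL: "g \<in> L2_space Om" using L2_iff[OF Om] by blast
  have sv: "sqi (ext Om (v n))" for n using s v by blast
  have le: "norm (cls (ext Om (v n)) - cls (ext Om g)) <= norm (x n - p)" for n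
  proof -
   have "norm (cls (%x. ext Om (v n) x - ext Om g x)) <= 1 * norm (cls (%x. ext Om (v n) x - g x))"
    by (rule norm_cls_mono[OF sqi_diff[OF sv sg] sqi_diff[OF sv g(1)]]) (auto simp: ext_def indicator_def)
   moreover have "cls (%x. ext Om (v n) x - ext Om g x) = cls (ext Om (v n)) - cls (ext Om g)" by (rule cls_simps(2)[OF sv sg, symmetric])
   moreover have "cls (%x. ext Om (v n) x - g x) = x n - p" using v g cls_simps(2)[OF sv g(1)] by simp
   ultimately show ?thesis by simp
  qed
  have x0: "(%n. norm (x n - p)) ~~> 0" using xp by (simp add: LIM_zero tendsto_norm_zero)
  have "g \<in> U"
  proof -
   have "\<exists>w\<in>U. L2_norm Om (%x. w x - g x) < \<epsilon>" if e: "\<epsilon> > 0" for \<epsilon>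
   proof -
    have "\<forall>\<^sub>F n in sequentially. norm (x n - p) < \<epsilon>" using x0 e by (rule order_tendstoD(2))
    then obtain n where n: "norm (x n - p) < \<epsilon>" by (auto simp: eventually_sequentially)
    have vL: "v n \<in> L2_space Om" using v U(1) by blast
    have "L2_norm Om (%x. v n x - g x) = norm (cls (ext Om (v n)) - cls (ext Om g))"
     using L2_norm_eq[OF Om L2_diff[OF Om vL gL]] cls_ext_diff[OF Om vL gL] by simp
    thus ?thesis using le[of n] n v by (intro bexI[of _ "v n"]) auto
   qed
   thus ?thesis using U(4) gL unfolding L2_closed_def by blast
  qed
  moreover have "p = cls (ext Om g)"
  proof (rule LIMSEQ_unique)
   show "x ~~> p" using xp by blast
   have "(%n. x n - cls (ext Om g)) ~~> 0" by (rule Lim_null_comparison[OF _ x0]) (use le v in simp)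
   thus "x ~~> cls (ext Om g)" by (rule LIM_zero_cancel)
  qed
  ultimately show "p \<in> C" unfolding C_def by blast
 qed
qed

context state_eq
begin

context
 fixes m :: nat and B :: "nat => real ^ 'n => real"
 assumes B: "\<forall>k\<in>{1..m}. B k \<in> Linf_space Om"
begin

definition control :: "(nat => (real ^ 'n) l2) => real ^ 'n => real" where
 "control u z = (\<Sum>i=1..m. B i z * rep (u i) z)"

lemma ext_sum: "ext Om (%z. \<Sum>i=1..m. B i z * g i z) = (%x. \<Sum>i=1..m. ext Om (B i) x * g i x)"
 by (rule HOL.ext) (simp add: ext_def sum_distrib_left mult.assoc)

lemma sum_L2: assumes "\<And>i. i \<in> {1..m} ==> sqi (g i)" shows "(%z. \<Sum>i=1..m. B i z * g i z) \<in> L2_space Om"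
 unfolding L2_iff[OF open_Om] ext_sum using B assms by (intro sqi_sum mul_sqi[OF open_Om]) auto

lemma control_L2: "control u \<in> L2_space Om"
 unfolding control_def[abs_def] by (rule sum_L2) (rule rep)

lemma cls_control: "cls (ext Om (control u)) = (\<Sum>i=1..m. mulop Om (B i) (u i))"
 unfolding control_def[abs_def] ext_sum mulop_def
 by (rule cls_sum[symmetric]) (use B in \<open>auto intro: mul_sqi[OF open_Om] rep\<close>)

lemma cls_rhs_control: "cls (rhs (control u)) = (\<Sum>i=1..m. mulop Om (B i) (u i)) - cls (ext Om (%x. f x 0))"
 unfolding rhs_def cls_ext_diff[OF open_Om control_L2 f_props(1)] cls_control ..

lemma control_state_cong:
 assumes v: "\<And>i. i \<in> {1..m} ==> v i \<in> L2_space Om"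
 shows "state Om a f (%z. \<Sum>i=1..m. B i z * v i z) = state Om a f (control (%i. cls (ext Om (v i))))"
proof -
 have s: "sqi (ext Om (v i))" if "i \<in> {1..m}" for i using v[OF that] L2_iff[OF open_Om] by blast
 have e: "ext Om (%z. \<Sum>i=1..m. B i z * v i z) = ext Om (%z. \<Sum>i=1..m. B i z * ext Om (v i) z)"
  by (rule HOL.ext) (auto simp: ext_def indicator_def)
 have L: "(%z. \<Sum>i=1..m. B i z * v i z) \<in> L2_space Om" unfolding L2_iff[OF open_Om] e
  by (rule L2_iff[OF open_Om, THEN iffD1, OF sum_L2[where g="%i. ext Om (v i)"]]) (rule s)
 have "ae x. \<forall>i\<in>{1..m}. rep (cls (ext Om (v i))) x = ext Om (v i) x"
  by (rule AE_finite_allI) (use rep_cls[OF s] in auto)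
 hence "ae x. x \<in> Om --> (\<Sum>i=1..m. B i x * v i x) = control (%i. cls (ext Om (v i))) x"
 proof eventually_elim
  case (elim x)
  show ?case
  proof
   assume x: "x \<in> Om"
   show "(\<Sum>i=1..m. B i x * v i x) = control (%i. cls (ext Om (v i))) x"
    unfolding control_def using elim x by (intro sum.cong) (auto simp: ext_simps)
  qed
 qed
 thus ?thesis by (rule state_cong[OF L control_L2])
qed

text \<open>Controls enter linearly through bounded symmetric multiplications, so weak convergence
  of controls is inherited by the right-hand sides; the bounds \<open>R i\<close> provide the
  uniform bounds for \<open>weak_to_uniform\<close>.\<close>

lemma state_weakly_continuous:
 assumes weak: "\<forall>i\<in>{1..m}. weakly_to (%l. u l i) (v i)" and R: "\<forall>i\<in>{1..m}. \<forall>l. norm (u l i) <= R i" "\<forall>i\<in>{1..m}. norm (v i) <= R i"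
 shows "\<exists>M. \<forall>l x. \<bar>state Om a f (control (u l)) x\<bar> <= M \<and> \<bar>state Om a f (control v) x\<bar> <= M"
  and "e > 0 ==> \<forall>\<^sub>F l in sequentially. ae x. \<bar>state Om a f (control (u l)) x - state Om a f (control v) x\<bar> <= e"
proof -
 have "\<forall>i. \<exists>C. i \<in> {1..m} --> C >= 0 \<and> (\<forall>p q. norm (mulop Om (B i) p - mulop Om (B i) q) <= C * norm (p - q))"
  using mulop_lipschitz[OF open_Om] B by blast
 from choice[OF this] obtain C where C: "\<forall>i. i \<in> {1..m} --> C i >= 0 \<and> (\<forall>p q. norm (mulop Om (B i) p - mulop Om (B i) q) <= C i * norm (p - q))" ..
 define R1 where "R1 = (\<Sum>i=1..m. C i * R i)"
 define R2 where "R2 = R1 + norm (cls (ext Om (%x. f x 0)))"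
 have bnd: "norm (cls (rhs (control p))) <= R2" if "\<forall>i\<in>{1..m}. norm (p i) <= R i" for p
 proof -
  have "norm (\<Sum>i=1..m. mulop Om (B i) (p i)) <= R1" unfolding R1_def
  proof (rule order_trans[OF norm_sum sum_mono])
   fix i assume i: "i \<in> {1..m}"
   have "norm (mulop Om (B i) (p i)) = norm (mulop Om (B i) (p i) - mulop Om (B i) 0)"
    using mulop_zero[OF open_Om] B i by simp
   also have "\<dots> <= C i * norm (p i - 0)" using C i by blast
   also have "\<dots> <= C i * R i" using C i that by (intro mult_left_mono) auto
   finally show "norm (mulop Om (B i) (p i)) <= C i * R i" .
  qed
  thus ?thesis unfolding cls_rhs_control R2_def
   using norm_triangle_ineq4[of "\<Sum>i=1..m. mulop Om (B i) (p i)" "cls (ext Om (%x. f x 0))"] by linarith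
 qed
 have bu: "norm (cls (rhs (control (u l)))) <= R2" for l by (rule bnd) (use R in blast)
 have bv: "norm (cls (rhs (control v))) <= R2" by (rule bnd) (use R in blast)
 have "\<bar>state Om a f (control (u l)) x\<bar> <= bound * R2 \<and> \<bar>state Om a f (control v) x\<bar> <= bound * R2" for l x
  using state_props(2)[OF control_L2, of "u l" x] state_props(2)[OF control_L2, of v x]
   mult_left_mono[OF bu bound(1), of l] mult_left_mono[OF bv bound(1)] by linarith
 thus "\<exists>M. \<forall>l x. \<bar>state Om a f (control (u l)) x\<bar> <= M \<and> \<bar>state Om a f (control v) x\<bar> <= M" by blast
 assume e: "e > 0"
 have "\<forall>l. \<exists>Y. sol h (rhs (control (u l))) (state Om a f (control (u l))) Y" using state_props(1)[OF control_L2] by blast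
 from choice[OF this] obtain Y where Y: "\<forall>l. sol h (rhs (control (u l))) (state Om a f (control (u l))) (Y l)" ..
 obtain Y0 where Y0: "sol h (rhs (control v)) (state Om a f (control v)) Y0" using state_props(1)[OF control_L2] by blast
 show "\<forall>\<^sub>F l in sequentially. ae x. \<bar>state Om a f (control (u l)) x - state Om a f (control v) x\<bar> <= e"
 proof (rule weak_to_uniform[OF dim monotone_h rhs_sqi[OF control_L2] rhs_sqi[OF control_L2] _ _ Y[rule_format] Y0 e])
  show "weakly_to (%l. cls (rhs (control (u l)))) (cls (rhs (control v)))"
   unfolding weakly_to_def cls_rhs_control
  proof
   fix y
   have "(%l. \<Sum>i=1..m. inner (u l i) (mulop Om (B i) y)) ~~> (\<Sum>i=1..m. inner (v i) (mulop Om (B i) y))"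
    using weak unfolding weakly_to_def by (intro tendsto_sum) blast
   moreover have "inner (\<Sum>i=1..m. mulop Om (B i) (p i)) y = (\<Sum>i=1..m. inner (p i) (mulop Om (B i) y))" for p
    unfolding inner_sum_left using mulop_sym[OF open_Om] B by (intro sum.cong) auto
   ultimately have "(%l. inner (\<Sum>i=1..m. mulop Om (B i) (u l i)) y) ~~> inner (\<Sum>i=1..m. mulop Om (B i) (v i)) y" by simp
   from tendsto_diff[OF this tendsto_const]
   show "(%l. inner ((\<Sum>i=1..m. mulop Om (B i) (u l i)) - cls (ext Om (%x. f x 0))) y)
    ~~> inner ((\<Sum>i=1..m. mulop Om (B i) (v i)) - cls (ext Om (%x. f x 0))) y"
    unfolding inner_diff_left .
  qed
  show "norm (cls (rhs (control (u l))) - cls (rhs (control v))) <= R2 + R2" for l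
   using norm_triangle_ineq4[of "cls (rhs (control (u l)))" "cls (rhs (control v))"] bu[of l] bv by linarith
 qed
qed

lemma state_cost_weakly_continuous:
 assumes l: "cost_integrand Om l"
  and weak: "\<forall>i\<in>{1..m}. weakly_to (%l. u l i) (v i)" and R: "\<forall>i\<in>{1..m}. \<forall>l. norm (u l i) <= R i" "\<forall>i\<in>{1..m}. norm (v i) <= R i"
 shows "(%n. \<integral>x. l x (state Om a f (control (u n)) x) \<partial>lebesgue_on Om) ~~> (\<integral>x. l x (state Om a f (control v) x) \<partial>lebesgue_on Om)"
proof -
 obtain M where M: "\<forall>l x. \<bar>state Om a f (control (u l)) x\<bar> <= M \<and> \<bar>state Om a f (control v) x\<bar> <= M"
  using state_weakly_continuous(1)[OF weak R] by blast
 have m: "state Om a f (control p) \<in> BM" for p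
  using state_props(3)[OF control_L2] by (simp add: borel_measurable_continuous_onI borel_lebesgue)
 show ?thesis
  by (rule cost_converges[OF open_Om bounded_Om l m m _ _ state_weakly_continuous(2)[OF weak R], where M=M]) (use M in blast)+
qed

context
 fixes \<zeta> :: "nat => real ^ 'n => real" and L :: "nat => real ^ 'n => real => real" and Uad :: "nat => (real ^ 'n => real) set"
 assumes \<zeta>: "\<forall>k\<in>{1..m}. \<zeta> k \<in> Linf_space Om \<and> (AE x in lebesgue_on Om. \<zeta> k x >= 0)"
  and L: "\<forall>k\<in>{1..m}. cost_integrand Om (L k)"
  and Uad: "\<forall>k\<in>{1..m}. Uad k \<subseteq> L2_space Om \<and> Uad k \<noteq> {} \<and> convex_function_set (Uad k) \<and> L2_closed Om (Uad k) \<and> L2_bounded Om (Uad k)"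
  and conv: "\<forall>k\<in>{1..m}. convex_problem m Uad (cost Om a f m B L \<zeta>) k"
begin

text \<open>Players are numbered from 1 in the game but from 0 in \<open>nash_existence\<close>, so
  a dummy player 0 is added, with zero cost and 0 as the only decision.\<close>

definition state_cost :: "nat => (nat => (real ^ 'n) l2) => real" where
 "state_cost k u = (if k = 0 then 0 else \<integral>x. L k x (state Om a f (control u) x) \<partial>lebesgue_on Om)"

definition control_cost :: "nat => (real ^ 'n) l2 => real" where
 "control_cost k p = (if k = 0 then 0 else 1 / 2 * inner p (mulop Om (\<zeta> k) p))"

definition admissible :: "nat => (real ^ 'n) l2 set" where
 "admissible k = (if k = 0 then {0} else (%v. cls (ext Om v)) ` Uad k)"

text \<open>The splitting on which \<open>nash_existence\<close> operates: a weakly continuous term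
  depending on all controls and a quadratic term in the player's own control.\<close>

lemma cost_eq:
 assumes v: "\<forall>i\<in>{1..m}. v i \<in> L2_space Om" and k: "k \<in> {1..m}" and u: "\<forall>i\<in>{1..m}. u i = cls (ext Om (v i))"
 shows "cost Om a f m B L \<zeta> k v = state_cost k u + control_cost k (u k)"
proof -
 have c: "control (%i. cls (ext Om (v i))) = control u" unfolding control_def using u by (intro HOL.ext sum.cong) auto
 have "state Om a f (%z. \<Sum>i=1..m. B i z * v i z) = state Om a f (control u)"
  using control_state_cong[of v] v c by simp
 moreover have "(\<integral>x. \<zeta> k x * (v k x)^2 \<partial>lebesgue_on Om) = inner (u k) (mulop Om (\<zeta> k) (u k))"
 proof -
  have z: "\<zeta> k \<in> Linf_space Om" using \<zeta> k by blast
  have s: "sqi (ext Om (v k))" using v k L2_iff[OF open_Om] by blast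
  have uk: "u k = cls (ext Om (v k))" using u k by blast
  have ae: "ae x. ext Om (%x. \<zeta> k x * (v k x)^2) x = ext Om (%x. \<zeta> k x * (rep (u k) x)^2) x"
   using rep_cls[OF s] unfolding uk by eventually_elim (auto simp: ext_def indicator_def)
  have m: "ext Om (%x. \<zeta> k x * (rep (u k) x)^2) = (%x. (ext Om (\<zeta> k) x * rep (u k) x) * rep (u k) x)"
   by (auto simp: ext_def power2_eq_square)
  have bm: "ext Om (%x. \<zeta> k x * (rep (u k) x)^2) \<in> BM" unfolding m
   by (rule borel_measurable_integrable[OF sqi_mult_integrable[OF mul_sqi[OF open_Om z rep(1)] rep(1)]])
  have "(\<integral>x. \<zeta> k x * (v k x)^2 \<partial>lebesgue_on Om) = (\<integral>x. \<zeta> k x * (rep (u k) x)^2 \<partial>lebesgue_on Om)"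
   unfolding integral_ext[OF open_Om]
   by (rule integral_cong_AE[OF borel_measurable_AE[OF bm] bm ae]) (use ae in \<open>auto elim: eventually_mono\<close>)
  thus ?thesis using quadratic_integral[OF open_Om z] by simp
 qed
 ultimately show ?thesis using k by (simp add: cost_def state_cost_def control_cost_def)
qed

lemma admissible_props: "k < Suc m ==> admissible k \<noteq> {} \<and> convex (admissible k) \<and> closed (admissible k) \<and> bounded (admissible k)"
proof (cases "k = 0")
 case False
 assume "k < Suc m"
 hence "k \<in> {1..m}" using False by simp
 hence "Uad k \<subseteq> L2_space Om" "Uad k \<noteq> {}" "convex_function_set (Uad k)" "L2_closed Om (Uad k)" "L2_bounded Om (Uad k)" using Uad by blast+
 from admissible_set[OF open_Om this] show ?thesis using False by (simp add: admissible_def)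
qed (simp add: admissible_def)

lemma admissible_repr:
 assumes "\<forall>i<Suc m. u i \<in> admissible i"
 shows "\<exists>v. \<forall>i\<in>{1..m}. v i \<in> Uad i \<and> u i = cls (ext Om (v i))"
proof -
 have "\<forall>i\<in>{1..m}. \<exists>v. v \<in> Uad i \<and> u i = cls (ext Om v)"
 proof
  fix i assume i: "i \<in> {1..m}"
  hence "u i \<in> admissible i" "i \<noteq> 0" using assms by auto
  thus "\<exists>v. v \<in> Uad i \<and> u i = cls (ext Om v)" by (auto simp: admissible_def)
 qed
 from bchoice[OF this] show ?thesis .
qed

theorem equilibrium: "\<exists>u. nash_equilibrium m Uad (cost Om a f m B L \<zeta>) u"
proof -
 have "\<exists>u. (\<forall>k<Suc m. u k \<in> admissible k) \<and>
  (\<forall>k<Suc m. \<forall>v\<in>admissible k. state_cost k u + control_cost k (u k) <= state_cost k (u(k := v)) + control_cost k v)"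
 proof (rule nash_existence)
  show "admissible k \<noteq> {} \<and> convex (admissible k) \<and> closed (admissible k) \<and> bounded (admissible k)" if "k < Suc m" for k
   using that by (rule admissible_props)
 next
  fix k u assume k: "k < Suc m" and u: "\<forall>i<Suc m. u i \<in> admissible i"
  show "convex_on (admissible k) (%p. state_cost k (u(k := p)) + control_cost k p)"
  proof (cases "k = 0")
   case True
   thus ?thesis by (simp add: admissible_def state_cost_def control_cost_def convex_on_def)
  next
   case False
   hence k1: "k \<in> {1..m}" using k by simp
   obtain v where v: "\<forall>i\<in>{1..m}. v i \<in> Uad i \<and> u i = cls (ext Om (v i))" using admissible_repr[OF u] by blast
   have cf: "convex_functional_on (Uad k) (%w. cost Om a f m B L \<zeta> k (v(k := w)))"
    using conv k1 v unfolding convex_problem_def by blast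
   \<comment> \<open>Convexity is assumed for functions and needed for classes; the equality
     transports it, and \<open>cw\<close> below identifies the class of a convex
     combination.\<close>
   have eq: "cost Om a f m B L \<zeta> k (v(k := w)) = state_cost k (u(k := cls (ext Om w))) + control_cost k (cls (ext Om w))" if "w \<in> Uad k" for w
   proof -
    have "cost Om a f m B L \<zeta> k (v(k := w)) = state_cost k (u(k := cls (ext Om w))) + control_cost k ((u(k := cls (ext Om w))) k)"
     by (rule cost_eq[OF _ k1]) (use v Uad that k1 in auto)
    thus ?thesis by simp
   qed
   show ?thesis
   proof (rule convex_onI)
    show "convex (admissible k)" using admissible_props[OF k] by blast
    fix t x y assume t: "(0::real) < t" "t < 1" and "x \<in> admissible k" "y \<in> admissible k"
    then obtain w1 w2 where w: "w1 \<in> Uad k" "w2 \<in> Uad k" "x = cls (ext Om w1)" "y = cls (ext Om w2)"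
     using False by (auto simp: admissible_def)
    define w where "w x = (1 - t) * w1 x + t * w2 x" for x
    have t01: "t \<in> {0..1}" using t by simp
    have wU: "w \<in> Uad k" unfolding w_def[abs_def] using Uad k1 w(1,2) t01 unfolding convex_function_set_def by blast
    have s: "sqi (ext Om w1)" "sqi (ext Om w2)" using w(1,2) Uad k1 L2_iff[OF open_Om] by blast+
    have "ext Om w = (%x. (1 - t) * ext Om w1 x + t * ext Om w2 x)" by (auto simp: w_def ext_def algebra_simps)
    hence cw: "cls (ext Om w) = (1 - t) *R x + t *R y" unfolding w(3,4) using s by (simp add: cls_simps sqi_cmult)
    have "cost Om a f m B L \<zeta> k (v(k := w)) <= (1 - t) * cost Om a f m B L \<zeta> k (v(k := w1)) + t * cost Om a f m B L \<zeta> k (v(k := w2))"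
     using cf w(1,2) t01 unfolding convex_functional_on_def w_def[abs_def] by blast
    thus "state_cost k (u(k := (1 - t) *R x + t *R y)) + control_cost k ((1 - t) *R x + t *R y)
     <= (1 - t) * (state_cost k (u(k := x)) + control_cost k x) + t * (state_cost k (u(k := y)) + control_cost k y)"
     unfolding eq[OF wU] eq[OF w(1)] eq[OF w(2)] cw w(3,4)[symmetric] .
   qed
  qed
 next
  fix k and u :: "nat => nat => (real ^ 'n) l2" and v
  assume k: "k < Suc m" and u: "\<forall>l. \<forall>i<Suc m. u l i \<in> admissible i" and v: "\<forall>i<Suc m. v i \<in> admissible i"
   and weak: "\<forall>i<Suc m. weakly_to (%l. u l i) (v i)"
  show "(%l. state_cost k (u l)) ~~> state_cost k v"
  proof (cases "k = 0")
   case False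
   hence k1: "k \<in> {1..m}" using k by simp
   have "\<forall>i. \<exists>R. i < Suc m --> (\<forall>p\<in>admissible i. norm p <= R)" using admissible_props bounded_iff by blast
   from choice[OF this] obtain R where R: "\<forall>i. i < Suc m --> (\<forall>p\<in>admissible i. norm p <= R i)" ..
   have i: "i < Suc m" if "i \<in> {1..m}" for i using that by simp
   have "cost_integrand Om (L k)" using L k1 by blast
   moreover have "\<forall>i\<in>{1..m}. weakly_to (%l. u l i) (v i)" "\<forall>i\<in>{1..m}. \<forall>l. norm (u l i) <= R i" "\<forall>i\<in>{1..m}. norm (v i) <= R i"
    using i weak R u v by blast+
   ultimately show ?thesis using state_cost_weakly_continuous False by (simp add: state_cost_def)
  qed (simp add: state_cost_def)
 next
  fix k and u :: "nat => (real ^ 'n) l2" and v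
  assume k: "k < Suc m" and lim: "u ~~> v"
  show "(%l. control_cost k (u l)) ~~> control_cost k v"
  proof (cases "k = 0")
   case False
   hence z: "\<zeta> k \<in> Linf_space Om" using k \<zeta> by simp
   show ?thesis using False unfolding control_cost_def
    by (simp only: if_False) (intro tendsto_mult tendsto_const tendsto_inner lim mulop_tendsto[OF open_Om z])
  qed (simp add: control_cost_def)
 next
  fix k and u :: "nat => (real ^ 'n) l2" and v and e :: real
  assume k: "k < Suc m" and weak: "weakly_to u v" and e: "e > 0"
  show "\<forall>\<^sub>F l in sequentially. control_cost k v <= control_cost k (u l) + e"
  proof (cases "k = 0")
   case True
   thus ?thesis using e by (simp add: control_cost_def)
  next
   case False
   hence z: "\<zeta> k \<in> Linf_space Om" "AE x in lebesgue_on Om. \<zeta> k x >= 0" using k \<zeta> by simp_all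
   define T where "T = mulop Om (\<zeta> k)"
   have "(%l. inner (u l) (T v) - inner v (T v)) ~~> inner v (T v) - inner v (T v)"
    using weak unfolding weakly_to_def by (intro tendsto_diff tendsto_const) blast
   hence "(%l. inner (u l) (T v) - inner v (T v)) ~~> 0" by simp
   hence "\<forall>\<^sub>F l in sequentially. - e < inner (u l) (T v) - inner v (T v)" using e by (intro order_tendstoD(1)) auto
   thus ?thesis
   proof eventually_elim
    case (elim l)
    have sym: "inner (T p) y = inner p (T y)" for p y unfolding T_def by (rule mulop_sym[OF open_Om z(1)])
    have lin: "T (u l - v) = T (u l) - T v"
    proof (rule vector_eq_rdot[THEN iffD1], rule allI)
     fix y
     show "inner (T (u l - v)) y = inner (T (u l) - T v) y" by (simp add: sym inner_diff_left)
    qed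
    \<comment> \<open>Weak lower semicontinuity from the nonnegative quadratic form at
      \<open>u l - v\<close>: the cross term is linear in \<open>u l\<close> and converges. The
      resulting \<open>2 * e\<close> becomes \<open>e\<close> through the factor 1/2 in the
      cost.\<close>
    have "0 <= inner (u l - v) (T (u l - v))" unfolding T_def by (rule mulop_nonneg[OF open_Om z])
    also have "\<dots> = inner (u l) (T (u l)) - 2 * inner (u l) (T v) + inner v (T v)"
     unfolding lin using sym[of v "u l"] by (simp add: inner_diff_left inner_diff_right inner_commute)
    finally have "inner v (T v) <= inner (u l) (T (u l)) + 2 * e" using elim by linarith
    thus ?case using False by (simp add: control_cost_def T_def)
   qed
  qed
 qed
 then obtain u where u: "\<forall>k<Suc m. u k \<in> admissible k"
  and opt: "\<forall>k<Suc m. \<forall>v\<in>admissible k. state_cost k u + control_cost k (u k) <= state_cost k (u(k := v)) + control_cost k v" by blast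
 obtain v where v: "\<forall>i\<in>{1..m}. v i \<in> Uad i \<and> u i = cls (ext Om (v i))" using admissible_repr[OF u] by blast
 have "cost Om a f m B L \<zeta> k (v(k := v k)) <= cost Om a f m B L \<zeta> k (v(k := w))" if k: "k \<in> {1..m}" and w: "w \<in> Uad k" for k w
 proof -
  have k0: "k \<noteq> 0" "k < Suc m" using k by auto
  have "cls (ext Om w) \<in> admissible k" using w k0 by (simp add: admissible_def)
  hence "state_cost k u + control_cost k (u k) <= state_cost k (u(k := cls (ext Om w))) + control_cost k ((u(k := cls (ext Om w))) k)"
   using opt k0(2) by simp
  moreover have "cost Om a f m B L \<zeta> k v = state_cost k u + control_cost k (u k)"
   by (rule cost_eq[OF _ k]) (use v Uad in auto)
  moreover have "cost Om a f m B L \<zeta> k (v(k := w)) = state_cost k (u(k := cls (ext Om w))) + control_cost k ((u(k := cls (ext Om w))) k)"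
   by (rule cost_eq[OF _ k]) (use v Uad w k in auto)
  ultimately show ?thesis by simp
 qed
 hence "nash_equilibrium m Uad (cost Om a f m B L \<zeta>) v"
  unfolding nash_equilibrium_def is_arg_min_def using v by (auto simp: not_less)
 thus ?thesis by blast
qed

end

end

end

theorem theorem3p2:
  fixes \<Omega> :: "(real ^ 'n) set"
    and a :: "'n \<Rightarrow> 'n \<Rightarrow> real ^ 'n \<Rightarrow> real"
    and f :: "real ^ 'n \<Rightarrow> real \<Rightarrow> real"
    and m :: nat
    and B \<zeta> :: "nat \<Rightarrow> real ^ 'n \<Rightarrow> real"
    and \<zeta>0 :: "nat \<Rightarrow> real"
    and L :: "nat \<Rightarrow> real ^ 'n \<Rightarrow> real \<Rightarrow> real"
    and Uad :: "nat \<Rightarrow> (real ^ 'n \<Rightarrow> real) set"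
  assumes "m \<ge> 1"
    and "CARD('n) \<in> {1, 2, 3}"
    and "bounded_lipschitz_domain \<Omega>"
    and "elliptic_coefficients \<Omega> a"
    and "\<forall>k \<in> {1..m}. B k \<in> Linf_space \<Omega>"
    and "\<forall>k \<in> {1..m}. \<zeta> k \<in> Linf_space \<Omega> \<and> \<zeta>0 k > 0 \<and> (AE x in lebesgue_on \<Omega>. \<zeta> k x \<ge> \<zeta>0 k)"
    and "state_nonlinearity \<Omega> f"
    and "\<forall>k \<in> {1..m}. cost_integrand \<Omega> (L k)"
    and "\<forall>k \<in> {1..m}. Uad k \<subseteq> L2_space \<Omega> \<and> Uad k \<noteq> {} \<and> convex_function_set (Uad k) \<and>
                       L2_closed \<Omega> (Uad k) \<and> L2_bounded \<Omega> (Uad k)"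
    and "\<forall>k \<in> {1..m}. convex_problem m Uad (cost \<Omega> a f m B L \<zeta>) k"
  shows "\<exists>u. nash_equilibrium m Uad (cost \<Omega> a f m B L \<zeta>) u"
proof -
 have d: "open \<Omega>" "bounded \<Omega>" "lipschitz_boundary \<Omega>" using assms(3) by (simp_all add: bounded_lipschitz_domain_def)
 obtain lam Lam where e: "elliptic \<Omega> (%i j. ext \<Omega> (a i j)) lam Lam" using elliptic_coefficients_form[OF d(1,2) assms(4)] by blast
 have "CARD('n) <= 3" using assms(2) by auto
 with e d(3) assms(7) interpret state_eq \<Omega> a lam Lam f by (intro state_eq.intro)
 have "\<forall>k\<in>{1..m}. \<zeta> k \<in> Linf_space \<Omega> \<and> (AE x in lebesgue_on \<Omega>. \<zeta> k x >= 0)"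
 proof (intro ballI conjI)
  fix k assume k: "k \<in> {1..m}"
  hence p: "\<zeta>0 k > 0" "AE x in lebesgue_on \<Omega>. \<zeta> k x >= \<zeta>0 k" using assms(6) by auto
  show "AE x in lebesgue_on \<Omega>. \<zeta> k x >= 0" using p(2) by eventually_elim (use p(1) in simp)
 qed (use assms(6) in auto)
 from equilibrium[OF assms(5) this assms(8-10)] show ?thesis .
qed

end
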